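(* Let $\Omega\subset\mathbb R^2$ be a bounded $C^\infty$ open set (i.e. with $C^\infty$ boundary) such that, for a constant $c_0$, the system $$(-\Delta)^{1/2}u=1\ \text{ in }\Omega,\qquad u=0\ \text{ in }\Omega^c,\qquad \partial_n^{1/2}u=c_0\ \text{ on }\partial\Omega$$ has at least one solution $u\in H^{1/2}(\mathbb R^2)$. Assume that $\Omega$ is connected. Then $\Omega$ is a disc.
   Context: $(-\Delta)^{1/2}$ is the fractional Laplacian on $\mathbb R^2$, $\widehat{(-\Delta)^{1/2}v}(\xi)=|\xi|\hat v(\xi)$, continuous from $H^{1/2}(\mathbb R^2)$ to $H^{-1/2}(\mathbb R^2)$. $\Omega^c=\mathbb R^2\setminus\Omega$ and $n(x)$ is the outward pointing unit normal at $x\in\partial\Omega$. The fractional normal derivative of a function $u$ vanishing on $\Omega^c$ at $x\in\partial\Omega$ is $$\partial_n^{1/2}u(x):=\lim_{y\to x,\ y\in\Omega}\frac{u(y)}{|(y-x)\cdot n(x)|^{1/2}}.$$ *)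

theory Defs
  imports "HOL-Analysis.Analysis"
begin

primrec Ck_on :: "nat \<Rightarrow> 'a::real_normed_vector set \<Rightarrow> ('a \<Rightarrow> 'b::real_normed_vector) \<Rightarrow> bool" where
  "Ck_on 0 S f \<longleftrightarrow> continuous_on S f"
| "Ck_on (Suc k) S f \<longleftrightarrow> (\<forall>x\<in>S. f differentiable (at x)) \<and>
     (\<forall>v. Ck_on k S (\<lambda>x. frechet_derivative f (at x) v))"

text \<open>Only meaningful for open \<open>S\<close>.\<close>

definition smooth_on :: "'a::real_normed_vector set \<Rightarrow> ('a \<Rightarrow> 'b::real_normed_vector) \<Rightarrow> bool" where
  "smooth_on S f \<longleftrightarrow> (\<forall>k. Ck_on k S f)"

definition local_defining_function ::
    "'a::real_inner set \<Rightarrow> 'a \<Rightarrow> 'a set \<Rightarrow> ('a \<Rightarrow> real) \<Rightarrow> bool" where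
  "local_defining_function \<Omega> x U \<rho> \<longleftrightarrow>
     open U \<and> x \<in> U \<and> smooth_on U \<rho> \<and>
     (\<forall>y\<in>U. frechet_derivative \<rho> (at y) \<noteq> (\<lambda>v. 0)) \<and>
     \<Omega> \<inter> U = {y \<in> U. \<rho> y < 0}"

definition smooth_boundary :: "'a::real_inner set \<Rightarrow> bool" where
  "smooth_boundary \<Omega> \<longleftrightarrow> (\<forall>x\<in>frontier \<Omega>. \<exists>U \<rho>. local_defining_function \<Omega> x U \<rho>)"

text \<open>The normal is the normalised gradient of a defining function. As \<open>\<rho>\<close> is negative
  inside \<open>\<Omega>\<close>, it points outward, and it does not depend on the choice of \<open>\<rho>\<close>.\<close>

definition outward_unit_normal :: "'a::real_inner set \<Rightarrow> 'a \<Rightarrow> 'a \<Rightarrow> bool" where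
  "outward_unit_normal \<Omega> x n \<longleftrightarrow> x \<in> frontier \<Omega> \<and>
     (\<exists>U \<rho> D. local_defining_function \<Omega> x U \<rho> \<and> (GDERIV \<rho> x :> D) \<and> n = sgn D)"

text \<open>The limit of \<open>u y / \<bar>(y - x) \<bullet> n\<bar>\<^sup>1\<^sup>/\<^sup>2\<close> as \<open>y\<close> tends to \<open>x\<close> in \<open>\<Omega>\<close> is taken
  non-tangentially, that is, inside every cone around the normal direction. A limit over
  unrestricted \<open>y \<in> \<Omega>\<close> would not exist even on the unit disc, for the solution, which is a
  multiple of \<open>sqrt (1 - (norm y)\<^sup>2)\<close>: the quotient tends to a nonzero value along the normal
  and to 0 along suitable tangential paths. An unrestricted limit, where it exists, is also
  a non-tangential limit (lemma \<open>has_half_normal_derivativeI_unrestricted\<close>).\<close>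

definition has_half_normal_derivative ::
    "'a::real_inner set \<Rightarrow> ('a \<Rightarrow> real) \<Rightarrow> 'a \<Rightarrow> real \<Rightarrow> bool" where
  "has_half_normal_derivative \<Omega> u x l \<longleftrightarrow>
     (\<exists>n. outward_unit_normal \<Omega> x n \<and>
       (\<forall>\<alpha>. 0 < \<alpha> \<and> \<alpha> < 1 \<longrightarrow>
         ((\<lambda>y. u y / sqrt \<bar>(y - x) \<bullet> n\<bar>) \<longlongrightarrow> l)
           (at x within {y \<in> \<Omega>. \<alpha> * norm (y - x) \<le> \<bar>(y - x) \<bullet> n\<bar>})))"

lemma has_half_normal_derivativeI_unrestricted:
  assumes "outward_unit_normal \<Omega> x n"
    and "((\<lambda>y. u y / sqrt \<bar>(y - x) \<bullet> n\<bar>) \<longlongrightarrow> l) (at x within \<Omega>)"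
  shows "has_half_normal_derivative \<Omega> u x l"
  unfolding has_half_normal_derivative_def
  using assms by (blast intro: tendsto_within_subset)

definition square_integrable :: "('a::euclidean_space \<Rightarrow> complex) \<Rightarrow> bool" where
  "square_integrable f \<longleftrightarrow>
     f \<in> borel_measurable lebesgue \<and> integrable lebesgue (\<lambda>x. (norm (f x))\<^sup>2)"

definition fourier :: "('a::euclidean_space \<Rightarrow> complex) \<Rightarrow> 'a \<Rightarrow> complex" where
  "fourier f \<xi> = (LINT x|lebesgue. exp (- \<i> * of_real (x \<bullet> \<xi>)) * f x)"

definition inverse_fourier :: "('a::euclidean_space \<Rightarrow> complex) \<Rightarrow> 'a \<Rightarrow> complex" where
  "inverse_fourier f x =
     (LINT \<xi>|lebesgue. exp (\<i> * of_real (x \<bullet> \<xi>)) * f \<xi>) / of_real ((2 * pi) ^ DIM('a))"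

text \<open>Plancherel's extension to square-integrable \<open>f\<close>: \<open>g\<close> is the limit, in the
  mean-square sense, of the Fourier integrals over balls. It is determined up to a null set.\<close>

definition is_fourier_L2 :: "('a::euclidean_space \<Rightarrow> complex) \<Rightarrow> ('a \<Rightarrow> complex) \<Rightarrow> bool" where
  "is_fourier_L2 f g \<longleftrightarrow> square_integrable f \<and> square_integrable g \<and>
     ((\<lambda>R. \<integral>\<^sup>+\<xi>. ennreal ((norm (g \<xi> - fourier (\<lambda>x. indicator (ball 0 R) x * f x) \<xi>))\<^sup>2) \<partial>lebesgue)
       \<longlongrightarrow> 0) at_top"

definition fourier_L2 :: "('a::euclidean_space \<Rightarrow> complex) \<Rightarrow> 'a \<Rightarrow> complex" where
  "fourier_L2 f = (SOME g. is_fourier_L2 f g)"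

text \<open>\<open>H\<^sup>s\<close> for \<open>s \<ge> 0\<close>; its elements are functions, not classes modulo null sets.\<close>

definition sobolev_H :: "real \<Rightarrow> ('a::euclidean_space \<Rightarrow> complex) set" where
  "sobolev_H s = {f. \<exists>g. is_fourier_L2 f g \<and>
     integrable lebesgue (\<lambda>\<xi>. (1 + (norm \<xi>)\<^sup>2) powr s * (norm (g \<xi>))\<^sup>2)}"

definition test_functions :: "'a::euclidean_space set \<Rightarrow> ('a \<Rightarrow> complex) set" where
  "test_functions \<Omega> = {\<phi>. smooth_on UNIV \<phi> \<and>
     compact (closure {x. \<phi> x \<noteq> 0}) \<and> closure {x. \<phi> x \<noteq> 0} \<subseteq> \<Omega>}"

text \<open>The tempered distribution \<open>T = (-\<Delta>)\<^sup>1\<^sup>/\<^sup>2 f\<close> whose Fourier transform is the function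
  \<open>norm \<xi> * fourier_L2 f \<xi>\<close>: its value at a test function \<open>\<phi>\<close> is that of its Fourier transform
  at \<open>inverse_fourier \<phi>\<close>.\<close>

definition half_laplacian ::
    "('a::euclidean_space \<Rightarrow> complex) \<Rightarrow> ('a \<Rightarrow> complex) \<Rightarrow> complex" where
  "half_laplacian f \<phi> =
     (LINT \<xi>|lebesgue. of_real (norm \<xi>) * fourier_L2 f \<xi> * inverse_fourier \<phi> \<xi>)"

definition distribution_eq_on ::
    "'a::euclidean_space set \<Rightarrow> (('a \<Rightarrow> complex) \<Rightarrow> complex) \<Rightarrow> ('a \<Rightarrow> complex) \<Rightarrow> bool" where
  "distribution_eq_on \<Omega> T h \<longleftrightarrow>
     (\<forall>\<phi>\<in>test_functions \<Omega>. T \<phi> = (LINT x|lebesgue. h x * \<phi> x))"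

definition overdetermined_solution ::
    "'a::euclidean_space set \<Rightarrow> real \<Rightarrow> ('a \<Rightarrow> real) \<Rightarrow> bool" where
  "overdetermined_solution \<Omega> c\<^sub>0 u \<longleftrightarrow>
     (\<lambda>x. complex_of_real (u x)) \<in> sobolev_H (1/2) \<and>
     distribution_eq_on \<Omega> (half_laplacian (\<lambda>x. complex_of_real (u x))) (\<lambda>x. 1) \<and>
     (\<forall>x\<in>- \<Omega>. u x = 0) \<and>
     (\<forall>x\<in>frontier \<Omega>. has_half_normal_derivative \<Omega> u x c\<^sub>0)"

end

(* In the plane the operator is, up to a constant, the gradient of the energy
   E(u, phi) = int int |y - x|^(-3) (u y - u x) (phi y - phi x) dx dy,
   so the equation says that E(u, phi) is a constant multiple of the integral of phi, for phi of
   finite energy vanishing outside Omega.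
   Moving planes: on the half-plane up to the critical line, v(x) = u(x) - u(x reflected) is
   nonnegative. If v is bounded below on a set K of positive measure, the long-range interaction
   with K lets v dominate every small barrier (affine function) * sqrt (r^2 - |x - c|^2), whose
   half-Laplacian is computed chord by chord. Hence, if Omega is not symmetric about the critical
   line, the reflected boundary cannot touch the boundary away from the line, since the barrier
   would contradict the equality of the two normal derivatives; so the critical line meets the
   boundary orthogonally.
   This orthogonal case is excluded by an argument over directions instead of Serrin's corner
   lemma. Asymmetry is an open condition on the direction, and by Baire and Sard an open set of
   asymmetric directions yields a whole boundary arc of orthogonal contacts. Mollify u at depth t
   below the arc: by the barrier its derivative along the arc is at most - gamma * sqrt t, whereas
   its values at the two ends, divided by sqrt t, have the same limit, because the fractional
   normal derivative is constant. So Omega is symmetric in every direction, hence a disc. *)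
theory Submission
  imports Defs "HOL-Probability.Probability" "HOL-Real_Asymp.Real_Asymp"
begin

section \<open>Measure-preserving maps and translations\<close>

text \<open>The solution is only an element of H^(1/2), known up to null sets, and no boundary
  regularity is established for it. Hence the equation is used solely through the energy,
  inequalities hold almost everywhere, and the normal derivative enters through balls of radius t/2
  at depth t below a boundary point, where u is close to c0 times the root of the depth. Serrin's
  corner lemma would need an expansion of u to second order. The argument over an arc needs only the
  first: on such a ball the barrier (distance to the line) * dome has size t * sqrt t,
  differentiating a mollification at scale t costs a factor 1/t, so the derivative along the arc has
  size sqrt t, while the values at both ends are known up to o(sqrt t). The arc arises by
  parametrising directions by their slope. At an orthogonal contact the direction is tangent to the
  boundary, so its slope is the value of the slope function m of a boundary curve. Finitely many
  such functions, restricted to closed sets of contacts, cover an interval of slopes; critical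
  values are nowhere dense, and Baire leaves an interval of contacts.\<close>

notation inner (infix ".*" 70) and scaleR (infixr "*." 75)
 and tendsto (infixr "--->" 55) and LIMSEQ ("(_)/ ----> (_)" [60, 60] 60)

abbreviation (input) nn_lborel :: "('a::euclidean_space => ennreal) => ennreal" (binder "NNINT " 60) where
 "nn_lborel f == nn_integral lborel f"

abbreviation (input) borelf :: "('a::topological_space => 'b::topological_space) => bool" where
 "borelf f == f \<in> borel_measurable borel"

abbreviation (input) lint :: "('a::euclidean_space => 'b::{banach, second_countable_topology}) => bool" where
 "lint f == integrable lborel f"

abbreviation (input) AE_lborel :: "('a::euclidean_space => bool) => bool" (binder "AEL " 10) where
 "AE_lborel P == almost_everywhere lborel P"

abbreviation (input) "lborel2 == lborel \<Otimes>\<^sub>M lborel"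

abbreviation (input) diff2 :: "('a::real_vector => real) => 'a => 'a => real" where
 "diff2 f x h == 2 * f x - f (x + h) - f (x - h)"

lemmas dist_norms = dist_norm norm_minus_commute
 and lint_add = Bochner_Integration.integrable_add
 and lint_bound = Bochner_Integration.integrable_bound
 and LINT_add = Bochner_Integration.integral_add
 and LINT_cong = Bochner_Integration.integral_cong
 and LINT_cong_AE = Bochner_Integration.integral_cong_AE

lemma not_AE_notin_ball:
 assumes "AEL x. x \<notin> ball (c::'a::euclidean_space) r" "0 < r" shows False
proof -
 have "emeasure lborel (ball c r) = 0" using assms(1) by (intro null_setsD1) (simp add: AE_iff_null_sets)
 thus False using content_ball_pos[OF assms(2), of c] by (simp add: measure_def)
qed

lemma integral_pos_ball:
 fixes f :: "'a::euclidean_space => real"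
 assumes f: "lint f" "!!x. 0 <= f x" and r: "0 < r" "!!x. x \<in> ball c r ==> 0 < f x"
 shows "0 < (LBINT x. f x)"
proof (rule ccontr)
 assume "~ ?thesis"
 moreover have "0 <= (LBINT x. f x)" using f(2) by simp
 ultimately have "(LBINT x. f x) = 0" by linarith
 hence "AEL x. f x = 0" by (subst (asm) integral_nonneg_eq_0_iff_AE[OF f(1)]) (use f(2) in auto)
 hence "AEL x. x \<notin> ball c r" by eventually_elim (use r(2) in force)
 thus False using r(1) by (rule not_AE_notin_ball)
qed

text \<open>The image measure, rather than an inverse with a Jacobian, encodes preservation of
  measure: it composes, it passes to the fibres of a product, and it serves integrals of all kinds
  alike.\<close>

definition mpm :: "('a::euclidean_space => 'a) => bool" where
 "mpm T \<longleftrightarrow> T \<in> borel_measurable borel & distr lborel borel T = lborel"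

lemma mpm_measurable [measurable_dest]:
 "mpm T ==> borelf T"
 by (simp add: mpm_def)

lemma mpm_nn_integral:
 assumes T: "mpm T" and [measurable]: "borelf f"
 shows "(NNINT x. f (T x)) = (NNINT x. f x)"
proof -
 have [measurable]: "borelf T" using T by (rule mpm_measurable)
 have "(NNINT x. f (T x)) = (\<integral>\<^sup>+x. f x \<partial>distr lborel borel T)"
  by (subst nn_integral_distr) auto
 thus ?thesis using T by (simp add: mpm_def)
qed

lemma mpm_integrable:
 fixes f :: "'a::euclidean_space => 'b::{banach, second_countable_topology}"
 assumes T: "mpm T" and f: "lint f"
 shows "lint (%x. f (T x))"
proof -
 have [measurable]: "borelf T" using T by (rule mpm_measurable)
 have "integrable (distr lborel borel T) f" using f T by (simp add: mpm_def)
 thus ?thesis by (rule integrable_distr[rotated]) simp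
qed

lemma mpm_integral:
 fixes f :: "'a::euclidean_space => 'b::{banach, second_countable_topology}"
 assumes T: "mpm T" and [measurable]: "borelf f"
 shows "(LBINT x. f (T x)) = (LBINT x. f x)"
proof -
 have [measurable]: "borelf T" using T by (rule mpm_measurable)
 have "(LBINT x. f (T x)) = (\<integral>x. f x \<partial>distr lborel borel T)"
  by (subst integral_distr) auto
 thus ?thesis using T by (simp add: mpm_def)
qed

lemma mpm_AE:
 assumes T: "mpm T" and "AEL x. P x"
 shows "AEL x. P (T x)"
proof (rule AE_distrD[of T lborel borel])
 show "T \<in> lborel \<rightarrow>\<^sub>M borel" using T by (simp add: mpm_def)
 have "distr lborel borel T = lborel" using T by (simp add: mpm_def)
 thus "AE x in distr lborel borel T. P x" using assms(2) by metis
qed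

lemma mpm_translation: "mpm ((+) c)"
 by (simp add: mpm_def lborel_distr_plus)

lemma mpm_translation': "mpm (%x. x + c)"
proof -
 have "(%x. x + c) = (+) c" by (auto simp: add.commute)
 thus ?thesis using mpm_translation by simp
qed

lemma mpm_comp:
 assumes "mpm S" "mpm T"
 shows "mpm (%x. S (T x))"
proof -
 have [measurable]: "borelf S" "borelf T"
  using assms by (auto dest: mpm_measurable)
 have "distr lborel borel (%x. S (T x)) = distr (distr lborel borel T) borel S"
  by (subst distr_distr) (auto simp: comp_def)
 thus ?thesis using assms by (simp add: mpm_def)
qed

text \<open>The preimage of a box is its image under the inverse, again an orthogonal map, and boxes
  determine Lebesgue measure.\<close>

lemma mpm_orthogonal:
 fixes T :: "real^2 => real^2"
 assumes T: "orthogonal_transformation T"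
 shows "mpm T"
proof -
 have lin: "linear T" and bij: "bij T" and oinv: "orthogonal_transformation (inv T)"
  using T by (auto simp: orthogonal_transformation_linear orthogonal_transformation_bij
    orthogonal_transformation_inv)
 have [measurable]: "borelf T"
  using lin by (intro borel_measurable_continuous_onI linear_continuous_on linear_conv_bounded_linear[THEN iffD1])
 have "lborel = distr lborel borel T"
 proof (rule lborel_eqI)
  fix l u :: "real^2" assume le: "!!b. b \<in> Basis ==> l .* b <= u .* b"
  have *: "T -` box l u = inv T ` box l u"
   by (simp add: bij bij_vimage_eq_inv_image)
  have m: "inv T ` box l u \<in> sets borel"
   unfolding *[symmetric] using measurable_sets[of T borel borel "box l u"] by simp
  have lm: "inv T ` box l u \<in> lmeasurable"
   by (rule measurable_orthogonal_image[OF oinv]) simp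
  have "emeasure (distr lborel borel T) (box l u) = emeasure lborel (inv T ` box l u)"
   by (subst emeasure_distr) (auto simp: *)
  also have "... = emeasure lebesgue (inv T ` box l u)"
   using m by simp
  also have "... = measure lebesgue (inv T ` box l u)"
   using lm by (simp add: emeasure_eq_measure2)
  also have "measure lebesgue (inv T ` box l u) = measure lebesgue (box l u)"
   by (rule measure_orthogonal_image[OF oinv]) simp
  also have "ennreal ... = (\<Prod>b\<in>Basis. (u - l) .* b)"
   using le by (simp add: measure_lborel_box_eq inner_diff_left)
  finally show "emeasure (distr lborel borel T) (box l u) = (\<Prod>b\<in>Basis. (u - l) .* b)" .
 qed simp
 thus ?thesis by (simp add: mpm_def)
qed

text \<open>Tonelli: each fibre integral is unchanged. This yields the shears on pairs of points,
  where the map of the second point depends on the first.\<close>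

lemma mpm_pair_fibre:
 fixes T :: "'a::euclidean_space => 'b::euclidean_space => 'b"
 assumes T: "!!x. mpm (T x)"
  and [measurable]: "borelf (%p. T (fst p) (snd p))"
 shows "mpm (%p. (fst p, T (fst p) (snd p)))"
proof -
 let ?S = "%p. (fst p, T (fst p) (snd p))"
 have S[measurable]: "borelf ?S"
  by (simp add: borel_prod[symmetric])
   (rule measurable_Pair, simp, simp add: borel_prod)
 have "distr lborel borel ?S = lborel"
 proof (rule measure_eqI)
  fix A :: "('a \<times> 'b) set" assume "A \<in> sets (distr lborel borel ?S)"
  hence A[measurable]: "A \<in> sets borel" by simp
  have "emeasure (distr lborel borel ?S) A = (NNINT p. indicator A (?S p))"
  proof -
   have "?S -` A \<in> sets borel" using measurable_sets[OF S A] by simp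
   hence "emeasure lborel (?S -` A) = (NNINT p. indicator (?S -` A) p)" by simp
   thus ?thesis by (subst emeasure_distr) (simp_all add: indicator_vimage)
  qed
  also have "... = (\<integral>\<^sup>+p. indicator A (?S p) \<partial>lborel2)"
   by (simp add: lborel_prod)
  also have "... = (NNINT x. NNINT y. indicator A (x, T x y))"
   by (subst lborel.nn_integral_fst[symmetric]) (simp_all add: lborel_prod)
  also have "... = (NNINT x. NNINT y. indicator A (x, y))"
  proof (rule nn_integral_cong, goal_cases)
   case (1 x)
   have "borelf (%y::'b. (x, y))"
    by (intro borel_measurable_continuous_onI continuous_intros)
   thus ?case
    by (intro mpm_nn_integral[OF T, where f="%y. indicator A (x, y)"]) simp
  qed
  also have "... = (\<integral>\<^sup>+p. indicator A p \<partial>lborel2)"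
   by (subst lborel.nn_integral_fst[symmetric]) (simp_all add: lborel_prod)
  also have "... = emeasure lborel A" by (simp add: lborel_prod)
  finally show "emeasure (distr lborel borel ?S) A = emeasure lborel A" .
 qed simp
 thus ?thesis by (simp add: mpm_def)
qed

lemma mpm_swap: "mpm (%p::'a::euclidean_space \<times> 'a. (snd p, fst p))"
proof -
 have "distr lborel borel (%p::'a \<times> 'a. (snd p, fst p)) = distr lborel2 lborel2 (%(x, y). (y, x))"
 proof (rule distr_cong)
  show "sets borel = sets (lborel \<Otimes>\<^sub>M (lborel::'a measure) :: ('a \<times> 'a) measure)" by (metis lborel_prod sets_lborel)
 qed (auto simp: lborel_prod)
 also have "... = lborel \<Otimes>\<^sub>M lborel"
  by (rule lborel_pair.distr_pair_swap[symmetric])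
 finally show ?thesis
  by (simp add: mpm_def lborel_prod)
   (intro borel_measurable_continuous_onI continuous_intros)
qed

lemma mpm_map_prod:
 fixes S :: "'a::euclidean_space => 'a" and T :: "'a => 'a"
 assumes S: "mpm S" and T: "mpm T"
 shows "mpm (%p. (S (fst p), T (snd p)))"
proof -
 have a: "mpm (%p::'a\<times>'a. (fst p, U (snd p)))" if "mpm U" for U
  using that by (intro mpm_pair_fibre measurable_compose[OF _ mpm_measurable[OF that]])
   (auto simp: borel_prod[symmetric])
 have "(%p::'a\<times>'a. (S (fst p), T (snd p))) = 
  (%p. (%p. (snd p, fst p)) ((%p. (fst p, S (snd p))) ((%p. (snd p, fst p)) ((%p. (fst p, T (snd p))) p))))"
  by auto
 thus ?thesis
  using mpm_comp[OF mpm_swap mpm_comp[OF a[OF S] mpm_comp[OF mpm_swap a[OF T]]]] by simp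
qed

lemma mpm_shear: "mpm (%p::'a::euclidean_space\<times>'a. (fst p, fst p + snd p))"
 by (intro mpm_pair_fibre mpm_translation) (intro borel_measurable_continuous_onI continuous_intros)

section \<open>Cartesian and slope coordinates of the plane\<close>

definition vec2 :: "real => real => real^2" where
 "vec2 a b = a *. axis 1 1 + b *. axis 2 1"

lemma vec2_nth [simp]: "vec2 a b $ 1 = a" "vec2 a b $ 2 = b"
 by (auto simp: vec2_def axis_def)

lemma Basis_real2: "Basis = {axis 1 1, axis 2 1 :: real^2}"
 using exhaust_2 by (auto simp: Basis_vec_def) metis

lemma inner_real2: "(x::real^2) .* y = x $ 1 * y $ 1 + x $ 2 * y $ 2"
 by (simp add: inner_vec_def sum_2)

lemma norm_vec2: "norm (vec2 a b) = sqrt (a^2 + b^2)"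
 by (simp add: norm_eq_sqrt_inner inner_real2 power2_eq_square)

lemma vec2_eta: "vec2 (x $ 1) (x $ 2) = x"
 by (simp add: vec_eq_iff forall_2)

lemma vec2_measurable [measurable]: "borelf (%p. vec2 (fst p) (snd p))"
 unfolding vec2_def by (intro borel_measurable_continuous_onI continuous_intros)

lemma distr_vec2:
 "distr (lborel :: (real \<times> real) measure) borel (%p. vec2 (fst p) (snd p)) = lborel"
proof (rule lborel_eqI[symmetric])
 fix l u :: "real^2" assume le: "!!b. b \<in> Basis ==> l .* b <= u .* b"
 have le': "l $ 1 <= u $ 1" "l $ 2 <= u $ 2"
  using le[of "axis 1 1"] le[of "axis 2 1"] by (auto simp: inner_axis axis_in_Basis_iff)
 have "(%p. vec2 (fst p) (snd p)) -` box l u = box (l$1) (u$1) \<times> box (l$2) (u$2)"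
  by (auto simp: mem_box_cart forall_2)
 hence "emeasure (distr lborel borel (%p. vec2 (fst p) (snd p))) (box l u)
   = emeasure lborel2 (box (l$1) (u$1) \<times> box (l$2) (u$2))"
  by (subst emeasure_distr) (auto simp: lborel_prod)
 also have "... = ennreal (u$1 - l$1) * ennreal (u$2 - l$2)"
  using le' by (subst lborel.emeasure_pair_measure_Times) auto
 also have "... = ennreal ((u$1 - l$1) * (u$2 - l$2))"
  using le' by (simp add: ennreal_mult)
 also have "(u$1 - l$1) * (u$2 - l$2) = (\<Prod>b\<in>Basis. (u - l) .* b)"
 proof -
  have ne: "axis 1 1 ~= (axis 2 1 :: real^2)" by (simp add: axis_eq_axis)
  show ?thesis unfolding Basis_real2 using ne by (simp add: inner_axis)
 qed
 finally show "emeasure (distr lborel borel (%p. vec2 (fst p) (snd p))) (box l u) = 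
  ennreal (\<Prod>b\<in>Basis. (u - l) .* b)" .
qed simp

lemma nn_integral_real2:
 assumes [measurable]: "borelf f"
 shows "(NNINT x. f (x::real^2)) = (NNINT a. NNINT b. f (vec2 a b))"
proof -
 have "(NNINT x. f x) = (NNINT p. f (vec2 (fst p) (snd p)))"
  by (subst distr_vec2[symmetric], subst nn_integral_distr) auto
 also have "... = (\<integral>\<^sup>+p. f (vec2 (fst p) (snd p)) \<partial>lborel2)"
  by (simp add: lborel_prod)
 also have "... = (NNINT a. NNINT b. f (vec2 a b))"
  by (subst lborel.nn_integral_fst[symmetric]) (simp_all add: lborel_prod)
 finally show ?thesis .
qed

lemma vec2_measurable2 [measurable (raw)]:
 assumes [measurable]: "f \<in> borel_measurable M" "g \<in> borel_measurable M"
 shows "(%x. vec2 (f x) (g x)) \<in> borel_measurable M"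
 unfolding vec2_def by simp

text \<open>Every vector of the plane off the second axis is written \<open>t (1, sg)\<close>, with Jacobian
 \<open>abs t\<close>. This replaces polar coordinates below.\<close>

lemma nn_integral_slope:
 assumes [measurable]: "borelf f"
 shows "(NNINT x. f (x::real^2))
  = (NNINT sg. NNINT t. ennreal (abs t) * f (t *. vec2 1 sg))"
proof -
 have sc: "t *. vec2 1 sg = vec2 t (t * sg)" for t sg
  by (simp add: vec_eq_iff forall_2)
 have "(NNINT x. f x) = (NNINT t. NNINT b. f (vec2 t b))"
  by (rule nn_integral_real2) simp
 also have "... = (NNINT t. NNINT sg. ennreal (abs t) * f (vec2 t (t * sg)))"
 proof (rule nn_integral_cong_AE)
  show "AEL t. (NNINT b. f (vec2 t b)) = (NNINT sg. ennreal (abs t) * f (vec2 t (t * sg)))"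
   using AE_lborel_singleton[of "0::real"]
  proof eventually_elim
   case (elim t)
   thus ?case
    by (subst nn_integral_real_affine[of _ t 0]) (auto simp: nn_integral_cmult)
  qed
 qed
 also have "... = (NNINT sg. NNINT t. ennreal (abs t) * f (vec2 t (t * sg)))"
  by (rule lborel_pair.Fubini') simp
 finally show ?thesis by (simp add: sc)
qed

section \<open>Continuity of translations\<close>

lemma integral_dominated_convergence_0:
 fixes s :: "nat => 'a => real"
 assumes "!!i. s i \<in> borel_measurable M" "integrable M w" "AE x in M. (%i. s i x) ----> 0"
  "!!i. AE x in M. norm (s i x) <= w x"
 shows "(%i. integral\<^sup>L M (s i)) ----> 0"
 using integral_dominated_convergence[of "%x. 0" M s w] assms by simp

lemma integrable_translate:
 fixes f :: "'a::euclidean_space => 'b::{banach, second_countable_topology}"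
 shows "lint f ==> lint (%x. f (x + c))"
 by (rule mpm_integrable[OF mpm_translation'])

lemma integral_translate:
 fixes f :: "'a::euclidean_space => 'b::{banach, second_countable_topology}"
 assumes "borelf f"
 shows "(LBINT x. f (x + c)) = (LBINT x. f x)"
 by (rule mpm_integral[OF mpm_translation' assms])

lemma integrable_mult_prod:
 fixes f g :: "_ => 'c::{real_normed_field, banach, second_countable_topology}"
 assumes f: "integrable (lborel :: 'a::euclidean_space measure) f" and g: "integrable (lborel :: 'b::euclidean_space measure) g"
 shows "lint (%p. f (fst p) * g (snd p))"
proof -
 have [measurable]: "borelf f" "borelf g"
  using f g by auto
 have "integrable lborel2 (%p. f (fst p) * g (snd p))"
 proof (rule lborel_pair.Fubini_integrable)
  show "AEL x. lint (%y. f (fst (x, y)) * g (snd (x, y)))"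
   using g by auto
  show "lint (%x. LBINT y. norm (f (fst (x, y)) * g (snd (x, y))))"
   using f g by (simp add: norm_mult)
 qed measurable
 thus ?thesis by (simp add: lborel_prod)
qed

lemma integral_fst_lborel:
 fixes f :: "_ => 'c::{banach, second_countable_topology}"
 assumes "integrable (lborel :: ('a::euclidean_space \<times> 'b::euclidean_space) measure) f"
 shows "(LBINT p. f p) = (LBINT x. LBINT y. f (x, y))"
 using lborel_pair.integral_fst'[of f] assms by (simp add: lborel_prod)

lemma integral_swap_lborel:
 fixes f :: "_ => 'c::{banach, second_countable_topology}"
 assumes "integrable (lborel :: ('a::euclidean_space \<times> 'b::euclidean_space) measure) f"
 shows "(LBINT x. LBINT y. f (x, y)) = (LBINT y. LBINT x. f (x, y))"
 using lborel_pair.Fubini_integral[of "%x y. f (x, y)"] assms by (simp add: lborel_prod)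

text \<open>The positive part of \<open>indicator U x - indicator U (x + y)\<close> is dominated by
  \<open>indicator U\<close> and tends to 0 pointwise because \<open>U\<close> is open; the negative
  part has the same integral, by translation invariance.\<close>

lemma translation_L1_tendsto_open:
 fixes U :: "'a::euclidean_space set"
 assumes U: "open U" "emeasure lborel U < \<infinity>"
 shows "((%y. LBINT x. abs (indicator U (x + y) - indicator U x :: real)) ---> 0) (at 0)"
proof -
 let ?i = "indicator U :: 'a => real"
 have Um[measurable]: "U \<in> sets borel" using U by simp
 have int: "lint ?i" using U by (simp add: integrable_indicator_iff)
 have int_y: "lint (%x. ?i (x + y))" for y
  using int by (rule integrable_translate)
 have eq: "(LBINT x. abs (?i (x + y) - ?i x)) = 2 * (LBINT x. max (?i x - ?i (x + y)) 0)" for y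
 proof -
  have "abs (?i (x + y) - ?i x) = 2 * max (?i x - ?i (x + y)) 0 + (?i (x + y) - ?i x)" for x
   by (auto split: split_indicator)
  hence "(LBINT x. abs (?i (x + y) - ?i x)) = 
    (LBINT x. 2 * max (?i x - ?i (x + y)) 0 + (?i (x + y) - ?i x))" by simp
  also have "... = 2 * (LBINT x. max (?i x - ?i (x + y)) 0) + ((LBINT x. ?i (x + y)) - (LBINT x. ?i x))"
   using int int_y by (subst LINT_add) auto
  also have "(LBINT x. ?i (x + y)) = (LBINT x. ?i x)" by (rule integral_translate) simp
  finally show ?thesis by simp
 qed
 have "((%y. LBINT x. max (?i x - ?i (x + y)) 0) ---> 0) (at 0)"
 proof (rule tendsto_at_iff_sequentially[THEN iffD2], intro allI impI, unfold comp_def)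
  fix Y :: "nat => 'a" assume "\<forall>i. Y i \<in> UNIV - {0}" and Y: "Y ----> 0"
  have "(%n. LBINT x. max (?i x - ?i (x + Y n)) 0) ----> 0"
  proof (rule integral_dominated_convergence_0[where w = ?i])
   show "AEL x. (%n. max (?i x - ?i (x + Y n)) 0) ----> 0"
   proof (rule AE_I2, goal_cases)
    case (1 x)
    show ?case
    proof (cases "x \<in> U")
     case True
     have "(%n. x + Y n) ----> x" using tendsto_add[OF tendsto_const Y, of x] by simp
     hence "eventually (%n. x + Y n \<in> U) sequentially"
      using U True topological_tendstoD by blast
     hence "eventually (%n. max (?i x - ?i (x + Y n)) 0 = 0) sequentially"
      by eventually_elim (use True in auto)
     thus ?thesis by (rule tendsto_eventually)
    qed (auto intro!: tendsto_eventually simp: indicator_def)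
   qed
  qed (use int in "auto split: split_indicator")
  thus "(%n. LBINT x. max (?i x - ?i (x + Y n)) 0) ----> 0" .
 qed
 from tendsto_mult[OF tendsto_const[of 2] this] show ?thesis
  unfolding eq by simp
qed

text \<open>Outer regularity reduces a Borel set to an open one: the error of replacing
  \<open>A\<close> by \<open>U\<close> has the same integral before and after translation. The limit
  case of the induction uses the same splitting into three terms.\<close>

lemma translation_L1_tendsto:
 fixes f :: "'a::euclidean_space => real"
 assumes "lint f"
 shows "((%y. LBINT x. abs (f (x + y) - f x)) ---> 0) (at 0)"
 using assms
proof (induction rule: integrable_induct)
 case (base A c)
 hence A[measurable]: "A \<in> sets borel" by simp
 show ?case
 proof (rule tendstoI)
  fix e :: real assume "0 < e"
  \<comment> \<open>The summand 1 keeps \<open>K\<close> positive when \<open>c = 0\<close>; three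
    errors of size \<open>d\<close>, multiplied by \<open>abs c\<close>, then stay below
    \<open>e\<close>.\<close>
  define K where "K = abs c + 1"
  have K: "0 < K" by (simp add: K_def add_nonneg_pos)
  define d where "d = e / (3 * K)"
  have d: "0 < d" using \<open>0 < e\<close> K by (simp add: d_def)
  obtain U where U: "open U" "A <= U" "emeasure lborel (U - A) < d"
   using outer_regular_lborel[OF A d] by blast
  have [measurable]: "U \<in> sets borel" using U by simp
  have fU: "emeasure lborel U < \<infinity>"
  proof -
   have "emeasure lborel U = emeasure lborel (U - A) + emeasure lborel A"
    using U by (subst plus_emeasure) (auto simp: Un_absorb2)
   also have "... < \<infinity>" using base U by (auto intro: order.strict_trans[OF U(3)]) 
   finally show ?thesis .
  qed
  let ?i = "indicator U :: 'a => real" and ?a = "indicator A :: 'a => real"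
  have ii: "lint ?i" "lint ?a"
   using fU base by (simp_all add: integrable_indicator_iff)
  have iid: "lint (%x. ?i x - ?a x)" using ii by auto
  have ii': "lint (%x. ?i (x + y))" "lint (%x. ?a (x + y))" "lint (%x. ?i (x + y) - ?a (x + y))" for y
   using ii iid integrable_translate by blast+
  have m: "(LBINT x. ?i x - ?a x) < d"
  proof -
   have "(LBINT x. ?i x - ?a x) = (LBINT x. indicator (U - A) x)"
    using U by (intro LINT_cong) (auto split: split_indicator)
   also have "... = measure lborel (U - A)" by simp
   also have "... < d" using U(3) d unfolding measure_def by (subst enn2real_less_iff) (auto intro: order.strict_trans[OF U(3)])
   finally show ?thesis .
  qed
  have my: "(LBINT x. ?i (x + y) - ?a (x + y)) < d" for y
   using m integral_translate[of "%x. ?i x - ?a x" y] by simp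
  have "eventually (%y. (LBINT x. abs (?i (x + y) - ?i x)) < d) (at 0)"
   by (rule order_tendstoD(2)[OF translation_L1_tendsto_open[OF U(1) fU] d])
  thus "eventually (%y. dist (LBINT x. abs (?a (x + y) *. c - ?a x *. c)) 0 < e) (at 0)"
  proof eventually_elim
   case (elim y)
   have "(LBINT x. abs (?a (x + y) - ?a x)) <=
    (LBINT x. abs (?i (x + y) - ?i x) + ((?i (x + y) - ?a (x + y)) + (?i x - ?a x)))"
    using ii ii' U by (intro integral_mono) (auto split: split_indicator)
   also have "... = (LBINT x. abs (?i (x + y) - ?i x)) + ((LBINT x. ?i (x + y) - ?a (x + y)) + (LBINT x. ?i x - ?a x))"
    using ii ii' by (subst LINT_add, simp, simp, subst LINT_add) auto
   also have "... < 3 * d" using m my[of y] elim by simp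
   finally have *: "(LBINT x. abs (?a (x + y) - ?a x)) < 3 * d" .
   have "(LBINT x. abs (?a (x + y) *. c - ?a x *. c)) = (LBINT x. abs (?a (x + y) - ?a x) * abs c)"
    by (simp add: left_diff_distrib[symmetric] abs_mult)
   also have "... = (LBINT x. abs (?a (x + y) - ?a x)) * abs c" by simp
   also have "... <= 3 * d * abs c" using * by (intro mult_right_mono) auto
   also have "... < 3 * d * (abs c + 1)" using d by simp
   also have "... = e"
    using K by (simp add: d_def flip: K_def)
   finally show ?case by (simp add: dist_real_def integral_nonneg_AE)
  qed
 qed
next
 case (add f g)
 note intf = add(1) and intg = add(2)
 have intf': "lint (%x. f (x + y))" "lint (%x. g (x + y))" for y
  using intf intg by (auto intro: integrable_translate)
 show ?case
 proof (rule tendsto_sandwich[OF _ _ tendsto_const])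
  show "eventually (%y. 0 <= (LBINT x. abs (f (x + y) + g (x + y) - (f x + g x)))) (at 0)" by simp
  show "eventually (%y. (LBINT x. abs (f (x + y) + g (x + y) - (f x + g x))) <=
    (LBINT x. abs (f (x + y) - f x)) + (LBINT x. abs (g (x + y) - g x))) (at 0)"
  proof (intro always_eventually allI)
   fix y
   have "(LBINT x. abs (f (x + y) + g (x + y) - (f x + g x))) <= (LBINT x. abs (f (x + y) - f x) + abs (g (x + y) - g x))"
    using intf intg intf' by (intro integral_mono) auto
   thus "(LBINT x. abs (f (x + y) + g (x + y) - (f x + g x))) <=
    (LBINT x. abs (f (x + y) - f x)) + (LBINT x. abs (g (x + y) - g x))"
    using intf intg intf' by (subst (asm) LINT_add) auto
  qed
  show "((%y. (LBINT x. abs (f (x + y) - f x)) + (LBINT x. abs (g (x + y) - g x))) ---> 0) (at 0)"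
   using tendsto_add[OF add(3,4)] by simp
 qed
next
 case (lim f s)
 have ints: "lint (s n)" and intf: "lint f" for n using lim by auto
 have L: "(%n. LBINT x. abs (s n x - f x)) ----> 0"
 proof (rule integral_dominated_convergence_0[where w = "%x. 3 * abs (f x)"])
  show "AEL x. (%n. abs (s n x - f x)) ----> 0"
  proof (rule AE_I2, goal_cases)
   case (1 x) show ?case
    using lim(2)[of x] by (simp add: LIM_zero_iff tendsto_rabs_zero_iff)
  qed
  show "AEL x. norm (abs (s n x - f x)) <= 3 * abs (f x)" for n
  proof (rule AE_I2, goal_cases)
   case (1 x) show ?case
    using lim(3)[of x n] by (simp add: abs_if split: if_splits)
  qed
 qed (use ints intf in auto)
 show ?case
 proof (rule tendstoI)
  fix e :: real assume "0 < e"
  then obtain n where n: "(LBINT x. abs (s n x - f x)) < e / 3"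
   using order_tendstoD(2)[OF L, of "e/3"] by (auto simp: eventually_sequentially)
  have "eventually (%y. (LBINT x. abs (s n (x + y) - s n x)) < e / 3) (at 0)"
   using \<open>0 < e\<close> by (intro order_tendstoD(2)[OF lim(5)[of n]]) simp
  thus "eventually (%y. dist (LBINT x. abs (f (x + y) - f x)) 0 < e) (at 0)"
  proof eventually_elim
   case (elim y)
   have i': "lint (%x. s n (x + y))" "lint (%x. f (x + y))"
    using ints intf by (auto intro: integrable_translate)
   have tr: "(LBINT x. abs (s n (x + y) - f (x + y))) = (LBINT x. abs (s n x - f x))"
    using integral_translate[of "%x. abs (s n x - f x)" y] ints[of n] intf by simp
   have "(LBINT x. abs (f (x + y) - f x)) <=
    (LBINT x. abs (s n (x + y) - s n x) + (abs (s n (x + y) - f (x + y)) + abs (s n x - f x)))"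
    using ints[of n] intf i' by (intro integral_mono) auto
   also have "... = (LBINT x. abs (s n (x + y) - s n x)) + ((LBINT x. abs (s n (x + y) - f (x + y))) + (LBINT x. abs (s n x - f x)))"
    using ints[of n] intf i' by (subst LINT_add, simp, simp, subst LINT_add) auto
   also have "... < e" using n elim tr by simp
   finally show ?case by (simp add: dist_real_def)
  qed
 qed
qed

lemma power2_diff_le: "(a - b)^2 <= 2 * a^2 + 2 * (b^2 :: real)"
 using sum_squares_bound[of a "- b"] by (simp add: power2_diff)

lemma young_inequality:
 fixes a b eta :: real
 assumes "0 < eta"
 shows "a * b <= a^2 / (2 * eta) + (eta / 2) * b^2"
proof -
 have "0 <= (a - eta * b)^2 / (2 * eta)" using assms by simp
 also have "... = a^2 / (2 * eta) + (eta / 2) * b^2 - a * b"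
  using assms by (simp add: power2_eq_square field_simps)
 finally show ?thesis by simp
qed

text \<open>Here \<open>f\<close> is only square integrable. Its truncation at height
  \<open>M\<close> is bounded, so continuity of translations in L1 applies; the remainder is small
  in L2 and is paired with the difference of \<open>g\<close> by Young's inequality.\<close>

lemma translation_correlation_tendsto:
 fixes f g :: "'a::euclidean_space => real"
 assumes f[measurable]: "borelf f" and f2: "lint (%x. (f x)^2)"
  and g: "lint g" and g2: "lint (%x. (g x)^2)"
 shows "((%y. LBINT x. f x * g (x + y)) ---> (LBINT x. f x * g x)) (at 0)"
proof (rule tendstoI)
 fix e :: real assume e: "0 < e"
 have gm[measurable]: "borelf g" using g by auto
 have g2': "lint (%x. (g (x + y))^2)" and g': "lint (%x. g (x + y))" for y
  using g g2 integrable_translate[of "%x. (g x)^2" y] integrable_translate[of g y] by auto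
 have int_mult: "lint (%x. h x * k x)"
  if "borelf h" "lint (%x. (h x)^2)" "borelf k" "lint (%x. (k x)^2)" 
  for h k :: "'a => real"
 proof (rule lint_bound[of _ "%x. (h x)^2 + (k x)^2"])
  show "AEL x. norm (h x * k x) <= norm ((h x)^2 + (k x)^2)"
  proof (rule AE_I2, goal_cases)
   case (1 x)
   have "2 * abs (h x * k x) <= (h x)^2 + (k x)^2"
    using sum_squares_bound[of "abs (h x)" "abs (k x)"] by (simp add: abs_mult)
   thus ?case by simp
  qed
 next
  show "(%x. h x * k x) \<in> borel_measurable lborel" using that by measurable
  show "lint (%x. (h x)^2 + (k x)^2)" using that by (intro lint_add)
 qed
 define G where "G = (LBINT x. (g x)^2)"
 have "0 <= G" by (simp add: G_def)
 \<comment> \<open>This \<open>eta\<close> makes the \<open>g\<close> half of Young's inequality at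
   most \<open>e / 4\<close> for every translation; the truncation level is chosen afterwards, in
   terms of \<open>eta\<close>.\<close>
 define eta where "eta = e / (8 * (G + 1))"
 have eta: "0 < eta" using e \<open>0 <= G\<close> by (simp add: eta_def)
 define fM where "fM M x = max (- real M) (min (real M) (f x))" for M x
 let ?p = "%M x. f x - fM M x"
 let ?q = "%y x. g (x + y) - g x"
 have [measurable]: "borelf (fM M)" for M unfolding fM_def by simp
 have L: "(%M. LBINT x. (?p M x)^2) ----> 0"
 proof (rule integral_dominated_convergence_0[where w = "%x. (f x)^2"])
  show "AEL x. (%M. (?p M x)^2) ----> 0"
  proof (rule AE_I2)
   fix x
   obtain N where N: "abs (f x) <= real N" using real_arch_simple by blast
   have "eventually (%M. (?p M x)^2 = 0) sequentially"
    unfolding eventually_sequentially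
   proof (intro exI[of _ N] allI impI)
    fix M :: nat assume "N <= M"
    hence "abs (f x) <= real M" using N by linarith
    thus "(?p M x)^2 = 0" by (auto simp: fM_def)
   qed
   thus "(%M. (?p M x)^2) ----> 0" by (rule tendsto_eventually)
  qed
  show "AEL x. norm ((?p M x)^2) <= (f x)^2" for M :: nat
  proof (rule AE_I2, goal_cases)
   case (1 x)
   have "abs (?p M x) <= abs (f x)" by (auto simp: fM_def)
   thus ?case by (simp add: abs_le_square_iff)
  qed
 qed (use f2 in auto)
 obtain M where M: "(LBINT x. (?p M x)^2) < e * eta / 2"
  using order_tendstoD(2)[OF L, of "e * eta / 2"] e eta by (auto simp: eventually_sequentially)
 have fM2: "lint (%x. (?p M x)^2)"
 proof (rule lint_bound[OF f2])
  show "AEL x. norm ((?p M x)^2) <= norm ((f x)^2)"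
  proof (rule AE_I2, goal_cases)
   case (1 x)
   have "abs (?p M x) <= abs (f x)" by (auto simp: fM_def)
   thus ?case by (simp add: abs_le_square_iff)
  qed
 qed simp
 have "eventually (%y. (LBINT x. abs (?q y x)) < e / (4 * (real M + 1))) (at 0)"
  using e by (intro order_tendstoD(2)[OF translation_L1_tendsto[OF g]]) simp
 thus "eventually (%y. dist (LBINT x. f x * g (x + y)) (LBINT x. f x * g x) < e) (at 0)"
 proof (rule eventually_mono)
  fix y assume elim: "(LBINT x. abs (?q y x)) < e / (4 * (real M + 1))"
  have gy2: "lint (%x. (?q y x)^2)"
  proof (rule lint_bound[of _ "%x. 2 * ((g (x + y))^2 + (g x)^2)"])
   show "AEL x. norm ((?q y x)^2) <= norm (2 * ((g (x + y))^2 + (g x)^2))"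
   proof (rule AE_I2, goal_cases)
    case (1 x) have "(?q y x)^2 <= 2 * ((g (x + y))^2 + (g x)^2)"
     using power2_diff_le[of "g (x + y)" "g x"] by simp
    thus ?case by simp
   qed
  qed (use g2 g2'[of y] in auto)
  have gy2b: "(LBINT x. (?q y x)^2) <= 4 * G"
  proof -
   have "(LBINT x. (?q y x)^2) <= (LBINT x. 2 * (g (x + y))^2 + 2 * (g x)^2)"
   proof (rule integral_mono)
    fix x show "(?q y x)^2 <= 2 * (g (x + y))^2 + 2 * (g x)^2"
     by (rule power2_diff_le)
   qed (use gy2 g2 g2'[of y] in auto)
   also have "... = 2 * (LBINT x. (g (x + y))^2) + 2 * G"
    using g2 g2'[of y] by (simp add: G_def)
   also have "(LBINT x. (g (x + y))^2) = G"
    unfolding G_def by (rule integral_translate) simp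
   finally show ?thesis by simp
  qed
  have i1: "lint (%x. f x * g (x + y))" "lint (%x. f x * g x)"
   using f2 g2 g2'[of y] by (auto intro!: int_mult)
  have i2: "lint (%x. abs (?q y x))" using g g'[of y] by auto
  have "abs ((LBINT x. f x * g (x + y)) - (LBINT x. f x * g x)) = abs (LBINT x. f x * g (x + y) - f x * g x)"
   using i1 by simp
  also have "... <= (LBINT x. abs (f x * g (x + y) - f x * g x))"
   by (rule integral_abs_bound)
  also have "... <= (LBINT x. ((?p M x)^2 / (2 * eta) + (eta / 2) * (?q y x)^2) + real M * abs (?q y x))"
  proof (rule integral_mono)
   fix x
   let ?a = "abs (?p M x)" and ?b = "abs (?q y x)"
   have 1: "?a * ?b <= (?p M x)^2 / (2 * eta) + (eta / 2) * (?q y x)^2"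
    using young_inequality[OF eta, of ?a ?b] by (simp only: power2_abs)
   have 2: "abs (fM M x) <= real M" by (auto simp: fM_def)
   have "f x * g (x + y) - f x * g x = (?p M x) * (?q y x) + fM M x * (?q y x)"
    by (simp add: algebra_simps)
   hence "abs (f x * g (x + y) - f x * g x) <= ?a * ?b + abs (fM M x) * ?b"
    by (metis abs_mult abs_triangle_ineq)
   also have "... <= ?a * ?b + real M * ?b" using 2 by (intro add_left_mono mult_right_mono) auto
   finally show "abs (f x * g (x + y) - f x * g x) <= ((?p M x)^2 / (2 * eta) + (eta / 2) * (?q y x)^2) + real M * ?b"
    using 1 by linarith
  next
   show "lint (%x. abs (f x * g (x + y) - f x * g x))"
    by (intro integrable_abs Bochner_Integration.integrable_diff i1)
   show "lint (%x. ((?p M x)^2 / (2 * eta) + (eta / 2) * (?q y x)^2) + real M * abs (?q y x))"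
    by (intro lint_add integrable_mult_right integrable_divide_zero fM2 gy2 i2)
  qed
  also have "... = (LBINT x. (?p M x)^2) / (2 * eta) + (eta / 2) * (LBINT x. (?q y x)^2) + real M * (LBINT x. abs (?q y x))"
   by (subst LINT_add,
     intro lint_add integrable_mult_right integrable_divide_zero fM2 gy2,
     intro integrable_mult_right i2, subst LINT_add,
     intro integrable_divide_zero fM2, intro integrable_mult_right gy2) simp
  also have "... < e"
  proof -
   have 1: "(LBINT x. (?p M x)^2) / (2 * eta) < e / 4"
    using M eta by (simp add: pos_divide_less_eq)
   have "(eta / 2) * (LBINT x. (?q y x)^2) <= (eta / 2) * (4 * G)"
    using gy2b eta by (intro mult_left_mono) auto
   also have "... <= eta * 2 * (G + 1)" using eta by simp
   also have "... = e / 4" using \<open>0 <= G\<close> by (simp add: eta_def field_simps)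
   finally have 2: "(eta / 2) * (LBINT x. (?q y x)^2) <= e / 4" .
   have "real M * (LBINT x. abs (?q y x)) <= real M * (e / (4 * (real M + 1)))"
    using elim by (intro mult_left_mono) auto
   also have "... <= (real M + 1) * (e / (4 * (real M + 1)))" using e by (intro mult_right_mono) auto
   also have "... = e / 4" by (simp add: field_simps)
   finally show ?thesis using 1 2 e by linarith
  qed
  finally show "dist (LBINT x. f x * g (x + y)) (LBINT x. f x * g x) < e" by (simp add: dist_real_def)
 qed
qed

section \<open>Gaussians and the Fourier transform\<close>

lemma integrable_mult_square:
 fixes h k :: "'a => real"
 assumes [measurable]: "h \<in> borel_measurable M" "k \<in> borel_measurable M"
  and "integrable M (%x. (h x)^2)" "integrable M (%x. (k x)^2)"
 shows "integrable M (%x. h x * k x)"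
proof (rule lint_bound)
 show "integrable M (%x. (h x)^2 + (k x)^2)" using assms by (intro lint_add)
 show "AE x in M. norm (h x * k x) <= norm ((h x)^2 + (k x)^2)"
 proof (rule AE_I2, goal_cases)
  case (1 x)
  have "2 * abs (h x * k x) <= (h x)^2 + (k x)^2"
   using sum_squares_bound[of "abs (h x)" "abs (k x)"] by (simp add: abs_mult)
  thus ?case by simp
 qed
qed measurable

lemma integral_real2_prod:
 fixes F G :: "real => complex"
 assumes F: "lint F" and G: "lint G"
 shows "lint (%x::real^2. F (x $ 1) * G (x $ 2))"
  and "integral\<^sup>L lborel (%x::real^2. F (x $ 1) * G (x $ 2)) = (LBINT a. F a) * (LBINT b. G b)"
proof -
 have [measurable]: "borelf F" "borelf G" using F G by auto
 have [measurable]: "borelf (%x::real^2. x $ i)" for i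
  by (intro borel_measurable_continuous_onI continuous_intros)
 let ?f = "%x::real^2. F (x $ 1) * G (x $ 2)"
 note i = integrable_mult_prod[OF F G]
 have "integrable (distr lborel borel (%p. vec2 (fst p) (snd p))) ?f"
  using i by (subst integrable_distr_eq) auto
 thus "lint ?f" by (simp add: distr_vec2)
 have "(LBINT x. ?f x) = (\<integral>x. ?f x \<partial>distr lborel borel (%p. vec2 (fst p) (snd p)))"
  by (simp add: distr_vec2)
 also have "... = (LBINT p. F (fst p) * G (snd p))" by (subst integral_distr) auto
 also have "... = (LBINT a. F a) * (LBINT b. G b)"
  by (subst integral_fst_lborel[OF i]) simp
 finally show "(LBINT x. ?f x) = (LBINT a. F a) * (LBINT b. G b)" .
qed

text \<open>The characteristic function of the standard normal law, freed of its normalising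
  constant.\<close>

lemma gaussian_fourier_1d:
 shows "lint (%x. cis (t * x) * of_real (exp (- x\<^sup>2 / 2)))"
  and "(LBINT x. cis (t * x) * of_real (exp (- x\<^sup>2 / 2))) = of_real (sqrt (2 * pi) * exp (- t\<^sup>2 / 2))"
proof -
 have eq: "cis (t * x) * of_real (exp (- x\<^sup>2 / 2)) = of_real (sqrt (2 * pi)) * (std_normal_density x *. iexp (t * x))" for x
  by (simp add: cis_conv_exp std_normal_density_def scaleR_conv_of_real)
 have m: "borelf (%x. iexp (t * x))"
  by (intro borel_measurable_continuous_onI continuous_intros)
 have "integrable std_normal_distribution (%x. iexp (t * x))"
 proof -
  interpret std: prob_space std_normal_distribution by (rule prob_space_normal_density) simp
  show ?thesis by (rule std.integrable_const_bound[where B = 1]) (use m in auto)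
 qed
 hence i: "lint (%x. std_normal_density x *. iexp (t * x))"
  by (subst (asm) integrable_density) (use m in auto)
 show "lint (%x. cis (t * x) * of_real (exp (- x\<^sup>2 / 2)))"
  unfolding eq using i by (intro integrable_mult_right)
 have "(LBINT x. std_normal_density x *. iexp (t * x)) = of_real (exp (- t\<^sup>2 / 2))"
  using char_std_normal_distribution[THEN fun_cong, of t] m
  unfolding char_def by (subst (asm) integral_density) auto
 thus "(LBINT x. cis (t * x) * of_real (exp (- x\<^sup>2 / 2))) = of_real (sqrt (2 * pi) * exp (- t\<^sup>2 / 2))"
  unfolding eq integral_mult_right_zero by (simp only: of_real_mult)
qed

definition gauss :: "real^2 => real" where
 "gauss x = exp (- (norm x)\<^sup>2 / 2)"

lemma gauss_nonneg [simp]: "0 <= gauss x" by (simp add: gauss_def)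
lemma gauss_le_1 [simp]: "gauss x <= 1" by (simp add: gauss_def)
lemma gauss_measurable [measurable]: "borelf gauss"
 unfolding gauss_def by simp

lemma gauss_fourier:
 shows "lint (%x. cis (x .* xi) * of_real (gauss x))"
  and "(LBINT x. cis (x .* xi) * of_real (gauss x)) = of_real (2 * pi * gauss xi)"
proof -
 let ?F = "%t x. cis (t * x) * of_real (exp (- x\<^sup>2 / 2))"
 have eq: "cis (x .* xi) * of_real (gauss x) = ?F (xi $ 1) (x $ 1) * ?F (xi $ 2) (x $ 2)" for x
 proof -
  have n: "(norm x)^2 = (x $ 1)^2 + (x $ 2)^2"
   by (simp only: power2_norm_eq_inner inner_real2) (simp add: power2_eq_square)
  have "gauss x = exp (- (x$1)\<^sup>2 / 2) * exp (- (x$2)\<^sup>2 / 2)"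
   unfolding gauss_def n exp_add[symmetric] by (simp add: add_divide_distrib)
  moreover have "cis (x .* xi) = cis (xi $ 1 * x $ 1) * cis (xi $ 2 * x $ 2)"
   by (simp add: cis_mult inner_real2 mult.commute)
  ultimately show ?thesis by simp
 qed
 note i = gaussian_fourier_1d(1)
 show "lint (%x. cis (x .* xi) * of_real (gauss x))"
  unfolding eq by (rule integral_real2_prod(1)[OF i i])
 have n: "(norm xi)^2 = (xi $ 1)^2 + (xi $ 2)^2"
  by (simp only: power2_norm_eq_inner inner_real2) (simp add: power2_eq_square)
 have g: "gauss xi = exp (- (xi$1)\<^sup>2 / 2) * exp (- (xi$2)\<^sup>2 / 2)"
  unfolding gauss_def n exp_add[symmetric] by (simp add: add_divide_distrib)
 have "(LBINT x. cis (x .* xi) * of_real (gauss x)) 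
   = of_real (sqrt (2 * pi) * exp (- (xi$1)\<^sup>2 / 2)) * of_real (sqrt (2 * pi) * exp (- (xi$2)\<^sup>2 / 2))"
  unfolding eq integral_real2_prod(2)[OF i i] gaussian_fourier_1d(2) by simp
 also have "... = of_real ((sqrt (2 * pi) * sqrt (2 * pi)) * gauss xi)"
  unfolding g by (simp only: of_real_mult[symmetric] mult_ac)
 also have "sqrt (2 * pi) * sqrt (2 * pi) = 2 * pi" by simp
 finally show "(LBINT x. cis (x .* xi) * of_real (gauss x)) = of_real (2 * pi * gauss xi)" .
qed

lemma gauss_integrable: "lint gauss"
proof -
 have "lint (%x. Re (cis (x .* 0) * of_real (gauss x)))"
  by (intro integrable_Re gauss_fourier(1))
 thus ?thesis by simp
qed

lemma gauss_integral: "(LBINT x. gauss x) = 2 * pi"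
proof -
 have "complex_of_real (LBINT x. gauss x) = (LBINT x. of_real (gauss x))" by simp
 also have "... = of_real (2 * pi)"
  using gauss_fourier(2)[of 0] by (simp add: gauss_def)
 finally show ?thesis by (simp only: of_real_eq_iff)
qed

lemma integral_scale_real2:
 fixes f :: "real^2 => 'b::{banach, second_countable_topology}"
 assumes c: "c ~= 0" and [measurable]: "borelf f"
 shows "(LBINT x. f x) = c^2 *. (LBINT x. f (c *. x))"
proof -
 have "(LBINT x. f x) = (\<integral>x. f x \<partial>density (distr lborel borel (%x. 0 + c *. x)) (%_. abs c^DIM(real^2)))"
  using lborel_affine[OF c, of "0::real^2"] by simp
 also have "... = c^2 *. (LBINT x. f (c *. x))"
  by (subst integral_density) (simp_all add: integral_distr)
 finally show ?thesis .
qed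

lemma integrable_scale_real2:
 fixes f :: "real^2 => 'b::{banach, second_countable_topology}"
 assumes c: "c ~= 0" and f: "lint f"
 shows "lint (%x. f (c *. x))"
proof -
 have [measurable]: "borelf f" using f by auto
 have "integrable (density (distr lborel borel (%x. 0 + c *. x)) (%_. abs c^DIM(real^2))) f"
  using lborel_affine[OF c, of "0::real^2"] f by simp
 hence "lint (%x. c^2 *. f (c *. x))"
  by (subst (asm) integrable_density) (simp_all add: integrable_distr_eq c)
 from integrable_scaleR_right[OF this, of "1 / c^2"] show ?thesis using c by simp
qed

lemma nn_integral_scale_real2:
 fixes f :: "real^2 => ennreal"
 assumes c: "c ~= 0" and [measurable]: "borelf f"
 shows "(NNINT x. f x) = ennreal (c^2) * (NNINT x. f (c *. x))"
proof -
 have "(NNINT x. f x) = (\<integral>\<^sup>+x. f x \<partial>density (distr lborel borel (%x. 0 + c *. x)) (%_. abs c^DIM(real^2)))"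
  using lborel_affine[OF c, of "0::real^2"] by simp
 also have "... = ennreal (c^2) * (NNINT x. f (c *. x))"
  by (subst nn_integral_density) (simp_all add: nn_integral_distr nn_integral_cmult)
 finally show ?thesis .
qed

section \<open>Plancherel's theorem by Gaussian summation\<close>

definition fhat :: "(real^2 => real) => real^2 => complex" where
 "fhat f xi = (LBINT x. cis (- (x .* xi)) * of_real (f x))"

lemma cis_measurable [measurable (raw)]:
 "f \<in> borel_measurable M ==> (%x. cis (f x)) \<in> borel_measurable M"
 unfolding cis_conv_exp by measurable

lemma cnj_measurable [measurable (raw)]:
 "f \<in> borel_measurable M ==> (%x. cnj (f x)) \<in> borel_measurable M"
 by (rule measurable_compose[OF _ borel_measurable_continuous_onI]) (auto intro!: continuous_intros)

lemma fhat_measurable [measurable]: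
 assumes [measurable]: "borelf f"
 shows "borelf (fhat f)"
 unfolding fhat_def by measurable

lemma integrable_cis_mult:
 assumes f: "lint f" and [measurable]: "borelf g"
 shows "lint (%x. cis (g x) * complex_of_real (f x))"
proof -
 have [measurable]: "borelf f" using f by auto
 show ?thesis
  by (rule lint_bound[OF f]) (auto simp: norm_mult)
qed

text \<open>Its Fourier transform is the product \<open>fhat f * cnj (fhat g)\<close>.\<close>

definition correlation :: "(real^2 => real) => (real^2 => real) => real^2 => real" where
 "correlation f g w = (LBINT x. f x * g (x + w))"

text \<open>Fubini after the shear that replaces the second point by \<open>x + w\<close>; the two
  phases combine to \<open>cis (w .* xi)\<close>.\<close>

lemma
 assumes f: "lint f" and g: "lint g"
 shows correlation_integrable: "lint (correlation f g)"
  and correlation_fourier: "fhat f xi * cnj (fhat g xi)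
   = (LBINT w. cis (w .* xi) * of_real (correlation f g w))"
proof -
 have [measurable]: "borelf f" "borelf g" using f g by auto
 have i: "lint (%p. f (fst p) * g (fst p + snd p))"
  using mpm_integrable[OF mpm_shear integrable_mult_prod[OF f g]] by simp
 have "integrable lborel2 (%(x, w). f x * g (x + w))"
  using i by (simp add: lborel_prod split_beta')
 hence "integrable lborel2 (%(w, x). f x * g (x + w))"
  using lborel_pair.integrable_product_swap_iff[of "%(x, w). f x * g (x + w)"] by simp
 from lborel_pair.integrable_fst'[OF this] show "lint (correlation f g)"
  by (simp add: correlation_def[abs_def])
 let ?F = "%x. cis (- (x .* xi)) * complex_of_real (f x)"
 let ?G = "%x. cis (x .* xi) * complex_of_real (g x)"
 have F: "lint ?F" and G: "lint ?G"
  using f g by (auto intro!: integrable_cis_mult)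
 have [measurable]: "borelf ?F" "borelf ?G" by measurable
 note FG = integrable_mult_prod[OF F G]
 have FGs: "lint (%p. ?F (fst p) * ?G (fst p + snd p))"
  using mpm_integrable[OF mpm_shear FG] by simp
 have "cnj (fhat g xi) = (LBINT x. cnj (cis (- (x .* xi)) * complex_of_real (g x)))"
  unfolding fhat_def by (rule Bochner_Integration.integral_cnj[symmetric])
 also have "... = (LBINT x. ?G x)"
  by (rule LINT_cong) (auto simp: cis_cnj)
 finally have "cnj (fhat g xi) = (LBINT x. ?G x)" .
 hence "fhat f xi * cnj (fhat g xi) = (LBINT p. ?F (fst p) * ?G (snd p))"
  by (subst integral_fst_lborel[OF FG]) (simp add: fhat_def)
 also have "... = (LBINT p. ?F (fst p) * ?G (fst p + snd p))"
  by (subst mpm_integral[OF mpm_shear, of "%p. ?F (fst p) * ?G (snd p)", symmetric])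
   (use borel_measurable_integrable[OF FG] in simp_all)
 also have "... = (LBINT x. LBINT w. ?F x * ?G (x + w))"
  by (subst integral_fst_lborel[OF FGs]) simp
 also have "... = (LBINT w. LBINT x. ?F x * ?G (x + w))"
  using integral_swap_lborel[OF FGs] by simp
 also have "... = (LBINT w. cis (w .* xi) * of_real (correlation f g w))"
 proof (rule LINT_cong[OF refl], goal_cases)
  case (1 w)
  have "?F x * ?G (x + w) = cis (w .* xi) * complex_of_real (f x * g (x + w))" for x
  proof -
   have "cis (- (x .* xi)) * cis ((x + w) .* xi) = cis (w .* xi)"
    by (simp add: cis_mult inner_add_left)
   thus ?thesis by (simp add: mult_ac)
  qed
  thus ?case
   by (simp only: correlation_def integral_mult_right_zero integral_complex_of_real)
 qed
 finally show "fhat f xi * cnj (fhat g xi)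
   = (LBINT w. cis (w .* xi) * of_real (correlation f g w))" .
qed

text \<open>The Gaussian factor makes the double integral absolutely convergent, even where the
  transform of \<open>A\<close> is not integrable; the inner integral is then the Gaussian transform
  at scale \<open>1 / eps\<close>.\<close>

lemma gauss_inversion:
 fixes A :: "real^2 => real"
 assumes A: "lint A" and eps: "0 < eps"
 shows "(LBINT xi. (LBINT w. cis (w .* xi) * of_real (A w)) * of_real (gauss (eps *. xi)))
  = of_real (2 * pi * (LBINT z. A (eps *. z) * gauss z))"
proof -
 have [measurable]: "borelf A" using A by auto
 have ge: "lint (%xi. gauss (eps *. xi))"
  using eps by (intro integrable_scale_real2 gauss_integrable) auto
 have pg: "lint (%p. A (snd p) * gauss (eps *. (fst p)))"
  using integrable_mult_prod[OF ge A] by (simp add: mult.commute)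
 have i: "lint (%p. cis (snd p .* fst p) * of_real (A (snd p) * gauss (eps *. (fst p))))"
  by (intro integrable_cis_mult pg) (intro borel_measurable_continuous_onI continuous_intros)
 have "(LBINT xi. (LBINT w. cis (w .* xi) * of_real (A w)) * of_real (gauss (eps *. xi)))
  = (LBINT xi. LBINT w. cis (w .* xi) * of_real (A w * gauss (eps *. xi)))"
  by (subst integral_mult_left_zero[symmetric]) (simp add: mult.assoc)
 also have "... = (LBINT w. LBINT xi. cis (w .* xi) * of_real (A w * gauss (eps *. xi)))"
  using integral_swap_lborel[OF i] by simp
 also have "... = (LBINT w. of_real ((2 * pi / eps^2) * (A w * gauss ((1 / eps) *. w))))"
 proof (rule LINT_cong[OF refl], goal_cases)
  case (1 w)
  let ?h = "%eta. cis (eta .* ((1 / eps) *. w)) * complex_of_real (gauss eta)"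
  have "(LBINT xi. ?h xi) = eps^2 *. (LBINT xi. ?h (eps *. xi))"
   using eps by (intro integral_scale_real2) auto
  hence 1: "(LBINT xi. ?h (eps *. xi)) = of_real (2 * pi / eps^2 * gauss ((1 / eps) *. w))"
   using eps unfolding gauss_fourier(2) by (simp add: scaleR_conv_of_real field_simps)
  have "(LBINT xi. cis (w .* xi) * of_real (A w * gauss (eps *. xi))) = (LBINT xi. of_real (A w) * ?h (eps *. xi))"
   using eps by (intro LINT_cong) (auto simp: inner_commute)
  also have "... = of_real (A w) * of_real (2 * pi / eps^2 * gauss ((1 / eps) *. w))"
   by (simp only: integral_mult_right_zero 1)
  finally show ?case
   by (simp only: of_real_mult[symmetric] mult_ac)
 qed
 also have "... = of_real (LBINT w. (2 * pi / eps^2) * (A w * gauss ((1 / eps) *. w)))"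
  by (rule integral_complex_of_real)
 also have "(LBINT w. (2 * pi / eps^2) * (A w * gauss ((1 / eps) *. w)))
   = (2 * pi / eps^2) * (LBINT w. A w * gauss ((1 / eps) *. w))"
  by (rule integral_mult_right_zero)
 also have "(LBINT w. A w * gauss ((1 / eps) *. w)) = eps^2 * (LBINT z. A (eps *. z) * gauss z)"
  using eps by (subst integral_scale_real2[of eps]) auto
 also have "(2 * pi / eps^2) * (eps^2 * (LBINT z. A (eps *. z) * gauss z)) = 2 * pi * (LBINT z. A (eps *. z) * gauss z)"
  using eps by simp
 finally show ?thesis .
qed

lemma gauss_approximate_identity:
 fixes A :: "real^2 => real"
 assumes [measurable]: "borelf A" and B: "!!x. abs (A x) <= B" and c: "(A ---> A 0) (at 0)"
 shows "(%n. LBINT z. A ((1 / real (Suc n)) *. z) * gauss z) ----> 2 * pi * A 0"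
proof -
 have "(%n. LBINT z. A ((1 / real (Suc n)) *. z) * gauss z) ----> (LBINT z. A 0 * gauss z)"
 proof (rule integral_dominated_convergence[where w = "%z. B * gauss z"])
  show "AEL z. (%n. A ((1 / real (Suc n)) *. z) * gauss z) ----> A 0 * gauss z"
  proof (rule AE_I2, goal_cases)
   case (1 z)
   have 1: "(%n. (1 / real (Suc n)) *. z) ----> 0 *. z"
    by (intro tendsto_scaleR LIMSEQ_Suc[OF lim_1_over_n] tendsto_const)
   have "isCont A 0" using c by (simp add: isCont_def)
   from isCont_tendsto_compose[OF this 1[simplified]]
   show ?case
    by (intro tendsto_mult tendsto_const) simp
  qed
  show "AEL z. norm (A ((1 / real (Suc n)) *. z) * gauss z) <= B * gauss z" for n :: nat
   by (rule AE_I2) (use B in "auto simp: abs_mult intro!: mult_right_mono")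
  show "lint (%z. B * gauss z)" using gauss_integrable by simp
 qed auto
 thus ?thesis by (simp add: gauss_integral mult.commute)
qed

lemma correlation_bound:
 assumes f: "lint f" "lint (%x. (f x)^2)"
  and g: "lint g" "lint (%x. (g x)^2)"
 shows "abs (correlation f g w) <= (LBINT x. (f x)^2) + (LBINT x. (g x)^2)"
proof -
 have [measurable]: "borelf f" "borelf g" using f g by auto
 have gw: "lint (%x. (g (x + w))^2)" by (rule integrable_translate[OF g(2)])
 have "abs (correlation f g w) <= (LBINT x. abs (f x * g (x + w)))"
  unfolding correlation_def by (rule integral_abs_bound)
 also have "... <= (LBINT x. (f x)^2 + (g (x + w))^2)"
 proof (rule integral_mono)
  show "lint (%x. abs (f x * g (x + w)))"
   by (intro integrable_abs integrable_mult_square) (use f gw in auto)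
  show "lint (%x. (f x)^2 + (g (x + w))^2)" using f gw by simp
  show "abs (f x * g (x + w)) <= (f x)^2 + (g (x + w))^2" for x
  proof -
   have "2 * (abs (f x) * abs (g (x + w))) <= (f x)^2 + (g (x + w))^2"
    using sum_squares_bound[of "abs (f x)" "abs (g (x + w))"] by simp
   moreover have "0 <= abs (f x) * abs (g (x + w))" by simp
   ultimately show ?thesis unfolding abs_mult by linarith
  qed
 qed
 also have "... = (LBINT x. (f x)^2) + (LBINT x. (g (x + w))^2)"
  using f gw by simp
 also have "(LBINT x. (g (x + w))^2) = (LBINT x. (g x)^2)"
  by (rule integral_translate) simp
 finally show ?thesis .
qed

text \<open>Gaussian summation of the correlation at 0, where it is continuous and equal to the
  integral of the product. One factor \<open>2 * pi\<close> comes from inversion, the other from the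
  total mass of \<open>gauss\<close>.\<close>

lemma plancherel_gauss_limit:
 assumes f: "lint f" "lint (%x. (f x)^2)"
  and g: "lint g" "lint (%x. (g x)^2)"
 shows "(%n. LBINT xi. fhat f xi * cnj (fhat g xi) * of_real (gauss ((1 / real (Suc n)) *. xi)))
  ----> of_real ((2 * pi)^2 * (LBINT x. f x * g x))"
proof -
 have [measurable]: "borelf f" "borelf g" using f g by auto
 note ci = correlation_integrable[OF f(1) g(1)]
 have c0: "correlation f g 0 = (LBINT x. f x * g x)" by (simp add: correlation_def)
 have eq: "(LBINT xi. fhat f xi * cnj (fhat g xi) * of_real (gauss ((1 / real (Suc n)) *. xi)))
   = of_real (2 * pi * (LBINT z. correlation f g ((1 / real (Suc n)) *. z) * gauss z))" for n
  unfolding correlation_fourier[OF f(1) g(1)]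
  by (rule gauss_inversion[OF ci]) simp
 have "(%n. LBINT z. correlation f g ((1 / real (Suc n)) *. z) * gauss z) ----> 2 * pi * correlation f g 0"
 proof (rule gauss_approximate_identity)
  show "borelf (correlation f g)" using ci by auto
  show "(correlation f g ---> correlation f g 0) (at 0)"
   unfolding c0 unfolding correlation_def[abs_def]
   by (rule translation_correlation_tendsto) (use f g in auto)
 qed (rule correlation_bound[OF f g])
 hence "(%n. complex_of_real (2 * pi * (LBINT z. correlation f g ((1 / real (Suc n)) *. z) * gauss z)))
  ----> of_real (2 * pi * (2 * pi * correlation f g 0))"
  by (intro tendsto_of_real tendsto_mult tendsto_const)
 thus ?thesis unfolding eq c0 by (simp add: power2_eq_square mult.assoc)
qed

text \<open>The damping factors increase to 1, so monotone convergence turns the limit of the damped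
  integrals into integrability.\<close>

lemma plancherel_norm:
 assumes f: "lint f" "lint (%x. (f x)^2)"
 shows "lint (%xi. (cmod (fhat f xi))^2)"
  and "(LBINT xi. (cmod (fhat f xi))^2) = (2 * pi)^2 * (LBINT x. (f x)^2)"
proof -
 have [measurable]: "borelf f" using f by auto
 define F where "F n xi = (cmod (fhat f xi))^2 * gauss ((1 / real (Suc n)) *. xi)" for n xi
 define C where "C = (LBINT x. abs (f x))"
 have bd: "cmod (fhat f xi) <= C" for xi
 proof -
  have "cmod (fhat f xi) <= (LBINT x. cmod (cis (- (x .* xi)) * of_real (f x)))"
   unfolding fhat_def by (rule integral_norm_bound)
  thus ?thesis by (simp add: norm_mult C_def)
 qed
 have "0 <= C" unfolding C_def by simp
 have gi: "lint (%xi. gauss ((1 / real (Suc n)) *. xi))" for n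
  by (intro integrable_scale_real2 gauss_integrable) auto
 have Fi: "lint (F n)" for n
 proof (rule lint_bound)
  show "lint (%xi. C^2 * gauss ((1 / real (Suc n)) *. xi))" using gi by simp
  show "AEL xi. norm (F n xi) <= norm (C^2 * gauss ((1 / real (Suc n)) *. xi))"
   using bd \<open>0 <= C\<close> by (intro AE_I2) (auto simp: F_def intro!: mult_right_mono power_mono)
 qed (simp add: F_def[abs_def])
 have lim: "(%n. LBINT xi. F n xi) ----> (2 * pi)^2 * (LBINT x. (f x)^2)"
 proof -
  have "(%n. complex_of_real (LBINT xi. F n xi)) ----> of_real ((2 * pi)^2 * (LBINT x. f x * f x))"
  proof -
   have "complex_of_real (LBINT xi. F n xi) =
    (LBINT xi. fhat f xi * cnj (fhat f xi) * of_real (gauss ((1 / real (Suc n)) *. xi)))" for n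
    unfolding integral_complex_of_real[symmetric] F_def
    by (simp only: of_real_mult complex_norm_square)
   thus ?thesis using plancherel_gauss_limit[OF f f] by simp
  qed
  thus ?thesis by (simp only: tendsto_of_real_iff power2_eq_square)
 qed
 have mono: "AEL xi. mono (%n. F n xi)"
 proof (rule AE_I2, rule monoI)
  fix xi :: "real^2" and m n :: nat assume "m <= n"
  hence "norm ((1 / real (Suc n)) *. xi) <= norm ((1 / real (Suc m)) *. xi)"
   by (simp add: frac_le mult_right_mono divide_left_mono)
  hence "gauss ((1 / real (Suc m)) *. xi) <= gauss ((1 / real (Suc n)) *. xi)"
   unfolding gauss_def by (auto intro!: power_mono divide_right_mono)
  thus "F m xi <= F n xi" unfolding F_def by (intro mult_left_mono) auto
 qed
 have pt: "AEL xi. (%n. F n xi) ----> (cmod (fhat f xi))^2"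
 proof (rule AE_I2, goal_cases)
  case (1 xi)
  have "(%n. gauss ((1 / real (Suc n)) *. xi)) ----> gauss (0 *. xi)"
   unfolding gauss_def by (intro tendsto_intros LIMSEQ_Suc[OF lim_1_over_n]) simp
  hence "(%n. F n xi) ----> (cmod (fhat f xi))^2 * gauss (0 *. xi)"
   unfolding F_def by (intro tendsto_mult tendsto_const)
  thus ?case by (simp add: gauss_def)
 qed
 have m: "(%xi. (cmod (fhat f xi))^2) \<in> borel_measurable lborel" by simp
 show "lint (%xi. (cmod (fhat f xi))^2)"
  by (rule integrable_monotone_convergence[OF Fi mono pt lim m])
 show "(LBINT xi. (cmod (fhat f xi))^2) = (2 * pi)^2 * (LBINT x. (f x)^2)"
  by (rule integral_monotone_convergence[OF Fi mono pt lim m])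
qed

lemma parseval:
 assumes f: "lint f" "lint (%x. (f x)^2)"
  and g: "lint g" "lint (%x. (g x)^2)"
 shows "(LBINT xi. fhat f xi * cnj (fhat g xi)) = of_real ((2 * pi)^2 * (LBINT x. f x * g x))"
proof (rule LIMSEQ_unique)
 let ?P = "%n xi. fhat f xi * cnj (fhat g xi) * of_real (gauss ((1 / real (Suc n)) *. xi))"
 let ?Q = "%xi. cmod (fhat f xi) * cmod (fhat g xi)"
 have [measurable]: "borelf f" "borelf g" using f g by auto
 show "(%n. LBINT xi. ?P n xi)
  ----> of_real ((2 * pi)^2 * (LBINT x. f x * g x))"
  by (rule plancherel_gauss_limit[OF f g])
 show "(%n. LBINT xi. ?P n xi)
  ----> (LBINT xi. fhat f xi * cnj (fhat g xi))"
 proof (rule integral_dominated_convergence[where w = "%xi. ?Q xi"])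
  show "AEL xi. (%n. ?P n xi)
   ----> fhat f xi * cnj (fhat g xi)"
  proof (rule AE_I2, goal_cases)
   case (1 xi)
   have "(%n. gauss ((1 / real (Suc n)) *. xi)) ----> gauss (0 *. xi)"
    unfolding gauss_def by (intro tendsto_intros LIMSEQ_Suc[OF lim_1_over_n]) simp
   hence "(%n. ?P n xi)
    ----> fhat f xi * cnj (fhat g xi) * of_real (gauss (0 *. xi))"
    by (intro tendsto_mult tendsto_const tendsto_of_real)
   thus ?case by (simp add: gauss_def)
  qed
  show "AEL xi. norm (?P n xi)
   <= ?Q xi" for n :: nat
  proof (rule AE_I2, goal_cases)
   case (1 xi)
   have "?Q xi * gauss ((1 / real (Suc n)) *. xi)
    <= ?Q xi * 1" by (intro mult_left_mono) auto
   thus ?case by (simp add: norm_mult)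
  qed
  show "lint (%xi. ?Q xi)"
   by (intro integrable_mult_square plancherel_norm(1) f g) simp_all
 qed simp_all
qed

lemma fhat_translate:
 assumes "lint f"
 shows "fhat (%x. f (x + h) - f x) xi = (cis (h .* xi) - 1) * fhat f xi"
proof -
 have [measurable]: "borelf f" using assms by auto
 have i: "lint (%x. cis (- (x .* xi)) * of_real (f (x + h)))"
  "lint (%x. cis (- (x .* xi)) * of_real (f x))"
  using integrable_translate[OF assms, of h] assms by (auto intro!: integrable_cis_mult)
 have "(LBINT x. cis (- (x .* xi)) * of_real (f (x + h))) 
   = (LBINT x. cis (h .* xi) * (cis (- ((x + h) .* xi)) * of_real (f (x + h))))"
 proof (rule LINT_cong[OF refl], goal_cases)
  case (1 x)
  have "cis (h .* xi) * cis (- ((x + h) .* xi)) = cis (- (x .* xi))"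
   by (simp add: cis_mult inner_add_left)
  thus ?case
   by (simp only: mult.assoc[symmetric])
 qed
 also have "... = cis (h .* xi) * fhat f xi"
  unfolding fhat_def integral_mult_right_zero
  by (subst integral_translate[of "%x. cis (- (x .* xi)) * of_real (f x)"]) simp_all
 finally have 1: "(LBINT x. cis (- (x .* xi)) * of_real (f (x + h))) = cis (h .* xi) * fhat f xi" .
 have "fhat (%x. f (x + h) - f x) xi = 
  (LBINT x. cis (- (x .* xi)) * of_real (f (x + h)) - cis (- (x .* xi)) * of_real (f x))"
  unfolding fhat_def by (simp add: right_diff_distrib)
 also have "... = cis (h .* xi) * fhat f xi - fhat f xi"
  using i by (subst Bochner_Integration.integral_diff) (auto simp: 1 fhat_def)
 finally show ?thesis by (simp add: left_diff_distrib)
qed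

section \<open>The kernel and its energy\<close>

lemma integral_FTC_UNIV:
 fixes f F :: "real => real"
 assumes F: "!!x. (F has_real_derivative f x) (at x)" and f: "!!x. isCont f x" and nn: "!!x. 0 <= f x"
  and A: "(F ---> A) at_bot" and B: "(F ---> B) at_top"
 shows "lint f" "integral\<^sup>L lborel f = B - A"
proof -
 have *: "((F \<circ> real_of_ereal) ---> A) (at_right (-\<infinity>))" "((F \<circ> real_of_ereal) ---> B) (at_left \<infinity>)"
  using A B by (simp_all add: ereal_tendsto_simps)
 have 1: "set_integrable lborel (einterval (-\<infinity>) \<infinity>) f"
  by (rule interval_integral_FTC_nonneg(1)[OF _ F f _ *]) (use nn in auto)
 have 2: "(LBINT x=-\<infinity>..\<infinity>. f x) = B - A"
  by (rule interval_integral_FTC_nonneg(2)[OF _ F f _ *]) (use nn in auto)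
 show "lint f" using 1 by (simp add: set_integrable_def)
 show "integral\<^sup>L lborel f = B - A" using 2
  by (simp add: interval_lebesgue_integral_def set_lebesgue_integral_def)
qed

lemma integral_inverse_1_plus_square:
 "lint (%x::real. 1 / (1 + x^2))" "(LBINT x. 1 / (1 + x^2)) = pi"
proof -
 have pos: "1 + x^2 ~= 0" for x :: real by (metis add_pos_nonneg less_numeral_extra(1) order_less_irrefl zero_le_power2)
 have d: "(arctan has_real_derivative 1 / (1 + x^2)) (at x)" for x
  by (auto intro!: derivative_eq_intros simp: inverse_eq_divide)
 have c: "isCont (%x::real. 1 / (1 + x^2)) x" for x
  by (intro continuous_intros pos)
 show "lint (%x::real. 1 / (1 + x^2))"
  by (rule integral_FTC_UNIV(1)[OF d c _ tendsto_arctan_at_bot tendsto_arctan_at_top]) simp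
 show "(LBINT x. 1 / (1 + x^2)) = pi"
  using integral_FTC_UNIV(2)[OF d c _ tendsto_arctan_at_bot tendsto_arctan_at_top] by simp
qed

text \<open>The kernel of an operator of order 1 in dimension 2, with exponent 2 + 1. Division by
  zero makes \<open>kern 0 = 0\<close>, so the diagonal contributes nothing.\<close>

definition kern :: "real^2 => real" where
 "kern h = 1 / norm h ^ 3"

lemma kern_nonneg [simp]: "0 <= kern h" by (simp add: kern_def)
lemma kern_commute: "kern (x - y) = kern (y - x)" by (simp add: kern_def norm_minus_commute)
lemma kern_measurable [measurable]: "borelf kern" unfolding kern_def by measurable
lemma kern_scale: "kern (c *. h) = kern h / abs c ^ 3" by (simp add: kern_def power_mult_distrib)

definition slope_norm :: "real => real" where
 "slope_norm sg = sqrt (1 + sg^2)"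

lemma norm_slope: "norm (vec2 1 sg) = slope_norm sg"
 by (simp add: norm_vec2 slope_norm_def)
lemma slope_norm_ge_1: "1 <= slope_norm sg" by (simp add: slope_norm_def)
lemma slope_norm_pos [simp]: "0 < slope_norm sg" using slope_norm_ge_1[of sg] by linarith
lemma slope_norm_nonneg [simp]: "0 <= slope_norm sg" by (rule less_imp_le) simp
lemma slope_norm_measurable [measurable]: "borelf slope_norm"
 unfolding slope_norm_def by measurable
lemma slope_norm_square: "(slope_norm sg)^2 = 1 + sg^2"
 by (simp add: slope_norm_def)

text \<open>The Jacobian turns the third power of \<open>abs t\<close> in the denominator into
  \<open>t^2\<close>: on each line through the origin the kernel becomes that of the one-dimensional
  half-Laplacian, which allows later computations chord by chord.\<close>

lemma kern_slope_integral:
 assumes [measurable]: "borelf f"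
 shows "(NNINT h. ennreal (kern h) * f h)
  = (NNINT sg. ennreal (1 / slope_norm sg ^ 3) * (NNINT t. ennreal (1 / t^2) * f (t *. vec2 1 sg)))"
proof -
 have "ennreal (abs t) * (ennreal (kern (t *. vec2 1 sg)) * f (t *. vec2 1 sg))
   = ennreal (1 / slope_norm sg ^ 3) * (ennreal (1 / t^2) * f (t *. vec2 1 sg))" for t sg
 proof -
  have "abs t * kern (t *. vec2 1 sg) = 1 / slope_norm sg ^ 3 * (1 / t^2)"
   by (cases "t = 0") (auto simp: kern_def norm_slope power_mult_distrib power2_eq_square power3_eq_cube abs_mult_self_eq)
  hence "ennreal (abs t) * ennreal (kern (t *. vec2 1 sg)) = ennreal (1 / slope_norm sg ^ 3) * ennreal (1 / t^2)"
   by (simp add: ennreal_mult[symmetric] less_imp_le)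
  thus ?thesis by (simp only: mult.assoc[symmetric])
 qed
 thus ?thesis
  by (subst nn_integral_slope) (simp_all add: nn_integral_cmult)
qed

text \<open>Levy's condition on the kernel. In slope coordinates the inner integral is that of
  \<open>G\<close>, scaled by \<open>slope_norm sg\<close>; what remains is the integral of
  \<open>1 / (1 + sg^2)\<close>.\<close>

lemma kern_min_finite: "lint (%h. kern h * min 1 ((norm h)^2))"
proof (rule integrableI_nonneg)
 define G where "G u = min 1 (u^2) / u^2" for u :: real
 have [measurable]: "borelf G" unfolding G_def by measurable
 have G0: "0 <= G u" for u by (simp add: G_def)
 have Gle: "G u <= 2 * (1 / (1 + u^2))" for u
 proof (cases "u = 0")
  case False
  hence p: "0 < u^2" by simp
  have d: "0 < 1 + u^2" using p by linarith
  show ?thesis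
  proof (cases "u^2 <= 1")
   case True
   hence "G u = 1" using p by (simp add: G_def)
   thus ?thesis using True d by (simp add: pos_le_divide_eq)
  next
   case False
   hence "G u = 1 / u^2" by (simp add: G_def)
   moreover have "1 / u^2 <= 2 / (1 + u^2)" using False d p by (simp add: divide_le_eq pos_le_divide_eq)
   ultimately show ?thesis by simp
  qed
 qed (simp add: G_def)
 have Gfin: "(NNINT u. ennreal (G u)) < \<infinity>"
 proof -
  have "(NNINT u. ennreal (G u)) <= (NNINT u. ennreal (2 * (1 / (1 + u^2))))"
   by (intro nn_integral_mono ennreal_leI Gle)
  also have "... < \<infinity>"
   by (subst nn_integral_eq_integral[OF integrable_mult_right[OF integral_inverse_1_plus_square(1)]]) auto
  finally show ?thesis .
 qed
 have inner: "(NNINT t. ennreal (1 / t^2) * ennreal (min 1 ((norm (t *. vec2 1 sg))^2)))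
   = ennreal (slope_norm sg) * (NNINT u. ennreal (G u))" for sg
 proof -
  let ?L = "slope_norm sg"
  have nt: "(norm (t *. vec2 1 sg))^2 = (?L * t)^2" for t
   by (simp only: norm_scaleR norm_slope power_mult_distrib power2_abs real_norm_def mult.commute)
  have "(NNINT u. ennreal (G u)) = ennreal ?L * (NNINT t. ennreal (G (?L * t)))"
   using nn_integral_real_affine[of "%u. ennreal (G u)" ?L 0] slope_norm_pos[of sg] by simp
  moreover have "ennreal (1 / t^2) * ennreal (min 1 ((norm (t *. vec2 1 sg))^2)) = ennreal (?L * ?L) * ennreal (G (?L * t))" for t
  proof -
   have "1 / t^2 * min 1 ((norm (t *. vec2 1 sg))^2) = (?L * ?L) * G (?L * t)"
    unfolding nt using slope_norm_pos[of sg] by (cases "t = 0") (simp_all add: G_def power_mult_distrib power2_eq_square)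
   thus ?thesis by (simp only: ennreal_mult[symmetric] G0 zero_le_square) (simp add: ennreal_mult'[symmetric])
  qed
  ultimately show ?thesis
   by (simp add: nn_integral_cmult mult.assoc ennreal_mult)
 qed
 have "(NNINT h. ennreal (kern h * min 1 ((norm h)^2)))
   = (NNINT h. ennreal (kern h) * ennreal (min 1 ((norm h)^2)))"
  by (simp add: ennreal_mult)
 also have "... = (NNINT sg. ennreal (1 / slope_norm sg ^ 3) * (ennreal (slope_norm sg) * (NNINT u. ennreal (G u))))"
  by (subst kern_slope_integral) (simp_all only: inner, measurable)
 also have "... = (NNINT sg. ennreal (1 / (1 + sg^2)) * (NNINT u. ennreal (G u)))"
 proof (rule nn_integral_cong, goal_cases)
  case (1 sg)
  have "1 / slope_norm sg ^ 3 * slope_norm sg = 1 / (1 + sg^2)"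
   using slope_norm_pos[of sg] unfolding slope_norm_square[symmetric] by (simp add: power2_eq_square power3_eq_cube)
  hence "ennreal (1 / slope_norm sg ^ 3) * ennreal (slope_norm sg) = ennreal (1 / (1 + sg^2))"
   by (simp add: ennreal_mult'[symmetric] less_imp_le)
  thus ?case
   by (simp only: mult.assoc[symmetric])
 qed
 also have "... = ennreal pi * (NNINT u. ennreal (G u))"
  using integral_inverse_1_plus_square by (subst nn_integral_multc) (simp_all add: nn_integral_eq_integral)
 also have "... < \<infinity>" using Gfin by (simp add: ennreal_mult_less_top)
 finally show "(NNINT h. ennreal (kern h * min 1 ((norm h)^2))) < \<infinity>" .
qed auto

lemma kern_integrable_dominated:
 assumes [measurable]: "borelf f" and b: "!!h. abs (f h) <= C * min 1 ((norm h)^2)"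
 shows "lint (%h. kern h * f h)"
proof (rule lint_bound)
 show "lint (%h. C * (kern h * min 1 ((norm h)^2)))" using kern_min_finite by simp
 show "AEL h. norm (kern h * f h) <= norm (C * (kern h * min 1 ((norm h)^2)))"
 proof (rule AE_I2, goal_cases)
  case (1 h)
  have "kern h * abs (f h) <= kern h * (C * min 1 ((norm h)^2))" by (intro mult_left_mono b) simp
  also have "... <= abs (C * (kern h * min 1 ((norm h)^2)))" by (simp add: mult_ac)
  finally show ?case by (simp add: abs_mult)
 qed
qed measurable

section \<open>The Fourier symbol of the kernel\<close>

lemma cmod_cis_minus_1: "(cmod (cis t - 1))^2 = 2 - 2 * cos t"
proof -
 have "(cmod (cis t - 1))^2 = (cos t - 1)^2 + (sin t)^2" by (simp add: cmod_power2)
 also have "... = 2 - 2 * cos t" using sin_cos_squared_add[of t] by (simp add: power2_diff)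
 finally show ?thesis .
qed

lemma cmod_cis_minus_1_le: "(cmod (cis t - 1))^2 <= 4 * min 1 (t^2)"
proof -
 have 1: "(cmod (cis t - 1))^2 <= 4" unfolding cmod_cis_minus_1 using cos_ge_minus_one[of t] by linarith
 have "2 - 2 * cos t = 4 * (sin (t/2))^2" using cos_double_sin[of "t/2"] by simp
 also have "... <= 4 * (t/2)^2" by (intro mult_left_mono abs_le_square_iff[THEN iffD1] abs_sin_x_le_abs_x) simp
 also have "... = t^2" by (simp add: power2_eq_square)
 also have "... <= 4 * t^2" by simp
 finally show ?thesis unfolding cmod_cis_minus_1[symmetric] using 1 by (simp add: min_def)
qed

definition symbol_const :: real where
 "symbol_const = (LBINT h. kern h * (cmod (cis (h .* axis 1 1) - 1))^2)"

lemma symbol_integrable: "lint (%h. kern h * (cmod (cis (h .* axis 1 1) - 1))^2)"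
proof (rule kern_integrable_dominated[where C = 4])
 fix h :: "real^2"
 have "(h .* axis 1 1)^2 <= (norm h)^2"
  using Cauchy_Schwarz_ineq2[of h "axis 1 1"] by (intro abs_le_square_iff[THEN iffD1]) simp
 hence "4 * min 1 ((h .* axis 1 1)^2) <= 4 * min 1 ((norm h)^2)" by simp
 with cmod_cis_minus_1_le[of "h .* axis 1 1"]
 have "(cmod (cis (h .* axis 1 1) - 1))^2 <= 4 * min 1 ((norm h)^2)" by (rule order_trans)
 thus "abs ((cmod (cis (h .* axis 1 1) - 1))^2) <= 4 * min 1 ((norm h)^2)"
  by (simp only: abs_of_nonneg zero_le_power2)
qed measurable

lemma symbol_const_pos: "0 < symbol_const"
 unfolding symbol_const_def
proof (rule integral_pos_ball[where c = "vec2 1 0" and r = 1, OF symbol_integrable])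
 fix h :: "real^2" assume "h \<in> ball (vec2 1 0) 1"
 hence "norm (h - vec2 1 0) < 1" by (simp add: dist_norms)
 hence "abs ((h - vec2 1 0) $ 1) < 1" using component_le_norm_cart[of "h - vec2 1 0" 1] by linarith
 hence h1: "0 < h $ 1" "h $ 1 < 2" by auto
 have "cos (h $ 1) < 1" using h1 pi_gt3 cos_monotone_0_pi[of 0 "h $ 1"] by simp
 moreover have "h ~= 0" using h1 by auto
 ultimately show "0 < kern h * (cmod (cis (h .* axis 1 1) - 1))^2"
  unfolding cmod_cis_minus_1 by (simp add: inner_axis kern_def)
qed simp_all

text \<open>Rotation invariance reduces the frequency to the first axis and homogeneity to unit
  length: the kernel contributes \<open>c ^ 3\<close>, the Jacobian divides by
  \<open>c^2\<close>.\<close>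

lemma symbol_eq: "(NNINT h. ennreal (kern h * (cmod (cis (h .* xi) - 1))^2)) = ennreal (symbol_const * norm xi)"
proof (cases "xi = 0")
 case False
 define c where "c = norm xi"
 have c: "0 < c" using False by (simp add: c_def)
 define F where "F h = ennreal (kern h * (cmod (cis (h .* axis 1 1) - 1))^2)" for h
 have [measurable]: "borelf F" unfolding F_def by measurable
 have "norm xi = norm (c *. axis 1 1 :: real^2)" using c by (simp add: c_def)
 then obtain T :: "real^2 => real^2" where T: "orthogonal_transformation T" "T xi = c *. axis 1 1"
  using orthogonal_transformation_exists by metis
 have "(NNINT h. ennreal (kern h * (cmod (cis (h .* xi) - 1))^2))
   = (NNINT h. ennreal (kern (T h) * (cmod (cis (T h .* (c *. axis 1 1)) - 1))^2))"
  unfolding T(2)[symmetric] using T(1) by (simp add: orthogonal_transformation_def kern_def orthogonal_transformation_norm[OF T(1)])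
 also have "... = (NNINT h. ennreal (kern h * (cmod (cis (h .* (c *. axis 1 1)) - 1))^2))"
  by (rule mpm_nn_integral[OF mpm_orthogonal[OF T(1)], of "%h. ennreal (kern h * (cmod (cis (h .* (c *. axis 1 1)) - 1))^2)"]) measurable
 also have "... = (NNINT h. ennreal (c ^ 3) * F (c *. h))"
  using c by (intro nn_integral_cong) (simp add: F_def kern_scale ennreal_mult'[symmetric])
 also have "... = ennreal (c ^ 3) * (NNINT h. F (c *. h))"
  by (rule nn_integral_cmult) measurable
 also have "... = ennreal c * (ennreal (c^2) * (NNINT h. F (c *. h)))"
  using c by (simp add: mult.assoc[symmetric] ennreal_mult'[symmetric] power2_eq_square power3_eq_cube)
 also have "ennreal (c^2) * (NNINT h. F (c *. h)) = (NNINT h. F h)"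
  using c by (intro nn_integral_scale_real2[symmetric]) auto
 also have "... = ennreal symbol_const"
  unfolding F_def symbol_const_def by (intro nn_integral_eq_integral symbol_integrable) auto
 finally show ?thesis using c symbol_const_pos by (simp add: c_def ennreal_mult'[symmetric] mult.commute)
qed simp

section \<open>The energy form\<close>

definition edens :: "(real^2 => real) => (real^2 => real) => (real^2) \<times> (real^2) => real" where
 "edens f g p = kern (snd p - fst p) * ((f (snd p) - f (fst p)) * (g (snd p) - g (fst p)))"

definition energy :: "(real^2 => real) => (real^2 => real) => real" where
 "energy f g = integral\<^sup>L lborel (edens f g)"

definition finite_energy :: "(real^2 => real) => bool" where
 "finite_energy f \<longleftrightarrow> f \<in> borel_measurable borel & lint (%x. (f x)^2) &
  lint (edens f f)"

lemma borel_prod_projections [measurable]: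
 "fst \<in> borel_measurable (borel :: ((real^2) \<times> (real^2)) measure)"
 "snd \<in> borel_measurable (borel :: ((real^2) \<times> (real^2)) measure)"
 by (intro borel_measurable_continuous_onI continuous_intros)+

lemma energy_density_measurable [measurable]:
 assumes [measurable]: "borelf f" "borelf g"
 shows "borelf (edens f g)"
 unfolding edens_def by measurable

lemma finite_energyD:
 assumes "finite_energy f"
 shows "borelf f" "lint (%x. (f x)^2)" "lint (edens f f)"
 using assms by (auto simp: finite_energy_def)

lemma energy_density_square:
 "edens f f p = (sqrt (kern (snd p - fst p)) * (f (snd p) - f (fst p)))^2"
 by (simp add: edens_def power_mult_distrib power2_eq_square)

lemma energy_density_square':
 "edens f f = (%p. (sqrt (kern (snd p - fst p)) * (f (snd p) - f (fst p)))^2)"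
 by (rule ext) (rule energy_density_square)

lemma energy_density_nonneg [simp]: "0 <= edens f f p"
 by (simp add: energy_density_square)

lemma energy_density_integrable:
 assumes f: "finite_energy f" and g: "finite_energy g"
 shows "lint (edens f g)"
proof -
 have [measurable]: "borelf f" "borelf g" using f g by (auto dest: finite_energyD)
 have eq: "edens f g p = (sqrt (kern (snd p - fst p)) * (f (snd p) - f (fst p))) * (sqrt (kern (snd p - fst p)) * (g (snd p) - g (fst p)))" for p
  by (simp add: edens_def)
 show ?thesis unfolding eq[abs_def]
 proof (rule integrable_mult_square)
  show "lint (%p. (sqrt (kern (snd p - fst p)) * (f (snd p) - f (fst p)))^2)"
   using finite_energyD(3)[OF f] by (simp only: energy_density_square')
  show "lint (%p. (sqrt (kern (snd p - fst p)) * (g (snd p) - g (fst p)))^2)"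
   using finite_energyD(3)[OF g] by (simp only: energy_density_square')
 qed measurable
qed

lemma finite_energy_domination:
 assumes [measurable]: "borelf f" and f2: "lint (%x. (f x)^2)"
  and F: "lint F" and b: "!!p. edens f f p <= F p"
 shows "finite_energy f"
 unfolding finite_energy_def
proof (intro conjI f2)
 show "lint (edens f f)"
 proof (rule lint_bound[OF F])
  show "AEL p. norm (edens f f p) <= norm (F p)"
   using b by (intro AE_I2) (simp add: abs_le_iff order_trans[OF _ abs_ge_self] order_trans[OF energy_density_nonneg])
 qed measurable
qed measurable

lemma finite_energy_add:
 assumes f: "finite_energy f" and g: "finite_energy g"
 shows "finite_energy (%x. f x + g x)"
proof (rule finite_energy_domination)
 have [measurable]: "borelf f" "borelf g" using f g by (auto dest: finite_energyD)
 show "borelf (%x. f x + g x)" by measurable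
 have "lint (%x. f x * g x)" using f g by (intro integrable_mult_square) (auto dest: finite_energyD)
 thus "lint (%x. (f x + g x)^2)"
  unfolding power2_sum using finite_energyD[OF f] finite_energyD[OF g] by (simp add: mult.assoc)
 show "lint (%p. 2 * edens f f p + 2 * edens g g p)"
  using finite_energyD[OF f] finite_energyD[OF g] by simp
 show "edens (%x. f x + g x) (%x. f x + g x) p <= 2 * edens f f p + 2 * edens g g p" for p
 proof -
  let ?k = "kern (snd p - fst p)" and ?a = "f (snd p) - f (fst p)" and ?b = "g (snd p) - g (fst p)"
  have "?k * (?a - (- ?b))^2 <= ?k * (2 * ?a^2 + 2 * (- ?b)^2)" by (intro mult_left_mono power2_diff_le) simp
  thus ?thesis by (simp add: edens_def power2_eq_square algebra_simps)
 qed
qed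

lemma finite_energy_cmult:
 assumes f: "finite_energy f" shows "finite_energy (%x. c * f x)"
proof (rule finite_energy_domination)
 have [measurable]: "borelf f" using f by (auto dest: finite_energyD)
 show "borelf (%x. c * f x)" by measurable
 show "lint (%x. (c * f x)^2)" using f by (auto dest: finite_energyD simp: power_mult_distrib)
 show "lint (%p. c^2 * edens f f p)" using f by (auto dest: finite_energyD)
 show "edens (%x. c * f x) (%x. c * f x) p <= c^2 * edens f f p" for p
  by (simp add: edens_def power2_eq_square algebra_simps)
qed

lemma finite_energy_diff:
 assumes f: "finite_energy f" and g: "finite_energy g"
 shows "finite_energy (%x. f x - g x)"
 using finite_energy_add[OF f finite_energy_cmult[OF g, of "-1"]] by simp

lemma energy_add_right:
 assumes "finite_energy f" "finite_energy g" "finite_energy h"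
 shows "energy f (%x. g x + h x) = energy f g + energy f h"
proof -
 have "edens f (%x. g x + h x) p = edens f g p + edens f h p" for p
  by (simp add: edens_def algebra_simps)
 thus ?thesis unfolding energy_def using assms
  by (simp add: energy_density_integrable[unfolded edens_def[abs_def]] energy_density_integrable cong: LINT_cong)
qed

lemma energy_diff_left:
 assumes "finite_energy f" "finite_energy g" "finite_energy h"
 shows "energy (%x. f x - g x) h = energy f h - energy g h"
proof -
 have "edens (%x. f x - g x) h p = edens f h p - edens g h p" for p
  by (simp add: edens_def algebra_simps)
 thus ?thesis unfolding energy_def using assms
  by (simp add: energy_density_integrable cong: LINT_cong)
qed

lemma energy_density_isometry:
 assumes T: "!!x y. norm (T x - T y) = norm (x - y)"
 shows "edens (%x. f (T x)) (%x. g (T x)) p = edens f g (T (fst p), T (snd p))"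
 by (simp add: edens_def kern_def T)

lemma
 assumes T: "mpm T" "!!x y. norm (T x - T y) = norm (x - y)"
 shows finite_energy_isometry: "finite_energy f ==> finite_energy (%x. f (T x))"
  and energy_isometry: "f \<in> borel_measurable borel ==> g \<in> borel_measurable borel ==>
   energy (%x. f (T x)) (%x. g (T x)) = energy f g"
proof -
 have [measurable]: "borelf T" using T by (auto dest: mpm_measurable)
 note TT = mpm_map_prod[OF T(1) T(1)]
 show "finite_energy (%x. f (T x))" if f: "finite_energy f"
 proof -
  have [measurable]: "borelf f" using f by (auto dest: finite_energyD)
  have "lint (%p. edens f f (T (fst p), T (snd p)))"
   by (rule mpm_integrable[OF TT finite_energyD(3)[OF f]])
  moreover have "lint (%x. (f (T x))^2)"
   by (rule mpm_integrable[OF T(1) finite_energyD(2)[OF f]])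
  ultimately show ?thesis
   unfolding finite_energy_def by (simp add: energy_density_isometry[OF T(2), abs_def])
 qed
 show "energy (%x. f (T x)) (%x. g (T x)) = energy f g"
  if [measurable]: "borelf f" "borelf g"
  unfolding energy_def energy_density_isometry[OF T(2), abs_def]
  by (rule mpm_integral[OF TT]) measurable
qed

lemma mpm_increment: "mpm (%p::(real^2)\<times>(real^2). (snd p, snd p + fst p))"
 using mpm_comp[OF mpm_shear mpm_swap] by simp

lemma energy_density_increment:
 "edens f g (x, x + h) = kern h * ((f (x + h) - f x) * (g (x + h) - g x))"
 by (simp add: edens_def)

lemma nn_integral_energy_increment:
 assumes [measurable]: "borelf f"
 shows "(NNINT p. ennreal (edens f f p))
  = (NNINT h. ennreal (kern h) * (NNINT x. ennreal ((f (x + h) - f x)^2)))"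
proof -
 have "(NNINT p. ennreal (edens f f p)) = (NNINT p. ennreal (edens f f (snd p, snd p + fst p)))"
  by (rule mpm_nn_integral[OF mpm_increment, symmetric]) measurable
 also have "... = (\<integral>\<^sup>+p. ennreal (kern (fst p)) * ennreal ((f (snd p + fst p) - f (snd p))^2) \<partial>lborel2)"
  by (simp add: lborel_prod energy_density_increment power2_eq_square ennreal_mult)
 also have "... = (NNINT h. NNINT x. ennreal (kern h) * ennreal ((f (x + h) - f x)^2))"
  by (subst lborel.nn_integral_fst[symmetric]) simp_all
 also have "... = (NNINT h. ennreal (kern h) * (NNINT x. ennreal ((f (x + h) - f x)^2)))"
  by (intro nn_integral_cong nn_integral_cmult) measurable
 finally show ?thesis .
qed

lemma energy_increment:
 assumes f: "finite_energy f" and g: "finite_energy g"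
 shows "lint (%h. kern h * (LBINT x. (f (x + h) - f x) * (g (x + h) - g x)))"
  and "energy f g = (LBINT h. kern h * (LBINT x. (f (x + h) - f x) * (g (x + h) - g x)))"
proof -
 let ?I = "%f g. LBINT h. kern h * (LBINT x. (f (x + h) - f x) * (g (x + h) - g x))"
 have [measurable]: "borelf f" "borelf g" using f g by (auto dest: finite_energyD)
 have i: "lint (%p. edens f g (snd p, snd p + fst p))"
  by (rule mpm_integrable[OF mpm_increment energy_density_integrable[OF f g]])
 hence i': "integrable lborel2 (%p. edens f g (snd p, snd p + fst p))"
  by (simp add: lborel_prod)
 show "lint (%h. kern h * (LBINT x. (f (x + h) - f x) * (g (x + h) - g x)))"
  using lborel_pair.integrable_fst'[OF i'] by (simp add: energy_density_increment)
 have "energy f g = (LBINT p. edens f g (snd p, snd p + fst p))"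
  unfolding energy_def by (rule mpm_integral[OF mpm_increment, symmetric]) measurable
 also have "... = ?I f g"
  by (subst integral_fst_lborel[OF i]) (simp add: energy_density_increment)
 finally show "energy f g = ?I f g" .
qed

lemma difference_square_integrable:
 fixes f :: "real^2 => real"
 assumes [measurable]: "borelf f" and f: "lint (%x. (f x)^2)"
 shows "lint (%x. (f (x + h) - f x)^2)"
proof (rule lint_bound)
 show "lint (%x. 2 * (f (x + h))^2 + 2 * (f x)^2)"
  using f integrable_translate[OF f, of h] by simp
 show "AEL x. norm ((f (x + h) - f x)^2) <= norm (2 * (f (x + h))^2 + 2 * (f x)^2)"
  by (rule AE_I2) (use power2_diff_le in simp)
qed measurable

text \<open>Plancherel in \<open>x\<close> for each fixed increment \<open>h\<close>, then Tonelli,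
  which leaves the symbol of the kernel. Stated in \<open>ennreal\<close>, the identity also decides
  when the energy is finite.\<close>

lemma energy_fourier:
 assumes f: "lint f" "lint (%x. (f x)^2)"
 shows "(NNINT p. ennreal (edens f f p))
  = ennreal (symbol_const / (2 * pi)^2) * (NNINT xi. ennreal (norm xi * (cmod (fhat f xi))^2))"
proof -
 let ?S = "%h xi. ennreal ((cmod (cis (h .* xi) - 1))^2)"
 let ?G = "%xi. ennreal ((cmod (fhat f xi))^2)"
 have [measurable]: "borelf f" using f by auto
 let ?c = "1 / (2 * pi)^2"
 have x: "(NNINT x. ennreal ((f (x + h) - f x)^2))
  = ennreal ?c * (NNINT xi. ?S h xi * ?G xi)" for h
 proof -
  have fh: "lint (%x. f (x + h) - f x)" using f integrable_translate[OF f(1), of h] by simp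
  have fh2: "lint (%x. (f (x + h) - f x)^2)" by (rule difference_square_integrable) (use f in auto)
  have eq: "(cmod (fhat (%x. f (x + h) - f x) xi))^2 = (cmod (cis (h .* xi) - 1))^2 * (cmod (fhat f xi))^2" for xi
   by (simp add: fhat_translate[OF f(1)] norm_mult power_mult_distrib)
  have "(NNINT x. ennreal ((f (x + h) - f x)^2)) = ennreal (LBINT x. (f (x + h) - f x)^2)"
   by (rule nn_integral_eq_integral[OF fh2]) simp
  also have "(LBINT x. (f (x + h) - f x)^2) = ?c * (LBINT xi. (cmod (fhat (%x. f (x + h) - f x) xi))^2)"
   unfolding plancherel_norm(2)[OF fh fh2] by simp
  also have "ennreal ... = ennreal ?c * ennreal (LBINT xi. (cmod (fhat (%x. f (x + h) - f x) xi))^2)"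
   by (rule ennreal_mult) auto
  also have "ennreal (LBINT xi. (cmod (fhat (%x. f (x + h) - f x) xi))^2) 
   = (NNINT xi. ennreal ((cmod (fhat (%x. f (x + h) - f x) xi))^2))"
   by (rule nn_integral_eq_integral[OF plancherel_norm(1)[OF fh fh2], symmetric]) simp
  finally show ?thesis unfolding eq by (simp add: ennreal_mult)
 qed
 have "(NNINT p. ennreal (edens f f p))
  = (NNINT h. NNINT xi. ennreal ?c * (ennreal (kern h) * ?S h xi * ?G xi))"
  unfolding nn_integral_energy_increment[OF \<open>f \<in> borel_measurable borel\<close>] x
 proof (rule nn_integral_cong, goal_cases)
  case (1 h)
  have "(NNINT xi. ennreal ?c * (ennreal (kern h) * ?S h xi * ?G xi))
   = (NNINT xi. (ennreal (kern h) * ennreal ?c) * (?S h xi * ?G xi))"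
   by (simp only: mult_ac)
  also have "... = (ennreal (kern h) * ennreal ?c) * (NNINT xi. ?S h xi * ?G xi)"
   by (rule nn_integral_cmult) measurable
  finally show ?case
   by (simp only: mult.assoc)
 qed
 also have "... = (NNINT xi. NNINT h. ennreal ?c * (ennreal (kern h) * ?S h xi * ?G xi))"
  by (rule lborel_pair.Fubini'[symmetric]) measurable
 also have "... = (NNINT xi. ennreal ?c * (ennreal (symbol_const * norm xi) * ?G xi))"
  unfolding symbol_eq[symmetric] by (intro nn_integral_cong) (simp add: nn_integral_cmult nn_integral_multc ennreal_mult)
 also have "... = (NNINT xi. ennreal (symbol_const / (2 * pi)^2) * ennreal (norm xi * (cmod (fhat f xi))^2))"
  using symbol_const_pos by (intro nn_integral_cong) (simp add: ennreal_mult'[symmetric] mult_ac)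
 also have "... = ennreal (symbol_const / (2 * pi)^2) * (NNINT xi. ennreal (norm xi * (cmod (fhat f xi))^2))"
  by (rule nn_integral_cmult) measurable
 finally show ?thesis .
qed

lemma finite_energy_fourier:
 assumes f: "lint f" "lint (%x. (f x)^2)"
 shows "finite_energy f \<longleftrightarrow> lint (%xi. norm xi * (cmod (fhat f xi))^2)"
proof -
 have [measurable]: "borelf f" using f by auto
 have c: "0 < symbol_const / (2 * pi)^2" using symbol_const_pos by simp
 have "finite_energy f \<longleftrightarrow> (NNINT p. ennreal (edens f f p)) < \<infinity>"
  unfolding finite_energy_def using f(2) by (simp add: integrable_iff_bounded[of lborel "edens f f"])
 also have "... \<longleftrightarrow> (NNINT xi. ennreal (norm xi * (cmod (fhat f xi))^2)) < \<infinity>"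
  unfolding energy_fourier[OF f] using c by (auto simp: ennreal_mult_less_top)
 also have "... \<longleftrightarrow> lint (%xi. norm xi * (cmod (fhat f xi))^2)"
  unfolding integrable_iff_bounded by (simp add: abs_mult)
 finally show ?thesis .
qed

text \<open>Fubini in the pair of increment and frequency. Absolute integrability is Cauchy-Schwarz
  with the weight \<open>norm xi\<close>, available through
  \<open>finite_energy_fourier\<close>.\<close>

lemma parseval_energy:
 assumes f: "lint f" "finite_energy f" and g: "lint g" "finite_energy g"
 shows "(LBINT xi. of_real (norm xi) * (fhat f xi * cnj (fhat g xi)))
  = of_real ((2 * pi)^2 / symbol_const * energy f g)"
proof -
 note f2 = finite_energyD[OF f(2)] and g2 = finite_energyD[OF g(2)]
 note [measurable] = f2(1) g2(1)
 have nf: "lint (%xi. norm xi * (cmod (fhat f xi))^2)"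
  using finite_energy_fourier[OF f(1) f2(2)] f(2) by blast
 have ng: "lint (%xi. norm xi * (cmod (fhat g xi))^2)"
  using finite_energy_fourier[OF g(1) g2(2)] g(2) by blast
 let ?A = "%xi. cmod (fhat f xi) * cmod (fhat g xi)"
 have nA: "lint (%xi. norm xi * ?A xi)"
 proof -
  have "lint (%xi. (sqrt (norm xi) * cmod (fhat f xi)) * (sqrt (norm xi) * cmod (fhat g xi)))"
   by (rule integrable_mult_square) (use nf ng in "simp_all add: power_mult_distrib")
  moreover have "(sqrt (norm xi) * cmod (fhat f xi)) * (sqrt (norm xi) * cmod (fhat g xi)) = norm xi * ?A xi" for xi
  proof -
   have "(sqrt (norm xi) * cmod (fhat f xi)) * (sqrt (norm xi) * cmod (fhat g xi)) = (sqrt (norm xi) * sqrt (norm xi)) * ?A xi"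
    by (simp only: mult_ac)
   thus ?thesis by simp
  qed
  ultimately show ?thesis by simp
 qed
 let ?H = "%p. complex_of_real (kern (fst p)) * (of_real ((cmod (cis (fst p .* snd p) - 1))^2) * (fhat f (snd p) * cnj (fhat g (snd p))))"
 have Hm: "?H \<in> borel_measurable lborel2" by measurable
 have nH: "(\<integral>\<^sup>+p. ennreal (norm (?H p)) \<partial>lborel2) = ennreal symbol_const * (NNINT xi. ennreal (norm xi * ?A xi))"
 proof -
  have "(\<integral>\<^sup>+p. ennreal (norm (?H p)) \<partial>lborel2) = 
   (\<integral>\<^sup>+p. ennreal (kern (fst p) * (cmod (cis (fst p .* snd p) - 1))^2) * ennreal (?A (snd p)) \<partial>lborel2)"
   by (simp add: norm_mult norm_power ennreal_mult mult.assoc)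
  also have "... = (NNINT xi. NNINT h. ennreal (kern h * (cmod (cis (h .* xi) - 1))^2) * ennreal (?A xi))"
   by (subst lborel_pair.nn_integral_snd[symmetric]) simp_all
  also have "... = (NNINT xi. ennreal (symbol_const * norm xi) * ennreal (?A xi))"
   by (subst nn_integral_multc) (simp_all add: symbol_eq)
  also have "... = (NNINT xi. ennreal symbol_const * ennreal (norm xi * ?A xi))"
   using symbol_const_pos by (simp add: ennreal_mult[symmetric] mult.assoc)
  also have "... = ennreal symbol_const * (NNINT xi. ennreal (norm xi * ?A xi))"
   by (rule nn_integral_cmult) measurable
  finally show ?thesis .
 qed
 have Hi: "integrable lborel2 ?H"
  unfolding integrable_iff_bounded nH using Hm nA by (simp add: integrable_iff_bounded ennreal_mult_less_top abs_mult)
 have Hi': "lint ?H" using Hi by (simp add: lborel_prod)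
 have sym: "(LBINT h. kern h * (cmod (cis (h .* xi) - 1))^2) = symbol_const * norm xi" for xi
  by (subst integral_eq_nn_integral) (auto simp: symbol_eq symbol_const_pos less_imp_le)
 have "of_real symbol_const * (LBINT xi. of_real (norm xi) * (fhat f xi * cnj (fhat g xi)))
  = (LBINT xi. of_real (symbol_const * norm xi) * (fhat f xi * cnj (fhat g xi)))"
  by (simp add: mult.assoc)
 also have "... = (LBINT xi. LBINT h. ?H (h, xi))"
  unfolding sym[symmetric] integral_complex_of_real[symmetric] integral_mult_left_zero[symmetric]
  by (simp add: mult.assoc)
 also have "... = (LBINT h. LBINT xi. ?H (h, xi))"
  by (rule integral_swap_lborel[OF Hi', symmetric])
 also have "... = (LBINT h. of_real ((2 * pi)^2 * (kern h * (LBINT x. (f (x + h) - f x) * (g (x + h) - g x)))))"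
 proof (rule LINT_cong[OF refl], goal_cases)
  case (1 h)
  have fh: "lint (%x. f (x + h) - f x)" "lint (%x. g (x + h) - g x)"
   using f g integrable_translate[OF f(1), of h] integrable_translate[OF g(1), of h] by simp_all
  have fh2: "lint (%x. (f (x + h) - f x)^2)" "lint (%x. (g (x + h) - g x)^2)"
   using f2 g2 by (auto intro: difference_square_integrable)
  have eq: "fhat (%x. f (x + h) - f x) xi * cnj (fhat (%x. g (x + h) - g x) xi)
   = of_real ((cmod (cis (h .* xi) - 1))^2) * (fhat f xi * cnj (fhat g xi))" for xi
   unfolding fhat_translate[OF f(1)] fhat_translate[OF g(1)] complex_norm_square
   by (simp add: mult_ac)
  have "(LBINT xi. ?H (h, xi)) = of_real (kern h) * (LBINT xi. of_real ((cmod (cis (h .* xi) - 1))^2) * (fhat f xi * cnj (fhat g xi)))"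
   by (simp del: of_real_power)
  also have "... = of_real (kern h) * of_real ((2 * pi)^2 * (LBINT x. (f (x + h) - f x) * (g (x + h) - g x)))"
   unfolding eq[symmetric] parseval[OF fh(1) fh2(1) fh(2) fh2(2)] by (rule refl)
  finally show ?case
   by (simp only: of_real_mult mult_ac)
 qed
 also have "... = of_real ((2 * pi)^2 * energy f g)"
  unfolding energy_increment(2)[OF f(2) g(2)] by (simp only: integral_complex_of_real integral_mult_right_zero)
 finally show ?thesis using symbol_const_pos
  by (simp add: field_simps)
qed

section \<open>From the distributional equation to the energy\<close>

lemma fourier_lebesgue_eq:
 assumes u0[measurable]: "borelf u0" and i: "lint u0"
  and f: "AEL x. f x = complex_of_real (u0 x)"
 shows "fourier f xi = fhat u0 xi"
proof -
 let ?E = "%x. exp (- \<i> * of_real (x .* xi)) * complex_of_real (u0 x)"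
 have "fourier f xi = (\<integral>x. ?E x \<partial>lebesgue)"
  unfolding fourier_def
 proof (rule LINT_cong_AE)
  show m: "(%x. ?E x) \<in> borel_measurable lebesgue"
   by (rule measurable_completion) measurable
  have ae: "AE x in lebesgue. ?E x = exp (- \<i> * of_real (x .* xi)) * f x"
   using AE_completion[OF f] by eventually_elim simp
  from borel_measurable_AE[OF m ae] show "(%x. exp (- \<i> * of_real (x .* xi)) * f x) \<in> borel_measurable lebesgue" .
  show "AE x in lebesgue. exp (- \<i> * of_real (x .* xi)) * f x = ?E x"
   using ae by eventually_elim simp
 qed
 also have "... = (LBINT x. ?E x)"
  by (rule integral_completion) measurable
 also have "... = fhat u0 xi" unfolding fhat_def by (simp add: cis_conv_exp)
 finally show ?thesis .
qed

text \<open>Restricting to a ball of radius at least \<open>R0\<close> changes nothing, so the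
  quantity whose limit defines the transform is constant for large \<open>R\<close>, hence 0. Every
  choice that \<open>fourier_L2\<close> may make thus agrees almost everywhere with the
  integral.\<close>

lemma is_fourier_L2_bounded_support:
 assumes [measurable]: "borelf u0" and i: "lint u0"
  and f: "AEL x. f x = complex_of_real (u0 x)" and R: "!!x. x \<notin> ball 0 R0 ==> f x = 0"
  and g: "is_fourier_L2 f g"
 shows "AEL xi. g xi = fhat u0 xi"
proof -
 have gm: "g \<in> borel_measurable lebesgue" using g by (simp add: is_fourier_L2_def square_integrable_def)
 let ?N = "%xi. ennreal ((norm (g xi - fhat u0 xi))^2)"
 have Z: "(%x. indicator (ball 0 R) x * f x) = f" if "R0 <= R" for R :: real
 proof (rule ext)
  fix x show "indicator (ball 0 R) x * f x = f x"
   using R[of x] that by (auto simp: indicator_def)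
 qed
 have "eventually (%R. (\<integral>\<^sup>+xi. ennreal ((norm (g xi - fourier (%x. indicator (ball 0 R) x * f x) xi))^2) \<partial>lebesgue)
   = (\<integral>\<^sup>+xi. ?N xi \<partial>lebesgue)) at_top"
  by (rule eventually_mono[OF eventually_ge_at_top[of R0]]) (simp add: Z fourier_lebesgue_eq[OF assms(1) i f])
 moreover have "((%R. \<integral>\<^sup>+xi. ennreal ((norm (g xi - fourier (%x. indicator (ball 0 R) x * f x) xi))^2) \<partial>lebesgue) ---> 0) at_top"
  using g by (simp add: is_fourier_L2_def)
 ultimately have "((%R::real. \<integral>\<^sup>+xi. ?N xi \<partial>lebesgue) ---> 0) at_top"
  by (rule Lim_transform_eventually[rotated])
 hence "(\<integral>\<^sup>+xi. ?N xi \<partial>lebesgue) = 0"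
  by (simp add: tendsto_const_iff)
 moreover have "?N \<in> borel_measurable lebesgue"
 proof -
  have "fhat u0 \<in> borel_measurable lebesgue" by (rule measurable_completion) measurable
  note [measurable] = this gm
  show ?thesis by measurable
 qed
 ultimately have "AE xi in lebesgue. ?N xi = 0"
  by (subst (asm) nn_integral_0_iff_AE) auto
 hence "AE xi in lebesgue. g xi = fhat u0 xi"
  by eventually_elim simp
 thus ?thesis by (simp add: AE_completion_iff)
qed

text \<open>The distributional pairing is a multiple of the energy, by Parseval's identity.\<close>

lemma overdetermined_weak_solution:
 fixes Omega :: "(real^2) set"
 assumes "open Omega" "bounded Omega" and u: "overdetermined_solution Omega c u"
 obtains u0 where "borelf u0" "lint u0" "AEL x. u0 x = u x"
  "!!x. x \<notin> Omega ==> u0 x = 0" "finite_energy u0"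
  "!!phi. (%x. complex_of_real (phi x)) \<in> test_functions Omega ==> lint phi ==> finite_energy phi ==>
   energy u0 phi = symbol_const * (LBINT x. phi x)"
proof -
 let ?f = "%x. complex_of_real (u x)"
 have off: "!!x. x \<notin> Omega ==> u x = 0" and de: "distribution_eq_on Omega (half_laplacian ?f) (%x. 1)"
  and sob: "?f \<in> sobolev_H (1/2)"
  using u by (auto simp: overdetermined_solution_def)
 have [measurable]: "Omega \<in> sets borel" using \<open>open Omega\<close> by simp
 obtain g where g: "is_fourier_L2 ?f g" and gi: "integrable lebesgue (%xi. (1 + (norm xi)^2) powr (1/2) * (norm (g xi))^2)"
  using sob by (auto simp: sobolev_H_def)
 have sq: "?f \<in> borel_measurable lebesgue" "integrable lebesgue (%x. (norm (?f x))^2)"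
  using g by (auto simp: is_fourier_L2_def square_integrable_def)
 have "u \<in> borel_measurable lebesgue"
  using measurable_compose[OF sq(1) borel_measurable_Re] by simp
 then obtain u1 where u1: "u1 \<in> borel_measurable lborel" "AEL x. u x = u1 x"
  using completion_ex_borel_measurable_real by blast
 \<comment> \<open>A Borel representative that vanishes at every point outside \<open>Omega\<close>,
   not just almost everywhere; \<open>u\<close> itself is only Lebesgue measurable.\<close>
 define u0 where "u0 x = indicator Omega x * u1 x" for x
 have u1m[measurable]: "borelf u1" using u1 by simp
 have u0m[measurable]: "borelf u0" unfolding u0_def by measurable
 have ae: "AEL x. u0 x = u x"
  using u1(2) by eventually_elim (use off in "auto simp: u0_def indicator_def")
 have off0: "u0 x = 0" if "x \<notin> Omega" for x using that by (simp add: u0_def)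
 have u0sq: "lint (%x. (u0 x)^2)"
 proof -
  have m: "(%x. (u0 x)^2) \<in> borel_measurable lebesgue" by (rule measurable_completion) measurable
  have "AE x in lebesgue. (norm (?f x))^2 = (u0 x)^2"
   using AE_completion[OF ae] by eventually_elim simp
  hence "integrable lebesgue (%x. (u0 x)^2)"
   by (rule integrable_cong_AE[THEN iffD1, OF borel_measurable_integrable[OF sq(2)] m _ sq(2)])
  thus ?thesis by (subst (asm) integrable_completion) auto
 qed
 have u0i: "lint u0"
 proof (rule lint_bound)
  have "lint (indicator Omega :: _ => real)"
   using emeasure_bounded_finite[OF \<open>bounded Omega\<close>] by (simp add: integrable_indicator_iff)
  thus "lint (%x. indicator Omega x + (u0 x)^2)" using u0sq by simp
  show "AEL x. norm (u0 x) <= norm (indicator Omega x + (u0 x)^2)"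
  proof (rule AE_I2, goal_cases)
   case (1 x)
   show ?case
   proof (cases "x \<in> Omega")
    case True
    have "2 * abs (u0 x) * 1 <= abs (u0 x)^2 + 1^2" by (rule sum_squares_bound)
    thus ?thesis using True by simp
   qed (simp add: off0)
  qed
 qed measurable
 have aef: "AEL x. ?f x = complex_of_real (u0 x)" using ae by eventually_elim simp
 obtain R0 where R0: "Omega <= ball 0 R0" using \<open>bounded Omega\<close> by (metis bounded_subset_ballD)
 have fR: "?f x = 0" if "x \<notin> ball 0 R0" for x
 proof -
  have "x \<notin> Omega" using R0 that by blast
  thus ?thesis using off by simp
 qed
 note L2 = is_fourier_L2_bounded_support[OF u0m u0i aef fR]
 have gu: "AEL xi. g xi = fhat u0 xi" by (rule L2[OF _ g])
 have "is_fourier_L2 ?f (fourier_L2 ?f)" unfolding fourier_L2_def using g by (rule someI[of "is_fourier_L2 ?f"])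
 hence Fu: "AEL xi. fourier_L2 ?f xi = fhat u0 xi" by (rule L2[rotated])
 have fe: "finite_energy u0"
  unfolding finite_energy_fourier[OF u0i u0sq]
 proof -
 let ?W = "%xi. (1 + (norm xi)^2) powr (1/2) * (norm (fhat u0 xi))^2"
  have m: "?W \<in> borel_measurable lebesgue"
   by (rule measurable_completion) measurable
  have "AE xi in lebesgue. (1 + (norm xi)^2) powr (1/2) * (norm (g xi))^2 = ?W xi"
   using AE_completion[OF gu] by eventually_elim simp
  hence "integrable lebesgue ?W"
   by (rule integrable_cong_AE[THEN iffD1, OF borel_measurable_integrable[OF gi] m _ gi])
  hence i: "lint ?W"
   by (subst (asm) integrable_completion) auto
  show "lint (%xi. norm xi * (cmod (fhat u0 xi))^2)"
  proof (rule lint_bound[OF i])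
   show "AEL xi. norm (norm xi * (cmod (fhat u0 xi))^2) <= norm (?W xi)"
   proof (rule AE_I2, goal_cases)
    case (1 xi)
    have "norm xi <= sqrt (1 + (norm xi)^2)" by (rule real_le_rsqrt) simp
    also have "... = (1 + (norm xi)^2) powr (1/2)" by (simp add: powr_half_sqrt)
    finally show ?case
     by (simp add: abs_mult mult_right_mono)
   qed
  qed measurable
 qed
 show thesis
 proof (rule that[OF u0m u0i ae off0 fe])
  fix phi assume test: "(%x. complex_of_real (phi x)) \<in> test_functions Omega" and phii: "lint phi" and phie: "finite_energy phi"
  have [measurable]: "borelf phi" using phie by (rule finite_energyD)
  let ?c = "%x. complex_of_real (phi x)"
 let ?A = "%xi. cnj (fhat phi xi) / of_real ((2 * pi)^2)"
  have inv: "inverse_fourier ?c xi = cnj (fhat phi xi) / of_real ((2 * pi)^2)" for xi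
  proof -
   have "inverse_fourier ?c xi = (LBINT x. exp (\<i> * of_real (xi .* x)) * ?c x) / of_real ((2 * pi)^2)"
    unfolding inverse_fourier_def by (subst integral_completion) simp_all
   also have "(LBINT x. exp (\<i> * of_real (xi .* x)) * ?c x) = (LBINT x. cnj (cis (- (x .* xi)) * ?c x))"
    by (rule LINT_cong) (auto simp: cis_cnj cis_conv_exp[symmetric] inner_commute)
   also have "... = cnj (fhat phi xi)"
    unfolding fhat_def by (rule Bochner_Integration.integral_cnj)
   finally show ?thesis .
  qed
  have "of_real (LBINT x. phi x) = (LINT x|lebesgue. 1 * ?c x)"
   by (subst integral_completion) simp_all
  also have "... = half_laplacian ?f ?c"
   using de test by (simp add: distribution_eq_on_def)
  also have "... = (\<integral>xi. of_real (norm xi) * fhat u0 xi * ?A xi \<partial>lebesgue)"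
   unfolding half_laplacian_def inv
  proof (rule LINT_cong_AE)
   show m: "(%xi. of_real (norm xi) * fhat u0 xi * ?A xi) \<in> borel_measurable lebesgue"
    by (rule measurable_completion) measurable
   have ae': "AE xi in lebesgue. of_real (norm xi) * fhat u0 xi * ?A xi 
     = of_real (norm xi) * fourier_L2 ?f xi * ?A xi"
    using AE_completion[OF Fu] by eventually_elim simp
   show "(%xi. of_real (norm xi) * fourier_L2 ?f xi * ?A xi) \<in> borel_measurable lebesgue"
    by (rule borel_measurable_AE[OF m ae'])
   show "AE xi in lebesgue. of_real (norm xi) * fourier_L2 ?f xi * ?A xi
     = of_real (norm xi) * fhat u0 xi * ?A xi" 
    using AE_completion[OF Fu] by eventually_elim simp
  qed
  also have "... = (LBINT xi. of_real (norm xi) * fhat u0 xi * ?A xi)"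
   by (rule integral_completion) measurable
  also have "... = (LBINT xi. (of_real (norm xi) * (fhat u0 xi * cnj (fhat phi xi))) / of_real ((2 * pi)^2))"
   by (simp add: mult.assoc)
  also have "... = of_real ((2 * pi)^2 / symbol_const * energy u0 phi) / of_real ((2 * pi)^2)"
   unfolding integral_divide_zero parseval_energy[OF u0i fe phii phie] by (rule refl)
  also have "... = of_real (energy u0 phi / symbol_const)" by simp
  finally have "(LBINT x. phi x) = energy u0 phi / symbol_const" by (simp only: of_real_eq_iff)
  thus "energy u0 phi = symbol_const * (LBINT x. phi x)" using symbol_const_pos by simp
 qed
qed

section \<open>Mollification and weak solutions\<close>

lemma Ck_on_cong_UNIV:
 assumes "Ck_on k UNIV f" "!!x. f x = g x" shows "Ck_on k UNIV g"
proof -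
 have "f = g" using assms(2) by auto
 thus ?thesis using assms(1) by simp
qed

lemma Ck_on_SucI:
 assumes d: "!!x. (f has_derivative f' x) (at x)" and k: "!!v. Ck_on k UNIV (%x. f' x v)"
 shows "Ck_on (Suc k) UNIV f"
proof -
 have "frechet_derivative f (at x) = f' x" for x
  using frechet_derivative_at[OF d[of x]] by simp
 thus ?thesis using d k by (auto simp: differentiable_def)
qed

lemma Ck_on_SucD:
 assumes "Ck_on (Suc k) UNIV f"
 shows "(f has_derivative frechet_derivative f (at x)) (at x)" "Ck_on k UNIV (%x. frechet_derivative f (at x) v)"
 using assms by (auto simp: frechet_derivative_works)

lemma Ck_on_Suc_imp: "Ck_on (Suc k) UNIV f ==> Ck_on k UNIV f"
proof (induction k arbitrary: f)
 case 0
 hence "!!x. f differentiable (at x)" by simp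
 thus ?case
  by (simp add: continuous_at_imp_continuous_on differentiable_imp_continuous_within)
next
 case (Suc k)
 have "Ck_on k UNIV (%x. frechet_derivative f (at x) v)" for v
  by (rule Suc.IH[OF Ck_on_SucD(2)[OF Suc.prems]])
 thus ?case using Suc.prems by simp
qed

lemma Ck_on_const: "Ck_on k UNIV (%x. c)"
proof (induction k arbitrary: c)
 case (Suc k)
 show ?case by (rule Ck_on_SucI[where f' = "%x v. 0"]) (auto intro: Suc)
qed simp

lemma Ck_on_bounded_linear:
 assumes "bounded_linear L" shows "Ck_on k UNIV L"
proof (cases k)
 case 0
 thus ?thesis using assms by (simp add: linear_continuous_on)
next
 case (Suc j)
 show ?thesis unfolding Suc
  by (rule Ck_on_SucI[where f' = "%x. L"]) (auto intro: Ck_on_const bounded_linear.has_derivative[OF assms] has_derivative_bounded_linear bounded_linear_imp_has_derivative assms)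
qed

lemma Ck_on_linear_compose:
 assumes L: "bounded_linear L" and "Ck_on k UNIV f" shows "Ck_on k UNIV (%x. L (f x))"
 using assms(2)
proof (induction k arbitrary: f)
 case 0
 thus ?case using L by (auto intro!: continuous_on_compose2[OF linear_continuous_on[OF L]])
next
 case (Suc k)
 show ?case
 proof (rule Ck_on_SucI)
  show "((%x. L (f x)) has_derivative (%v. L (frechet_derivative f (at x) v))) (at x)" for x
   by (rule bounded_linear.has_derivative[OF L Ck_on_SucD(1)[OF Suc.prems]])
  show "Ck_on k UNIV (%x. L (frechet_derivative f (at x) v))" for v
   by (rule Suc.IH[OF Ck_on_SucD(2)[OF Suc.prems]])
 qed
qed

lemma Ck_on_add:
 assumes "Ck_on k UNIV f" "Ck_on k UNIV g" shows "Ck_on k UNIV (%x. f x + g x)"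
 using assms
proof (induction k arbitrary: f g)
 case 0
 thus ?case by (auto intro: continuous_intros)
next
 case (Suc k)
 show ?case
 proof (rule Ck_on_SucI)
  show "((%x. f x + g x) has_derivative (%v. frechet_derivative f (at x) v + frechet_derivative g (at x) v)) (at x)" for x
   by (rule has_derivative_add[OF Ck_on_SucD(1)[OF Suc.prems(1)] Ck_on_SucD(1)[OF Suc.prems(2)]])
  show "Ck_on k UNIV (%x. frechet_derivative f (at x) v + frechet_derivative g (at x) v)" for v
   by (intro Suc.IH Ck_on_SucD(2)[OF Suc.prems(1)] Ck_on_SucD(2)[OF Suc.prems(2)])
 qed
qed

lemma Ck_on_mult:
 fixes f g :: "_ => real"
 assumes "Ck_on k UNIV f" "Ck_on k UNIV g" shows "Ck_on k UNIV (%x. f x * g x)"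
 using assms
proof (induction k arbitrary: f g)
 case 0
 thus ?case by (auto intro: continuous_intros)
next
 case (Suc k)
 show ?case
 proof (rule Ck_on_SucI)
  show "((%x. f x * g x) has_derivative (%v. f x * frechet_derivative g (at x) v + frechet_derivative f (at x) v * g x)) (at x)" for x
   by (rule has_derivative_mult[OF Ck_on_SucD(1)[OF Suc.prems(1)] Ck_on_SucD(1)[OF Suc.prems(2)]])
  show "Ck_on k UNIV (%x. f x * frechet_derivative g (at x) v + frechet_derivative f (at x) v * g x)" for v
   by (intro Ck_on_add Suc.IH Ck_on_SucD(2)[OF Suc.prems(1)] Ck_on_SucD(2)[OF Suc.prems(2)] Ck_on_Suc_imp[OF Suc.prems(1)] Ck_on_Suc_imp[OF Suc.prems(2)])
 qed
qed

text \<open>The induction needs the whole chain of derivatives at once, since differentiating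
  \<open>F n\<close> along \<open>rho\<close> brings in \<open>F (Suc n)\<close>.\<close>

lemma Ck_on_real_compose:
 fixes F :: "nat => real => real"
 assumes F: "!!n t. (F n has_real_derivative F (Suc n) t) (at t)" and "Ck_on k UNIV rho"
 shows "Ck_on k UNIV (%x. F n (rho x))"
 using assms(2)
proof (induction k arbitrary: n)
 case 0
 have "continuous_on UNIV (F n)" by (intro continuous_at_imp_continuous_on ballI DERIV_isCont[OF F])
 thus ?case using 0 by (auto intro: continuous_on_compose2)
next
 case (Suc k)
 show ?case
 proof (rule Ck_on_SucI)
  show "((%x. F n (rho x)) has_derivative (%v. frechet_derivative rho (at x) v * F (Suc n) (rho x))) (at x)" for x
   using DERIV_compose_FDERIV[OF F Ck_on_SucD(1)[OF Suc.prems], of n x] by simp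
  show "Ck_on k UNIV (%x. frechet_derivative rho (at x) v * F (Suc n) (rho x))" for v
   by (intro Ck_on_mult Suc.IH Ck_on_SucD(2)[OF Suc.prems] Ck_on_Suc_imp[OF Suc.prems])
 qed
qed

text \<open>With s = 1 / t, the derivative in t of p(s) exp(-s) is s^2 (p(s) - p'(s)) exp(-s); the
  polynomial \<open>[:0, 0, 1:]\<close> is s^2.\<close>

primrec bump_poly :: "nat => real poly" where
 "bump_poly 0 = 1"
| "bump_poly (Suc n) = [:0, 0, 1:] * (bump_poly n - pderiv (bump_poly n))"

text \<open>The successive derivatives of \<open>exp (- 1 / t)\<close>, extended by \<open>0\<close> to \<open>t <= 0\<close>.\<close>

definition bump_deriv :: "nat => real => real" where
 "bump_deriv n t = (if 0 < t then poly (bump_poly n) (1 / t) * exp (- (1 / t)) else 0)"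

lemma poly_exp_tendsto_0: "((%s. poly p s * exp (- s)) ---> (0::real)) at_top"
proof -
 have "((%s. \<Sum>i\<le>degree p. coeff p i * (s ^ i / exp s)) ---> (\<Sum>i\<le>degree p. coeff p i * 0)) at_top"
  by (intro tendsto_sum tendsto_mult tendsto_const tendsto_power_div_exp_0)
 moreover have "(\<Sum>i\<le>degree p. coeff p i * (s ^ i / exp s)) = poly p s * exp (- s)" for s :: real
  by (simp add: poly_altdef sum_distrib_right exp_minus divide_inverse mult.assoc)
 ultimately show ?thesis by simp
qed

lemma bump_deriv_has_derivative: "(bump_deriv n has_real_derivative bump_deriv (Suc n) t) (at t)"
proof -
 consider "t < 0" | "t = 0" | "0 < t" by linarith
 thus ?thesis
 proof cases
  case 1
  have "((%t. 0) has_real_derivative bump_deriv (Suc n) t) (at t)"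
   using 1 by (simp add: bump_deriv_def)
  thus ?thesis
   by (rule has_field_derivative_transform_within_open[of _ _ _ "{..<0}"]) (use 1 in "auto simp: bump_deriv_def")
 next
  case 3
  have "((%t. poly (bump_poly n) (1 / t) * exp (- (1 / t))) has_real_derivative bump_deriv (Suc n) t) (at t)"
  proof -
   have i: "((%t. 1 / t) has_real_derivative - (1 / t^2)) (at t)"
    using 3 by (auto intro!: derivative_eq_intros simp: power2_eq_square)
   have p: "((%t. poly (bump_poly n) (1 / t)) has_real_derivative poly (pderiv (bump_poly n)) (1 / t) * - (1 / t^2)) (at t)"
    by (rule DERIV_chain2[OF poly_DERIV i])
   have e: "((%t. exp (- (1 / t))) has_real_derivative exp (- (1 / t)) * (1 / t^2)) (at t)"
    using DERIV_chain2[OF DERIV_exp DERIV_minus[OF i]] by simp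
   show ?thesis
    by (rule DERIV_cong[OF DERIV_mult[OF p e]])
     (use 3 in "simp add: bump_deriv_def power2_eq_square field_simps")
  qed
  thus ?thesis
   by (rule has_field_derivative_transform_within_open[of _ _ _ "{0<..}"]) (use 3 in "auto simp: bump_deriv_def")
 next
  case 2
  \<comment> \<open>At the origin the difference quotient from the right is again a polynomial in 1
    / h times exp (-1 / h).\<close>
  have r: "((%h. bump_deriv n h / h) ---> 0) (at_right 0)"
  proof -
   have "((%h. poly ([:0, 1:] * bump_poly n) (inverse h) * exp (- inverse h)) ---> 0) (at_right (0::real))"
    using poly_exp_tendsto_0 filterlim_inverse_at_top_right by (rule filterlim_compose)
   moreover have "eventually (%h. poly ([:0, 1:] * bump_poly n) (inverse h) * exp (- inverse h) = bump_deriv n h / h) (at_right 0)"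
    by (rule eventually_mono[OF eventually_at_right_less]) (simp add: bump_deriv_def divide_inverse mult_ac)
   ultimately show ?thesis by (rule Lim_transform_eventually)
  qed
  have l: "((%h. bump_deriv n h / h) ---> 0) (at_left 0)"
   by (rule tendsto_eventually, rule eventually_at_leftI[of "-1"]) (auto simp: bump_deriv_def)
  have "((%h. bump_deriv n h / h) ---> 0) (at 0)"
   using l r by (simp add: filterlim_split_at)
  thus ?thesis unfolding 2 DERIV_def by (simp add: bump_deriv_def)
 qed
qed

definition bump :: "real => real^2 => real" where
 "bump delta x = bump_deriv 0 (1 - x .* x / delta^2)"

lemma bump_smooth: "Ck_on k UNIV (bump delta)"
proof -
 have id: "Ck_on k UNIV (%x::real^2. x $ i)" for i
  by (rule Ck_on_bounded_linear[OF bounded_linear_vec_nth])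
 have "Ck_on k UNIV (%x::real^2. 1 + (- 1 / delta^2) * (x $ 1 * x $ 1 + x $ 2 * x $ 2))"
  by (intro Ck_on_add Ck_on_mult id Ck_on_const)
 hence "Ck_on k UNIV (%x::real^2. bump_deriv 0 (1 + (- 1 / delta^2) * (x $ 1 * x $ 1 + x $ 2 * x $ 2)))"
  by (intro Ck_on_real_compose[where F = bump_deriv] bump_deriv_has_derivative)
 thus ?thesis by (rule Ck_on_cong_UNIV) (simp add: bump_def inner_real2)
qed

lemma bump_support: "0 < delta ==> delta <= norm x ==> bump delta x = 0"
proof -
 assume d: "0 < delta" "delta <= norm x"
 hence "delta^2 <= x .* x" by (simp flip: power2_norm_eq_inner add: power_mono)
 thus ?thesis using d by (simp add: bump_def bump_deriv_def)
qed

lemma bump_nonneg [simp]: "0 <= bump delta x" by (simp add: bump_def bump_deriv_def)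

lemma bump_pos: "norm x < delta ==> 0 < bump delta x"
proof -
 assume d: "norm x < delta"
 hence "0 < delta" using norm_ge_zero[of x] by linarith
 moreover have "x .* x < delta^2" using d by (simp flip: power2_norm_eq_inner add: power_strict_mono)
 ultimately show ?thesis by (simp add: bump_def bump_deriv_def)
qed

lemma bump_continuous: "continuous_on UNIV (bump delta)"
 using bump_smooth[of 0] by simp

lemma bump_measurable [measurable]: "borelf (bump delta)"
 by (rule borel_measurable_continuous_onI[OF bump_continuous])

lemma integrable_continuous_bounded_support:
 fixes f :: "'a::euclidean_space => real"
 assumes c: "continuous_on UNIV f" and s: "!!x. r <= norm x ==> f x = 0"
 shows "lint f"
proof -
 have "lint (%x. indicator (cball 0 r) x *. f x)"
  by (rule borel_integrable_compact) (auto intro: continuous_on_subset[OF c])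
 moreover have "indicator (cball 0 r) x *. f x = f x" for x
  using s[of x] by (cases "norm x <= r") auto
 ultimately show ?thesis by (simp only:)
qed

lemma bump_integrable: "0 < delta ==> lint (bump delta)"
 by (rule integrable_continuous_bounded_support[OF bump_continuous bump_support])

lemma bump_integral_pos:
 assumes "0 < delta" shows "0 < (LBINT x. bump delta x)"
 by (rule integral_pos_ball[OF bump_integrable[OF assms] _ assms, of 0]) (simp_all add: bump_pos)

section \<open>Convolution with a smooth kernel\<close>

abbreviation convolution :: "(real^2 => real) => (real^2 => real) => real^2 => real" where
 "convolution eta g \<equiv> %x. LBINT y. eta (x - y) * g y"

lemma Ck_derivative_support:
 assumes eta: "Ck_on (Suc 0) UNIV eta" and s: "!!x. r <= norm x ==> eta x = 0" and x: "r < norm x"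
 shows "frechet_derivative eta (at x) v = (0::real)"
proof -
 have "((%x. 0) has_derivative frechet_derivative eta (at x)) (at x)"
  by (rule has_derivative_transform_within_open[OF Ck_on_SucD(1)[OF eta], of "{x. r < norm x}"])
   (use x s in "auto intro: open_Collect_less continuous_intros")
 from frechet_derivative_at[OF this] show ?thesis by (simp add: frechet_derivative_const)
qed

lemma continuous_bounded_support_uniform:
 fixes f :: "real^2 => real"
 assumes c: "continuous_on UNIV f" and s: "!!x. r < norm x ==> f x = 0" and "0 < e"
 obtains d where "0 < d" "!!x y. norm (x - y) < d ==> abs (f x - f y) < e"
proof -
 have "uniformly_continuous_on (cball 0 (r + 1)) f"
  by (intro compact_uniformly_continuous continuous_on_subset[OF c]) auto
 then obtain d where d: "0 < d" "!!x y. x \<in> cball 0 (r + 1) ==> y \<in> cball 0 (r + 1) ==> dist y x < d ==> dist (f y) (f x) < e"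
  using \<open>0 < e\<close> unfolding uniformly_continuous_on_def by metis
 show thesis
 proof (rule that[of "min d 1"])
  fix x y :: "real^2" assume xy: "norm (x - y) < min d 1"
  have n: "norm x <= norm y + norm (x - y)" "norm y <= norm x + norm (x - y)"
   using norm_triangle_ineq[of y "x - y"] norm_triangle_ineq[of x "y - x"] by (simp_all add: norm_minus_commute)
  show "abs (f x - f y) < e"
  proof (cases "norm x <= r \<or> norm y <= r")
   case True
   hence "x \<in> cball 0 (r + 1)" "y \<in> cball 0 (r + 1)" using n xy by auto
   thus ?thesis using d(2)[of y x] xy by (auto simp: dist_norm)
  qed (use s[of x] s[of y] \<open>0 < e\<close> in auto)
 qed (use d in auto)
qed

lemma convolution_integrable:
 fixes eta g :: "real^2 => real"
 assumes c: "continuous_on UNIV eta" and s: "!!x. r < norm x ==> eta x = 0" and g: "lint g"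
 shows "lint (%y. eta (x - y) * g y)"
proof -
 obtain B where "\<forall>y\<in>eta ` cball 0 r. norm y <= B"
  using compact_imp_bounded[OF compact_continuous_image[OF continuous_on_subset[OF c] compact_cball[of 0 r]]]
  unfolding bounded_iff by blast
 hence B: "!!z. z \<in> cball 0 r ==> abs (eta z) <= B" by simp
 have B': "abs (eta z) <= abs B" for z
 proof (cases "norm z <= r")
  case True
  thus ?thesis using B[of z] by auto
 qed (use s in simp)
 have [measurable]: "borelf eta" "borelf g"
  using borel_measurable_continuous_onI[OF c] g by auto
 show ?thesis
  by (rule lint_bound[of _ "%y. abs B * g y"])
   (use g B' in "auto simp: abs_mult intro!: mult_right_mono")
qed

text \<open>The derivative falls on the smooth factor. The first-order remainder of
  \<open>eta\<close> is small relative to \<open>norm v\<close>, uniformly in the base point because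
  the partial derivatives are uniformly continuous; it is then integrated against
  \<open>abs (g y)\<close>.\<close>

lemma convolution_has_derivative:
 fixes eta :: "real^2 => real"
 assumes eta: "Ck_on (Suc 0) UNIV eta" and s: "!!x. r <= norm x ==> eta x = 0" and g: "lint g"
 shows "(convolution eta g has_derivative (%v. convolution (%z. frechet_derivative eta (at z) v) g x)) (at x)"
proof -
 define D where "D v z = frechet_derivative eta (at z) v" for v z
 note dd = Ck_on_SucD(1)[OF eta]
 have Dc: "continuous_on UNIV (D v)" for v using eta by (simp add: D_def[abs_def])
 have Ds: "D v z = 0" if "r < norm z" for v z unfolding D_def by (rule Ck_derivative_support[OF eta s that])
 have lin: "D v z = v $ 1 * D (axis 1 1) z + v $ 2 * D (axis 2 1) z" for v z
 proof -
  interpret bounded_linear "frechet_derivative eta (at z)" using dd by (rule has_derivative_bounded_linear)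
  have "D v z = D (vec2 (v $ 1) (v $ 2)) z" by (simp add: vec2_eta)
  thus ?thesis unfolding vec2_def D_def by (simp add: add scale)
 qed
 have ic: "lint (%y. D v (x - y) * g y)" for v x
  by (rule convolution_integrable[OF Dc Ds g])
 have ieta: "lint (%y. eta (x - y) * g y)" for x
  by (rule convolution_integrable[of _ r]) (use Ck_on_Suc_imp[OF eta] s g in auto)
 have L: "convolution (D v) g x = v $ 1 * convolution (D (axis 1 1)) g x + v $ 2 * convolution (D (axis 2 1)) g x" for v
  unfolding lin[of v] using ic[of "axis 1 1" x] ic[of "axis 2 1" x]
  by (simp add: distrib_right mult.assoc)
 have bl: "bounded_linear (%v. convolution (D v) g x)"
  by (subst L) (intro bounded_linear_add bounded_linear_mult_const bounded_linear_vec_nth)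
 have "\<forall>e>0. eventually (%w. norm (convolution eta g w - convolution eta g x - convolution (D (w - x)) g x) <= e * norm (w - x)) (at x)"
 proof (intro allI impI)
  fix e :: real assume "0 < e"
  define G where "G = (LBINT y. abs (g y)) + 1"
  have G: "0 < G" by (simp add: G_def add_nonneg_pos)
  have e': "0 < e / (2 * G)" using \<open>0 < e\<close> G by simp
  obtain d1 where d1: "0 < d1" "!!x y. norm (x - y) < d1 ==> abs (D (axis 1 1) x - D (axis 1 1) y) < e / (2 * G)"
   using continuous_bounded_support_uniform[OF Dc[of "axis 1 1"] Ds e'] by blast
  obtain d2 where d2: "0 < d2" "!!x y. norm (x - y) < d2 ==> abs (D (axis 2 1) x - D (axis 2 1) y) < e / (2 * G)"
   using continuous_bounded_support_uniform[OF Dc[of "axis 2 1"] Ds e'] by blast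
  have rem: "abs (eta (z + v) - eta z - D v z) <= e / G * norm v" if v: "norm v < min d1 d2" for v z
  proof -
   have "\<exists>t\<in>{0<..<1}. eta (z + 1 *. v) - eta (z + 0 *. v) = D v (z + t *. v) * (1 - 0)"
   proof (rule mvt_simple[of 0 1 "%t. eta (z + t *. v)" "%t s. D v (z + t *. v) * s"])
    show "((%t. eta (z + t *. v)) has_derivative (%s. D v (z + t *. v) * s)) (at t within {0..1})" for t
    proof -
     have "((%t. z + t *. v) has_derivative (%s. s *. v)) (at t)" by (auto intro!: derivative_eq_intros)
     from has_derivative_compose[OF this dd[of "z + t *. v"]]
     have "((%t. eta (z + t *. v)) has_derivative (%s. frechet_derivative eta (at (z + t *. v)) (s *. v))) (at t)" .
     moreover have "frechet_derivative eta (at (z + t *. v)) (s *. v) = D v (z + t *. v) * s" for s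
      using bounded_linear.linear[OF has_derivative_bounded_linear[OF dd[of "z + t *. v"]]]
      by (simp add: D_def linear_scale)
     ultimately show ?thesis by (simp add: has_derivative_at_withinI)
    qed
   qed simp
   then obtain t where t: "0 < t" "t < 1" "eta (z + v) - eta z = D v (z + t *. v)" by auto
   have tv: "norm ((z + t *. v) - z) < min d1 d2"
    using t v mult_left_le_one_le[of "norm v" t] by (simp add: abs_of_pos) 
   have "abs (eta (z + v) - eta z - D v z) = abs (v $ 1 * (D (axis 1 1) (z + t *. v) - D (axis 1 1) z) + v $ 2 * (D (axis 2 1) (z + t *. v) - D (axis 2 1) z))"
    unfolding t(3) lin[of v] by (simp add: algebra_simps)
   also have "... <= abs (v $ 1) * abs (D (axis 1 1) (z + t *. v) - D (axis 1 1) z) + abs (v $ 2) * abs (D (axis 2 1) (z + t *. v) - D (axis 2 1) z)"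
    unfolding abs_mult[symmetric] by (rule abs_triangle_ineq)
   also have "... <= norm v * (e / (2 * G)) + norm v * (e / (2 * G))"
    using d1(2)[of "z + t *. v" z] d2(2)[of "z + t *. v" z] tv component_le_norm_cart[of v]
    by (intro add_mono mult_mono) auto
   also have "... = e / G * norm v" using G by (simp add: field_simps)
   finally show ?thesis .
  qed
  have "eventually (%w. dist w x < min d1 d2) (at x)"
   unfolding eventually_at using d1 d2 by (intro exI[of _ "min d1 d2"]) auto
  thus "eventually (%w. norm (convolution eta g w - convolution eta g x - convolution (D (w - x)) g x) <= e * norm (w - x)) (at x)"
  proof eventually_elim
   case (elim w)
   have "norm (convolution eta g w - convolution eta g x - convolution (D (w - x)) g x)
    = abs (LBINT y. (eta (w - y) - eta (x - y) - D (w - x) (x - y)) * g y)"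
    using ieta[of w] ieta[of x] ic[of "w - x" x] by (simp add: left_diff_distrib)
   also have "... <= (LBINT y. e / G * norm (w - x) * abs (g y))"
   proof (rule integral_abs_bound_integral)
    show "lint (%y. (eta (w - y) - eta (x - y) - D (w - x) (x - y)) * g y)"
     using ieta[of w] ieta[of x] ic[of "w - x" x] by (simp add: left_diff_distrib)
    show "lint (%y. e / G * norm (w - x) * abs (g y))" using g by simp
    fix y
    have "abs (eta (w - y) - eta (x - y) - D (w - x) (x - y)) <= e / G * norm (w - x)"
     using rem[of "w - x" "x - y"] elim by (simp add: dist_norm)
    thus "abs ((eta (w - y) - eta (x - y) - D (w - x) (x - y)) * g y) <= e / G * norm (w - x) * abs (g y)"
     unfolding abs_mult by (rule mult_right_mono) simp
   qed
   also have "... = e / G * norm (w - x) * (G - 1)" by (simp add: G_def)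
   also have "... <= e / G * norm (w - x) * G" using \<open>0 < e\<close> G by (intro mult_left_mono) auto
   also have "... = e * norm (w - x)" using G by simp
   finally show ?case .
  qed
 qed
 thus ?thesis using bl unfolding has_derivative_within_alt2 D_def by simp
qed

text \<open>Each derivative of \<open>eta\<close> is a kernel of the same kind, with the support
  radius enlarged by 1 to pass from a strict to a weak inequality; hence \<open>r\<close> varies in
  the induction.\<close>

lemma convolution_smooth:
 fixes eta :: "real^2 => real"
 assumes "!!k. Ck_on k UNIV eta" and "!!x. r <= norm x ==> eta x = 0" and g: "lint g"
 shows "Ck_on k UNIV (convolution eta g)"
 using assms(1,2)
proof (induction k arbitrary: eta r)
 case 0
 show ?case
  unfolding Ck_on.simps
  by (intro continuous_at_imp_continuous_on ballI has_derivative_continuous[OF convolution_has_derivative[OF 0(1) 0(2) g]])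
next
 case (Suc k)
 show ?case
 proof (rule Ck_on_SucI[OF convolution_has_derivative[OF Suc.prems(1) Suc.prems(2) g]])
  fix v
  show "Ck_on k UNIV (convolution (%z. frechet_derivative eta (at z) v) g)"
  proof (rule Suc.IH[of _ "r + 1"])
   show "Ck_on j UNIV (%z. frechet_derivative eta (at z) v)" for j
    by (rule Ck_on_SucD(2)[OF Suc.prems(1)])
   show "frechet_derivative eta (at x) v = 0" if "r + 1 <= norm x" for x
    using that by (intro Ck_derivative_support[OF Suc.prems(1) Suc.prems(2)]) auto
  qed
 qed
qed

section \<open>Extension of the equation to test functions of finite energy\<close>

lemma integrable_indicator_bounded:
 assumes "S \<in> sets borel" "bounded S"
 shows "lint (indicator S :: 'a::euclidean_space => real)"
 using emeasure_bounded_finite[OF assms(2)] assms(1) by (simp add: integrable_indicator_iff)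

lemma integrable_square_bounded_support:
 fixes f :: "'a::euclidean_space => real"
 assumes [measurable]: "borelf f" and f2: "lint (%x. (f x)^2)"
  and s: "!!x. r <= norm x ==> f x = 0"
 shows "lint f"
proof (rule lint_bound)
 show "lint (%x. indicator (cball 0 r) x + (f x)^2)"
  using integrable_indicator_bounded[of "cball 0 r :: 'a set"] f2 by simp
 show "AEL x. norm (f x) <= norm (indicator (cball 0 r) x + (f x)^2)"
 proof (rule AE_I2, goal_cases)
  case (1 x)
  have "2 * abs (f x) * 1 <= abs (f x)^2 + 1^2" by (rule sum_squares_bound)
  thus ?case
   using s[of x] by (cases "norm x <= r") auto
 qed
qed measurable

text \<open>For each increment the inner integral is a correlation, continuous in the translation;
  the sum of the two diagonal terms dominates it for all translations.\<close>

lemma energy_translation_tendsto: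
 assumes u: "finite_energy u" "lint u" and phi: "finite_energy phi" "lint phi"
 shows "((%y. energy u (%x. phi (x + y))) ---> energy u phi) (at 0)"
proof (rule tendsto_at_iff_sequentially[THEN iffD2], intro allI impI, unfold comp_def)
 fix Y :: "nat => real^2" assume Y0: "\<forall>i. Y i \<in> UNIV - {0}" and Y: "Y ----> 0"
 note u' = finite_energyD[OF u(1)] and phi' = finite_energyD[OF phi(1)]
 note [measurable] = u'(1) phi'(1)
 have Ym: "finite_energy (%x. phi (x + y))" for y
  by (rule finite_energy_isometry[OF mpm_translation' _ phi(1)]) simp
 define a where "a h = (LBINT x. (u (x + h) - u x)^2)" for h
 define b where "b h = (LBINT x. (phi (x + h) - phi x)^2)" for h
 define d where "d h x = phi (x + h) - phi x" for h x
 define j where "j y h = (LBINT x. (u (x + h) - u x) * d h (x + y))" for y h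
 have [measurable]: "borelf (d h)" "borelf (%p. d (fst p) (snd p))" for h
  unfolding d_def by measurable
 have au: "lint (%x. (u (x + h) - u x)^2)" "lint (%x. (d h x)^2)" for h
  unfolding d_def using u' phi' by (auto intro: difference_square_integrable)
 have di: "lint (d h)" for h unfolding d_def using phi(2) integrable_translate[OF phi(2), of h] by simp
 have [measurable]: "borelf (j y)" for y unfolding j_def d_def by measurable
 have "(%n. LBINT h. kern h * j (Y n) h) ----> (LBINT h. kern h * j 0 h)"
 proof (rule integral_dominated_convergence[where w = "%h. kern h * a h + kern h * b h"])
  show "lint (%h. kern h * a h + kern h * b h)"
   using energy_increment(1)[OF u(1) u(1)] energy_increment(1)[OF phi(1) phi(1)]
   by (simp add: a_def b_def power2_eq_square)
  show "AEL h. (%n. kern h * j (Y n) h) ----> kern h * j 0 h"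
  proof (intro AE_I2 tendsto_mult tendsto_const)
   fix h :: "real^2"
   have "((%y. j y h) ---> j 0 h) (at 0)"
    unfolding j_def add_0_right by (rule translation_correlation_tendsto) (use au[of h] di in simp_all)
   thus "(%n. j (Y n) h) ----> j 0 h"
    using Y Y0 unfolding tendsto_at_iff_sequentially comp_def by blast
  qed
  show "AEL h. norm (kern h * j (Y n) h) <= kern h * a h + kern h * b h" for n :: nat
  proof (rule AE_I2, goal_cases)
   case (1 h)
   have i: "lint (%x. (d h (x + Y n))^2)"
    by (rule integrable_translate[OF au(2)])
   have "abs (j (Y n) h) <= (LBINT x. (u (x + h) - u x)^2 + (d h (x + Y n))^2)"
    unfolding j_def
   proof (rule integral_abs_bound_integral)
    show "lint (%x. (u (x + h) - u x) * (d h (x + Y n)))"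
     by (rule integrable_mult_square) (use au[of h] i in simp_all)
    show "lint (%x. (u (x + h) - u x)^2 + (d h (x + Y n))^2)"
     using au[of h] i by simp
    fix x let ?p = "u (x + h) - u x" and ?q = "d h (x + Y n)"
    have "2 * (abs ?p * abs ?q) <= ?p^2 + ?q^2" using sum_squares_bound[of "abs ?p" "abs ?q"] by simp
    moreover have "0 <= abs ?p * abs ?q" by simp
    ultimately show "abs (?p * ?q) <= ?p^2 + ?q^2" unfolding abs_mult by linarith
   qed
   also have "... = a h + (LBINT x. (d h (x + Y n))^2)"
    using au[of h] i by (simp add: a_def)
   also have "(LBINT x. (d h (x + Y n))^2) = b h"
    unfolding b_def d_def[symmetric] by (rule integral_translate) simp
   finally have "kern h * abs (j (Y n) h) <= kern h * (a h + b h)" by (rule mult_left_mono) simp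
   thus ?case by (simp add: abs_mult distrib_left)
  qed
 qed measurable
 moreover have "energy u (%x. phi (x + y)) = (LBINT h. kern h * j y h)" for y
  unfolding energy_increment(2)[OF u(1) Ym] j_def d_def by (simp add: add_ac)
 moreover have "energy u phi = (LBINT h. kern h * j 0 h)"
  unfolding energy_increment(2)[OF u(1) phi(1)] j_def d_def by simp
 ultimately show "(%n. energy u (%x. phi (x + Y n))) ----> energy u phi" by simp
qed

text \<open>The square of an increment is at most a constant times \<open>min 1 ((norm h)^2)\<close>
  and vanishes unless one endpoint lies in the support ball; Levy's condition on the kernel does the
  rest.\<close>

lemma lipschitz_finite_energy:
 fixes f :: "real^2 => real"
 assumes L: "!!x y. abs (f x - f y) <= L * norm (x - y)" and s: "!!x. r <= norm x ==> f x = 0" and r: "0 <= r"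
 shows "finite_energy f" "lint f"
proof -
 have L0: "0 <= L" using L[of "axis 1 1" 0] by simp
 have c: "continuous_on UNIV f"
  by (rule lipschitz_on_continuous_on[of L]) (auto simp: lipschitz_on_def dist_norm L0 L)
 have [measurable]: "borelf f" by (rule borel_measurable_continuous_onI[OF c])
 \<comment> \<open>Every point of the support ball has a zero of \<open>f\<close> at distance
   \<open>2 * r + 1\<close>, which bounds \<open>f\<close>.\<close>
 define M where "M = L * (2 * r + 1)"
 have M: "abs (f x) <= M" for x
 proof (cases "norm x <= r")
  case True
  let ?z = "(2 * r + 1) *. axis 1 1 :: real^2"
  have "norm ?z <= norm (x + ?z) + norm x" using norm_triangle_ineq4[of "x + ?z" x] by simp
  hence "r <= norm (x + ?z)" using r True by simp
  thus ?thesis using L[of x "x + ?z"] s[of "x + ?z"] r by (simp add: M_def)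
 qed (use s[of x] L0 r in "simp add: M_def")
 define C where "C = L^2 + 4 * M^2"
 let ?i = "indicator (cball 0 r) :: real^2 => real"
 have ii: "lint ?i" by (rule integrable_indicator_bounded) auto
 show fi: "lint f" by (rule integrable_continuous_bounded_support[OF c s])
 have f2: "lint (%x. (f x)^2)"
  by (rule integrable_continuous_bounded_support[of _ r]) (use c s in "auto intro: continuous_intros")
 have b: "(f (x + h) - f x)^2 <= (C * min 1 ((norm h)^2)) * (?i (x + h) + ?i x)" for x h
 proof (cases "norm x <= r \<or> norm (x + h) <= r")
  case True
  have 1: "(f (x + h) - f x)^2 <= L^2 * (norm h)^2"
   using power_mono[OF L[of "x + h" x] abs_ge_zero, of 2] by (simp add: power_mult_distrib)
  have "abs (f (x + h) - f x) <= 2 * M" using M[of x] M[of "x + h"] by linarith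
  hence 2: "(f (x + h) - f x)^2 <= 4 * M^2" using power_mono[of "abs (f (x + h) - f x)" "2 * M" 2] by (simp add: power_mult_distrib)
  have "(f (x + h) - f x)^2 <= C * min 1 ((norm h)^2)"
  proof (cases "(norm h)^2 <= 1")
   case True
   thus ?thesis using 1 by (simp add: C_def distrib_right add_increasing2)
  next
   case False
   thus ?thesis using 2 by (simp add: C_def add_increasing)
  qed
  also have "... <= C * min 1 ((norm h)^2) * (?i (x + h) + ?i x)"
   using mult_left_mono[of 1 "?i (x + h) + ?i x" "C * min 1 ((norm h)^2)"] True
   by (auto simp: C_def indicator_def)
  finally show ?thesis .
 qed (use s[of x] s[of "x + h"] in auto)
 have "(NNINT p. ennreal (edens f f p))
  <= (NNINT h. ennreal (kern h * (C * min 1 ((norm h)^2)) * (2 * (LBINT x. ?i x))))"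
  unfolding nn_integral_energy_increment[OF \<open>f \<in> borel_measurable borel\<close>]
 proof (rule nn_integral_mono)
  fix h :: "real^2"
  have "(NNINT x. ennreal ((f (x + h) - f x)^2)) <= (NNINT x. ennreal ((C * min 1 ((norm h)^2)) * (?i (x + h) + ?i x)))"
   by (intro nn_integral_mono ennreal_leI b)
  also have "... = ennreal (LBINT x. (C * min 1 ((norm h)^2)) * (?i (x + h) + ?i x))"
   using ii integrable_translate[OF ii, of h] by (intro nn_integral_eq_integral) (auto simp: C_def)
  also have "(LBINT x. (C * min 1 ((norm h)^2)) * (?i (x + h) + ?i x)) = (C * min 1 ((norm h)^2)) * (2 * (LBINT x. ?i x))"
   unfolding integral_mult_right_zero
   by (subst LINT_add[OF integrable_translate[OF ii] ii], subst integral_translate[of ?i]) (auto intro: borel_measurable_indicator)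
  finally show "ennreal (kern h) * (NNINT x. ennreal ((f (x + h) - f x)^2))
   <= ennreal (kern h * (C * min 1 ((norm h)^2)) * (2 * (LBINT x. ?i x)))"
   by (simp add: ennreal_mult' mult.assoc mult_left_mono)
 qed
 also have "... = ennreal (LBINT h. kern h * (C * min 1 ((norm h)^2)) * (2 * (LBINT x. ?i x)))"
 proof (intro nn_integral_eq_integral)
  have "lint (%h. C * (kern h * min 1 ((norm h)^2)) * (2 * (LBINT x. ?i x)))"
   using kern_min_finite by (intro integrable_mult_left integrable_mult_right)
  thus "lint (%h. kern h * (C * min 1 ((norm h)^2)) * (2 * (LBINT x. ?i x)))"
   by (simp only: mult_ac)
 qed (auto simp: C_def)
 also have "... < \<infinity>" by simp
 finally show "finite_energy f"
  unfolding finite_energy_def using f2 by (simp add: integrable_iff_bounded[of lborel "edens f f"])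
qed

lemma continuous_bounded_support_bounded:
 fixes f :: "real^2 => real"
 assumes c: "continuous_on UNIV f" and s: "!!x. r < norm x ==> f x = 0"
 obtains B where "0 <= B" "!!x. abs (f x) <= B"
proof -
 obtain B where "\<forall>y\<in>f ` cball 0 r. norm y <= B"
  using compact_imp_bounded[OF compact_continuous_image[OF continuous_on_subset[OF c] compact_cball[of 0 r]]]
  unfolding bounded_iff by blast
 hence B: "!!z. norm z <= r ==> abs (f z) <= B" by simp
 show thesis
 proof (rule that[of "abs B"])
  show "abs (f x) <= abs B" for x using B[of x] s[of x] by (cases "norm x <= r") auto
 qed simp
qed

lemma C1_bounded_support_lipschitz:
 fixes f :: "real^2 => real"
 assumes f: "Ck_on (Suc 0) UNIV f" and s: "!!x. r <= norm x ==> f x = 0"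
 obtains L where "!!x y. abs (f x - f y) <= L * norm (x - y)"
proof -
 let ?D = "%v z. frechet_derivative f (at z) v"
 have c: "continuous_on UNIV (?D v)" for v using f by simp
 have Ds: "?D v z = 0" if "r < norm z" for v z by (rule Ck_derivative_support[OF f s that])
 obtain B1 where B1: "0 <= B1" "!!z. abs (?D (axis 1 1) z) <= B1" by (rule continuous_bounded_support_bounded[where r = r, OF c[of "axis 1 1"] Ds]) (assumption, rule that)
 obtain B2 where B2: "0 <= B2" "!!z. abs (?D (axis 2 1) z) <= B2" by (rule continuous_bounded_support_bounded[where r = r, OF c[of "axis 2 1"] Ds]) (assumption, rule that)
 have b: "norm (f x - f y) <= (B1 + B2) * norm (x - y)" for x y
 proof (rule differentiable_bound[of UNIV f "%x. frechet_derivative f (at x)"])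
  show "(f has_derivative frechet_derivative f (at z)) (at z within UNIV)" for z
   using Ck_on_SucD(1)[OF f] by simp
  show "onorm (frechet_derivative f (at z)) <= B1 + B2" for z
  proof (rule onorm_le)
   fix v :: "real^2"
   interpret bounded_linear "frechet_derivative f (at z)"
    using Ck_on_SucD(1)[OF f] by (rule has_derivative_bounded_linear)
   have "?D v z = ?D (vec2 (v $ 1) (v $ 2)) z" by (simp add: vec2_eta)
   also have "... = v $ 1 * ?D (axis 1 1) z + v $ 2 * ?D (axis 2 1) z"
    unfolding vec2_def by (simp add: add scale)
   finally have "abs (?D v z) <= abs (v $ 1) * abs (?D (axis 1 1) z) + abs (v $ 2) * abs (?D (axis 2 1) z)"
    unfolding abs_mult[symmetric] by (simp only: abs_triangle_ineq)
   also have "... <= norm v * B1 + norm v * B2"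
    using B1 B2 component_le_norm_cart[of v] by (intro add_mono mult_mono) auto
   finally show "norm (?D v z) <= (B1 + B2) * norm v" by (simp add: algebra_simps)
  qed
 qed auto
 show thesis by (rule that) (use b in simp)
qed

lemma mpm_reflect_translate: "mpm (%y::real^2. x - y)"
proof -
 have "mpm (uminus :: real^2 => real^2)"
  by (rule mpm_orthogonal) (simp add: orthogonal_transformation_def linear_uminus)
 from mpm_comp[OF mpm_translation[of x] this] show ?thesis by simp
qed

lemma integral_mult_le_energies:
 assumes u: "finite_energy u" and phi: "finite_energy phi"
 shows "(LBINT p. abs (edens u phi p)) <= energy u u + energy phi phi"
proof -
 have "abs (edens u phi p) <= edens u u p + edens phi phi p" for p
 proof -
  let ?a = "u (snd p) - u (fst p)" and ?b = "phi (snd p) - phi (fst p)" and ?k = "kern (snd p - fst p)"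
  have "2 * (abs ?a * abs ?b) <= ?a^2 + ?b^2" using sum_squares_bound[of "abs ?a" "abs ?b"] by simp
  moreover have "0 <= abs ?a * abs ?b" by simp
  ultimately have "abs (?a * ?b) <= ?a^2 + ?b^2" unfolding abs_mult by linarith
  from mult_left_mono[OF this, of ?k] show ?thesis
   by (simp add: edens_def abs_mult power2_eq_square distrib_left)
 qed
 hence "(LBINT p. abs (edens u phi p)) <= (LBINT p. edens u u p + edens phi phi p)"
  by (intro integral_mono integrable_abs energy_density_integrable lint_add u phi)
 also have "... = energy u u + energy phi phi"
  unfolding energy_def by (intro LINT_add energy_density_integrable u phi)
 finally show ?thesis .
qed

text \<open>Only smooth test functions occur, as in the distributional equation. Three extensions
  follow: to compact support in \<open>Omega\<close>, to support near one point of the closure, and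
  to all functions of finite energy that vanish almost everywhere outside
  \<open>Omega\<close>.\<close>

definition weak_solution :: "(real^2) set => (real^2 => real) => bool" where
 "weak_solution Omega u \<longleftrightarrow> finite_energy u & lint u &
  (\<forall>phi. (%x. complex_of_real (phi x)) \<in> test_functions Omega --> lint phi --> finite_energy phi -->
   energy u phi = symbol_const * (LBINT x. phi x))"

text \<open>Mollifications of \<open>phi\<close> are admissible and have the same integral. Their
  energy with \<open>u\<close> is an average of the energies of translates of \<open>phi\<close>,
  which depend continuously on the translation at 0; a discrepancy at 0 would therefore persist in
  the average.\<close>

lemma weak_solution_compact_support:
 assumes u: "weak_solution Omega u" and "open Omega" and phi: "finite_energy phi"
  and C: "compact C" "C <= Omega" "!!x. x \<notin> C ==> phi x = 0"
 shows "energy u phi = symbol_const * (LBINT x. phi x)"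
proof -
 let ?E = "%y. energy u (%x. phi (x - y))"
 let ?S = "symbol_const * (LBINT x. phi x)"
 have ue: "finite_energy u" and ui: "lint u" using u by (auto simp: weak_solution_def)
 note [measurable] = finite_energyD(1)[OF ue] finite_energyD(1)[OF phi]
 obtain r where r: "!!x. x \<in> C ==> norm x < r" "0 < r"
  using compact_imp_bounded[OF C(1)] by (metis bounded_pos_less)
 have phii: "lint phi"
  by (rule integrable_square_bounded_support[OF finite_energyD(1,2)[OF phi], of r]) (use C(3) r(1) in "metis not_less")
 obtain delta0 where delta0: "0 < delta0" "(\<Union>x\<in>C. ball x delta0) <= Omega"
  using compact_subset_open_imp_ball_epsilon_subset[OF C(1) \<open>open Omega\<close> C(2)] by blast
 have phiy: "finite_energy (%x. phi (x - y))" for y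
  using finite_energy_isometry[OF mpm_translation'[of "- y"] _ phi] by simp
 have main: "\<exists>eta. (\<forall>y. 0 <= eta y) & (\<forall>y. delta <= norm y --> eta y = 0) & lint eta & (LBINT y. eta y) = 1 &
  eta \<in> borel_measurable borel & ?E \<in> borel_measurable borel &
  ?S = (LBINT y. eta y * ?E y)"
  if delta: "0 < delta" "delta < delta0" for delta
 proof -
  define c where "c = 1 / (LBINT x. bump delta x)"
  have c: "0 < c" using bump_integral_pos[OF delta(1)] by (simp add: c_def)
  define eta where "eta x = c * bump delta x" for x
  have etak: "Ck_on k UNIV eta" for k unfolding eta_def by (intro Ck_on_mult Ck_on_const bump_smooth)
  have etas: "eta x = 0" if "delta <= norm x" for x using bump_support[OF delta(1) that] by (simp add: eta_def)
  have eta0: "0 <= eta x" for x using c by (simp add: eta_def)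
  have etai: "lint eta" unfolding eta_def using bump_integrable[OF delta(1)] by simp
  have eta1: "(LBINT y. eta y) = 1" using bump_integral_pos[OF delta(1)] by (simp add: eta_def c_def)
  have [measurable]: "borelf eta" using etai by auto
  let ?g = "convolution eta phi"
  have g: "?g x = (LBINT y. eta y * phi (x - y))" for x
   using mpm_integral[OF mpm_reflect_translate[of x], of "%y. eta (x - y) * phi y"] by simp
  have gi: "lint (%y. eta y * phi (x - y))" for x
   using mpm_integrable[OF mpm_reflect_translate[of x] convolution_integrable[of eta delta phi x]] etak[of 0] etas phii by simp
  define K where "K = (%p. fst p + snd p) ` (C \<times> cball 0 delta)"
  have K: "compact K" unfolding K_def
   by (intro compact_continuous_image continuous_intros compact_Times C compact_cball)
  have KOmega: "K <= Omega"
  proof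
   fix z assume "z \<in> K"
   then obtain x y where z: "z = x + y" "x \<in> C" "norm y <= delta" by (auto simp: K_def)
   hence "z \<in> ball x delta0" using delta by (simp add: dist_norm)
   thus "z \<in> Omega" using delta0 z by blast
  qed
  have gK: "?g x = 0" if "x \<notin> K" for x
  proof -
   have z: "eta y * phi (x - y) = 0" for y
   proof (cases "norm y <= delta")
    case True
    have "x - y \<notin> C"
    proof
     assume "x - y \<in> C"
     hence "(x - y) + y \<in> K" using True unfolding K_def by force
     thus False using that by simp
    qed
    thus ?thesis using C(3) by simp
   qed (use etas in simp)
   show ?thesis unfolding g z by simp
  qed
  obtain R where R: "!!x. x \<in> K ==> norm x < R" "0 < R"
   using compact_imp_bounded[OF K] by (metis bounded_pos_less)
  have gk: "Ck_on k UNIV ?g" for k by (rule convolution_smooth[OF etak etas phii])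
  have gR: "?g x = 0" if "R <= norm x" for x using gK R that by force
  obtain L where L: "!!x y. abs (?g x - ?g y) <= L * norm (x - y)"
   by (rule C1_bounded_support_lipschitz[where r = R, OF gk gR]) (assumption, rule that)
  have ge: "finite_energy ?g" "lint ?g"
   using lipschitz_finite_energy[OF L gR] R by auto
  have "(%x. complex_of_real (?g x)) \<in> test_functions Omega"
  proof -
   have sub: "closure {x. complex_of_real (?g x) ~= 0} <= K"
    by (rule closure_minimal) (use gK K in "auto simp: compact_imp_closed")
   have "compact (closure {x. complex_of_real (?g x) ~= 0})"
    using closed_Int_compact[OF closed_closure K, of "{x. complex_of_real (?g x) ~= 0}"] sub by (simp add: Int_absorb2)
   moreover have "smooth_on UNIV (%x. complex_of_real (?g x))"
    unfolding smooth_on_def by (intro allI Ck_on_linear_compose[OF bounded_linear_of_real] gk)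
   ultimately show ?thesis using sub KOmega unfolding test_functions_def by blast
  qed
  hence "energy u ?g = symbol_const * (LBINT x. ?g x)"
   by (rule u[unfolded weak_solution_def, THEN conjunct2, THEN conjunct2, rule_format, OF _ ge(2,1)])
  moreover have "(LBINT x. ?g x) = (LBINT x. phi x)"
  proof -
   have i: "lint (%p. eta (snd p - fst p) * phi (fst p))"
   proof -
    have "mpm (%y::real^2. y - x)" for x using mpm_translation'[of "- x"] by simp
    hence "mpm (%p::(real^2)\<times>(real^2). (fst p, snd p - fst p))"
     by (rule mpm_pair_fibre[of "%x y. y - x"]) measurable
    from mpm_integrable[OF this integrable_mult_prod[OF phii etai]] show ?thesis by (simp add: mult.commute)
   qed
   have "(LBINT x. ?g x) = (LBINT y. LBINT x. eta (x - y) * phi y)"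
    using integral_swap_lborel[OF i] by simp
   also have "... = (LBINT y. (LBINT x. eta x) * phi y)"
   proof (rule LINT_cong[OF refl])
    show "(LBINT x. eta (x - y) * phi y) = (LBINT x. eta x) * phi y" for y
     using integral_translate[of eta "- y"] by simp
   qed
   finally show ?thesis by (simp add: eta1)
  qed
  moreover have Fub: "energy u ?g = (LBINT y. eta y * ?E y)"
   and Fm: "borelf ?E"
  proof -
   let ?H = "%q. eta (fst q) * edens u (%x. phi (x - fst q)) (snd q)"
   have dm[measurable]: "(%q. edens u (%x. phi (x - fst q)) (snd q)) \<in> borel_measurable (lborel \<Otimes>\<^sub>M (lborel :: ((real^2) \<times> (real^2)) measure))"
    unfolding edens_def by measurable
   show Fm: "borelf ?E"
    unfolding energy_def using lborel.borel_measurable_lebesgue_integral[of "%y p. edens u (%x. phi (x - y)) p" lborel] dm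
    by (simp add: split_beta')
   have Ephi: "energy (%x. phi (x - y)) (%x. phi (x - y)) = energy phi phi" for y
    using energy_isometry[OF mpm_translation'[of "- y"], of phi phi] by simp
   have Hi: "integrable lborel2 ?H"
   proof (rule lborel_pair.Fubini_integrable)
    show "?H \<in> borel_measurable lborel2" by measurable
    show "AEL y. lint (%p. ?H (y, p))"
     using energy_density_integrable[OF ue phiy] by simp
    show "lint (%y. LBINT p. norm (?H (y, p)))"
    proof (rule lint_bound[of _ "%y. eta y * (energy u u + energy phi phi)"])
     show "lint (%y. eta y * (energy u u + energy phi phi))" using etai by simp
     show "AEL y. norm (LBINT p. norm (?H (y, p))) <= norm (eta y * (energy u u + energy phi phi))"
     proof (rule AE_I2, goal_cases)
      case (1 y)
      have "(LBINT p. norm (?H (y, p))) = eta y * (LBINT p. abs (edens u (%x. phi (x - y)) p))"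
       using eta0[of y] by (simp add: abs_mult)
      also have "... <= eta y * (energy u u + energy phi phi)"
       using integral_mult_le_energies[OF ue phiy[of y]] eta0[of y] by (intro mult_left_mono) (simp_all add: Ephi)
      finally show ?case by simp
     qed
    qed measurable
   qed
   hence Hi': "lint ?H" by (simp add: lborel_prod)
   have "energy u ?g = (LBINT p. LBINT y. ?H (y, p))"
    unfolding energy_def
   proof (rule LINT_cong[OF refl], goal_cases)
    case (1 p)
    have "?g (snd p) - ?g (fst p) = (LBINT y. eta y * (phi (snd p - y) - phi (fst p - y)))"
     unfolding g using gi by (simp add: right_diff_distrib)
    moreover have "(LBINT y. ?H (y, p)) = (LBINT y. (kern (snd p - fst p) * (u (snd p) - u (fst p))) * (eta y * (phi (snd p - y) - phi (fst p - y))))"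
     unfolding edens_def fst_conv snd_conv by (simp only: mult_ac)
    ultimately show ?case
     unfolding edens_def[of u ?g] by simp
   qed
   also have "... = (LBINT y. LBINT p. ?H (y, p))" by (rule integral_swap_lborel[OF Hi', symmetric])
   finally show "energy u ?g = (LBINT y. eta y * ?E y)"
    by (simp add: energy_def)
  qed
  ultimately have "?S = (LBINT y. eta y * ?E y)"
   by (simp only:)
  thus ?thesis using eta0 etas etai eta1 Fm \<open>eta \<in> borel_measurable borel\<close> by (intro exI[of _ eta] conjI allI impI)
 qed
 show ?thesis
 proof (rule ccontr)
  let ?e = "abs (energy u phi - ?S)"
  assume "energy u phi ~= ?S"
  hence e: "0 < ?e" by simp
  have "eventually (%y. dist (energy u (%x. phi (x + y))) (energy u phi) < ?e / 2) (at 0)"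
   using energy_translation_tendsto[OF ue ui phi phii] e by (intro tendstoD) auto
  then obtain d where d: "0 < d" "!!y. y ~= 0 ==> norm y < d ==> abs (energy u (%x. phi (x + y)) - energy u phi) < ?e / 2"
   unfolding eventually_at by (auto simp: dist_real_def)
  define delta where "delta = min d delta0 / 2"
  have delta: "0 < delta" "delta < delta0" "delta < d" using d delta0 by (auto simp: delta_def)
  from main[OF delta(1,2)] obtain eta where eta': "\<forall>y. 0 <= eta y" "\<forall>y. delta <= norm y --> eta y = 0" "lint eta" "(LBINT y. eta y) = 1"
   and m[measurable]: "borelf eta" "borelf ?E"
   and eq: "?S = (LBINT y. eta y * ?E y)"
   by (elim exE conjE) (rule that)
  have eta: "!!y. 0 <= eta y" "!!y. delta <= norm y ==> eta y = 0" "lint eta" "(LBINT y. eta y) = 1"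
   using eta' by auto
  have b: "abs (eta y * (?E y - energy u phi)) <= eta y * (?e / 2)" for y
  proof (cases "norm y < delta")
   case True
   have "abs (?E y - energy u phi) <= ?e / 2"
    using d(2)[of "- y"] True delta e by (cases "y = 0") auto
   hence "eta y * abs (?E y - energy u phi) <= eta y * (?e / 2)"
    by (rule mult_left_mono) (rule eta(1))
   thus ?thesis using eta(1)[of y] by (simp only: abs_mult abs_of_nonneg)
  qed (use eta(2) in simp)
  have i1: "lint (%y. eta y * (?E y - energy u phi))"
  proof (rule lint_bound[of _ "%y. eta y * (?e / 2)"])
   show "AEL y. norm (eta y * (?E y - energy u phi)) <= norm (eta y * (?e / 2))"
    by (rule AE_I2) (use b in "auto intro: order_trans[OF _ abs_ge_self]")
  qed (use eta(3) in simp_all)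
  have i2: "lint (%y. eta y * energy u phi)" using eta(3) by simp
  have "(LBINT y. eta y * ?E y) = 
   (LBINT y. eta y * (?E y - energy u phi) + eta y * energy u phi)"
   by (simp add: algebra_simps)
  also have "... = (LBINT y. eta y * (?E y - energy u phi)) + energy u phi"
   by (subst LINT_add[OF i1 i2]) (simp add: eta(4))
  finally have "?e = abs (LBINT y. eta y * (?E y - energy u phi))"
   unfolding eq by simp
  also have "... <= (LBINT y. eta y * (?e / 2))"
   by (rule integral_abs_bound_integral[OF i1 _ b]) (use eta(3) in simp)
  also have "... = ?e / 2" by (simp only: integral_mult_left_zero eta(4) mult_1)
  finally show False using e by simp
 qed
qed

lemma AE_pair_lborel:
 assumes "AE x in (lborel :: (real^2) measure). P x"
 shows "AE p in (lborel :: ((real^2) \<times> (real^2)) measure). P (fst p) & P (snd p)"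
proof -
 obtain N where N: "N \<in> null_sets lborel" "{x. ~ P x} <= N"
  using assms by (auto simp: eventually_ae_filter)
 have [measurable]: "N \<in> sets borel" using N by auto
 have aeN: "AEL x. x \<notin> N" using N(1) by (rule AE_not_in)
 have "AE p in lborel \<Otimes>\<^sub>M lborel. fst p \<notin> N & snd p \<notin> N"
 proof (rule lborel_pair.AE_pair_measure)
  show "AEL x. AEL y. fst (x, y) \<notin> N & snd (x, y) \<notin> N"
  proof (rule eventually_mono[OF aeN])
   fix x assume "x \<notin> N"
   thus "AEL y. fst (x, y) \<notin> N & snd (x, y) \<notin> N" using aeN by simp
  qed
  show "{p \<in> space lborel2. fst p \<notin> N & snd p \<notin> N} \<in> sets lborel2" by measurable
 qed
 thus ?thesis
  unfolding lborel_prod by eventually_elim (use N in blast)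
qed

lemma energy_density_cong_AE:
 assumes f: "AEL x. f x = f' x" and g: "AEL x. g x = g' x"
 shows "AEL p. edens f g p = edens f' g' p"
 using AE_pair_lborel[OF f] AE_pair_lborel[OF g] by eventually_elim (simp add: edens_def)

lemma energy_cong_AE:
 assumes [measurable]: "borelf f" "borelf f'" "borelf g" "borelf g'"
  and "AEL x. f x = f' x" "AEL x. g x = g' x"
 shows "energy f g = energy f' g'"
 unfolding energy_def by (intro LINT_cong_AE energy_density_cong_AE assms(5,6)) measurable

lemma finite_energy_cong_AE:
 assumes f: "finite_energy f" and g[measurable]: "borelf g" and ae: "AEL x. f x = g x"
 shows "finite_energy g"
proof -
 note [measurable] = finite_energyD(1)[OF f]
 have "lint (%x. (g x)^2)"
  by (rule integrable_cong_AE[THEN iffD1, OF _ _ _ finite_energyD(2)[OF f]]) (use ae in "auto elim!: eventually_mono")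
 moreover have "lint (edens g g)"
  by (rule integrable_cong_AE[THEN iffD1, OF _ _ energy_density_cong_AE[OF ae ae] finite_energyD(3)[OF f]]) measurable
 ultimately show ?thesis by (simp add: finite_energy_def)
qed

text \<open>Product rule for increments: one term is bounded by the density of \<open>phi\<close>,
  the other by the square of \<open>phi\<close> at the first point times an integrable function of
  the increment.\<close>

lemma finite_energy_mult_lipschitz:
 fixes zeta :: "real^2 => real"
 assumes phi: "finite_energy phi" and L: "!!x y. abs (zeta x - zeta y) <= L * norm (x - y)" and b: "!!x. abs (zeta x) <= 1"
 shows "finite_energy (%x. zeta x * phi x)"
proof -
 note phi' = finite_energyD[OF phi]
 have "continuous_on UNIV zeta"
  by (rule lipschitz_on_continuous_on[of "abs L"])
   (auto simp: lipschitz_on_def dist_norm intro!: order_trans[OF L mult_right_mono])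
 note [measurable] = borel_measurable_continuous_onI[OF this] phi'(1)
 define C where "C = L^2 + 4"
 define F where "F p = 2 * edens phi phi p + 2 * ((phi (fst p))^2 * (C * (kern (snd p - fst p) * min 1 ((norm (snd p - fst p))^2))))" for p
 show ?thesis
 proof (rule finite_energy_domination)
  show "lint (%x. (zeta x * phi x)^2)"
  proof (rule lint_bound[OF phi'(2)])
   show "AEL x. norm ((zeta x * phi x)^2) <= norm ((phi x)^2)"
   proof (rule AE_I2, goal_cases)
    case (1 x) have "(zeta x)^2 * (phi x)^2 <= 1 * (phi x)^2" using b[of x] by (intro mult_right_mono) (auto simp: abs_square_le_1)
    thus ?case by (simp add: power_mult_distrib)
   qed
  qed measurable
  have mt: "mpm (%y::real^2. y - x)" for x using mpm_translation'[of "- x"] by simp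
  have "mpm (%p::(real^2)\<times>(real^2). (fst p, snd p - fst p))"
   by (rule mpm_pair_fibre[of "%x y. y - x", OF mt]) measurable
  from mpm_integrable[OF this integrable_mult_prod[OF phi'(2) integrable_mult_right[OF kern_min_finite, of C]]]
  show "lint F" unfolding F_def using phi'(3) by simp
  show "edens (%x. zeta x * phi x) (%x. zeta x * phi x) p <= F p" for p
  proof -
   let ?x = "fst p" and ?y = "snd p" let ?k = "kern (?y - ?x)"
   have c: "(zeta ?y - zeta ?x)^2 <= C * min 1 ((norm (?y - ?x))^2)"
   proof (cases "(norm (?y - ?x))^2 <= 1")
    case True
    have "(zeta ?y - zeta ?x)^2 <= L^2 * (norm (?y - ?x))^2"
     using power_mono[OF L[of ?y ?x] abs_ge_zero, of 2] by (simp add: power_mult_distrib)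
    thus ?thesis using True by (simp add: C_def distrib_right add_increasing2)
   next
    case False
    have "abs (zeta ?y - zeta ?x) <= 2" using b[of ?x] b[of ?y] by linarith
    hence "(zeta ?y - zeta ?x)^2 <= 4" using power_mono[of "abs (zeta ?y - zeta ?x)" 2 2] by simp
    thus ?thesis using False by (simp add: C_def add_increasing)
   qed
   have "zeta ?y * phi ?y - zeta ?x * phi ?x = zeta ?y * (phi ?y - phi ?x) - (- phi ?x * (zeta ?y - zeta ?x))" by (simp add: algebra_simps)
   hence "(zeta ?y * phi ?y - zeta ?x * phi ?x)^2 <= 2 * ((zeta ?y)^2 * (phi ?y - phi ?x)^2) + 2 * ((phi ?x)^2 * (zeta ?y - zeta ?x)^2)"
    using power2_diff_le[of "zeta ?y * (phi ?y - phi ?x)" "- phi ?x * (zeta ?y - zeta ?x)"] by (simp add: power_mult_distrib)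
   also have "... <= 2 * (1 * (phi ?y - phi ?x)^2) + 2 * ((phi ?x)^2 * (C * min 1 ((norm (?y - ?x))^2)))"
    using b[of ?y] c by (intro add_mono mult_left_mono mult_right_mono) (auto simp: abs_square_le_1)
   finally have "?k * (zeta ?y * phi ?y - zeta ?x * phi ?x)^2 <= ?k * (2 * (1 * (phi ?y - phi ?x)^2) + 2 * ((phi ?x)^2 * (C * min 1 ((norm (?y - ?x))^2))))"
    by (rule mult_left_mono) simp
   thus ?thesis by (simp add: F_def edens_def power2_eq_square algebra_simps)
  qed
 qed measurable
qed

text \<open>The segment property: near each point of the closure one direction pushes the closure
  into \<open>Omega\<close>. Interior points can be served by \<open>e = 0\<close>.\<close>

definition locally_inward :: "'a::real_normed_vector set => bool" where
 "locally_inward Omega \<longleftrightarrow> (\<forall>x\<in>closure Omega. \<exists>r>0. \<exists>e. \<exists>t0>0. \<forall>z\<in>cball x r \<inter> closure Omega. \<forall>t. 0 < t --> t < t0 --> z + t *. e \<in> Omega)"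

text \<open>Translation by \<open>t *. e\<close> produces a function with compact support in
  \<open>Omega\<close> and the same integral; the energy is continuous as \<open>t\<close> tends to
  0.\<close>

lemma weak_solution_local:
 assumes u: "weak_solution Omega u" and "open Omega" "bounded Omega" and phi: "finite_energy phi"
  and r: "!!z t. z \<in> cball x r \<inter> closure Omega ==> 0 < t ==> t < t0 ==> z + t *. e \<in> Omega" and "0 < t0"
  and s: "!!z. z \<notin> cball x r \<inter> closure Omega ==> phi z = 0"
 shows "energy u phi = symbol_const * (LBINT x. phi x)"
proof -
 have ue: "finite_energy u" and ui: "lint u" using u by (auto simp: weak_solution_def)
 note [measurable] = finite_energyD(1)[OF phi]
 let ?K = "cball x r \<inter> closure Omega"
 have K: "compact ?K" by (simp add: compact_Int_closed)
 obtain R where R: "!!z. z \<in> ?K ==> norm z < R" using compact_imp_bounded[OF K] by (metis bounded_pos_less)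
 have phii: "lint phi"
  by (rule integrable_square_bounded_support[OF finite_energyD(1,2)[OF phi], of R]) (use s R in "metis not_less")
 have eq: "energy u (%z. phi (z + - (t *. e))) = symbol_const * (LBINT x. phi x)" if t: "0 < t" "t < t0" for t
 proof -
  have "energy u (%z. phi (z + - (t *. e))) = symbol_const * (LBINT z. phi (z + - (t *. e)))"
  proof (rule weak_solution_compact_support[OF u \<open>open Omega\<close> finite_energy_isometry[OF mpm_translation' _ phi]])
   show "compact ((%z. z + t *. e) ` ?K)" by (intro compact_continuous_image continuous_intros K)
   show "(%z. z + t *. e) ` ?K <= Omega" using r t by blast
   show "phi (z + - (t *. e)) = 0" if "z \<notin> (%z. z + t *. e) ` ?K" for z
   proof (rule s)
    show "z + - (t *. e) \<notin> ?K" using that by (metis (no_types, lifting) imageI add.assoc add.left_inverse add_0_right)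
   qed
  qed simp
  also have "(LBINT z. phi (z + - (t *. e))) = (LBINT x. phi x)"
   by (rule integral_translate) measurable
  finally show ?thesis .
 qed
 \<comment> \<open>The summand 2 keeps every \<open>Y n\<close> strictly below \<open>t0\<close>,
   already for \<open>n = 0\<close>.\<close>
 define Y where "Y n = t0 / real (n + 2)" for n
 have Y: "0 < Y n" "Y n < t0" for n using \<open>0 < t0\<close> by (auto simp: Y_def divide_less_eq)
 show ?thesis
 proof (cases "e = 0")
  case True
  thus ?thesis using eq[OF Y] by simp
 next
  case False
  have "Y ----> 0" unfolding Y_def by real_asymp
  hence "(%n. - (Y n *. e)) ----> - (0 *. e)" by (intro tendsto_intros)
  hence "(%n. energy u (%z. phi (z + - (Y n *. e)))) ----> energy u phi"
   using energy_translation_tendsto[OF ue ui phi phii, unfolded tendsto_at_iff_sequentially comp_def, rule_format, of "%n. - (Y n *. e)"]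
    False Y(1) by (simp add: less_imp_neq[symmetric])
  thus ?thesis unfolding eq[OF Y] by (simp add: LIMSEQ_const_iff)
 qed
qed

lemma cutoff_exists:
 fixes x0 :: "real^2"
 assumes "0 < rho"
 obtains zeta L where "!!x y. abs (zeta x - zeta y) <= L * norm (x - y)" "!!x. 0 <= zeta x & zeta x <= (1::real)"
  "!!x. x \<in> cball x0 rho ==> zeta x = 1" "!!x. x \<notin> cball x0 (2 * rho) ==> zeta x = 0"
proof (rule that[of "%x. max 0 (min 1 (2 - dist x0 x / rho))" "1 / rho"])
 fix x y :: "real^2"
 have "abs (dist x0 x - dist x0 y) <= norm (x - y)"
  by (metis abs_dist_diff_le dist_commute dist_norm)
 hence "abs (dist x0 x / rho - dist x0 y / rho) <= 1 / rho * norm (x - y)"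
  using assms by (simp add: diff_divide_distrib[symmetric] divide_right_mono)
 thus "abs (max 0 (min 1 (2 - dist x0 x / rho)) - max 0 (min 1 (2 - dist x0 y / rho))) <= 1 / rho * norm (x - y)" by linarith
qed (use assms in "auto simp: field_simps")

text \<open>A finite cover of the closure is peeled off ball by ball: the part of \<open>psi\<close>
  under the cutoff is local, and the remainder vanishes on that ball, so the induction takes care of
  it.\<close>

theorem weak_solution_all:
 assumes u: "weak_solution Omega u" and Omega: "open Omega" "bounded Omega" "locally_inward Omega" and phi: "finite_energy phi"
  and s: "AEL x. x \<notin> Omega --> phi x = 0"
 shows "energy u phi = symbol_const * (LBINT x. phi x)"
proof -
 have ue: "finite_energy u" and ui: "lint u" using u by (auto simp: weak_solution_def)
 have "\<exists>r>0. \<exists>e. \<exists>t0>0. \<forall>z\<in>cball x r \<inter> closure Omega. \<forall>t. 0 < t --> t < t0 --> z + t *. e \<in> Omega" if "x \<in> closure Omega" for x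
  using Omega(3) that unfolding locally_inward_def by blast
 then obtain r where r: "!!x. x \<in> closure Omega ==> 0 < r x & (\<exists>e. \<exists>t0>0. \<forall>z\<in>cball x (r x) \<inter> closure Omega. \<forall>t. 0 < t --> t < t0 --> z + t *. e \<in> Omega)"
  by metis
 have cov: "closure Omega <= (\<Union>x\<in>closure Omega. ball x (r x / 2))" using r by force
 have cc: "compact (closure Omega)" using Omega(2) by (simp add: compact_closure)
 obtain F where F: "F <= closure Omega" "finite F" "closure Omega <= (\<Union>x\<in>F. ball x (r x / 2))"
  by (rule compactE_image[OF cc open_ball cov])
 have ind: "energy u psi = symbol_const * (LBINT x. psi x)"
  if "finite F'" "F' <= closure Omega" "finite_energy psi" "\<forall>x. x \<notin> Omega --> psi x = 0" "\<forall>x. x \<notin> (\<Union>x\<in>F'. ball x (r x / 2)) --> psi x = 0" for F' psi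
  using that
 proof (induction F' arbitrary: psi rule: finite_induct)
  case empty
  hence "psi = (%x. 0)" by auto
  thus ?case by (simp add: energy_def edens_def[abs_def])
 next
  case (insert a F')
  have ra: "0 < r a / 2" using r insert.prems(1) by auto
  obtain zeta L where zeta: "!!x y. abs (zeta x - zeta y) <= L * norm (x - y)" "!!x. 0 <= zeta x & zeta x <= 1"
   "!!x. x \<in> cball a (r a / 2) ==> zeta x = 1" "!!x. x \<notin> cball a (2 * (r a / 2)) ==> zeta x = 0"
   using cutoff_exists[OF ra, of a] by metis
  have f1: "finite_energy (%x. zeta x * psi x)"
   by (rule finite_energy_mult_lipschitz[OF insert.prems(2) zeta(1)]) (use zeta(2) in auto)
  have f2: "finite_energy (%x. (1 - zeta x) * psi x)"
   by (rule finite_energy_mult_lipschitz[OF insert.prems(2), of _ L]) (use zeta(1,2) in "auto simp: abs_minus_commute")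
  have i: "lint theta" if "finite_energy theta" "!!x. x \<notin> Omega ==> theta x = 0" for theta
  proof -
   obtain R where R: "!!z. z \<in> Omega ==> norm z < R" using Omega(2) by (metis bounded_pos_less)
   show ?thesis
    by (rule integrable_square_bounded_support[OF finite_energyD(1,2)[OF that(1)], of R]) (use that(2) R in "metis not_less")
  qed
  have 1: "energy u (%x. zeta x * psi x) = symbol_const * (LBINT x. zeta x * psi x)"
  proof -
   obtain e t0 where et: "0 < t0" "\<forall>z\<in>cball a (r a) \<inter> closure Omega. \<forall>t. 0 < t --> t < t0 --> z + t *. e \<in> Omega"
    using r insert.prems(1) by (metis insert_subset)
   show ?thesis
   proof (rule weak_solution_local[OF u Omega(1,2) f1 _ et(1), of a "r a"])
    show "zeta z * psi z = 0" if "z \<notin> cball a (r a) \<inter> closure Omega" for z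
     using that zeta(4)[of z] insert.prems(3) closure_subset[of Omega] by auto
   qed (use et(2) in blast)
  qed
  have 2: "energy u (%x. (1 - zeta x) * psi x) = symbol_const * (LBINT x. (1 - zeta x) * psi x)"
  proof (rule insert.IH[OF _ f2])
   show "F' <= closure Omega" using insert.prems(1) by simp
   show "\<forall>x. x \<notin> Omega --> (1 - zeta x) * psi x = 0" using insert.prems(3) by simp
   show "\<forall>x. x \<notin> (\<Union>x\<in>F'. ball x (r x / 2)) --> (1 - zeta x) * psi x = 0"
   proof (intro allI impI)
    fix x assume x: "x \<notin> (\<Union>x\<in>F'. ball x (r x / 2))"
    show "(1 - zeta x) * psi x = 0"
    proof (cases "x \<in> cball a (r a / 2)")
     case False
     hence "x \<notin> (\<Union>x\<in>insert a F'. ball x (r x / 2))" using x by auto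
     thus ?thesis using insert.prems(4) by simp
    qed (simp add: zeta(3))
   qed
  qed
  have "energy u psi = energy u (%x. zeta x * psi x + (1 - zeta x) * psi x)" by (simp add: algebra_simps)
  also have "... = energy u (%x. zeta x * psi x) + energy u (%x. (1 - zeta x) * psi x)" by (rule energy_add_right[OF ue f1 f2])
  also have "... = symbol_const * (LBINT x. zeta x * psi x + (1 - zeta x) * psi x)"
   unfolding 1 2 using i[OF f1] i[OF f2] insert.prems(3) by (simp add: distrib_left)
  also have "... = symbol_const * (LBINT x. psi x)" by (simp add: algebra_simps)
  finally show ?case .
 qed
 note [measurable] = finite_energyD(1)[OF phi] finite_energyD(1)[OF ue]
 have [measurable]: "Omega \<in> sets borel" using Omega(1) by simp
 let ?psi = "%x. indicator Omega x * phi x"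
 have ae: "AEL x. phi x = ?psi x" using s by eventually_elim (auto simp: indicator_def)
 have "energy u phi = energy u ?psi" by (rule energy_cong_AE) (use ae in auto)
 also have "... = symbol_const * (LBINT x. ?psi x)"
 proof (rule ind[OF F(2,1)])
  show "finite_energy ?psi" by (rule finite_energy_cong_AE[OF phi _ ae]) measurable
  show "\<forall>x. x \<notin> (\<Union>x\<in>F. ball x (r x / 2)) --> ?psi x = 0" using F(3) closure_subset[of Omega] by (auto simp: indicator_def)
 qed simp
 also have "(LBINT x. ?psi x) = (LBINT x. phi x)"
 proof (rule LINT_cong_AE)
  show "AEL x. ?psi x = phi x" using ae by eventually_elim simp
 qed measurable
 finally show ?thesis .
qed

section \<open>Reflections and antisymmetric comparison\<close>

definition reflect :: "real^2 => real => real^2 => real^2" where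
 "reflect e l x = x - (2 * (x .* e - l)) *. e"

lemma reflect_isometry:
 assumes e: "norm e = 1" shows "norm (reflect e l x - reflect e l y) = norm (x - y)"
proof -
 have ee: "e .* e = 1" using e by (simp add: norm_eq_1)
 have "(reflect e l x - reflect e l y) .* (reflect e l x - reflect e l y) = (x - y) .* (x - y)"
  unfolding reflect_def by (simp add: inner_simps ee inner_commute algebra_simps)
 thus ?thesis by (simp add: norm_eq_sqrt_inner)
qed

lemma reflect_involution [simp]: "norm e = 1 ==> reflect e l (reflect e l x) = x"
 by (simp add: reflect_def inner_simps norm_eq_1 algebra_simps)

lemma reflect_inner: "norm e = 1 ==> reflect e l x .* e = 2 * l - x .* e"
 by (simp add: reflect_def inner_simps norm_eq_1 algebra_simps)

lemma reflect_fixed: "x .* e = l ==> reflect e l x = x"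
 by (simp add: reflect_def)

lemma reflect_continuous: "continuous_on UNIV (reflect e l)"
 unfolding reflect_def by (intro continuous_intros)

lemma reflect_mpm:
 assumes e: "norm e = 1" shows "mpm (reflect e l)"
proof -
 have "orthogonal_transformation (reflect e 0)"
  unfolding orthogonal_transformation
 proof
  show "linear (reflect e 0)" by (rule linearI) (auto simp: reflect_def inner_simps algebra_simps)
  show "\<forall>v. norm (reflect e 0 v) = norm v" using reflect_isometry[OF e, of 0 _ 0] by (simp add: reflect_def)
 qed
 hence "mpm (%x. (2 * l) *. e + reflect e 0 x)"
  by (intro mpm_comp[OF mpm_translation mpm_orthogonal])
 thus ?thesis by (simp add: reflect_def[abs_def] algebra_simps)
qed

text \<open>The added term is four times the product of the signed distances to the line. All
  comparisons of the two kernels rest on this identity.\<close>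

lemma dist_reflect:
 assumes e: "norm e = 1"
 shows "(norm (x - reflect e l y))^2 = (norm (x - y))^2 + 4 * (l - x .* e) * (l - y .* e)"
proof -
 have ee: "e .* e = 1" using e by (simp add: norm_eq_1)
 show ?thesis unfolding power2_norm_eq_inner reflect_def
  by (simp add: inner_simps ee inner_commute algebra_simps)
qed

locale reflection =
 fixes e :: "real^2" and l :: real
 assumes e: "norm e = 1"
begin

abbreviation "R \<equiv> reflect e l"
abbreviation "Hs \<equiv> {x. x .* e < l}"

lemma R_measurable [measurable]: "borelf R"
 using reflect_mpm[OF e] by (rule mpm_measurable)

lemma Hs_measurable [measurable]: "Hs \<in> sets borel"
 by (intro borel_open open_Collect_less continuous_intros)

lemma R_R [simp]: "R (R x) = x" using e by simp

lemma R_Hs: "R x .* e < l \<longleftrightarrow> l < x .* e" using reflect_inner[OF e, of l x] by auto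

lemma kern_R_R: "kern (R x - R y) = kern (x - y)"
 using reflect_isometry[OF e] by (simp add: kern_def)

lemma kern_R: "kern (R x - y) = kern (x - R y)"
 using kern_R_R[of "R x" y] by simp

lemma kern_reflect_le:
 assumes "x .* e <= l" "y .* e <= l" "x ~= y"
 shows "kern (x - R y) <= kern (x - y)"
proof -
 have "(norm (x - y))^2 <= (norm (x - R y))^2"
  unfolding dist_reflect[OF e] using assms by simp
 hence "norm (x - y) <= norm (x - R y)" by (rule power2_le_imp_le) simp
 hence "norm (x - y) ^ 3 <= norm (x - R y) ^ 3" by (rule power_mono) simp
 thus ?thesis unfolding kern_def using assms(3) \<open>norm (x - y) <= norm (x - R y)\<close>
  by (intro divide_left_mono mult_pos_pos zero_less_power) (auto intro: less_le_trans)
qed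

text \<open>Sum over the orbit of a pair under reflecting either point. It reduces the double
  integral to pairs in one half-plane, where the second kernel \<open>kern (x - R y)\<close> appears
  beside \<open>kern (x - y)\<close>.\<close>

definition fold4 :: "((real^2) \<times> (real^2) => real) => (real^2) \<times> (real^2) => real" where
 "fold4 F p = F (fst p, snd p) + F (R (fst p), snd p) + F (fst p, R (snd p)) + F (R (fst p), R (snd p))"

lemma
 assumes F: "lint F"
 shows fold4_integrable: "lint (fold4 F)"
  and fold4_integral: "(LBINT p. fold4 F p) = 4 * (LBINT p. F p)"
proof -
 have [measurable]: "borelf F" using F by auto
 have id: "mpm (%x::real^2. x)" using mpm_translation'[of 0] by simp
 note m = mpm_map_prod[OF id id] mpm_map_prod[OF reflect_mpm[OF e] id] mpm_map_prod[OF id reflect_mpm[OF e]] mpm_map_prod[OF reflect_mpm[OF e] reflect_mpm[OF e]]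
 note i = m[THEN mpm_integrable[OF _ F]]
 have eq: "fold4 F = (%p. F (fst p, snd p) + F (R (fst p), snd p) + F (fst p, R (snd p)) + F (R (fst p), R (snd p)))"
  by (rule ext) (rule fold4_def)
 show "lint (fold4 F)" unfolding eq by (intro lint_add i)
 have "(LBINT p. fold4 F p) = (LBINT p. F (fst p, snd p)) + (LBINT p. F (R (fst p), snd p)) + (LBINT p. F (fst p, R (snd p))) + (LBINT p. F (R (fst p), R (snd p)))"
  unfolding eq using i by simp
 thus "(LBINT p. fold4 F p) = 4 * (LBINT p. F p)"
  using m[THEN mpm_integral[of _ F]] by simp
qed

text \<open>The negative part on one side of the line, extended by 0 rather than antisymmetrically,
  so that it is a nonnegative test function.\<close>

definition lower_half :: "(real^2 => real) => real^2 => real" where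
 "lower_half z x = (if x .* e < l then max (- z x) 0 else 0)"

lemma lower_half_measurable [measurable]:
 assumes [measurable]: "borelf z" shows "borelf (lower_half z)"
 unfolding lower_half_def by measurable

text \<open>The product of the increments of \<open>z\<close> and of its negative part is
  nonpositive, so the larger kernel \<open>kern (x - y)\<close> in front of it may be lowered to
  \<open>kern (x - R y)\<close>. The mixed terms then cancel and only squares remain.\<close>

lemma fold4_point:
 assumes anti: "!!x. z (R x) = - z x" and x: "x .* e <= l" and y: "y .* e <= l"
 shows "fold4 (edens z (lower_half z)) (x, y) <= - 2 * kern (x - R y) * ((lower_half z x)^2 + (lower_half z y)^2)"
proof -
 have T: "z x = 0" if "x .* e = l" for x using anti[of x] reflect_fixed[OF that] by simp
 have low: "lower_half z x = max (- z x) 0" if "x .* e <= l" for x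
  using that T[of x] by (cases "x .* e = l") (auto simp: lower_half_def)
 have low0: "lower_half z (R x) = 0" if "x .* e <= l" for x using that by (simp add: lower_half_def R_Hs)
 let ?k1 = "kern (x - y)" and ?k2 = "kern (x - R y)" and ?a = "lower_half z x" and ?b = "lower_half z y"
 have S: "fold4 (edens z (lower_half z)) (x, y) = ?k1 * ((z y - z x) * (?b - ?a)) + ?k2 * ((z y + z x) * (?b + ?a))"
  unfolding fold4_def edens_def
  by (simp add: anti low0[OF x] low0[OF y] kern_commute[of y x] kern_commute[of y "R x"] kern_commute[of "R y" x] kern_R algebra_simps)
 have n: "(z y - z x) * (?b - ?a) <= 0" unfolding low[OF x] low[OF y]
  by (cases "z y <= z x") (auto simp: mult_le_0_iff)
 have "?k1 * ((z y - z x) * (?b - ?a)) <= ?k2 * ((z y - z x) * (?b - ?a))"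
 proof (cases "x = y")
  case False
  from mult_right_mono_neg[OF kern_reflect_le[OF x y False] n] show ?thesis .
 qed simp
 hence "fold4 (edens z (lower_half z)) (x, y) <= ?k2 * (2 * (z x * ?a + z y * ?b))"
  unfolding S by (simp add: algebra_simps)
 also have "z x * ?a = - ?a\<^sup>2" unfolding low[OF x] by (auto simp: max_def power2_eq_square)
 also have "z y * ?b = - ?b\<^sup>2" unfolding low[OF y] by (auto simp: max_def power2_eq_square)
 finally show ?thesis by (simp add: algebra_simps)
qed

lemma fold4_R: "fold4 F (R x, y) = fold4 F (x, y)" "fold4 F (x, R y) = fold4 F (x, y)"
 by (auto simp: fold4_def)

lemma fold4_nonpos:
 assumes anti: "!!x. z (R x) = - z x"
 shows "fold4 (edens z (lower_half z)) p <= 0"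
proof -
 define c where "c x = (if x .* e <= l then x else R x)" for x
 have ce: "c x .* e <= l" for x using R_Hs[of x] by (auto simp: c_def not_le)
 have "fold4 (edens z (lower_half z)) p = fold4 (edens z (lower_half z)) (c (fst p), c (snd p))"
  by (auto simp: c_def fold4_R)
 also have "... <= - 2 * kern (c (fst p) - R (c (snd p))) * ((lower_half z (c (fst p)))^2 + (lower_half z (c (snd p)))^2)"
  by (rule fold4_point[where z = z, OF anti ce ce])
 also have "... <= 0" by (simp add: mult_nonneg_nonneg)
 finally show ?thesis .
qed

lemma Hs_not_null: "~ (AEL y. ~ y .* e < l)"
proof
 assume "AEL y. ~ y .* e < l"
 hence "AEL y. y \<notin> ball ((l - 1) *. e) 1"
 proof eventually_elim
  case (elim y)
  show ?case
  proof
   assume "y \<in> ball ((l - 1) *. e) 1"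
   hence "norm (y - (l - 1) *. e) < 1" by (simp add: dist_norms)
   moreover have "(y - (l - 1) *. e) .* e <= norm (y - (l - 1) *. e)"
    using norm_cauchy_schwarz[of "y - (l - 1) *. e" e] e by simp
   moreover have "(y - (l - 1) *. e) .* e = y .* e - (l - 1)" using e by (simp add: inner_simps norm_eq_1)
   ultimately show False using elim by simp
  qed
 qed
 thus False by (rule not_AE_notin_ball) simp
qed

text \<open>The maximum principle for antisymmetric functions. The folded density is nonpositive
  with nonnegative integral, hence 0 almost everywhere; since \<open>kern (x - R y)\<close> is
  positive for two points below the line, \<open>fold4_point\<close> leaves no nonzero
  value.\<close>

lemma antisymmetric_lower_half_zero:
 assumes [measurable]: "borelf z" and anti: "!!x. z (R x) = - z x"
  and i: "lint (edens z (lower_half z))" and nn: "0 <= energy z (lower_half z)"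
 shows "AEL x. lower_half z x = 0"
proof -
 let ?S = "fold4 (edens z (lower_half z))"
 have "0 <= (LBINT p. - ?S p)" by (rule Bochner_Integration.integral_nonneg) (simp add: fold4_nonpos[where z = z, OF anti])
 hence "(LBINT p. - ?S p) = 0"
  using nn fold4_integral[OF i] by (simp add: energy_def)
 hence "AEL p. - ?S p = 0"
  using integral_nonneg_eq_0_iff_AE[of lborel "%p. - ?S p"] fold4_integrable[OF i] fold4_nonpos[where z = z, OF anti] by simp
 hence "AE p in lborel \<Otimes>\<^sub>M lborel. ?S p = 0" unfolding lborel_prod by simp
 from lborel_pair.AE_pair[OF this] have ae: "AEL x. AEL y. ?S (x, y) = 0" .
 show ?thesis using ae
 proof eventually_elim
  case (elim x)
  show ?case
  proof (rule ccontr)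
   assume nz: "lower_half z x ~= 0"
   hence x: "x .* e < l" by (auto simp: lower_half_def split: if_splits)
   have "AEL y. ~ y .* e < l" using elim
   proof eventually_elim
    case (elim y)
    show ?case
    proof
     assume y: "y .* e < l"
     have "x ~= R y" using x y R_Hs[of y] by auto
     hence "0 < kern (x - R y)" by (simp add: kern_def)
     moreover have "0 < (lower_half z x)^2 + (lower_half z y)^2" using nz by (simp add: add_pos_nonneg)
     ultimately have "0 < kern (x - R y) * ((lower_half z x)^2 + (lower_half z y)^2)" by (rule mult_pos_pos)
     thus False using fold4_point[where z = z, OF anti, of x y] x y elim by simp
    qed
   qed
   thus False using Hs_not_null by simp
  qed
 qed
qed

text \<open>The cut along the line could create energy between points on opposite sides.
  Antisymmetry prevents it: the square of \<open>v x\<close> is at most the sum of the squares of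
  \<open>v y - v x\<close> and \<open>v y + v x\<close>, and the latter is the increment to
  \<open>R y\<close>, which is no farther from \<open>x\<close> than \<open>y\<close> is.\<close>

lemma lower_half_finite_energy:
 assumes v: "finite_energy v" and anti: "!!x. v (R x) = - v x"
 shows "finite_energy (lower_half v)"
proof (rule finite_energy_domination)
 note v' = finite_energyD[OF v]
 note [measurable] = v'(1)
 show "borelf (lower_half v)" by measurable
 have le: "abs (lower_half v x) <= abs (v x)" for x by (auto simp: lower_half_def)
 show "lint (%x. (lower_half v x)^2)"
  by (rule lint_bound[OF v'(2)]) (use le in "auto simp: abs_le_square_iff")
 show "lint (fold4 (edens v v))" by (rule fold4_integrable[OF v'(3)])
 show "edens (lower_half v) (lower_half v) p <= fold4 (edens v v) p" for p
 proof -
  obtain x y where p: "p = (x, y)" by (cases p)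
  have nn: "0 <= edens v v q" for q by simp
  have mixed: "kern (x - y) * (v x)^2 <= edens v v (x, y) + edens v v (x, R y)"
   if "x .* e < l" "l <= y .* e" for x y
  proof (cases "x = R y")
   case True
   hence "v y = - v x" using anti[of y] by simp
   hence "edens v v (x, y) = kern (x - y) * (4 * (v x)^2)"
    by (simp add: edens_def kern_commute[of y x] power2_eq_square)
   moreover have "kern (x - y) * (v x)^2 <= kern (x - y) * (4 * (v x)^2)" by (intro mult_left_mono) auto
   ultimately show ?thesis using nn[of "(x, R y)"] by linarith
  next
   case False
   have "R y .* e <= l" using that reflect_inner[OF e, of l y] by simp
   hence k: "kern (x - y) <= kern (x - R y)" using kern_reflect_le[of x "R y"] that False by simp
   have "kern (x - y) * (v x)^2 <= kern (x - y) * (v y - v x)^2 + kern (x - y) * (v y + v x)^2"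
   proof -
    have "(v x)^2 <= (v y - v x)^2 + (v y + v x)^2" by (simp add: power2_sum power2_diff)
    from mult_left_mono[OF this kern_nonneg[of "x - y"]] show ?thesis by (simp add: distrib_left)
   qed
   also have "... <= kern (x - y) * (v y - v x)^2 + kern (x - R y) * (v y + v x)^2"
    using k by (intro add_left_mono mult_right_mono) auto
   also have "kern (x - R y) * (v y + v x)^2 = edens v v (x, R y)"
   proof -
    have "(- v y - v x) * (- v y - v x) = (v y + v x)^2" by (simp add: power2_eq_square algebra_simps)
    thus ?thesis by (simp add: edens_def kern_commute[of "R y" x] anti)
   qed
   finally show ?thesis by (simp add: edens_def kern_commute[of y x] power2_eq_square)
  qed
  have sym: "edens v v (x, y) = edens v v (y, x)" for x y
   by (simp add: edens_def kern_commute[of y x] algebra_simps)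
  have sq: "(lower_half v x)^2 <= (v x)^2" for x using le[of x] by (simp add: abs_le_square_iff)
  consider "x .* e < l" "y .* e < l" | "x .* e < l" "l <= y .* e" | "l <= x .* e" "y .* e < l" | "l <= x .* e" "l <= y .* e" by linarith
  thus ?thesis
  proof cases
   case 1
   have "abs (lower_half v y - lower_half v x) <= abs (v y - v x)" using 1 by (auto simp: lower_half_def)
   hence "(lower_half v y - lower_half v x)^2 <= (v y - v x)^2" by (simp add: abs_le_square_iff)
   from mult_left_mono[OF this kern_nonneg] have "edens (lower_half v) (lower_half v) (x, y) <= edens v v (x, y)"
    by (simp add: edens_def power2_eq_square)
   thus ?thesis using nn unfolding p fold4_def by (smt (verit) fst_conv snd_conv)
  next
   case 2
   have "edens (lower_half v) (lower_half v) (x, y) = kern (x - y) * (lower_half v x)^2"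
    using 2 by (simp add: edens_def lower_half_def kern_commute[of y x] power2_eq_square)
   also have "... <= kern (x - y) * (v x)^2" by (intro mult_left_mono sq) simp
   also note mixed[OF 2]
   finally show ?thesis using nn unfolding p fold4_def by (smt (verit) fst_conv snd_conv)
  next
   case 3
   have "edens (lower_half v) (lower_half v) (x, y) = kern (y - x) * (lower_half v y)^2"
    using 3 by (simp add: edens_def lower_half_def power2_eq_square)
   also have "... <= kern (y - x) * (v y)^2" by (intro mult_left_mono sq) simp
   also note mixed[OF 3(2,1)]
   also have "edens v v (y, x) + edens v v (y, R x) = edens v v (x, y) + edens v v (R x, y)"
    by (simp only: sym[of y])
   finally show ?thesis using nn unfolding p fold4_def by (smt (verit) fst_conv snd_conv)
  next
   case 4
   hence "edens (lower_half v) (lower_half v) (x, y) = 0" by (simp add: edens_def lower_half_def)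
   thus ?thesis using nn unfolding p fold4_def by (smt (verit) fst_conv snd_conv)
  qed
 qed
qed

end

section \<open>The solution and its reflected difference\<close>

locale torsion_solution =
 fixes Omega :: "(real^2) set" and u :: "real^2 => real"
 assumes op: "open Omega" and bd: "bounded Omega" and inw: "locally_inward Omega"
  and ws: "weak_solution Omega u" and off: "!!x. x \<notin> Omega ==> u x = 0"
begin

lemma ue: "finite_energy u" using ws by (simp add: weak_solution_def)
lemma um [measurable]: "borelf u" using ue by (rule finite_energyD)
lemma Omega_borel [measurable]: "Omega \<in> sets borel" using op by simp

lemmas weak_equation = weak_solution_all[OF ws op bd inw]

lemma Omega_not_full: "~ (AEL x. x \<in> Omega)"
proof
 assume "AEL x. x \<in> Omega"
 hence "emeasure lborel (UNIV :: (real^2) set) = emeasure lborel Omega"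
  by (intro emeasure_eq_AE) auto
 thus False using emeasure_bounded_finite[OF bd] by simp
qed

text \<open>Tested with its negative part, \<open>u\<close> has nonnegative energy by the equation,
  yet at most minus the energy of that part. The negative part is thus almost everywhere constant,
  and it is 0 outside the bounded set \<open>Omega\<close>.\<close>

lemma u_nonneg: "AEL x. 0 <= u x"
proof -
 let ?phi = "%x. max (- u x) 0"
 have le: "abs (?phi x - ?phi y) <= abs (u x - u y)" "abs (?phi x) <= abs (u x)" for x y by auto
 have fe: "finite_energy ?phi"
 proof (rule finite_energy_domination[OF _ _ finite_energyD(3)[OF ue]])
  show "lint (%x. (?phi x)^2)"
   by (rule lint_bound[OF finite_energyD(2)[OF ue]]) (simp, rule AE_I2, simp add: abs_le_square_iff[THEN iffD1, OF le(2)])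
  show "edens ?phi ?phi p <= edens u u p" for p
   unfolding edens_def power2_eq_square[symmetric]
   by (intro mult_left_mono abs_le_square_iff[THEN iffD1] le(1)) simp
 qed measurable
 have "AEL x. x \<notin> Omega --> ?phi x = 0" using off by simp
 hence "0 <= energy u ?phi" using weak_equation[OF fe] symbol_const_pos by simp
 moreover have "energy u ?phi <= - energy ?phi ?phi"
 proof -
  have "edens u ?phi p <= - edens ?phi ?phi p" for p
  proof -
   have "(u (snd p) - u (fst p)) * (?phi (snd p) - ?phi (fst p)) <= - ((?phi (snd p) - ?phi (fst p)) * (?phi (snd p) - ?phi (fst p)))"
    by (auto simp: max_def algebra_simps mult_nonneg_nonpos mult_nonneg_nonpos2 mult_nonpos_nonpos)
   from mult_left_mono[OF this kern_nonneg[of "snd p - fst p"]] show ?thesis by (simp add: edens_def)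
  qed
  hence "energy u ?phi <= (LBINT p. - edens ?phi ?phi p)"
   unfolding energy_def by (intro integral_mono energy_density_integrable ue fe Bochner_Integration.integrable_minus)
  thus ?thesis by (simp add: energy_def)
 qed
 moreover have "0 <= energy ?phi ?phi" unfolding energy_def by (rule Bochner_Integration.integral_nonneg) simp
 ultimately have "energy ?phi ?phi = 0" by linarith
 hence "AEL p. edens ?phi ?phi p = 0"
  unfolding energy_def by (subst (asm) integral_nonneg_eq_0_iff_AE[OF finite_energyD(3)[OF fe]]) auto
 hence "AE p in lborel \<Otimes>\<^sub>M lborel. edens ?phi ?phi p = 0" unfolding lborel_prod by simp
 from lborel_pair.AE_pair[OF this] have "AEL x. AEL y. edens ?phi ?phi (x, y) = 0" .
 thus ?thesis
 proof eventually_elim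
  case (elim x)
  show ?case
  proof (rule ccontr)
   assume "~ 0 <= u x"
   hence px: "?phi x ~= 0" by auto
   from elim have "AEL y. y \<in> Omega"
   proof eventually_elim
    case (elim y)
    show ?case
    proof (rule ccontr)
     assume y: "y \<notin> Omega"
     hence "?phi y = 0" using off by simp
     moreover from this px have "x ~= y" by auto
     hence "kern (y - x) ~= 0" by (simp add: kern_def)
     ultimately show False using elim px by (simp add: edens_def)
    qed
   qed
   thus False using Omega_not_full by simp
  qed
 qed
qed

text \<open>If \<open>u\<close> vanished almost everywhere on the ball, only the cross terms would
  survive in its energy with a tent function over that ball, and they are nonpositive; the equation
  makes this energy positive.\<close>

lemma u_positive_set:
 assumes "0 < rho" and sub: "ball a rho <= Omega"
 obtains delta where "0 < delta" "0 < measure lborel {x \<in> ball a rho. delta <= u x}"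
proof -
 let ?phi = "%x. max 0 (rho - dist a x)"
 have L: "abs (?phi x - ?phi y) <= 1 * norm (x - y)" for x y
 proof -
  have "abs (dist a x - dist a y) <= norm (x - y)" by (metis abs_dist_diff_le dist_commute dist_norm)
  thus ?thesis by linarith
 qed
 have "?phi x = 0" if "norm a + rho <= norm x" for x
  using that norm_triangle_ineq2[of x a] by (simp add: dist_norms)
 note fe = lipschitz_finite_energy[OF L this]
 have fe: "finite_energy ?phi" "lint ?phi" using fe \<open>0 < rho\<close> by (auto simp: add_nonneg_nonneg)
 have z: "x \<notin> ball a rho ==> ?phi x = 0" for x by simp
 have ae: "AEL x. x \<notin> Omega --> ?phi x = 0" by (rule AE_I2) (use z sub in blast)
 have ip: "0 < (LBINT x. ?phi x)" by (rule integral_pos_ball[OF fe(2) _ \<open>0 < rho\<close>, of a]) auto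
 show thesis
 proof (rule ccontr)
  assume neg: "~ thesis"
  have "AEL x. x \<in> ball a rho --> u x < 1 / real (Suc n)" for n
  proof -
   let ?S = "{x \<in> ball a rho. 1 / real (Suc n) <= u x}"
   have "?S \<in> sets borel" by measurable
   have "~ 0 < measure lborel ?S" using that[of "1 / real (Suc n)"] neg by auto
   hence "measure lborel ?S = 0" using measure_nonneg[of lborel ?S] by linarith
   moreover have "emeasure lborel ?S < \<infinity>" by (intro emeasure_bounded_finite bounded_subset[OF bounded_ball[of a rho]]) auto
   ultimately have "emeasure lborel ?S = 0" using emeasure_eq_ennreal_measure[of lborel ?S] by auto
   hence "?S \<in> null_sets lborel" using \<open>?S \<in> sets borel\<close> by auto
   thus ?thesis by (rule AE_I') auto
  qed
  hence "AEL x. \<forall>n. x \<in> ball a rho --> u x < 1 / real (Suc n)" unfolding AE_all_countable by blast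
  with u_nonneg have "AEL x. 0 <= u x & u x * ?phi x = 0"
  proof eventually_elim
   case (elim x)
   show ?case
   proof (cases "x \<in> ball a rho")
    case True
    hence lt: "u x < 1 / real (Suc n)" for n using elim by auto
    have "u x <= 0"
    proof (rule ccontr)
     assume "~ u x <= 0"
     then obtain n where "inverse (real (Suc n)) < u x" using reals_Archimedean[of "u x"] by auto
     thus False using lt[of n] by (simp add: inverse_eq_divide)
    qed
    thus ?thesis using elim by auto
   qed (use elim z in auto)
  qed
  from AE_pair_lborel[OF this] have "AEL p. edens u ?phi p <= 0"
  proof eventually_elim
   case (elim p)
   have "(u (snd p) - u (fst p)) * (?phi (snd p) - ?phi (fst p))
    = u (snd p) * ?phi (snd p) + u (fst p) * ?phi (fst p) - (u (snd p) * ?phi (fst p) + u (fst p) * ?phi (snd p))"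
    by (simp only: left_diff_distrib right_diff_distrib)
   also have "... = - (u (snd p) * ?phi (fst p) + u (fst p) * ?phi (snd p))" using elim by (simp only:)
   also have "... <= 0" using elim mult_nonneg_nonneg[of "u (snd p)" "?phi (fst p)"] mult_nonneg_nonneg[of "u (fst p)" "?phi (snd p)"]
    by linarith
   finally show ?case by (simp add: edens_def mult_nonneg_nonpos)
  qed
  hence "0 <= (LBINT p. - edens u ?phi p)" by (intro integral_nonneg_AE) auto
  hence "energy u ?phi <= 0" unfolding energy_def by simp
  moreover have "0 < energy u ?phi" using weak_equation[OF fe(1) ae] ip symbol_const_pos by simp
  ultimately show False by simp
 qed
qed

end

locale torsion_reflection = torsion_solution + reflection +
 assumes cap: "!!x. x \<in> Omega ==> l < x .* e ==> R x \<in> Omega"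
begin

definition v :: "real^2 => real" where "v x = u x - u (R x)"

lemma v_R: "v (R x) = - v x" by (simp add: v_def)

lemma uRe: "finite_energy (%x. u (R x))"
 by (rule finite_energy_isometry[OF reflect_mpm[OF e, of l] reflect_isometry[OF e, of l] ue])

lemma ve: "finite_energy v" unfolding v_def[abs_def] by (rule finite_energy_diff[OF ue uRe])

lemma vm [measurable]: "borelf v" using ve by (rule finite_energyD)

text \<open>The test function and its reflection are both admissible, so the constant right-hand
  sides cancel; the energy of the reflected solution is moved onto the reflected test
  function.\<close>

lemma energy_v:
 assumes phi: "finite_energy phi" and 1: "AEL x. phi x ~= 0 --> x \<in> Omega & R x \<in> Omega"
 shows "energy v phi = 0"
proof -
 note [measurable] = finite_energyD(1)[OF phi]
 have f2: "finite_energy (%x. phi (R x))"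
  by (rule finite_energy_isometry[OF reflect_mpm[OF e, of l] reflect_isometry[OF e, of l] phi])
 have 2: "AEL x. x \<notin> Omega --> phi x = 0" using 1 by eventually_elim auto
 have 3: "AEL x. x \<notin> Omega --> phi (R x) = 0" using mpm_AE[OF reflect_mpm[OF e, of l] 1] by eventually_elim auto
 have "energy v phi = energy u phi - energy (%x. u (R x)) phi"
  unfolding v_def[abs_def] by (rule energy_diff_left[OF ue uRe phi])
 also have "energy u phi = symbol_const * (LBINT x. phi x)"
  by (rule weak_equation[OF phi 2])
 also have "energy (%x. u (R x)) phi = energy u (%x. phi (R x))"
  using energy_isometry[OF reflect_mpm[OF e, of l] reflect_isometry[OF e, of l], of u "%x. phi (R x)"] by simp
 also have "... = symbol_const * (LBINT x. phi (R x))"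
  by (rule weak_equation[OF f2 3])
 also have "(LBINT x. phi (R x)) = (LBINT x. phi x)"
  by (rule mpm_integral[OF reflect_mpm[OF e, of l]]) measurable
 finally show ?thesis by simp
qed

text \<open>Where \<open>v\<close> is negative below the line, \<open>u (R x)\<close> is positive,
  so \<open>R x\<close> lies in the part of \<open>Omega\<close> beyond the line and
  \<open>x\<close> lies in \<open>Omega\<close> as well: there the energy of \<open>v\<close>
  vanishes and the maximum principle applies.\<close>

lemma v_nonneg: "AEL x. x .* e < l --> 0 <= v x"
proof -
 have fe: "finite_energy (lower_half v)" by (rule lower_half_finite_energy[OF ve v_R])
 have "AEL x. lower_half v x = 0"
 proof (rule antisymmetric_lower_half_zero[OF vm v_R energy_density_integrable[OF ve fe]])
  have "AEL x. lower_half v x ~= 0 --> x \<in> Omega & R x \<in> Omega"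
   using u_nonneg mpm_AE[OF reflect_mpm[OF e, of l] u_nonneg]
  proof eventually_elim
   case (elim x)
   show ?case
   proof
    assume nz: "lower_half v x ~= 0"
    hence x: "x .* e < l" "u x < u (R x)" by (auto simp: lower_half_def v_def split: if_splits)
    hence "R x \<in> Omega" using off[of "R x"] elim by fastforce
    moreover have "R (R x) \<in> Omega" by (rule cap[OF \<open>R x \<in> Omega\<close>]) (use x R_Hs[of "R x"] in simp)
    ultimately show "x \<in> Omega & R x \<in> Omega" by simp
   qed
  qed
  from energy_v[OF fe this] show "0 <= energy v (lower_half v)" by simp
 qed
 thus ?thesis by eventually_elim (auto simp: lower_half_def split: if_splits)
qed

end

section \<open>Long-range comparison with a barrier\<close>

context reflection
begin

text \<open>With d <= D the two distances, D^3 - d^3 is at least (D^2 - d^2) D, and D^2 - d^2 is the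
  product supplied by \<open>dist_reflect\<close>; the remaining denominator d^3 D^2 is at most the
  fifth power of the bound.\<close>

lemma kern_reflect_gap:
 assumes x: "x .* e <= l" and y: "y .* e <= l" and ne: "x ~= y" and D: "norm (y - R x) <= D"
 shows "4 * (l - x .* e) * (l - y .* e) / D ^ 5 <= kern (y - x) - kern (y - R x)"
proof -
 let ?d = "norm (y - x)" and ?D = "norm (y - R x)"
 have eq: "?D^2 = ?d^2 + 4 * (l - x .* e) * (l - y .* e)"
  using dist_reflect[OF e, of y l x] by (simp add: algebra_simps)
 have d: "0 < ?d" using ne by simp
 have g: "0 <= 4 * (l - x .* e) * (l - y .* e)" using x y by simp
 have "?d <= ?D" by (rule power2_le_imp_le) (use eq g in auto)
 have D0: "0 < ?D" "0 < D" using d \<open>?d <= ?D\<close> D by linarith+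
 have "4 * (l - x .* e) * (l - y .* e) / D ^ 5 <= 4 * (l - x .* e) * (l - y .* e) / (?d ^ 3 * ?D ^ 2)"
 proof (intro divide_left_mono g mult_pos_pos zero_less_power D0 d)
  have "?d ^ 3 * ?D ^ 2 <= D ^ 3 * D ^ 2" by (intro mult_mono power_mono) (use D \<open>?d <= ?D\<close> D0 in auto)
  thus "?d ^ 3 * ?D^2 <= D ^ 5" by (simp add: power_add[symmetric])
 qed
 also have "4 * (l - x .* e) * (l - y .* e) / (?d ^ 3 * ?D ^ 2) = (?D^2 - ?d^2) / (?d ^ 3 * ?D ^ 2)" using eq by simp
 also have "(?D^2 - ?d^2) / (?d ^ 3 * ?D ^ 2) = (?D^2 - ?d^2) * ?D / (?d ^ 3 * ?D ^ 3)"
  using D0(1) by (simp add: power2_eq_square power3_eq_cube)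
 also have "... <= (?D ^ 3 - ?d ^ 3) / (?d ^ 3 * ?D ^ 3)"
 proof (intro divide_right_mono)
  have "?d^2 * ?d <= ?d^2 * ?D" by (rule mult_left_mono) (use \<open>?d <= ?D\<close> in auto)
  thus "(?D^2 - ?d^2) * ?D <= ?D ^ 3 - ?d ^ 3" by (simp add: power2_eq_square power3_eq_cube algebra_simps)
 qed simp
 also have "... = kern (y - x) - kern (y - R x)" using D0 d by (simp add: kern_def field_simps)
 finally show ?thesis .
qed

end

context torsion_reflection
begin

text \<open>The negative part \<open>phi\<close> of \<open>v - b\<close> is tested against
  \<open>v - b - delta * w\<close>, where \<open>w\<close> is the antisymmetric indicator of
  \<open>K\<close>. Subtracting \<open>delta * w\<close> leaves the negative part unchanged but adds
  the interaction with \<open>K\<close>, a gain proportional to the integral of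
  \<open>phi x * (l - x .* e)\<close>. The bound on \<open>Cb\<close> says that the gain pays for
  the half-Laplacian of the barrier.\<close>

lemma comparison:
 assumes b: "finite_energy b" "!!x. b (R x) = - b x"
  and B: "bounded B" "!!x. x .* e < l ==> 0 < b x ==> x \<in> B" "!!x. x \<in> B ==> x .* e < l ==> x \<in> Omega & R x \<in> Omega"
  and K: "K \<in> sets borel" "bounded K" "0 < a0" "0 <= delta" "!!x. x \<in> K ==> a0 <= l - x .* e & delta <= v x & b x = 0"
  and sep: "0 < kappa" "!!x y. x \<in> K ==> y \<in> B ==> y .* e < l ==> kappa <= norm (y - x) & norm (y - R x) <= D"
  and barrier: "!!phi. finite_energy phi ==> (!!x. 0 <= phi x) ==> AEL x. phi x ~= 0 --> x \<in> B & x .* e < l & phi x <= b x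
   ==> energy b phi <= Cb * (LBINT x. phi x * (l - x .* e))"
  and Cb: "Cb <= 8 * delta * a0 * measure lborel K / D ^ 5"
 shows "AEL x. x .* e < l --> b x <= v x"
proof -
 note [measurable] = finite_energyD(1)[OF b(1)] K(1)
 define z0 where "z0 x = v x - b x" for x
 have z0e: "finite_energy z0" unfolding z0_def[abs_def] by (rule finite_energy_diff[OF ve b(1)])
 have z0R: "z0 (R x) = - z0 x" for x by (simp add: z0_def v_R b(2))
 define phi where "phi = lower_half z0"
 have phie: "finite_energy phi" unfolding phi_def by (rule lower_half_finite_energy[OF z0e z0R])
 note [measurable] = finite_energyD(1)[OF phie]
 have phi0: "0 <= phi x" for x by (simp add: phi_def lower_half_def)
 have phiup: "phi x = 0" if "~ x .* e < l" for x using that by (simp add: phi_def lower_half_def)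
 have KHs: "x .* e < l" if "x \<in> K" for x using K(3) K(5)[OF that] by simp
 have phiK: "phi x = 0" if "x \<in> K" for x using K(4) K(5)[OF that] by (auto simp: phi_def lower_half_def z0_def)
 have supp: "AEL x. phi x ~= 0 --> x \<in> B & x .* e < l & phi x <= b x" using v_nonneg
 proof eventually_elim
  case (elim x)
  show ?case
  proof
   assume "phi x ~= 0"
   hence x: "x .* e < l" "v x < b x" "phi x = b x - v x" by (auto simp: phi_def lower_half_def z0_def split: if_splits)
   thus "x \<in> B & x .* e < l & phi x <= b x" using elim B(2)[of x] by auto
  qed
 qed
 obtain r where r: "!!x. x \<in> B ==> norm x <= r" "0 <= r" using B(1) unfolding bounded_iff by (metis norm_ge_zero order_trans linear)
 have iphi: "lint phi"
 proof (rule lint_bound)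
  show "lint (%x. indicator (cball 0 r) x + (phi x)^2)"
   by (intro lint_add integrable_indicator_bounded finite_energyD(2)[OF phie]) auto
  show "AEL x. norm (phi x) <= norm (indicator (cball 0 r) x + (phi x)^2)" using supp
  proof eventually_elim
   case (elim x)
   have "abs (phi x) <= 1 + (phi x)^2" using zero_le_power2[of "abs (phi x) - 1"] by (simp add: power2_diff)
   thus ?case using elim r(1) by (cases "phi x = 0") (auto simp: indicator_def)
  qed
 qed measurable
 have iphil: "lint (%x. phi x * (l - x .* e))"
 proof (rule lint_bound[OF integrable_mult_left[OF iphi, of "abs l + r"]])
  show "AEL x. norm (phi x * (l - x .* e)) <= norm (phi x * (abs l + r))" using supp
  proof eventually_elim
   case (elim x)
   have "phi x ~= 0 ==> abs (l - x .* e) <= abs l + r"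
    using elim r Cauchy_Schwarz_ineq2[of x e] e by fastforce
   thus ?case using r(2) by (cases "phi x = 0") (auto simp: abs_mult intro!: mult_left_mono)
  qed
 qed measurable
 define E where "E p = indicator K (fst p) * kern (snd p - fst p) * phi (snd p)" for p :: "(real^2) \<times> (real^2)"
 define E' where "E' p = indicator K (fst p) * kern (snd p - R (fst p)) * phi (snd p)" for p :: "(real^2) \<times> (real^2)"
 have [measurable]: "borelf E" "borelf E'" unfolding E_def[abs_def] E'_def[abs_def] by measurable
 have iP: "lint (%p. indicator K (fst p) * phi (snd p))"
  by (intro integrable_mult_prod integrable_indicator_bounded K iphi)
 have kb: "kern h <= 1 / kappa ^ 3" if "kappa <= norm h" for h
  unfolding kern_def using sep(1) that by (intro divide_left_mono power_mono mult_pos_pos zero_less_power) auto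
 have sup2: "AE p :: (real^2) \<times> (real^2) in lborel. phi (snd p) ~= 0 --> snd p \<in> B & snd p .* e < l"
  using AE_pair_lborel[OF supp] by (rule eventually_mono) simp
 have far: "kappa <= norm (y - R x)" if "x \<in> K" "y \<in> B" "y .* e < l" for x y
 proof -
  have "(norm (y - x))^2 <= (norm (y - R x))^2" unfolding dist_reflect[OF e] using KHs[OF that(1)] that(3) by simp
  thus ?thesis using sep(2)[OF that] power2_le_imp_le[of "norm (y - x)" "norm (y - R x)"] by simp
 qed
 have iE: "lint E"
 proof (rule lint_bound[OF integrable_mult_left[OF iP, of "1 / kappa ^ 3"]])
  show "AEL p. norm (E p) <= norm (indicator K (fst p) * phi (snd p) * (1 / kappa ^ 3))" using sup2
  proof eventually_elim
   case (elim p)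
   thus ?case using sep(1) kb[of "snd p - fst p"] sep(2)[of "fst p" "snd p"] phi0[of "snd p"]
    by (cases "fst p \<in> K"; cases "phi (snd p) = 0") (auto simp: E_def abs_mult mult.commute[of "kern _"] divide_inverse intro!: mult_left_mono)
  qed
 qed measurable
 have iE': "lint E'"
 proof (rule lint_bound[OF integrable_mult_left[OF iP, of "1 / kappa ^ 3"]])
  show "AEL p. norm (E' p) <= norm (indicator K (fst p) * phi (snd p) * (1 / kappa ^ 3))" using sup2
  proof eventually_elim
   case (elim p)
   thus ?case using sep(1) kb[of "snd p - R (fst p)"] far[of "fst p" "snd p"] phi0[of "snd p"]
    by (cases "fst p \<in> K"; cases "phi (snd p) = 0") (auto simp: E'_def abs_mult mult.commute[of "kern _"] divide_inverse intro!: mult_left_mono)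
  qed
 qed measurable
 \<comment> \<open>The kernel gap is integrated over first points in \<open>K\<close>, whose
   distance to the line is at least \<open>a0\<close>.\<close>
 have "4 * a0 / D ^ 5 * measure lborel K * (LBINT x. phi x * (l - x .* e))
   = (LBINT p. 4 * a0 / D ^ 5 * (indicator K (fst p) * (phi (snd p) * (l - snd p .* e))))"
  using K(1,2) by (subst integral_fst_lborel) (auto intro!: integrable_mult_right integrable_mult_prod integrable_indicator_bounded iphil)
 also have "... <= (LBINT p. E p - E' p)"
 proof (rule integral_mono_AE)
  show "AEL p. 4 * a0 / D ^ 5 * (indicator K (fst p) * (phi (snd p) * (l - snd p .* e))) <= E p - E' p" using sup2
  proof eventually_elim
   case (elim p)
   obtain x y where p: "p = (x, y)" by (cases p)
   show ?case
   proof (cases "x \<in> K & phi y ~= 0")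
    case True
    hence y: "y \<in> B" "y .* e < l" "x \<in> K" using elim p by auto
    note s = sep(2)[OF y(3) y(1,2)]
    have "4 * a0 * (l - y .* e) / D ^ 5 <= 4 * (l - x .* e) * (l - y .* e) / D ^ 5"
     using s K(5)[OF y(3)] y(2) by (intro divide_right_mono mult_right_mono mult_left_mono zero_le_power order_trans[OF norm_ge_zero, of "y - R x" D]) auto
    also have "... <= kern (y - x) - kern (y - R x)"
     by (rule kern_reflect_gap) (use s sep(1) KHs[OF y(3)] y(2) in auto)
    finally have "4 * a0 * (l - y .* e) / D ^ 5 * phi y <= (kern (y - x) - kern (y - R x)) * phi y"
     by (rule mult_right_mono) (rule phi0)
    thus ?thesis using y(3) unfolding p E_def E'_def by (simp add: algebra_simps)
   qed (auto simp: p E_def E'_def)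
  qed
 qed (auto intro!: iE iE' integrable_mult_right integrable_mult_prod integrable_indicator_bounded iphil K)
 finally have main: "4 * a0 / D ^ 5 * measure lborel K * (LBINT x. phi x * (l - x .* e)) <= (LBINT p. E p) - (LBINT p. E' p)"
  using iE iE' by simp
 \<comment> \<open>The energy of \<open>w\<close> itself may be infinite. Its density with
   \<open>phi\<close> is integrable all the same, because \<open>K\<close> and its mirror image keep
   distance \<open>kappa\<close> from the support of \<open>phi\<close>; so it is computed directly
   from \<open>E\<close> and \<open>E'\<close>.\<close>
 define w where "w x = (indicator K x - indicator K (R x) :: real)" for x
 have id: "mpm (%x::real^2. x)" using mpm_translation'[of 0] by simp
 note mR = mpm_map_prod[OF reflect_mpm[OF e, of l] id]
 define F where "F p = E p - E' (R (fst p), snd p)" for p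
 have F: "lint F" "(LBINT p. F p) = (LBINT p. E p) - (LBINT p. E' p)"
  unfolding F_def[abs_def] using iE mpm_integrable[OF mR iE'] mpm_integral[OF mR, of E'] by auto
 have [measurable]: "borelf F" using F(1) by simp
 have wdens: "edens w phi p = - (F p + F (snd p, fst p))" for p
 proof -
  obtain x y where p: "p = (x, y)" by (cases p)
  have wphi: "w x * phi x = 0" for x
   using phiK[of x] phiup[of x] KHs[of "R x"] R_Hs[of x] by (auto simp: w_def indicator_def)
  have Fw: "F (x, y) = w x * kern (y - x) * phi y" for x y by (simp add: F_def E_def E'_def w_def algebra_simps)
  have "(w y - w x) * (phi y - phi x) = w y * phi y + w x * phi x - w y * phi x - w x * phi y" by (simp add: algebra_simps)
  thus ?thesis unfolding p edens_def wphi by (simp add: Fw kern_commute[of x y] algebra_simps)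
 qed
 have iw: "lint (edens w phi)"
  unfolding wdens[abs_def] using F(1) mpm_integrable[OF mpm_swap F(1)] by simp
 have ew: "energy w phi = - 2 * ((LBINT p. E p) - (LBINT p. E' p))"
  unfolding energy_def wdens[abs_def] F(2)[symmetric] using F(1) mpm_integrable[OF mpm_swap F(1)] mpm_integral[OF mpm_swap, of F] by simp
 define z where "z x = z0 x - delta * w x" for x
 have [measurable]: "borelf w" "borelf z0" using finite_energyD(1)[OF z0e] unfolding w_def[abs_def] by measurable
 have zm: "borelf z" unfolding z_def[abs_def] by measurable
 have zR: "z (R x) = - z x" for x by (simp add: z_def z0R w_def algebra_simps)
 \<comment> \<open>On \<open>K\<close> the barrier vanishes and \<open>v >= delta\<close>, so
   \<open>z\<close> is still nonnegative there; elsewhere below the line \<open>w\<close> is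
   0.\<close>
 have low: "lower_half z = phi"
 proof
  fix x show "lower_half z x = phi x"
  proof (cases "x \<in> K")
   case True
   hence "0 <= z x" using K(5)[OF True] R_Hs[of x] KHs[of x] KHs[of "R x"] by (auto simp: z_def z0_def w_def indicator_def)
   thus ?thesis using phiK[OF True] by (simp add: lower_half_def)
  next
   case False
   thus ?thesis using KHs[of "R x"] R_Hs[of x] by (auto simp: phi_def lower_half_def z_def w_def indicator_def)
  qed
 qed
 have zdens: "edens z phi p = edens z0 phi p - delta * edens w phi p" for p
  by (simp add: edens_def z_def algebra_simps)
 have iz: "lint (edens z phi)"
  unfolding zdens[abs_def] by (intro Bochner_Integration.integrable_diff integrable_mult_right energy_density_integrable z0e phie iw)
 have "energy z phi = energy z0 phi - delta * energy w phi"
  unfolding energy_def zdens[abs_def] using energy_density_integrable[OF z0e phie] iw by simp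
 also have "energy z0 phi = energy v phi - energy b phi" unfolding z0_def[abs_def] by (rule energy_diff_left[OF ve b(1) phie])
 also have "energy v phi = 0" by (rule energy_v[OF phie]) (use supp B(3) in "auto elim!: eventually_mono")
 finally have ez: "energy z phi = 2 * delta * ((LBINT p. E p) - (LBINT p. E' p)) - energy b phi" by (simp add: ew algebra_simps)
 have I0: "0 <= (LBINT x. phi x * (l - x .* e))"
  by (rule Bochner_Integration.integral_nonneg) (use phi0 phiup in "metis diff_ge_0_iff_ge less_imp_le mult_nonneg_nonneg mult_zero_left order_refl")
 have "energy b phi <= Cb * (LBINT x. phi x * (l - x .* e))" by (rule barrier[OF phie phi0 supp])
 also have "... <= (8 * delta * a0 * measure lborel K / D ^ 5) * (LBINT x. phi x * (l - x .* e))" by (rule mult_right_mono[OF Cb I0])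
 also have "... = 2 * delta * (4 * a0 / D ^ 5 * measure lborel K * (LBINT x. phi x * (l - x .* e)))" by simp
 also have "... <= 2 * delta * ((LBINT p. E p) - (LBINT p. E' p))" by (intro mult_left_mono main) (use K(4) in simp)
 finally have "0 <= energy z phi" unfolding ez by simp
 hence "AEL x. phi x = 0"
  using antisymmetric_lower_half_zero[where z = z, OF zm zR] iz unfolding low by simp
 thus ?thesis by eventually_elim (auto simp: phi_def lower_half_def z0_def split: if_splits)
qed

end

section \<open>The half-Laplacian of a dome\<close>

definition half_circle :: "real => real => real" where
 "half_circle a tau = sqrt (max 0 (a^2 - tau^2))"

lemma half_circle_continuous: "continuous_on UNIV (half_circle a)"
 unfolding half_circle_def by (intro continuous_intros)

lemma half_circle_measurable [measurable]: "borelf (half_circle a)"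
 by (rule borel_measurable_continuous_onI[OF half_circle_continuous])

lemma half_circle_square: "abs tau <= a ==> (half_circle a tau)^2 = a^2 - tau^2"
 using abs_le_square_iff[of tau a] by (simp add: half_circle_def max_def)

lemma half_circle_zero: "0 <= a ==> a <= abs tau ==> half_circle a tau = 0"
 using abs_le_square_iff[of a tau] by (simp add: half_circle_def max_def)

lemma half_circle_pos: "abs tau < a ==> 0 < half_circle a tau"
 using power_strict_mono[of "abs tau" a 2] by (simp add: half_circle_def)

lemma half_circle_deriv:
 assumes "abs tau < a"
 shows "(half_circle a has_real_derivative - tau / half_circle a tau) (at tau)"
proof -
 have p: "0 < a^2 - tau^2" using half_circle_pos[OF assms] half_circle_square[of tau a] assms by (metis less_imp_le zero_less_power)
 have "((%x. sqrt (a^2 - x^2)) has_real_derivative - tau / sqrt (a^2 - tau^2)) (at tau)"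
  using p by (auto intro!: derivative_eq_intros simp: field_simps)
 moreover have "eventually (%x. sqrt (a^2 - x^2) = half_circle a x) (nhds tau)"
 proof -
  have "eventually (%x. x \<in> {-a<..<a}) (nhds tau)" using assms by (intro eventually_nhds_in_open) auto
  thus ?thesis by eventually_elim (use half_circle_square half_circle_def in "smt (verit) abs_square_le_1 greaterThanLessThan_iff half_circle_pos half_circle_square real_sqrt_unique")
 qed
 moreover have "half_circle a tau = sqrt (a^2 - tau^2)" using p by (simp add: half_circle_def)
 ultimately show ?thesis by (subst DERIV_cong_ev[OF refl _ refl, symmetric]) (auto elim: eventually_mono)
qed

lemma integral_inverse_square_outside:
 assumes eps: "0 < (eps::real)"
 shows "lint (%t. indicator {t. eps <= abs t} t / t^2)" "(LBINT t. indicator {t. eps <= abs t} t / t^2) = 2 / eps"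
proof -
 let ?h = "%t::real. indicator {eps..} t / t^2"
 have "(NNINT t. ennreal (1 / t^2) * indicator {eps..} t) = ennreal (0 - (- 1 / eps))"
 proof (rule nn_integral_FTC_atLeast)
  show "!!x. eps <= x ==> DERIV (%x. - 1 / x) x :> 1 / x^2"
   using eps by (auto intro!: derivative_eq_intros simp: power2_eq_square)
  show "((%x::real. - 1 / x) ---> 0) at_top" by real_asymp
 qed (use eps in auto)
 hence "(NNINT t. ennreal (?h t)) = ennreal (1 / eps)" by (simp add: indicator_mult_ennreal mult.commute divide_inverse)
 hence h: "has_bochner_integral lborel ?h (1 / eps)"
  using eps by (intro has_bochner_integral_nn_integral) auto
 hence h': "has_bochner_integral lborel (%t. ?h (- t)) (1 / eps)"
  using lborel_has_bochner_integral_real_affine_iff[of "-1" ?h "1 / eps" 0] by simp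
 have eq: "?h t + ?h (- t) = indicator {t. eps <= abs t} t / t^2" for t using eps by (auto simp: indicator_def)
 have "has_bochner_integral lborel (%t. indicator {t. eps <= abs t} t / t^2) (1 / eps + 1 / eps)"
  using has_bochner_integral_add[OF h h'] unfolding eq .
 thus "lint (%t. indicator {t. eps <= abs t} t / t^2)" "(LBINT t. indicator {t. eps <= abs t} t / t^2) = 2 / eps"
  by (auto simp: has_bochner_integral_iff)
qed

text \<open>The one-dimensional half-Laplacian of a half circle with affine weight, by an explicit
  primitive \<open>G\<close> of \<open>f tau / (tau - s)^2\<close>. After truncation at
  \<open>eps\<close> the values of \<open>G\<close> on both sides of \<open>s\<close> cancel the
  singular term \<open>2 * f s / eps\<close> in the limit, and only the end values
  \<open>G a - G (- a)\<close> survive.\<close>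

lemma half_circle_second_difference_integral:
 fixes a s A B :: real
 defines "f \<equiv> %tau. (A + B * tau) * half_circle a tau"
 assumes s: "abs s < a" and int: "lint (%t. diff2 f s t / t^2)"
 shows "(LBINT t. diff2 f s t / t^2) = 2 * pi * (A + 2 * B * s)"
proof -
 let ?q = "half_circle a"
 define w where "w = ?q s"
 \<comment> \<open>Classical primitive: the derivative of \<open>L\<close> is
   \<open>w / ((tau - s) * half_circle a tau)\<close>. The function \<open>n\<close> stays positive
   on the whole chord.\<close>
 define n where "n tau = a^2 - s * tau + w * ?q tau" for tau
 define L where "L tau = ln ((tau - s)^2) / 2 - ln (n tau)" for tau
 \<comment> \<open>The weight is split as \<open>(A + B * s) + B * (tau - s)\<close>, so
   \<open>G\<close> combines primitives of the half circle divided by \<open>(tau - s)^2\<close> and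
   by \<open>tau - s\<close>.\<close>
 define G where "G tau = - (A + B * s) * (?q tau / (tau - s) + arcsin (tau / a) + (s / w) * L tau) + B * (w * L tau + ?q tau - s * arcsin (tau / a))" for tau
 have a: "0 < a" using s by linarith
 have w: "0 < w" "w^2 = a^2 - s^2" unfolding w_def using half_circle_pos[OF s] half_circle_square[of s a] s by auto
 have q0: "0 <= ?q tau" for tau by (simp add: half_circle_def)
 have n0: "0 < n tau" if "abs tau <= a" for tau
 proof -
  have "abs s * abs tau <= abs s * a" using that by (intro mult_left_mono) auto
  also have "... < a * a" using s a by simp
  finally have "s * tau < a^2" using abs_ge_self[of "s * tau"] unfolding abs_mult power2_eq_square by linarith
  thus ?thesis unfolding n_def using mult_nonneg_nonneg[of w "?q tau"] w q0[of tau] by linarith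
 qed
 have cn: "continuous_on S n" for S unfolding n_def[abs_def] by (intro continuous_intros continuous_on_subset[OF half_circle_continuous]) auto
 have dL: "(L has_real_derivative w / ((tau - s) * ?q tau)) (at tau)" if tau: "abs tau < a" "tau ~= s" for tau
 proof -
  let ?Q = "?q tau"
  have Q: "0 < ?Q" "?Q * ?Q = a^2 - tau^2" using half_circle_pos[OF tau(1)] half_circle_square[of tau a] tau by (auto simp: power2_eq_square)
  have np: "0 < n tau" using n0 tau by simp
  have dn: "(n has_real_derivative - s + w * (- tau / ?Q)) (at tau)"
   unfolding n_def[abs_def] by (auto intro!: derivative_eq_intros half_circle_deriv[OF tau(1)])
  have dl: "((%tau. ln ((tau - s)^2)) has_real_derivative (2 * (tau - s)) / (tau - s)^2) (at tau)"
   using tau(2) by (auto intro!: derivative_eq_intros)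
  have "(L has_real_derivative (2 * (tau - s)) / (tau - s)^2 / 2 - (- s + w * (- tau / ?Q)) / n tau) (at tau)"
   unfolding L_def[abs_def] using np
   by (intro DERIV_diff DERIV_cdivide dl) (use DERIV_chain2[OF DERIV_ln_divide[OF np] dn] in simp)
  moreover have "(2 * (tau - s)) / (tau - s)^2 / 2 - (- s + w * (- tau / ?Q)) / n tau = w / ((tau - s) * ?Q)"
  proof -
   have 1: "(2 * (tau - s)) / (tau - s)^2 / 2 = 1 / (tau - s)" proof -
    have "(2 * x) / x^2 / 2 = 1 / x" for x :: real by (simp add: power2_eq_square)
    thus ?thesis .
   qed
   have 2: "(- s + w * (- tau / ?Q)) = - (s * ?Q + w * tau) / ?Q" using Q by (simp add: field_simps)
   have "(s * ?Q + w * tau) * (tau - s) + ?Q * n tau = w * n tau"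
   proof -
    have "(s * ?Q + w * tau) * (tau - s) + ?Q * n tau - w * n tau = w * (tau^2 + ?Q * ?Q - a^2) - ?Q * (w^2 - (a^2 - s^2))"
     unfolding n_def by (simp add: algebra_simps power2_eq_square)
    thus ?thesis unfolding Q(2) w(2) by simp
   qed
   thus ?thesis unfolding 1 2 using Q np tau(2) by (simp add: field_simps)
  qed
  ultimately show ?thesis by simp
 qed
 have dG: "(G has_real_derivative f tau / (tau - s)^2) (at tau)" if tau: "abs tau < a" "tau ~= s" for tau
 proof -
  let ?Q = "?q tau" and ?d = "tau - s"
  have Q: "0 < ?Q" "?Q * ?Q = a^2 - tau^2" using half_circle_pos[OF tau(1)] half_circle_square[of tau a] tau by (auto simp: power2_eq_square)
  have asin: "((%tau. arcsin (tau / a)) has_real_derivative 1 / ?Q) (at tau)"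
  proof -
   have "sqrt (1 - (tau / a)^2) = ?Q / a"
    using Q a by (intro real_sqrt_unique) (auto simp: power_divide field_simps power2_eq_square)
   moreover have "- 1 < tau / a" "tau / a < 1" using tau(1) a by (auto simp: less_divide_eq)
   hence "((%tau. arcsin (tau / a)) has_real_derivative inverse (sqrt (1 - (tau / a)^2)) * (1 / a)) (at tau)"
    by (intro DERIV_chain2[OF DERIV_arcsin] DERIV_cdivide DERIV_ident)
   ultimately show ?thesis using a by (simp add: inverse_eq_divide)
  qed
  define d where "d = ?d"
  have d: "d ~= 0" "tau = d + s" using tau(2) by (auto simp: d_def)
  have qd: "((%tau. ?q tau / (tau - s)) has_real_derivative ((- tau / ?Q) * d - ?Q * (1 - 0)) / (d * d)) (at tau)"
   unfolding d_def by (intro DERIV_divide DERIV_diff DERIV_ident DERIV_const half_circle_deriv[OF tau(1)]) (use tau(2) in simp)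
  have "(G has_real_derivative - (A + B * s) * (((- tau / ?Q) * d - ?Q * (1 - 0)) / (d * d) + 1 / ?Q + (s / w) * (w / (d * ?Q)))
    + B * (w * (w / (d * ?Q)) + - tau / ?Q - s * (1 / ?Q))) (at tau)"
   unfolding G_def[abs_def] 
   by (intro DERIV_add DERIV_diff DERIV_cmult half_circle_deriv[OF tau(1)] dL[OF tau, folded d_def] asin qd)
  moreover have "((- tau / ?Q) * d - ?Q * (1 - 0)) / (d * d) + 1 / ?Q + (s / w) * (w / (d * ?Q)) = - ?Q / d^2"
  proof -
   have "((- tau / ?Q) * d - ?Q * (1 - 0)) / (d * d) = - tau / (?Q * d) - ?Q / d^2"
    using d(1) by (simp add: diff_divide_distrib power2_eq_square)
   moreover have "1 / ?Q + (s / w) * (w / (d * ?Q)) = (d + s) / (?Q * d)" using Q(1) w(1) d(1) by (simp add: add_divide_distrib mult.commute)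
   ultimately show ?thesis unfolding d(2)[symmetric] by simp
  qed
  moreover have "w * (w / (d * ?Q)) + - tau / ?Q - s * (1 / ?Q) = ?Q / d"
  proof -
   have "w * (w / (d * ?Q)) + - tau / ?Q - s * (1 / ?Q) = (w^2 - tau * d - s * d) / (d * ?Q)"
    using Q(1) d(1) by (simp add: diff_divide_distrib power2_eq_square)
   also have "w^2 - tau * d - s * d = ?Q * ?Q" unfolding Q(2) w(2) d_def by (simp add: algebra_simps power2_eq_square)
   finally show ?thesis using Q(1) by simp
  qed
  moreover have "- (A + B * s) * (- ?Q / d^2) + B * (?Q / d) = f tau / d^2"
  proof -
   have "B * (?Q / d) = (B * d) * ?Q / d^2" using d(1) by (simp add: power2_eq_square)
   thus ?thesis unfolding f_def d_def by (simp add: add_divide_distrib[symmetric] algebra_simps)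
  qed
  ultimately show ?thesis by (simp add: d_def)
 qed
 have cG: "continuous_on {c..d} G" if "- a <= c" "d <= a" "s \<notin> {c..d}" for c d
 proof -
  have 1: "x ~= s" if "x \<in> {c..d}" for x using that \<open>s \<notin> {c..d}\<close> by auto
  have 2: "n x ~= 0" if "x \<in> {c..d}" for x using that \<open>- a <= c\<close> \<open>d <= a\<close> n0[of x] by (auto simp: abs_le_iff)
  have 3: "- 1 <= x / a & x / a <= 1" if "x \<in> {c..d}" for x using that \<open>- a <= c\<close> \<open>d <= a\<close> a by (auto simp: le_divide_eq divide_le_eq)
  have q: "continuous_on {c..d} ?q" by (rule continuous_on_subset[OF half_circle_continuous]) simp
  have l: "continuous_on {c..d} L" unfolding L_def[abs_def]
   by (intro continuous_on_diff continuous_on_divide continuous_on_ln continuous_on_power continuous_on_id continuous_on_const cn) (use 1 2 in auto)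
  have r: "continuous_on {c..d} (%tau. arcsin (tau / a))"
   by (intro continuous_on_arcsin continuous_on_divide continuous_on_id continuous_on_const) (use a 3 in auto)
  show ?thesis unfolding G_def[abs_def]
   by (intro continuous_on_add continuous_on_diff continuous_on_mult continuous_on_divide continuous_on_id continuous_on_const q l r) (use 1 in auto)
 qed
 have piece: "set_integrable lborel {c..d} (%tau. f tau / (tau - s)^2)" "(\<integral>tau\<in>{c..d}. f tau / (tau - s)^2 \<partial>lborel) = G d - G c"
  if cd: "- a <= c" "c <= d" "d <= a" "s \<notin> {c..d}" for c d
 proof -
  have c: "continuous_on {c..d} (%tau. f tau / (tau - s)^2)"
   unfolding f_def by (intro continuous_intros continuous_on_subset[OF half_circle_continuous]) (use cd in auto)
  show i: "set_integrable lborel {c..d} (%tau. f tau / (tau - s)^2)" by (rule borel_integrable_atLeastAtMost'[OF c])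
  have "((%tau. f tau / (tau - s)^2) has_integral (G d - G c)) {c..d}"
  proof (rule fundamental_theorem_of_calculus_interior)
   show "(G has_vector_derivative f x / (x - s)^2) (at x)" if "x \<in> {c<..<d}" for x
    using dG[of x] that cd by (auto simp: has_real_derivative_iff_has_vector_derivative)
  qed (use cd cG in auto)
  thus "(\<integral>tau\<in>{c..d}. f tau / (tau - s)^2 \<partial>lborel) = G d - G c"
   using set_borel_integral_eq_integral(2)[OF i] by (simp add: integral_unique)
 qed
 have ends: "G a - G (- a) = - pi * (A + 2 * B * s)"
 proof -
  have "L a - L (- a) = 0"
  proof -
   have "n a = a * (a - s)" "n (- a) = a * (a + s)" using a by (simp_all add: n_def half_circle_zero power2_eq_square algebra_simps)
   moreover have "ln ((a - s)^2) / 2 = ln (a - s)" "ln ((- a - s)^2) / 2 = ln (a + s)"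
    using ln_realpow[of "a - s" 2] ln_realpow[of "a + s" 2] s by (auto simp: power2_commute power2_eq_square algebra_simps)
   moreover have "0 < a - s" "0 < a + s" using s by auto
   ultimately show ?thesis using a by (simp add: L_def ln_mult)
  qed
  hence "L (- a) = L a" by simp
  thus ?thesis using a by (simp add: G_def half_circle_zero algebra_simps)
 qed
 \<comment> \<open>The tails of \<open>2 * f s / t^2\<close> contribute
   \<open>4 * f s / eps\<close>; the two shifted copies of \<open>f\<close> contribute equally,
   whence the factors 2.\<close>
 define I where "I eps = 2 * (2 * f s / eps + G (s + eps) - G (s - eps)) - 2 * (G a - G (- a))" for eps
 have trunc: "(LBINT t. indicator {t. eps <= abs t} t * (diff2 f s t / t^2)) = I eps"
  if eps: "0 < eps" "eps < a - abs s" for eps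
 proof -
  let ?g = "%t. indicator {t. eps <= abs t} t * (f (s + t) / t^2)"
  let ?h = "%tau. indicator {-a..s-eps} tau *. (f tau / (tau - s)^2) + indicator {s+eps..a} tau *. (f tau / (tau - s)^2)"
  have p1: "- a <= s - eps" "s - eps <= a" "s \<notin> {-a..s-eps}" and p2: "- a <= s + eps" "s + eps <= a" "s \<notin> {s+eps..a}" using eps by auto
  have h: "has_bochner_integral lborel ?h ((G (s - eps) - G (- a)) + (G a - G (s + eps)))"
   using piece[OF _ p1] piece[OF p2(1,2) _ p2(3)] a
   by (intro has_bochner_integral_add) (auto simp: has_bochner_integral_iff set_integrable_def set_lebesgue_integral_def)
  have "?h (s + 1 * t) = ?g t" for t
   using half_circle_zero[of a "s + t"] a eps by (auto simp: indicator_def f_def abs_if split: if_splits)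
  hence g: "has_bochner_integral lborel ?g ((G (s - eps) - G (- a)) + (G a - G (s + eps)))"
   using lborel_has_bochner_integral_real_affine_iff[of 1 ?h _ s] h by simp
  hence g': "has_bochner_integral lborel (%t. ?g (- t)) ((G (s - eps) - G (- a)) + (G a - G (s + eps)))"
   using lborel_has_bochner_integral_real_affine_iff[of "-1" ?g _ 0] by simp
  have k: "has_bochner_integral lborel (%t. 2 * f s * (indicator {t. eps <= abs t} t / t^2)) (2 * f s * (2 / eps))"
   using integral_inverse_square_outside[OF eps(1)] by (intro has_bochner_integral_mult_right) (simp add: has_bochner_integral_iff)
  have "2 * f s * (indicator {t. eps <= abs t} t / t^2) - ?g t - ?g (- t) = indicator {t. eps <= abs t} t * (diff2 f s t / t^2)" for t
   by (auto simp: indicator_def diff_divide_distrib)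
  with has_bochner_integral_diff[OF has_bochner_integral_diff[OF k g] g'] show ?thesis
   by (simp add: has_bochner_integral_iff I_def)
 qed
 \<comment> \<open>Differentiability of the half circle at \<open>s\<close> settles the quotients,
   the two logarithms of \<open>eps^2\<close> cancel, and everything else is continuous.\<close>
 have lim0: "((%eps. 2 * f s / eps + G (s + eps) - G (s - eps)) ---> 0) (at_right 0)"
 proof -
  have sh: "((%eps. s + eps) ---> s) (at_right 0)" "((%eps. s - eps) ---> s) (at_right 0)" by (auto intro!: tendsto_eq_intros)
  have Cq: "isCont ?q s" and Cn: "isCont n s" and Ca: "isCont (%tau. arcsin (tau / a)) s"
  proof -
   show "isCont ?q s" using half_circle_continuous[of a] by (simp add: continuous_on_eq_continuous_at)
   show "isCont n s" using cn[of UNIV] by (simp add: continuous_on_eq_continuous_at)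
   show "isCont (%tau. arcsin (tau / a)) s"
    using s a by (intro isCont_o2[where g = arcsin and f = "%tau. tau / a"] isCont_arcsin continuous_intros) (auto simp: less_divide_eq divide_less_eq)
  qed
  note ic = isCont_tendsto_compose
  have ns: "n s ~= 0" using n0[of s] s by simp
  have ln: "((%eps. ln (n (s + eps)) - ln (n (s - eps))) ---> ln (n s) - ln (n s)) (at_right 0)"
   by (intro tendsto_intros ic[OF Cn] sh ns)
  have asn: "((%eps. arcsin ((s + eps) / a) - arcsin ((s - eps) / a)) ---> arcsin (s / a) - arcsin (s / a)) (at_right 0)"
   by (intro tendsto_diff ic[OF Ca] sh)
  have qd: "((%eps. ?q (s + eps) - ?q (s - eps)) ---> w - w) (at_right 0)" unfolding w_def
   by (intro tendsto_diff ic[OF Cq] sh)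
  have D: "((%eps. (?q (s + eps) - ?q s) / eps) ---> - s / w) (at 0)" using half_circle_deriv[OF s] unfolding DERIV_def w_def .
  have D1: "((%eps. (?q (s + eps) - ?q s) / eps) ---> - s / w) (at_right 0)" by (rule tendsto_within_subset[OF D]) simp
  have "((%eps. (?q (s + - eps) - ?q s) / - eps) ---> - s / w) (at_right 0)"
   by (rule filterlim_compose[OF D]) (auto simp: filterlim_at eventually_at_filter intro!: tendsto_eq_intros)
  from tendsto_diff[OF this D1] have "((%eps. (?q (s + - eps) - ?q s) / - eps - (?q (s + eps) - ?q s) / eps) ---> - s / w - - s / w) (at_right 0)" .
  moreover have "(?q (s + - eps) - ?q s) / - eps - (?q (s + eps) - ?q s) / eps = (2 * w - ?q (s + eps) - ?q (s - eps)) / eps" for eps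
   by (cases "eps = 0") (simp_all add: w_def field_simps)
  ultimately
  have qq: "((%eps. (2 * w - ?q (s + eps) - ?q (s - eps)) / eps) ---> - s / w - - s / w) (at_right 0)"
   by (simp only:)
  let ?F = "%x y z v. (A + B * s) * (x - y + (s / w) * z) + B * (- w * z + v - s * y)"
  let ?H = "%eps. ?F ((2 * w - ?q (s + eps) - ?q (s - eps)) / eps) (arcsin ((s + eps) / a) - arcsin ((s - eps) / a)) (ln (n (s + eps)) - ln (n (s - eps))) (?q (s + eps) - ?q (s - eps))"
  let ?J = "?F (- s / w - - s / w) (arcsin (s / a) - arcsin (s / a)) (ln (n s) - ln (n s)) (w - w)"
  have "(?H --->
   ?J) (at_right 0)"
   by (intro tendsto_add tendsto_mult tendsto_diff[OF qq asn] tendsto_diff[OF _ tendsto_mult[OF tendsto_const asn]] tendsto_const ln qd)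
  moreover have "eventually (%eps. ?H eps
   = 2 * f s / eps + G (s + eps) - G (s - eps)) (at_right 0)"
   using eventually_at_right_less[of "0::real"]
  proof eventually_elim
   case (elim eps)
   define x u y u' y' where xy: "x = ?q (s + eps)" "u = arcsin ((s + eps) / a)" "y = ?q (s - eps)" "u' = arcsin ((s - eps) / a)" "y' = s / w"
   have "G (s + eps) = - (A + B * s) * (x / eps + u + y' * (ln (eps^2) / 2 - ln (n (s + eps)))) + B * (w * (ln (eps^2) / 2 - ln (n (s + eps))) + x - s * u)"
    and "G (s - eps) = - (A + B * s) * (- (y / eps) + u' + y' * (ln (eps^2) / 2 - ln (n (s - eps)))) + B * (w * (ln (eps^2) / 2 - ln (n (s - eps))) + y - s * u')"
    by (simp_all add: G_def L_def xy)
   moreover have "(2 * w - x - y) / eps = 2 * w / eps - x / eps - y / eps" by (simp add: diff_divide_distrib)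
   moreover have "2 * f s / eps = (A + B * s) * (2 * w / eps)" by (simp add: f_def w_def)
   ultimately show ?case unfolding xy[symmetric] by algebra
  qed
  ultimately have "((%eps. 2 * f s / eps + G (s + eps) - G (s - eps)) --->
   ?J) (at_right 0)"
   by (rule Lim_transform_eventually)
  thus ?thesis by simp
 qed
 have lim: "(I ---> 2 * pi * (A + 2 * B * s)) (at_right 0)"
 proof -
  have "(I ---> 2 * 0 - 2 * (G a - G (- a))) (at_right 0)"
   unfolding I_def by (intro tendsto_intros lim0)
  thus ?thesis unfolding ends by (simp add: algebra_simps)
 qed
 define eps where "eps i = (a - abs s) / real (Suc (Suc i))" for i
 let ?D = "%t. diff2 f s t / t^2" let ?E = "%i t. indicator {t. eps i <= abs t} t * ?D t"
 have e0: "0 < eps i" "eps i < a - abs s" for i proof -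
  have d: "0 < a - abs s" using s by simp
  thus "0 < eps i" by (simp add: eps_def)
  have "(a - abs s) * 1 < (a - abs s) * real (Suc (Suc i))" using d by (intro mult_strict_left_mono) auto
  thus "eps i < a - abs s" unfolding eps_def by (subst divide_less_eq) simp
 qed
 have el: "eps ----> 0" unfolding eps_def
  by (rule LIMSEQ_Suc[OF LIMSEQ_Suc[OF lim_const_over_n]])
 have "(%i. LBINT t. ?E i t) ----> (LBINT t. ?D t)"
 proof (rule integral_dominated_convergence[OF _ _ integrable_norm[OF int]])
  show "AEL t. (%i. ?E i t) ----> ?D t"
  proof (rule AE_I2, goal_cases)
   case (1 t)
   show ?case
   proof (cases "t = 0")
    case False
    hence "eventually (%i. eps i < abs t) sequentially" using order_tendstoD(2)[OF el, of "abs t"] by simp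
    thus ?thesis by (intro tendsto_eventually) (rule eventually_mono, assumption, simp add: indicator_def)
   qed simp
  qed
  show "(%t. ?D t) \<in> borel_measurable lborel" using int by (rule borel_measurable_integrable)
  thus "(%t. ?E i t) \<in> borel_measurable lborel" for i
   by (intro borel_measurable_times borel_measurable_indicator) auto
  show "AEL t. norm (?E i t) <= norm (?D t)" for i
   by (rule AE_I2) (simp add: indicator_def)
 qed
 moreover have "(%i. I (eps i)) ----> 2 * pi * (A + 2 * B * s)"
  by (rule filterlim_compose[OF lim]) (auto simp: filterlim_at el e0 e0(1)[THEN less_imp_neq, symmetric])
 ultimately show ?thesis using trunc[OF e0] LIMSEQ_unique by simp
qed

text \<open>The signed counterpart of \<open>kern_slope_integral\<close>: the plane is the image of
  the pairs of slope and parameter with density \<open>abs t\<close>, so Fubini also gives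
  integrability along almost every line.\<close>

lemma kern_slope_lebesgue:
 fixes f :: "real^2 => real"
 assumes fm [measurable]: "borelf f" and i: "lint (%h. kern h * f h)"
 shows "AEL sg. lint (%t. f (t *. vec2 1 sg) / t^2)"
  and "(LBINT h. kern h * f h) = (LBINT sg. (1 / slope_norm sg ^ 3) * (LBINT t. f (t *. vec2 1 sg) / t^2))"
proof -
 let ?T = "%p::real \<times> real. snd p *. vec2 1 (fst p)"
 let ?L = "lborel \<Otimes>\<^sub>M lborel :: (real \<times> real) measure"
 let ?M = "density ?L (%p. ennreal (abs (snd p)))"
 have [measurable]: "?T \<in> borel_measurable ?L"
  unfolding lborel_prod vec2_def by (simp, intro borel_measurable_continuous_onI continuous_intros)
 have D: "distr ?M borel ?T = lborel"
 proof (rule measure_eqI)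
  fix A assume "A \<in> sets (distr ?M borel ?T)"
  hence [measurable]: "A \<in> sets borel" by simp
  have "emeasure (distr ?M borel ?T) A = (\<integral>\<^sup>+x. indicator A x \<partial>distr ?M borel ?T)" by (subst nn_integral_indicator) simp_all
  also have "... = (\<integral>\<^sup>+p. ennreal (abs (snd p)) * indicator A (?T p) \<partial>?L)"
   by (subst nn_integral_distr, simp, simp, subst nn_integral_density) simp_all
  also have "... = (NNINT sg. NNINT t. ennreal (abs t) * indicator A (t *. vec2 1 sg))"
   by (subst lborel.nn_integral_fst[symmetric]) simp_all
  also have "... = emeasure lborel A" by (subst nn_integral_slope[symmetric]) simp_all
  finally show "emeasure (distr ?M borel ?T) A = emeasure lborel A" .
 qed simp
 have eq: "abs (snd p) * (kern (?T p) * f (?T p)) = 1 / slope_norm (fst p) ^ 3 * (f (?T p) / (snd p)^2)" for p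
 proof -
  have "abs (snd p) * kern (?T p) = 1 / slope_norm (fst p) ^ 3 * (1 / (snd p)^2)"
   by (cases "snd p = 0") (auto simp: kern_def norm_slope power_mult_distrib power2_eq_square power3_eq_cube abs_mult_self_eq)
  thus ?thesis by (simp only: mult.assoc[symmetric]) simp
 qed
 have [measurable]: "borelf (%h. kern h * f h)" by measurable
 have "integrable (distr ?M borel ?T) (%h. kern h * f h)" unfolding D by (rule i)
 hence "integrable ?M (%p. kern (?T p) * f (?T p))" by (subst (asm) integrable_distr_eq) simp_all
 hence j: "integrable ?L (%p. 1 / slope_norm (fst p) ^ 3 * (f (?T p) / (snd p)^2))"
  by (subst (asm) integrable_density) (simp_all add: eq)
 show "AEL sg. lint (%t. f (t *. vec2 1 sg) / t^2)"
  using lborel_pair.AE_integrable_fst'[OF j]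
 proof eventually_elim
  case (elim sg)
  from integrable_mult_right[OF this, of "slope_norm sg ^ 3"] show ?case using slope_norm_pos[of sg] by simp
 qed
 have "(LBINT h. kern h * f h) = (\<integral>h. kern h * f h \<partial>distr ?M borel ?T)" unfolding D ..
 also have "... = (\<integral>p. kern (?T p) * f (?T p) \<partial>?M)" by (rule integral_distr) simp_all
 also have "... = (\<integral>p. 1 / slope_norm (fst p) ^ 3 * (f (?T p) / (snd p)^2) \<partial>?L)"
  by (subst integral_density) (simp_all add: eq)
 also have "... = (LBINT sg. (1 / slope_norm sg ^ 3) * (LBINT t. f (t *. vec2 1 sg) / t^2))"
  unfolding lborel_pair.integral_fst'[OF j, symmetric] fst_conv snd_conv integral_mult_right_zero ..
 finally show "(LBINT h. kern h * f h) = (LBINT sg. (1 / slope_norm sg ^ 3) * (LBINT t. f (t *. vec2 1 sg) / t^2))" .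
qed

text \<open>The moments that remain when a product of two linear forms in the chord direction is
  averaged over all slopes; the odd one vanishes by symmetry.\<close>

lemma slope_moments:
 "has_bochner_integral lborel (%sg::real. 1 / (1 + sg^2)^2) (pi / 2)"
 "has_bochner_integral lborel (%sg::real. sg / (1 + sg^2)^2) 0"
 "has_bochner_integral lborel (%sg::real. sg^2 / (1 + sg^2)^2) (pi / 2)"
proof -
 have pos: "0 < 1 + x^2" for x :: real by (simp add: add_pos_nonneg)
 let ?F = "%x::real. x / (1 + x^2) / 2 + arctan x / 2"
 have d: "(?F has_real_derivative 1 / (1 + x^2)^2) (at x)" for x
 proof -
  have "((%x. x / (1 + x^2)) has_real_derivative (1 * (1 + x^2) - x * (2 * x)) / ((1 + x^2) * (1 + x^2))) (at x)"
   using pos[of x] by (auto intro!: derivative_eq_intros)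
  hence "(?F has_real_derivative (1 * (1 + x^2) - x * (2 * x)) / ((1 + x^2) * (1 + x^2)) / 2 + inverse (1 + x^2) / 2) (at x)"
   by (intro DERIV_add DERIV_cdivide DERIV_arctan)
  moreover define u where "u = 1 + x^2"
  have "(1 * u - x * (2 * x)) / (u * u) / 2 + inverse u / 2 = 1 / u^2"
  proof -
   have eq: "1 * u - x * (2 * x) = 2 - u" by (simp add: u_def power2_eq_square)
   have "u ~= 0" using pos[of x] by (simp add: u_def)
   thus ?thesis unfolding eq by (simp add: field_simps power2_eq_square)
  qed
  ultimately show ?thesis by (simp add: u_def)
 qed
 have c: "isCont (%x::real. 1 / (1 + x^2)^2) x" for x using pos[of x] by (intro continuous_intros) auto
 have l: "(?F ---> 0 / 2 + (- (pi / 2)) / 2) at_bot" "(?F ---> 0 / 2 + (pi / 2) / 2) at_top"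
  by ((intro tendsto_add tendsto_divide tendsto_const tendsto_arctan_at_bot tendsto_arctan_at_top; (real_asymp | simp))+)
 note m = integral_FTC_UNIV[OF d c _ l]
 show 0: "has_bochner_integral lborel (%sg::real. 1 / (1 + sg^2)^2) (pi / 2)"
  using m by (simp add: has_bochner_integral_iff)
 have "x^2 / (1 + x^2)^2 = 1 / (1 + x^2) - 1 / (1 + x^2)^2" for x :: real
 proof -
  have "1 / (1 + x^2) = (1 + x^2) / (1 + x^2)^2" using pos[of x] by (simp add: power2_eq_square)
  thus ?thesis by (simp add: diff_divide_distrib[symmetric])
 qed
 thus "has_bochner_integral lborel (%sg::real. sg^2 / (1 + sg^2)^2) (pi / 2)"
  using has_bochner_integral_diff[OF _ 0, of "%x. 1 / (1 + x^2)" pi] integral_inverse_1_plus_square by (simp add: has_bochner_integral_iff)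
 let ?g = "%sg::real. sg / (1 + sg^2)^2"
 have g: "lint ?g"
 proof (rule lint_bound[OF integral_inverse_1_plus_square(1)])
  show "AEL x. norm (?g x) <= norm (1 / (1 + x^2))"
  proof (rule AE_I2, goal_cases)
   case (1 x)
   have "abs x <= 1 + x^2" using zero_le_power2[of "abs x - 1"] by (simp add: power2_diff)
   hence "abs x / (1 + x^2)^2 <= (1 + x^2) / (1 + x^2)^2" by (intro divide_right_mono) auto
   also have "... = 1 / (1 + x^2)" using pos[of x] by (simp add: power2_eq_square)
   finally show ?case using pos[of x] by simp
  qed
 qed simp
 have "(LBINT x. ?g x) = (LBINT x. ?g (- x))"
  using lborel_integral_real_affine[of "-1" ?g 0] by simp
 hence "(LBINT x. ?g x) = 0" by simp
 thus "has_bochner_integral lborel (%sg::real. sg / (1 + sg^2)^2) 0" using g by (simp add: has_bochner_integral_iff)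
qed

section \<open>Domes and their second differences\<close>

definition dome :: "real^2 => real => real^2 => real" where
 "dome c r x = sqrt (max 0 (r^2 - (norm (x - c))^2))"

lemma dome_nonneg [simp]: "0 <= dome c r x" by (simp add: dome_def)
lemma dome_continuous: "continuous_on UNIV (dome c r)" unfolding dome_def[abs_def] by (intro continuous_intros)
lemma dome_measurable [measurable]: "borelf (dome c r)"
 by (rule borel_measurable_continuous_onI[OF dome_continuous])
lemma dome_outside: "0 <= r ==> r <= norm (x - c) ==> dome c r x = 0"
 using power_mono[of r "norm (x - c)" 2] by (simp add: dome_def)
lemma dome_square: "norm (x - c) <= r ==> (dome c r x)^2 = r^2 - (norm (x - c))^2"
 using power_mono[of "norm (x - c)" r 2] by (simp add: dome_def)
lemma dome_le: "0 <= r ==> dome c r x <= r"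
 unfolding dome_def by (rule real_le_lsqrt) auto

text \<open>On the line through \<open>x\<close> in direction \<open>d\<close>, \<open>s\<close> is
  the offset of \<open>x\<close> from the midpoint of the chord and \<open>a\<close> its
  half-length, both in units of \<open>norm d\<close>.\<close>

lemma dome_chord:
 fixes x c d beta :: "real^2"
 assumes x: "0 < dome c r x" and d: "0 < norm d"
 defines "s \<equiv> ((x - c) .* d) / (norm d)^2"
 defines "a \<equiv> sqrt ((dome c r x)^2 / (norm d)^2 + s^2)"
 shows "abs s < a" "dome c r (x + t *. d) = norm d * half_circle a (s + t)"
proof -
 have "s^2 < (dome c r x)^2 / (norm d)^2 + s^2" using x d by simp
 hence "sqrt (s^2) < a" unfolding a_def by (rule real_sqrt_less_mono)
 thus "abs s < a" by simp
 have D: "(dome c r x)^2 = r^2 - (norm (x - c))^2" using x by (auto simp: dome_def max_def split: if_splits)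
 have a2: "a^2 = (dome c r x)^2 / (norm d)^2 + s^2" unfolding a_def by simp
 have sd: "s * (norm d)^2 = (x - c) .* d" using d by (simp add: s_def)
 have n: "(norm (x + t *. d - c))^2 = (norm (x - c))^2 + 2 * t * ((x - c) .* d) + t^2 * (norm d)^2"
  unfolding power2_norm_eq_inner by (simp add: inner_simps inner_commute algebra_simps power2_eq_square)
 have "(norm d)^2 * (a^2 - (s + t)^2) = (dome c r x)^2 - (s * (norm d)^2) * (2 * t) - t^2 * (norm d)^2"
  unfolding a2 using d by (simp add: algebra_simps power2_sum)
 also have "... = r^2 - (norm (x + t *. d - c))^2" unfolding sd n D by (simp add: algebra_simps)
 finally have "r^2 - (norm (x + t *. d - c))^2 = (norm d)^2 * (a^2 - (s + t)^2)" by simp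
 hence "dome c r (x + t *. d) = sqrt (max 0 ((norm d)^2 * (a^2 - (s + t)^2)))" by (simp add: dome_def)
 also have "max 0 ((norm d)^2 * (a^2 - (s + t)^2)) = (norm d)^2 * max 0 (a^2 - (s + t)^2)"
  using d by (simp add: max_def zero_le_mult_iff mult_le_0_iff)
 finally show "dome c r (x + t *. d) = norm d * half_circle a (s + t)"
  by (simp add: half_circle_def real_sqrt_mult)
qed

text \<open>Each line through \<open>x\<close> contributes the value for a weighted half circle, and
  the slope moments add these up. The result is again affine in \<open>x\<close>, which is what
  makes affine multiples of domes good barriers.\<close>

lemma dome_half_laplacian:
 fixes x c beta :: "real^2" and alpha r :: real
 defines "f \<equiv> %x. (alpha + x .* beta) * dome c r x"
 assumes x: "0 < dome c r x" and i: "lint (%h. kern h * diff2 f x h)"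
 shows "(LBINT h. kern h * diff2 f x h) = 2 * pi^2 * (alpha + x .* beta + ((x - c) .* beta) / 2)"
proof -
 let ?D = "%h. diff2 f x h" and ?p = "alpha + x .* beta" and ?y = "x - c"
 have [measurable]: "borelf f" unfolding f_def by measurable
 have Dm: "borelf ?D" by measurable
 note k = kern_slope_lebesgue[OF Dm i]
 let ?g = "%sg. 2 * pi * (?p * (1 / (1 + sg^2)) + (?y $ 1 * beta $ 1 * (1 / (1 + sg^2)^2)
   + (?y $ 1 * beta $ 2 + ?y $ 2 * beta $ 1) * (sg / (1 + sg^2)^2) + ?y $ 2 * beta $ 2 * (sg^2 / (1 + sg^2)^2)))"
 have "AEL sg. (1 / slope_norm sg ^ 3) * (LBINT t. ?D (t *. vec2 1 sg) / t^2) = ?g sg"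
  using k(1)
 proof eventually_elim
  case (elim sg)
  let ?d = "vec2 1 sg"
  define n where "n = slope_norm sg"
  have n: "norm ?d = n" "0 < n" "n^2 = 1 + sg^2" by (auto simp: n_def norm_slope slope_norm_square)
  define s where "s = (?y .* ?d) / n^2"
  define a where "a = sqrt ((dome c r x)^2 / n^2 + s^2)"
  have nd: "0 < norm ?d" using n by simp
  note ch = dome_chord[OF x nd, unfolded n(1), folded s_def, folded a_def]
  define B where "B = beta .* ?d"
  \<comment> \<open>On the chord the affine factor is \<open>A + B * tau\<close> with
    \<open>tau = s + t\<close>, so that at \<open>x\<close> it takes the value
    \<open>A + B * s = alpha + x .* beta\<close>.\<close>
  define A where "A = ?p - s * B"
  let ?f = "%tau. (A + B * tau) * half_circle a tau"
  have fx: "f (x + t *. ?d) = n * ?f (s + t)" for t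
   unfolding f_def ch(2) A_def B_def by (simp add: inner_simps inner_commute algebra_simps)
  have De: "?D (t *. ?d) = n * diff2 ?f s t" for t
   using fx[of 0] fx[of t] fx[of "- t"] by (simp add: algebra_simps)
  have "lint (%t. diff2 ?f s t / t^2)"
   using integrable_mult_right[OF elim, of "1 / n"] n(2) unfolding De by simp
  from half_circle_second_difference_integral[OF ch(1) this]
  have "(LBINT t. ?D (t *. ?d) / t^2) = n * (2 * pi * (A + 2 * B * s))"
   unfolding De times_divide_eq_right[symmetric] integral_mult_right_zero by simp
  also have "A + 2 * B * s = ?p + (?y .* ?d) * (beta .* ?d) / n^2" by (simp add: A_def s_def B_def)
  finally have "(1 / slope_norm sg ^ 3) * (LBINT t. ?D (t *. ?d) / t^2) = 2 * pi * (?p * (1 / n^2) + (?y .* ?d) * (beta .* ?d) * (1 / (n^2)^2))"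
   unfolding n_def[symmetric] using n(2) by (simp add: field_simps power2_eq_square power3_eq_cube)
  also have "(?y .* ?d) * (beta .* ?d) = ?y $ 1 * beta $ 1 + (?y $ 1 * beta $ 2 + ?y $ 2 * beta $ 1) * sg + ?y $ 2 * beta $ 2 * sg^2"
   by (simp add: inner_real2 algebra_simps power2_eq_square)
  finally show ?case unfolding n(3) by (simp add: add_divide_distrib distrib_right)
 qed
 hence "(LBINT h. kern h * ?D h) = (LBINT sg. ?g sg)"
  unfolding k(2) by (intro integral_cong_AE) measurable
 also have "... = 2 * pi * (?p * pi + (?y $ 1 * beta $ 1 * (pi / 2) + (?y $ 1 * beta $ 2 + ?y $ 2 * beta $ 1) * 0 + ?y $ 2 * beta $ 2 * (pi / 2)))"
  by (intro has_bochner_integral_integral_eq has_bochner_integral_mult_right has_bochner_integral_add slope_moments)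
   (simp add: has_bochner_integral_iff integral_inverse_1_plus_square)
 also have "... = 2 * pi^2 * (?p + (?y .* beta) / 2)" 
 proof -
  have "2 * pi * (p * pi + (a * (pi / 2) + b * 0 + d * (pi / 2))) = 2 * pi^2 * (p + (a + d) / 2)" for p a b d :: real
   by (simp add: power2_eq_square distrib_left add_divide_distrib)
  thus ?thesis by (simp only: inner_real2)
 qed
 finally show ?thesis .
qed

lemma near_far_bound:
 assumes "0 < rho" and near: "norm (h::real^2) <= rho ==> X <= C1 * (norm h)^2" and far: "X <= M" and "0 <= C1" "0 <= M"
 shows "X <= (C1 * max 1 (rho^2) + M / min 1 (rho^2)) * min 1 ((norm h)^2)"
proof (cases "norm h <= rho")
 case True
 hence "(norm h)^2 <= rho^2" by (intro power_mono) auto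
 hence "(norm h)^2 <= max 1 (rho^2) * min 1 ((norm h)^2)"
  by (cases "(norm h)^2 <= 1") (auto simp: max_def min_def mult_le_cancel_right1)
 hence "C1 * (norm h)^2 <= C1 * (max 1 (rho^2) * min 1 ((norm h)^2))" using assms(4) by (intro mult_left_mono)
 moreover have "0 <= M / min 1 (rho^2) * min 1 ((norm h)^2)" using assms(5) by auto
 ultimately show ?thesis using near[OF True] by (simp add: distrib_right mult.assoc)
next
 case False
 hence "rho^2 <= (norm h)^2" using assms(1) by (intro power_mono) auto
 hence "min 1 (rho^2) <= min 1 ((norm h)^2)" by simp
 hence "M * 1 <= M * (min 1 ((norm h)^2) / min 1 (rho^2))"
  using assms(1,5) by (intro mult_left_mono) (auto simp: le_divide_eq)
 moreover have "0 <= C1 * max 1 (rho^2) * min 1 ((norm h)^2)" using assms(4) by auto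
 ultimately show ?thesis using far by (simp add: distrib_right)
qed

text \<open>Both one-sided differences are rationalised. In their sum the first-order quantity
  \<open>m\<close> survives only multiplied by \<open>d - b\<close>, which is itself of order
  \<open>m\<close>.\<close>

lemma sqrt_second_difference:
 fixes a b d m k eps :: real
 assumes e: "0 < eps" and abd: "eps / 2 <= b" "eps / 2 <= d" "eps <= a"
  and b: "b^2 = a^2 - k - 2 * m" and d: "d^2 = a^2 - k + 2 * m" and k: "0 <= k"
 shows "abs (b - d) <= 4 * abs m / eps" "abs (2 * a - b - d) <= 2 * k / eps + 8 * m^2 / eps ^ 3"
proof -
 have p: "0 < a + b" "0 < a + d" "0 < b + d" "eps <= a + b" "eps <= a + d" "eps <= b + d" using e abd by linarith+
 have bd: "d - b = 4 * m / (b + d)"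
 proof -
  have "(d - b) * (b + d) = 4 * m" using b d by (simp add: algebra_simps power2_eq_square)
  thus ?thesis using p(3) by (simp add: eq_divide_eq)
 qed
 have "abs (4 * m / (b + d)) <= 4 * abs m / eps" using p e by (simp add: abs_mult frac_le)
 thus 1: "abs (b - d) <= 4 * abs m / eps" unfolding bd[symmetric] by simp
 have ab: "a - b = (k + 2 * m) / (a + b)"
 proof -
  have "(a - b) * (a + b) = k + 2 * m" using b by (simp add: algebra_simps power2_eq_square)
  thus ?thesis using p(1) by (simp add: eq_divide_eq)
 qed
 have ad: "a - d = (k - 2 * m) / (a + d)"
 proof -
  have "(a - d) * (a + d) = k - 2 * m" using d by (simp add: algebra_simps power2_eq_square)
  thus ?thesis using p(2) by (simp add: eq_divide_eq)
 qed
 have "2 * a - b - d = (a - b) + (a - d)" by simp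
 also have "... = k / (a + b) + k / (a + d) + 2 * m * (d - b) / ((a + b) * (a + d))"
 proof -
  have "(a - b) + (a - d) = k / (a + b) + k / (a + d) + 2 * m * (1 / (a + b) - 1 / (a + d))"
   unfolding ab ad by (simp add: add_divide_distrib diff_divide_distrib right_diff_distrib)
  also have "1 / (a + b) - 1 / (a + d) = (d - b) / ((a + b) * (a + d))" using p(1,2) by (simp add: diff_frac_eq)
  finally show ?thesis by simp
 qed
 finally have split: "2 * a - b - d = k / (a + b) + k / (a + d) + 2 * m * (d - b) / ((a + b) * (a + d))" .
 have "abs (2 * a - b - d) <= abs (k / (a + b)) + abs (k / (a + d)) + abs (2 * m * (d - b) / ((a + b) * (a + d)))" unfolding split by (rule abs_triangle_ineq[THEN order_trans]) (intro add_mono abs_triangle_ineq order_refl)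
 also have "abs (k / (a + b)) <= k / eps" using p e k by (simp add: frac_le)
 also have "abs (k / (a + d)) <= k / eps" using p e k by (simp add: frac_le)
 also have "abs (2 * m * (d - b) / ((a + b) * (a + d))) <= (2 * abs m * (4 * abs m / eps)) / (eps * eps)"
  unfolding abs_divide abs_mult using p e 1 by (intro frac_le mult_mono) (auto simp: abs_minus_commute)
 also have "(2 * abs m * (4 * abs m / eps)) / (eps * eps) = 8 * m^2 / eps ^ 3" by (simp add: power2_eq_square power3_eq_cube abs_mult_self_eq)
 finally show "abs (2 * a - b - d) <= 2 * k / eps + 8 * m^2 / eps ^ 3" by simp
qed

text \<open>Away from the rim the dome is smooth with quantitative bounds; for large increments
  boundedness suffices, and \<open>near_far_bound\<close> joins the two ranges.\<close>

lemma dome_second_difference: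
 fixes c beta :: "real^2" and alpha r :: real
 defines "f \<equiv> %x. (alpha + x .* beta) * dome c r x"
 assumes r: "0 < r" and eps: "0 < eps"
 obtains C where "!!x h. eps <= dome c r x ==> abs (diff2 f x h) <= C * min 1 ((norm h)^2)"
proof (cases "eps <= r")
 case False
 thus thesis using that[of 0] dome_le[of r c] r by (meson less_imp_le order_trans)
next
 case True
 define P where "P = abs alpha + (norm c + r) * norm beta"
 \<comment> \<open>With this radius both shifted points still have dome value at least
   \<open>eps / 2\<close>, as the squares change by at most \<open>3 / 4 * eps^2\<close>.\<close>
 define rho where "rho = eps^2 / (4 * r)"
 define C1 where "C1 = P * (2 / eps + 8 * r^2 / eps ^ 3) + norm beta * (4 * r / eps)"
 have P0: "0 <= P" using r by (simp add: P_def)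
 have Pb: "abs (alpha + x .* beta) <= P" if "norm (x - c) <= r" for x
 proof -
  have "abs (x .* beta) <= norm x * norm beta" by (rule Cauchy_Schwarz_ineq2)
  also have "... <= (norm c + r) * norm beta" using that norm_triangle_sub[of x c] by (intro mult_right_mono) auto
  finally show ?thesis unfolding P_def by linarith
 qed
 have fb: "abs (f x) <= P * r" for x
 proof (cases "norm (x - c) <= r")
  case True
  thus ?thesis unfolding f_def abs_mult using dome_le[of r c x] r P0 by (intro mult_mono Pb) auto
 next
  case False
  thus ?thesis unfolding f_def using dome_outside[of r x c] r P0 by simp
 qed
 have rho0: "0 < rho" using eps r by (simp add: rho_def)
 show thesis
 proof (rule that)
  fix x h assume x: "eps <= dome c r x"
  show "abs (diff2 f x h) <= (C1 * max 1 (rho^2) + 4 * (P * r) / min 1 (rho^2)) * min 1 ((norm h)^2)"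
  proof (rule near_far_bound[OF rho0])
   show "abs (diff2 f x h) <= 4 * (P * r)" using fb[of x] fb[of "x + h"] fb[of "x - h"] by linarith
   show "0 <= 4 * (P * r)" using P0 r by simp
   show "0 <= C1" using P0 r eps by (simp add: C1_def)
   assume h: "norm h <= rho"
   have xr: "norm (x - c) <= r"
   proof (rule ccontr)
    assume "~ norm (x - c) <= r"
    hence "dome c r x = 0" using r by (intro dome_outside) auto
    thus False using x eps by simp
   qed
   let ?m = "(x - c) .* h" and ?a = "dome c r x" and ?b = "dome c r (x + h)" and ?d = "dome c r (x - h)"
   have m: "abs ?m <= r * norm h" using Cauchy_Schwarz_ineq2[of "x - c" h] mult_right_mono[OF xr norm_ge_zero[of h]] by linarith
   have a2: "?a^2 = r^2 - (norm (x - c))^2" by (rule dome_square[OF xr])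
   have e2: "eps^2 <= ?a^2" using x eps by (intro power_mono) auto
   have n1: "(norm (x + h - c))^2 = (norm (x - c))^2 + (norm h)^2 + 2 * ?m" "(norm (x - h - c))^2 = (norm (x - c))^2 + (norm h)^2 - 2 * ?m"
    unfolding power2_norm_eq_inner by (simp_all add: inner_simps inner_commute algebra_simps)
   have small: "(norm h)^2 + 2 * abs ?m <= 3 / 4 * eps^2"
   proof -
    have "rho <= r / 4"
    proof -
     have "eps^2 <= r^2" using True eps by (intro power_mono) auto
     thus ?thesis using r by (simp add: rho_def divide_le_eq power2_eq_square)
    qed
    hence "norm h * norm h <= rho * (r / 4)" using h rho0 by (intro mult_mono) auto
    moreover have "abs ?m <= rho * r" using m h r by (smt (verit) mult.commute mult_left_mono)
    moreover have "rho * r = eps^2 / 4" using r by (simp add: rho_def)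
    ultimately show ?thesis by (simp add: power2_eq_square)
   qed
   have b2: "?b^2 = ?a^2 - (norm h)^2 - 2 * ?m" "?d^2 = ?a^2 - (norm h)^2 + 2 * ?m"
   proof -
    have "(norm (x + h - c))^2 <= r^2" "(norm (x - h - c))^2 <= r^2" using small e2 n1 a2 zero_le_power2[of eps] by linarith+
    hence "norm (x + h - c) <= r" "norm (x - h - c) <= r" using r by (auto intro: power2_le_imp_le)
    thus "?b^2 = ?a^2 - (norm h)^2 - 2 * ?m" "?d^2 = ?a^2 - (norm h)^2 + 2 * ?m"
     using n1 a2 by (simp_all add: dome_square)
   qed
   have half: "eps / 2 <= y" if "(eps / 2)^2 <= y^2" "0 <= y" for y using power2_le_imp_le[OF that] .
   have "(eps / 2)^2 <= ?b^2" "(eps / 2)^2 <= ?d^2" unfolding b2 using small e2 by (auto simp: power_divide)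
   hence bd: "eps / 2 <= ?b" "eps / 2 <= ?d" using half[of ?b] half[of ?d] by simp_all
   note sq = sqrt_second_difference[OF eps bd x b2]
   have m2: "?m^2 <= r^2 * (norm h)^2" using power_mono[OF m, of 2] by (simp add: power_mult_distrib)
   have s1: "abs (2 * ?a - ?b - ?d) <= (2 / eps + 8 * r^2 / eps ^ 3) * (norm h)^2"
   proof -
    have "8 * ?m^2 / eps ^ 3 <= 8 * (r^2 * (norm h)^2) / eps ^ 3" using m2 eps by (intro divide_right_mono mult_left_mono) auto
    thus ?thesis using sq(2) by (simp add: distrib_right)
   qed
   have s2: "abs (?b - ?d) <= 4 * r / eps * norm h"
   proof -
    have "4 * abs ?m / eps <= 4 * (r * norm h) / eps" using m eps by (intro divide_right_mono mult_left_mono) auto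
    thus ?thesis using sq(1) by simp
   qed
   have "diff2 f x h = (alpha + x .* beta) * (2 * ?a - ?b - ?d) - (h .* beta) * (?b - ?d)"
    unfolding f_def by (simp add: inner_simps algebra_simps)
   also have "abs (...) <= abs (alpha + x .* beta) * abs (2 * ?a - ?b - ?d) + abs (h .* beta) * abs (?b - ?d)"
    unfolding abs_mult[symmetric] by (rule abs_triangle_ineq4)
   also have "... <= P * ((2 / eps + 8 * r^2 / eps ^ 3) * (norm h)^2) + (norm h * norm beta) * (4 * r / eps * norm h)"
    using s1 s2 Pb[OF xr] Cauchy_Schwarz_ineq2[of h beta] P0 by (intro add_mono mult_mono) auto
   also have "... = C1 * (norm h)^2" by (simp add: C1_def algebra_simps power2_eq_square)
   finally show "abs (diff2 f x h) <= C1 * (norm h)^2" .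
  qed
 qed
qed

text \<open>Soft thresholding. It is odd and 1-Lipschitz, so antisymmetry is kept, and it removes
  the rim of a dome, where the gradient blows up. As \<open>soft eps a >= a - eps\<close>, with
  equality for \<open>a > eps\<close>, it does not increase second differences at points above the
  threshold.\<close>

definition soft :: "real => real => real" where
 "soft eps a = (if eps < a then a - eps else if a < - eps then a + eps else 0)"

lemma soft_measurable [measurable]: "borelf (soft eps)" unfolding soft_def[abs_def] by measurable
lemma soft_minus: "0 < eps ==> soft eps (- a) = - soft eps a" by (auto simp: soft_def)
lemma soft_lipschitz: "0 < eps ==> abs (soft eps a - soft eps b) <= abs (a - b)" by (auto simp: soft_def)
lemma soft_ge: "0 < eps ==> a - eps <= soft eps a" by (auto simp: soft_def)
lemma soft_0: "0 < eps ==> abs a <= eps ==> soft eps a = 0" by (auto simp: soft_def)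

text \<open>The passage from a pointwise half-Laplacian to the energy. At points where
  \<open>phi\<close> is nonzero, thresholding can only lower the second difference; Fubini then
  brings the integral over increments inside.\<close>

lemma energy_soft_le:
 fixes b :: "real^2 => real"
 assumes eps: "0 < eps" and bm [measurable]: "borelf b" and fb: "finite_energy (%x. soft eps (b x))"
  and phi: "finite_energy phi" "lint phi" "!!x. 0 <= phi x"
  and S: "AEL x. phi x ~= 0 --> eps < b x & (\<forall>h. abs (diff2 b x h) <= C * min 1 ((norm h)^2))
    & (LBINT h. kern h * diff2 b x h) <= Lambda x"
  and Lambda: "lint (%x. phi x * Lambda x)"
 shows "energy (%x. soft eps (b x)) phi <= (LBINT x. phi x * Lambda x)"
proof -
 let ?t = "%x. soft eps (b x)"
 let ?D = "%h x. diff2 b x h"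
 note [measurable] = finite_energyD(1)[OF phi(1)]
 have t2: "lint (%x. (?t x)^2)" using finite_energyD(2)[OF fb] .
 have iD: "lint (%x. phi x * ?D h x)" for h
 proof (rule lint_bound[OF integrable_mult_left[OF phi(2), of "abs C"]])
  show "AEL x. norm (phi x * ?D h x) <= norm (phi x * abs C)" using S
  proof eventually_elim
   case (elim x)
   show ?case
   proof (cases "phi x = 0")
    case False
    hence "abs (?D h x) <= C * min 1 ((norm h)^2)" using elim by blast
    also have "... <= abs C * 1" by (intro mult_mono) auto
    finally show ?thesis by (simp add: abs_mult mult_left_mono)
   qed simp
  qed
 qed measurable
 \<comment> \<open>Discrete summation by parts for a fixed increment: translating one of the two
   terms moves both differences onto the barrier.\<close>
 have inner: "(LBINT x. (?t (x + h) - ?t x) * (phi (x + h) - phi x)) <= (LBINT x. phi x * ?D h x)" for h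
 proof -
  have d: "lint (%x. (?t (x + h) - ?t x) * phi x)" for h
   by (intro integrable_mult_square difference_square_integrable t2 finite_energyD(2)[OF phi(1)]) measurable
  have d': "lint (%x. (?t x - ?t (x - h)) * phi x)"
  proof -
   have "(%x. (?t x - ?t (x - h)) * phi x) = (%x. - ((?t (x + - h) - ?t x) * phi x))" by (simp add: algebra_simps)
   thus ?thesis using d[of "- h"] by simp
  qed
  have d'': "lint (%x. (?t (x + h) - ?t x) * phi (x + h))" using integrable_translate[OF d', of h] by simp
  have "(LBINT x. (?t (x + h) - ?t x) * (phi (x + h) - phi x)) = (LBINT x. (?t (x + h) - ?t x) * phi (x + h)) - (LBINT x. (?t (x + h) - ?t x) * phi x)"
   unfolding right_diff_distrib by (rule Bochner_Integration.integral_diff[OF d'' d])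
  also have "(LBINT x. (?t (x + h) - ?t x) * phi (x + h)) = (LBINT x. (?t x - ?t (x - h)) * phi x)"
   using integral_translate[of "%x. (?t x - ?t (x - h)) * phi x" h] by simp
  also have "(LBINT x. (?t x - ?t (x - h)) * phi x) - (LBINT x. (?t (x + h) - ?t x) * phi x) = (LBINT x. (?t x - ?t (x - h)) * phi x - (?t (x + h) - ?t x) * phi x)"
   by (rule Bochner_Integration.integral_diff[OF d' d, symmetric])
  also have "... <= (LBINT x. phi x * ?D h x)"
  proof (rule integral_mono_AE[OF Bochner_Integration.integrable_diff[OF d' d] iD])
   show "AEL x. (?t x - ?t (x - h)) * phi x - (?t (x + h) - ?t x) * phi x <= phi x * ?D h x" using S
   proof eventually_elim
    case (elim x)
    show ?case
    proof (cases "phi x = 0")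
     case False
     hence "?t x = b x - eps" using elim by (simp add: soft_def)
     hence "2 * ?t x - ?t (x - h) - ?t (x + h) <= ?D h x"
      using soft_ge[OF eps, of "b (x + h)"] soft_ge[OF eps, of "b (x - h)"] by linarith
     from mult_left_mono[OF this phi(3)[of x]] show ?thesis by (simp add: algebra_simps)
    qed simp
   qed
  qed
  finally show ?thesis .
 qed
 let ?F = "%p. kern (fst p) * (phi (snd p) * ?D (fst p) (snd p))"
 have F: "lint ?F"
 proof (rule lint_bound[OF integrable_mult_prod[OF kern_min_finite integrable_mult_left[OF phi(2), of C]]])
  have "AEL p. norm (?F p) <= norm (kern (fst p) * min 1 ((norm (fst p))^2) * (phi (snd p) * C))"
   using AE_pair_lborel[OF S]
  proof eventually_elim
   case (elim p)
   show ?case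
   proof (cases "phi (snd p) = 0")
    case False
    hence "abs (?D (fst p) (snd p)) <= C * min 1 ((norm (fst p))^2)" using elim by blast
    hence D: "abs (?D (fst p) (snd p)) <= abs C * min 1 ((norm (fst p))^2)" by (rule order_trans) (auto intro: mult_right_mono)
    have "kern (fst p) * phi (snd p) * abs (?D (fst p) (snd p)) <= kern (fst p) * phi (snd p) * (abs C * min 1 ((norm (fst p))^2))"
     using phi(3) by (intro mult_left_mono D) simp
    thus ?thesis using phi(3)[of "snd p"] by (simp add: abs_mult mult_ac)
   qed simp
  qed
  thus "AEL p. norm (?F p) <= norm (kern (fst p) * min 1 ((norm (fst p))^2) * (phi (snd p) * C))" .
 qed measurable
 have F': "integrable lborel2 ?F" using F by (simp add: lborel_prod)
 have iF: "lint (%h. kern h * (LBINT x. phi x * ?D h x))"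
  using lborel_pair.integrable_fst'[OF F'] by simp
 have iG: "lint (%x. phi x * (LBINT h. kern h * ?D h x))"
 proof -
  have "(LBINT h. ?F (h, x)) = phi x * (LBINT h. kern h * ?D h x)" for x
   unfolding integral_mult_right_zero[symmetric] by (rule LINT_cong) (simp_all add: mult_ac)
  moreover have "lint (%x. LBINT h. ?F (h, x))"
   using lborel_pair.integrable_snd[of "%h x. ?F (h, x)"] F' by (simp add: case_prod_beta')
  ultimately show ?thesis by simp
 qed
 have "energy ?t phi = (LBINT h. kern h * (LBINT x. (?t (x + h) - ?t x) * (phi (x + h) - phi x)))"
  by (rule energy_increment(2)[OF fb phi(1)])
 also have "... <= (LBINT h. kern h * (LBINT x. phi x * ?D h x))"
  by (intro integral_mono energy_increment(1)[OF fb phi(1)] iF mult_left_mono inner) simp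
 also have "... = (LBINT h. LBINT x. ?F (h, x))" by simp
 also have "... = (LBINT x. LBINT h. ?F (h, x))" by (rule integral_swap_lborel[OF F])
 also have "... = (LBINT x. phi x * (LBINT h. kern h * ?D h x))"
 proof (rule LINT_cong[OF refl], goal_cases)
  case (1 x)
  show ?case
   unfolding integral_mult_right_zero[symmetric] by (rule LINT_cong) (simp_all add: mult_ac)
 qed
 also have "... <= (LBINT x. phi x * Lambda x)"
 proof (rule integral_mono_AE[OF iG Lambda])
  show "AEL x. phi x * (LBINT h. kern h * ?D h x) <= phi x * Lambda x" using S
  proof eventually_elim
   case (elim x)
   thus ?case using phi(3)[of x] by (cases "phi x = 0") (auto intro: mult_left_mono)
  qed
 qed
 finally show ?thesis .
qed

text \<open>Thresholding gives 0 where the dome is low, so the dome may be replaced there by the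
  constant \<open>delta\<close>; the resulting product is Lipschitz with bounded support.\<close>

lemma soft_dome_finite_energy:
 fixes c beta :: "real^2"
 assumes r: "0 < r" and eps: "0 < eps"
 shows "finite_energy (%x. soft eps ((alpha + x .* beta) * dome c r x))" (is "finite_energy ?t")
proof -
 define P where "P = abs alpha + (norm c + r) * norm beta + 1"
 define p where "p x = max (- P) (min P (alpha + x .* beta))" for x
 \<comment> \<open>Below height \<open>delta\<close> the weighted dome is at most
   \<open>P * delta <= eps\<close>, which \<open>soft eps\<close> sends to 0.\<close>
 define delta where "delta = min r (eps / P)"
 define rho where "rho = sqrt (r^2 - delta^2)"
 define g where "g x = sqrt (r^2 - (min (norm (x - c)) rho)^2)" for x
 have P: "0 < P" using r by (simp add: P_def add_nonneg_pos)
 have delta: "0 < delta" "delta <= r" "P * delta <= eps" using r eps P by (auto simp: delta_def min_def field_simps)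
 have rho2: "rho^2 = r^2 - delta^2" "0 <= rho" using delta power_mono[of delta r 2] by (auto simp: rho_def)
 have rhor: "rho <= r" by (rule power2_le_imp_le) (use rho2 r in auto)
 have pP: "abs (p x) <= P" for x using P by (auto simp: p_def)
 have pe: "p x = alpha + x .* beta" if "norm (x - c) <= r" for x
 proof -
  have "abs (x .* beta) <= norm x * norm beta" by (rule Cauchy_Schwarz_ineq2)
  also have "... <= (norm c + r) * norm beta" using that norm_triangle_sub[of x c] by (intro mult_right_mono) auto
  finally have "abs (alpha + x .* beta) <= P" unfolding P_def by linarith
  thus ?thesis by (simp add: p_def)
 qed
 have sq: "delta^2 <= r^2 - (min (norm (x - c)) rho)^2" for x
 proof -
  have "(min (norm (x - c)) rho)^2 <= rho^2" using rho2(2) by (intro power_mono) auto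
  thus ?thesis using rho2(1) by simp
 qed
 have gdelta: "delta <= g x" for x unfolding g_def using sq delta by (intro real_le_rsqrt)
 have gr: "g x <= r" for x unfolding g_def using r by (intro real_le_lsqrt) auto
 have eq: "?t x = soft eps (p x * g x)" for x
 proof (cases "norm (x - c) <= rho")
  case True
  hence "(norm (x - c))^2 <= r^2" using rhor by (intro power_mono) auto
  thus ?thesis using True rhor by (simp add: pe g_def dome_def)
 next
  case False
  hence "g x = delta" using rho2(1) delta by (simp add: g_def)
  hence "abs (p x * g x) <= eps" using order_trans[OF mult_right_mono[OF pP[of x], of delta] delta(3)] delta(1) by (simp add: abs_mult)
  moreover have "abs ((alpha + x .* beta) * dome c r x) <= eps"
  proof (cases "norm (x - c) <= r")
   case True
   have "dome c r x <= delta"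
   proof (rule power2_le_imp_le)
    have "rho^2 <= (norm (x - c))^2" using False rho2(2) by (intro power_mono) auto
    thus "(dome c r x)^2 <= delta^2" unfolding dome_square[OF True] using rho2(1) by simp
   qed (use delta in simp)
   hence "abs (p x) * dome c r x <= P * delta" using P by (intro mult_mono pP) auto
   thus ?thesis using delta(3) pe[OF True] by (simp add: abs_mult)
  qed (use eps r in "simp add: dome_outside")
  ultimately show ?thesis using eps by (simp add: soft_0)
 qed
 have pl: "abs (p x - p y) <= norm beta * norm (x - y)" for x y
 proof -
  have "abs (p x - p y) <= abs ((x - y) .* beta)" unfolding p_def inner_diff_left by auto
  also have "... <= norm (x - y) * norm beta" by (rule Cauchy_Schwarz_ineq2)
  finally show ?thesis by (simp add: mult.commute)
 qed
 have gl: "abs (g x - g y) <= r / delta * norm (x - y)" for x y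
 proof -
  let ?m = "%x. min (norm (x - c)) rho"
  have m: "abs (?m x - ?m y) <= norm (x - y)" using norm_triangle_ineq3[of "x - c" "y - c"] by simp
  have s: "0 < g x + g y" "2 * delta <= g x + g y" using gdelta[of x] gdelta[of y] delta by linarith+
  have "0 <= delta^2" by simp
  hence nn: "0 <= r^2 - (?m x)^2" "0 <= r^2 - (?m y)^2" using sq[of x] sq[of y] by linarith+
  have "(g x - g y) * (g x + g y) = (?m y - ?m x) * (?m x + ?m y)"
   using real_sqrt_pow2[OF nn(1)] real_sqrt_pow2[OF nn(2)] unfolding g_def by (simp add: algebra_simps power2_eq_square)
  hence "abs (g x - g y) * (g x + g y) = abs (?m y - ?m x) * abs (?m x + ?m y)" using s(1) by (metis abs_mult abs_of_pos)
  also have "... <= norm (x - y) * (2 * r)" using m rhor rho2(2) by (intro mult_mono) (auto simp: abs_minus_commute)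
  finally have "abs (g x - g y) * (2 * delta) <= norm (x - y) * (2 * r)" using s(2) by (smt (verit) mult_left_mono abs_ge_zero)
  thus ?thesis using delta(1) by (simp add: field_simps)
 qed
 have L: "abs (?t x - ?t y) <= (P * (r / delta) + r * norm beta) * norm (x - y)" for x y
 proof -
  have "abs (?t x - ?t y) <= abs (p x * g x - p y * g y)" unfolding eq by (rule soft_lipschitz[OF eps])
  also have "p x * g x - p y * g y = p x * (g x - g y) + g y * (p x - p y)" by (simp add: algebra_simps)
  also have "abs (...) <= abs (p x) * abs (g x - g y) + abs (g y) * abs (p x - p y)" unfolding abs_mult[symmetric] by (rule abs_triangle_ineq)
  also have "... <= P * (r / delta * norm (x - y)) + r * (norm beta * norm (x - y))"
   using pP[of x] gl[of x y] pl[of x y] gr[of y] gdelta[of y] delta P r by (intro add_mono mult_mono) auto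
  finally show ?thesis by (simp add: algebra_simps)
 qed
 show ?thesis
 proof (rule lipschitz_finite_energy(1)[OF L])
  fix x :: "real^2" assume "norm c + r <= norm x"
  hence "r <= norm (x - c)" using norm_triangle_ineq2[of x c] by linarith
  thus "?t x = 0" using r eps by (simp add: dome_outside soft_0)
 qed (use r in simp)
qed

section \<open>Hopf bounds\<close>

lemma integrable_mult_AE_bounded_support:
 fixes phi g :: "'a::euclidean_space => real"
 assumes [measurable]: "borelf phi" "borelf g" and phi: "lint (%x. (phi x)^2)"
  and s: "AEL x. phi x ~= 0 --> norm x <= r & abs (g x) <= M"
 shows "lint (%x. phi x * g x)"
proof (rule lint_bound)
 show "lint (%x. (indicator (cball 0 r) x + (phi x)^2) * M)"
  by (intro integrable_mult_left lint_add integrable_indicator_bounded phi) auto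
 show "AEL x. norm (phi x * g x) <= norm ((indicator (cball 0 r) x + (phi x)^2) * M)" using s
 proof eventually_elim
  case (elim x)
  have "abs (phi x) <= 1 + (phi x)^2" using zero_le_power2[of "abs (phi x) - 1"] by (simp add: power2_diff)
  hence "abs (phi x) * abs (g x) <= (1 + (phi x)^2) * abs M" if "phi x ~= 0" using elim that by (intro mult_mono) auto
  thus ?case using elim by (cases "phi x = 0") (auto simp: abs_mult)
 qed
qed measurable

lemma dome_pos_ball: "0 < dome c r x ==> 0 <= r ==> x \<in> ball c r"
 using dome_outside[of r x c] by (force simp: dist_norms)

context torsion_reflection
begin

text \<open>The thresholded barriers have finite energy and inherit the pointwise bound on the
  half-Laplacian of \<open>f\<close>, so \<open>comparison\<close> applies to each; the threshold
  \<open>1 / real (Suc n)\<close> then tends to 0.\<close>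

lemma soft_comparison:
 assumes f: "borelf f" "!!x. f (R x) = - f x" "!!eps. 0 < eps ==> finite_energy (%x. soft eps (f x))"
  and r: "0 < r" and B: "ball c r <= Omega" "ball (R c) r <= Omega" "!!x. x .* e < l ==> 0 < f x ==> x \<in> ball c r"
  and K: "K \<in> sets borel" "bounded K" "0 < a0" "0 <= delta" "0 < kappa"
   "!!x. x \<in> K ==> a0 <= l - x .* e & delta <= v x & f x = 0 & r + kappa <= norm (x - c) & r + norm (c - R c) + norm (x - c) <= D"
  and diff: "!!eps. 0 < eps ==> \<exists>C. \<forall>x. x .* e < l --> eps < f x --> (\<forall>h. abs (diff2 f x h) <= C * min 1 ((norm h)^2))
    & (LBINT h. kern h * diff2 f x h) <= Cb * (l - x .* e)"
  and Cb: "Cb <= 8 * delta * a0 * measure lborel K / D ^ 5"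
 shows "AEL x. x .* e < l --> f x <= v x"
proof -
 have le: "AEL x. x .* e < l --> soft eps (f x) <= v x" if eps: "0 < eps" for eps
 proof (rule comparison[where B = "ball c r" and K = K, OF f(3)[OF eps] _ _ _ _ K(1-4) _ K(5) _ _ Cb])
  have pos: "eps < f x" if "0 < soft eps (f x)" for x using that eps by (auto simp: soft_def split: if_splits)
  show "soft eps (f (R x)) = - soft eps (f x)" for x unfolding f(2) using eps by (rule soft_minus)
  show "x \<in> ball c r" if "x .* e < l" "0 < soft eps (f x)" for x using B(3)[OF that(1)] pos[OF that(2)] eps by simp
  show "x \<in> Omega & R x \<in> Omega" if "x \<in> ball c r" for x
   using that B reflect_isometry[OF e, of l x c] by (auto simp: dist_norms)
  show "a0 <= l - x .* e & delta <= v x & soft eps (f x) = 0" if "x \<in> K" for x using K(6)[OF that] eps by (simp add: soft_0)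
  show "kappa <= norm (y - x) & norm (y - R x) <= D" if "x \<in> K" "y \<in> ball c r" for x y
  proof -
   have "norm (y - c) < r" using that by (simp add: dist_norms)
   moreover have "norm (x - c) <= norm (y - x) + norm (y - c)" using norm_triangle_ineq[of "x - y" "y - c"] by (simp add: norm_minus_commute)
   moreover have "norm (y - R x) <= norm (y - R c) + norm (x - c)" using norm_triangle_ineq4[of "y - R c" "R x - R c"] reflect_isometry[OF e] by simp
   moreover have "norm (y - R c) <= norm (y - c) + norm (c - R c)" using norm_triangle_ineq[of "y - c" "c - R c"] by simp
   ultimately show ?thesis using K(6)[OF that(1)] by linarith
  qed
  fix phi assume phi: "finite_energy phi" "!!x. 0 <= phi x" and s: "AEL x. phi x ~= 0 --> x \<in> ball c r & x .* e < l & phi x <= soft eps (f x)"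
  note [measurable] = finite_energyD(1)[OF phi(1)]
  obtain C where C: "\<forall>x. x .* e < l --> eps < f x --> (\<forall>h. abs (diff2 f x h) <= C * min 1 ((norm h)^2))
    & (LBINT h. kern h * diff2 f x h) <= Cb * (l - x .* e)" using diff[OF eps] by blast
  have s': "AEL x. phi x ~= 0 --> norm x <= norm c + r & abs (l - x .* e) <= abs (l - c .* e) + r" using s
  proof eventually_elim
   case (elim x)
   have "abs ((c - x) .* e) <= norm (c - x)" using Cauchy_Schwarz_ineq2[of "c - x" e] e by simp
   moreover have "norm x <= norm c + norm (c - x)" using norm_triangle_ineq2[of x c] by (simp add: norm_minus_commute)
   ultimately show ?case using elim by (auto simp: dist_norm inner_simps)
  qed
  have s1: "AEL x. phi x ~= 0 --> norm x <= norm c + r & abs (1::real) <= 1" using s' by eventually_elim auto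
  have i1: "lint phi" using integrable_mult_AE_bounded_support[OF _ _ finite_energyD(2)[OF phi(1)] s1] by simp
  have i2: "lint (%x. phi x * (l - x .* e))"
   by (rule integrable_mult_AE_bounded_support[OF _ _ finite_energyD(2)[OF phi(1)] s']) measurable
  have "energy (%x. soft eps (f x)) phi <= (LBINT x. phi x * (Cb * (l - x .* e)))"
  proof (rule energy_soft_le[OF eps f(1) f(3)[OF eps] phi(1) i1 phi(2)])
   show "lint (%x. phi x * (Cb * (l - x .* e)))" using integrable_mult_right[OF i2, of Cb] by (simp add: mult_ac)
   show "AEL x. phi x ~= 0 --> eps < f x & (\<forall>h. abs (diff2 f x h) <= C * min 1 ((norm h)^2))
    & (LBINT h. kern h * diff2 f x h) <= Cb * (l - x .* e)" using s
   proof eventually_elim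
    case (elim x)
    show ?case
    proof
     assume "phi x ~= 0"
     hence "0 < soft eps (f x)" "x .* e < l" using elim phi(2)[of x] by auto
     thus "eps < f x & (\<forall>h. abs (diff2 f x h) <= C * min 1 ((norm h)^2))
      & (LBINT h. kern h * diff2 f x h) <= Cb * (l - x .* e)" using pos[of x] C by blast
    qed
   qed
  qed
  also have "... = Cb * (LBINT x. phi x * (l - x .* e))"
   unfolding integral_mult_right_zero[symmetric] by (simp add: mult_ac)
  finally show "energy (%x. soft eps (f x)) phi <= Cb * (LBINT x. phi x * (l - x .* e))" .
 qed simp
 have "AEL x. \<forall>n. x .* e < l --> soft (1 / real (Suc n)) (f x) <= v x"
  unfolding AE_all_countable by (intro allI le) simp
 thus ?thesis
 proof eventually_elim
  case (elim x)
  show ?case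
  proof
   assume "x .* e < l"
   hence "f x <= v x + 1 / real (Suc n)" for n using elim[rule_format, of n] soft_ge[of "1 / real (Suc n)" "f x"] by simp
   thus "f x <= v x" by (rule_tac field_le_epsilon) (meson add_left_mono less_imp_le nat_approx_posE order_trans)
  qed
 qed
qed

text \<open>For a dome centred on the line, weighted by the distance to the line,
  \<open>dome_half_laplacian\<close> gives \<open>2 * pi^2 * (1 + 1 / 2)\<close> times the weight.
  This is proportional to \<open>l - x .* e\<close>, the form that the interaction with
  \<open>K\<close> can absorb.\<close>

lemma hopf_centred:
 assumes c: "c .* e = l" and r: "0 < r" and B: "ball c r <= Omega" and gamma: "0 < gamma"
  and K: "K \<in> sets borel" "bounded K" "0 < a0" "0 <= delta" "0 < kappa"
   "!!x. x \<in> K ==> a0 <= l - x .* e & delta <= v x & r + kappa <= norm (x - c) & r + norm (x - c) <= D"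
  and small: "3 * pi^2 * gamma <= 8 * delta * a0 * measure lborel K / D ^ 5"
 shows "AEL x. x .* e < l --> gamma * (l - x .* e) * dome c r x <= v x"
proof -
 define f where "f x = (gamma * l + x .* (- gamma *. e)) * dome c r x" for x
 have fe: "f x = gamma * (l - x .* e) * dome c r x" for x by (simp add: f_def algebra_simps)
 have cR: "R c = c" by (rule reflect_fixed[OF c])
 have nR: "norm (R x - c) = norm (x - c)" for x using reflect_isometry[OF e, of l x c] cR by simp
 have fm: "borelf f" unfolding f_def[abs_def] by measurable
 have ball: "x \<in> ball c r" if "f x ~= 0" for x
  using that r dome_nonneg[of c r x] by (intro dome_pos_ball le_neq_trans) (auto simp: fe)
 have "AEL x. x .* e < l --> f x <= v x"
 proof (rule soft_comparison[OF fm _ _ r B _ _ K(1-5) _ _ small])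
  show "f (R x) = - f x" for x unfolding fe by (simp add: dome_def nR reflect_inner[OF e] algebra_simps)
  show "finite_energy (%x. soft eps (f x))" if "0 < eps" for eps unfolding f_def by (rule soft_dome_finite_energy[OF r that])
  show "a0 <= l - x .* e & delta <= v x & f x = 0 & r + kappa <= norm (x - c) & r + norm (c - R c) + norm (x - c) <= D" if "x \<in> K" for x
   using K(5) K(6)[OF that] r dome_outside[of r x c] by (simp add: fe cR)
  fix eps :: real assume eps: "0 < eps"
  hence "0 < eps / (gamma * r)" using gamma r by simp
  from dome_second_difference[OF r this, where alpha = "gamma * l" and beta = "- gamma *. e" and c = c, folded f_def]
  obtain C where C: "!!x h. eps / (gamma * r) <= dome c r x ==> abs (diff2 f x h) <= C * min 1 ((norm h)^2)" by blast
  show "\<exists>C. \<forall>x. x .* e < l --> eps < f x --> (\<forall>h. abs (diff2 f x h) <= C * min 1 ((norm h)^2))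
    & (LBINT h. kern h * diff2 f x h) <= 3 * pi^2 * gamma * (l - x .* e)"
  proof (intro exI[of _ C] allI impI)
   fix x assume x: "x .* e < l" "eps < f x"
   have "norm (c - x) < r" using ball[of x] x eps by (simp add: dist_norm)
   moreover have "abs ((c - x) .* e) <= norm (c - x)" using Cauchy_Schwarz_ineq2[of "c - x" e] e by simp
   ultimately have "f x <= gamma * r * dome c r x" unfolding fe using gamma c by (intro mult_right_mono mult_left_mono) (auto simp: inner_simps)
   hence d: "eps / (gamma * r) <= dome c r x" using gamma r x(2) by (simp add: divide_le_eq mult_ac)
   have d0: "0 < dome c r x" using d eps gamma r by (smt (verit) divide_pos_pos mult_pos_pos)
   have int: "lint (%h. kern h * diff2 f x h)"
    by (rule kern_integrable_dominated[OF _ C[OF d]]) (use fm in measurable)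
   have "(LBINT h. kern h * diff2 f x h) = 2 * pi^2 * (gamma * l + x .* (- gamma *. e) + ((x - c) .* (- gamma *. e)) / 2)"
    unfolding f_def by (rule dome_half_laplacian[OF d0 int[unfolded f_def]])
   also have "... = 3 * pi^2 * gamma * (l - x .* e)" using c by (simp add: inner_simps algebra_simps add_divide_distrib diff_divide_distrib)
   finally show "(\<forall>h. abs (diff2 f x h) <= C * min 1 ((norm h)^2))
    & (LBINT h. kern h * diff2 f x h) <= 3 * pi^2 * gamma * (l - x .* e)" using C[OF d] by simp
  qed
 qed (use B cR ball in auto)
 thus ?thesis unfolding fe .
qed

text \<open>The ball keeps distance \<open>d0\<close> from the line, so the dome is made
  antisymmetric by subtracting its mirror image. Inside the ball the mirror image adds a bounded
  amount to the half-Laplacian, while \<open>l - x .* e\<close> is at least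
  \<open>d0\<close>.\<close>

lemma hopf_interior:
 assumes r: "0 < r" and d0: "0 < d0" "r + d0 <= l - c .* e" and B: "ball c r <= Omega" "ball (R c) r <= Omega"
  and K: "K \<in> sets borel" "bounded K" "0 < a0" "0 < delta" "0 < kappa" "0 < measure lborel K"
   "!!x. x \<in> K ==> a0 <= l - x .* e & delta <= v x & r + kappa <= norm (x - c)"
 obtains gamma where "0 < gamma" "AEL x. x .* e < l --> gamma * dome c r x <= v x"
proof -
 obtain D0 where D0: "!!x. x \<in> K ==> norm x <= D0" using K(2) unfolding bounded_iff by blast
 define D where "D = abs D0 + norm (R c) + 2 * norm c + r + 1"
 have D: "0 < D" using r by (simp add: D_def add_nonneg_pos)
 \<comment> \<open>The near coefficient is 0 because the mirror dome vanishes within distance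
   \<open>d0\<close> of a point of the ball; farther away two dome values give
   \<open>2 * r\<close>.\<close>
 define C2 where "C2 = 0 * max 1 (d0^2) + (2 * r) / min 1 (d0^2)"
 define M where "M = 2 * pi^2 + C2 * (LBINT h. kern h * min 1 ((norm h)^2))"
 have C2: "0 <= C2" using r d0 by (simp add: C2_def)
 have M: "0 < M" unfolding M_def by (intro add_pos_nonneg mult_nonneg_nonneg C2 Bochner_Integration.integral_nonneg) simp_all
 \<comment> \<open>Chosen so that \<open>gamma * M / d0\<close> is exactly the bound that the
   interaction with \<open>K\<close> allows; \<open>M\<close> bounds the half-Laplacian of the
   barrier for \<open>gamma = 1\<close>.\<close>
 define gamma where "gamma = (8 * delta * a0 * measure lborel K / D ^ 5) * d0 / M"
 have gamma: "0 < gamma" unfolding gamma_def using K D d0 M by simp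
 define f where "f x = gamma * (dome c r x - dome (R c) r x)" for x
 have dR: "dome (R c) r x = dome c r (R x)" for x using reflect_isometry[OF e, of l x "R c"] by (simp add: dome_def)
 have fR: "f (R x) = - f x" for x unfolding f_def dR by (simp add: algebra_simps)
 have far: "norm (x - R c) \<ge> r + d0" if "x .* e <= l" for x
 proof -
  have "(R c - x) .* e <= norm (R c - x)" using norm_cauchy_schwarz[of "R c - x" e] e by simp
  thus ?thesis using that d0 by (simp add: inner_simps reflect_inner[OF e] norm_minus_commute)
 qed
 have far0: "dome (R c) r x = 0" if "x .* e <= l" for x using far[OF that] r d0 by (intro dome_outside) auto
 have cB: "y .* e <= l - d0" if "y \<in> ball c r" for y
 proof -
  have "(y - c) .* e <= norm (y - c)" using norm_cauchy_schwarz[of "y - c" e] e by simp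
  thus ?thesis using that d0 by (simp add: inner_simps dist_norms)
 qed
 have fm: "borelf f" unfolding f_def[abs_def] by measurable
 have ball: "x \<in> ball c r" if "x .* e < l" "0 < f x" for x
  using that far0[of x] r gamma by (intro dome_pos_ball) (auto simp: f_def zero_less_mult_iff)
 have "AEL x. x .* e < l --> f x <= v x"
 proof (rule soft_comparison[where Cb = "gamma * M / d0", OF fm fR _ r B ball K(1-3) less_imp_le[OF K(4)] K(5)])
  show "finite_energy (%x. soft eps (f x))" if eps: "0 < eps" for eps
  proof -
   have "soft eps (f x) = soft eps ((gamma + x .* 0) * dome c r x) - soft eps ((gamma + x .* 0) * dome (R c) r x)" for x
   proof (cases "x .* e <= l")
    case False
    hence "R x .* e <= l" using reflect_inner[OF e, of l x] by simp
    from far0[OF this] have "dome c r x = 0" by (simp add: dR)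
    thus ?thesis using eps soft_minus[OF eps] by (simp add: f_def soft_0)
   qed (use eps in "simp add: f_def far0 soft_0")
   thus ?thesis by (simp only:) (intro finite_energy_diff soft_dome_finite_energy r eps)
  qed
  show "a0 <= l - x .* e & delta <= v x & f x = 0 & r + kappa <= norm (x - c) & r + norm (c - R c) + norm (x - c) <= D" if "x \<in> K" for x
   using K(3,5) K(7)[OF that] D0[OF that] r dome_outside[of r x c] far0[of x] norm_triangle_ineq4[of c "R c"] norm_triangle_ineq4[of x c]
   by (simp add: f_def D_def)
  show "gamma * M / d0 <= 8 * delta * a0 * measure lborel K / D ^ 5" using M d0 by (simp add: gamma_def)
  fix eps :: real assume eps: "0 < eps"
  hence "0 < eps / gamma" using gamma by simp
  from dome_second_difference[OF r this, where alpha = 1 and beta = 0 and c = c]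
  obtain C where C: "!!x h. eps / gamma <= dome c r x ==> abs (diff2 (dome c r) x h) <= C * min 1 ((norm h)^2)" by auto
  show "\<exists>C. \<forall>x. x .* e < l --> eps < f x --> (\<forall>h. abs (diff2 f x h) <= C * min 1 ((norm h)^2))
    & (LBINT h. kern h * diff2 f x h) <= gamma * M / d0 * (l - x .* e)"
  proof (intro exI[of _ "gamma * (C + C2)"] allI impI)
   fix x assume x: "x .* e < l" "eps < f x"
   hence xB: "x .* e <= l - d0" using ball[of x] eps cB[of x] by simp
   have d: "eps / gamma <= dome c r x" using gamma far0[of x] x by (simp add: f_def divide_le_eq mult_ac)
   have dp: "0 < dome c r x" using d eps gamma by (smt (verit) divide_pos_pos)
   let ?D = "%h. diff2 (dome c r) x h" and ?E = "%h. dome (R c) r (x + h) + dome (R c) r (x - h)"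
   have E: "abs (?E h) <= C2 * min 1 ((norm h)^2)" for h unfolding C2_def
   proof (rule near_far_bound[OF d0(1)])
    show "abs (?E h) <= 2 * r" using dome_le[of r "R c" "x + h"] dome_le[of r "R c" "x - h"] r by simp
    assume h: "norm h <= d0"
    have "abs (h .* e) <= d0" using Cauchy_Schwarz_ineq2[of h e] e h by simp
    thus "abs (?E h) <= 0 * (norm h)^2" using xB far0[of "x + h"] far0[of "x - h"] by (simp add: inner_simps)
   qed (use r in auto)
   have Df: "diff2 f x h = gamma * (?D h + ?E h)" for h
    using far0[of x] x(1) by (simp add: f_def algebra_simps)
   have "abs (?D h + ?E h) <= (C + C2) * min 1 ((norm h)^2)" for h
    using C[OF d, of h] E[of h] unfolding distrib_right by linarith
   from mult_left_mono[OF this, of gamma] have bound: "abs (diff2 f x h) <= (gamma * (C + C2)) * min 1 ((norm h)^2)" for h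
    unfolding Df using gamma by (simp add: abs_mult mult_ac)
   have iD: "lint (%h. kern h * ?D h)" by (rule kern_integrable_dominated[OF _ C[OF d]]) measurable
   have iE: "lint (%h. kern h * ?E h)" by (rule kern_integrable_dominated[OF _ E]) measurable
   have "(LBINT h. kern h * diff2 f x h) = (LBINT h. gamma * (kern h * ?D h + kern h * ?E h))"
    by (rule LINT_cong) (simp_all only: Df distrib_left mult.left_commute)
   also have "... = gamma * ((LBINT h. kern h * ?D h) + (LBINT h. kern h * ?E h))"
    unfolding integral_mult_right_zero LINT_add[OF iD iE] ..
   also have "(LBINT h. kern h * ?D h) = 2 * pi^2"
    using dome_half_laplacian[OF dp, of 1 0] iD by simp
   also have "(LBINT h. kern h * ?E h) <= (LBINT h. C2 * (kern h * min 1 ((norm h)^2)))"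
   proof (rule integral_mono[OF iE])
    show "kern h * ?E h <= C2 * (kern h * min 1 ((norm h)^2))" for h
    proof -
     have "kern h * ?E h <= kern h * (C2 * min 1 ((norm h)^2))" using E[of h] by (intro mult_left_mono) auto
     thus ?thesis by (simp only: mult.left_commute)
    qed
   qed (use kern_min_finite in simp)
   also have "... = C2 * (LBINT h. kern h * min 1 ((norm h)^2))" by simp
   finally have I: "(LBINT h. kern h * diff2 f x h) <= gamma * M" using gamma unfolding M_def by simp
   have "1 <= (l - x .* e) / d0" using xB d0(1) by (simp add: le_divide_eq)
   from mult_left_mono[OF this, of "gamma * M"] I show "(\<forall>h. abs (diff2 f x h) <= gamma * (C + C2) * min 1 ((norm h)^2))
    & (LBINT h. kern h * diff2 f x h) <= gamma * M / d0 * (l - x .* e)" using bound gamma M by simp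
  qed
 qed
 hence "AEL x. x .* e < l --> gamma * dome c r x <= v x" by eventually_elim (use far0 in "auto simp: f_def")
 thus thesis using that gamma by blast
qed

end

section \<open>Boundary charts\<close>

text \<open>Two derivatives of a defining function are retained: the Lipschitz bound
  \<open>L\<close> on the gradient \<open>N\<close> gives uniform interior balls, and continuity of
  \<open>N'\<close> gives boundary curves with continuously differentiable slope.\<close>

locale boundary_chart =
 fixes Omega :: "(real^2) set" and p r rho N N' L
 assumes op: "open Omega" and r: "0 < r" and L: "0 <= L"
  and der: "!!x. x \<in> ball p r ==> (rho has_derivative (%h. N x .* h)) (at x)"
  and nz: "!!x. x \<in> ball p r ==> N x ~= 0"
  and der2: "!!x. x \<in> ball p r ==> (N has_derivative N' x) (at x)"
  and cont2: "!!v. continuous_on (ball p r) (%x. N' x v)"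
  and lip: "!!x y. x \<in> ball p r ==> y \<in> ball p r ==> norm (N x - N y) <= L * norm (x - y)"
  and inside: "!!x. x \<in> ball p r ==> x \<in> Omega \<longleftrightarrow> rho x < (0::real)"
begin

lemma along: 
 assumes "x \<in> ball p r" shows "((%t. rho (x + t *. d)) has_real_derivative N x .* d) (at 0)"
proof -
 have "((%t. x + t *. d) has_derivative (%t. t *. d)) (at 0)" by (auto intro!: derivative_eq_intros)
 from has_derivative_compose[OF this, of rho "%h. N x .* h"] der[OF assms] show ?thesis
  by (simp add: has_field_derivative_def mult.commute[of _ "N x .* d"])
qed

lemma stays: "x \<in> ball p r ==> \<exists>s>0. \<forall>t. abs t < s --> x + t *. d \<in> ball p r"
proof -
 assume x: "x \<in> ball p r"
 have "((%t. x + t *. d) ---> x) (at 0)" by (auto intro!: tendsto_eq_intros)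
 hence "eventually (%t. x + t *. d \<in> ball p r) (at 0)" by (rule topological_tendstoD) (use x in auto)
 then obtain s where "0 < s" "!!t. t ~= 0 ==> abs t < s ==> x + t *. d \<in> ball p r" by (auto simp: eventually_at dist_real_def)
 thus ?thesis using x by (metis add.right_neutral scaleR_zero_left)
qed

lemma descend:
 assumes x: "x \<in> ball p r" and "N x .* d < 0" "rho x <= 0"
 shows "\<exists>s>0. \<forall>t. 0 < t & t < s --> x + t *. d \<in> Omega"
proof -
 obtain s where s: "0 < s" "!!t. 0 < t ==> t < s ==> rho (x + t *. d) < rho x"
  using has_real_derivative_neg_dec_right[OF along[OF x, of d, THEN has_field_derivative_at_within], of UNIV] assms(2) by auto
 obtain s' where s': "0 < s'" "!!t. abs t < s' ==> x + t *. d \<in> ball p r" using stays[OF x, of d] by blast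
 have "x + t *. d \<in> Omega" if "0 < t" "t < min s s'" for t
  using that s(2)[of t] s'(2)[of t] assms(3) by (subst inside) auto
 thus ?thesis using s(1) s'(1) by (intro exI[of _ "min s s'"]) auto
qed

lemma ascend:
 assumes x: "x \<in> ball p r" and "0 < N x .* d" "0 <= rho x"
 shows "\<exists>s>0. \<forall>t. 0 < t & t < s --> x + t *. d \<in> ball p r & 0 < rho (x + t *. d)"
proof -
 obtain s where s: "0 < s" "!!t. 0 < t ==> t < s ==> rho x < rho (x + t *. d)"
  using has_real_derivative_pos_inc_right[OF along[OF x, of d, THEN has_field_derivative_at_within], of UNIV] assms(2) by auto
 obtain s' where s': "0 < s'" "!!t. abs t < s' ==> x + t *. d \<in> ball p r" using stays[OF x, of d] by blast
 have "x + t *. d \<in> ball p r & 0 < rho (x + t *. d)" if "0 < t" "t < min s s'" for t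
  using that s(2)[of t] s'(2)[of t] assms(3) by auto
 thus ?thesis using s(1) s'(1) by (intro exI[of _ "min s s'"]) auto
qed

lemma rho_continuous: "continuous_on (ball p r) rho"
 by (intro continuous_at_imp_continuous_on ballI has_derivative_continuous[OF der])

lemma N_continuous: "continuous_on (ball p r) N"
 by (intro continuous_at_imp_continuous_on ballI has_derivative_continuous[OF der2])

lemma closure_le:
 assumes x: "x \<in> ball p r" "x \<in> closure Omega" shows "rho x <= 0"
proof (rule ccontr)
 assume "~ rho x <= 0"
 hence "x \<in> ball p r \<inter> rho -` {0<..}" using x by auto
 moreover have "open (ball p r \<inter> rho -` {0<..})" using rho_continuous by (intro continuous_open_preimage) auto
 ultimately have "(ball p r \<inter> rho -` {0<..}) \<inter> Omega ~= {}" using x(2) open_Int_closure_eq_empty by blast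
 thus False using inside by force
qed

lemma frontier_iff: "x \<in> ball p r ==> x \<in> frontier Omega \<longleftrightarrow> rho x = 0"
proof -
 assume x: "x \<in> ball p r"
 have "x \<in> closure Omega" if "rho x = 0"
 proof -
  have "N x .* (- N x) < 0" using nz[OF x] by simp
  from descend[OF x this] that obtain s where s: "0 < s" "\<forall>t. 0 < t & t < s --> x + t *. (- N x) \<in> Omega" by (simp only: order_refl) blast
  have "((%t. x + t *. (- N x)) ---> x) (at_right 0)" by (auto intro!: tendsto_eq_intros)
  moreover have "eventually (%t. x + t *. (- N x) \<in> Omega) (at_right 0)" using s unfolding eventually_at_right_field by blast
  ultimately show ?thesis by (intro Lim_in_closed_set[OF closed_closure]) (auto elim: eventually_mono simp: closure_subset[THEN subsetD])
 qed
 moreover have "frontier Omega = closure Omega - Omega" using op by (simp add: frontier_def interior_open)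
 ultimately have "x \<in> frontier Omega \<longleftrightarrow> x \<in> closure Omega & x \<notin> Omega" "rho x = 0 ==> x \<in> closure Omega" by simp_all
 thus ?thesis using closure_le[OF x] inside[OF x] by linarith
qed

lemma exterior_near:
 assumes "x \<in> ball p r" "x \<in> frontier Omega" "0 < eps"
 obtains y where "dist x y < eps" "y \<notin> closure Omega"
proof -
 have "0 < N x .* N x" using nz[OF assms(1)] by simp
 then obtain s where s: "0 < s" "!!t. 0 < t ==> t < s ==> x + t *. N x \<in> ball p r & 0 < rho (x + t *. N x)"
  using ascend[OF assms(1), of "N x"] frontier_iff[OF assms(1)] assms(2) by (simp only: order_refl simp_thms) blast
 define t where "t = min (s / 2) (eps / (2 * norm (N x)))"
 have n: "0 < norm (N x)" using nz[OF assms(1)] by simp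
 have t: "0 < t" "t < s" "t * norm (N x) < eps"
  using s(1) n assms(3) by (auto simp: t_def min_def field_simps)
 show thesis
 proof (rule that)
  show "dist x (x + t *. N x) < eps" using t by (simp add: dist_norm)
  show "x + t *. N x \<notin> closure Omega" using closure_le s(2)[OF t(1,2)] by force
 qed
qed

text \<open>If \<open>w\<close> differed from the normal, the direction \<open>sgn (N x) - w\<close>
  would leave \<open>Omega\<close> to first order and yet have negative inner product with
  \<open>w\<close>.\<close>

lemma touching_direction:
 assumes x: "x \<in> ball p r" "x \<in> frontier Omega" and w: "norm w = 1"
  and desc: "!!d. d .* w < 0 ==> \<exists>s>0. \<forall>t. 0 < t & t < s --> ~ (x + t *. d \<in> ball p r & 0 < rho (x + t *. d))"
 shows "w = sgn (N x)"
proof (rule ccontr)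
 let ?n = "sgn (N x)"
 assume ne: "w ~= ?n"
 have n: "norm ?n = 1" using nz[OF x(1)] by (simp add: norm_sgn)
 have "0 < (norm (w - ?n))^2" using ne by simp
 hence wn: "w .* ?n < 1" using w n by (simp add: power2_norm_eq_inner inner_simps inner_commute norm_eq_1)
 have "(?n - w) .* w < 0" using wn w by (simp add: inner_simps inner_commute norm_eq_1)
 moreover have "0 < N x .* (?n - w)"
 proof -
  have "N x .* (?n - w) = norm (N x) * (?n .* (?n - w))" using nz[OF x(1)] by (simp add: sgn_div_norm)
  thus ?thesis using wn n nz[OF x(1)] by (simp add: inner_simps inner_commute norm_eq_1)
 qed
 moreover have "0 <= rho x" using frontier_iff x by simp
 ultimately obtain s s' where "0 < s" "0 < s'" "!!t. 0 < t ==> t < s ==> x + t *. (?n - w) \<in> ball p r & 0 < rho (x + t *. (?n - w))"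
  "!!t. 0 < t ==> t < s' ==> ~ (x + t *. (?n - w) \<in> ball p r & 0 < rho (x + t *. (?n - w)))"
  using ascend[OF x(1), of "?n - w"] desc[of "?n - w"] by metis
 thus False by (meson dense less_trans min_less_iff_conj)
qed

text \<open>The vector \<open>n\<close> may come from an unrelated defining function, but the
  directions with negative inner product with it enter \<open>Omega\<close>, and these determine the
  normal of the chart.\<close>

lemma outward_unit_normal_eq:
 assumes x: "x \<in> ball p r" and n: "outward_unit_normal Omega x n"
 shows "n = sgn (N x)"
proof -
 obtain U sg D where l: "local_defining_function Omega x U sg" and D: "GDERIV sg x :> D" "n = sgn D"
  using n unfolding outward_unit_normal_def by blast
 have fr: "x \<in> frontier Omega" using n by (simp add: outward_unit_normal_def)
 note l' = l[unfolded local_defining_function_def]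
 have dD: "(sg has_derivative (%h. D .* h)) (at x)" using D(1) by (simp add: gderiv_def inner_commute)
 have "D ~= 0"
 proof
  assume "D = 0"
  hence "frechet_derivative sg (at x) = (%v. 0)" using frechet_derivative_at[OF dD] by simp
  thus False using l' by auto
 qed
 hence n1: "norm n = 1" by (simp add: D norm_sgn)
 have s0: "sg x \<ge> 0" using l' fr op by (auto simp: frontier_def interior_open)
 show ?thesis
 proof (rule touching_direction[OF x fr n1])
  fix d assume d: "d .* n < 0"
  have "((%t. x + t *. d) has_derivative (%t. t *. d)) (at 0)" by (auto intro!: derivative_eq_intros)
  from has_derivative_compose[OF this, of sg "%h. D .* h"] dD
  have dt: "((%t. sg (x + t *. d)) has_real_derivative D .* d) (at 0)"
   by (simp add: has_field_derivative_def mult.commute[of _ "D .* d"])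
  have "D .* d < 0" using d \<open>D ~= 0\<close> by (simp add: D sgn_div_norm inner_commute mult_less_0_iff zero_less_mult_iff divide_less_0_iff)
  then obtain s where s: "0 < s" "!!t. 0 < t ==> t < s ==> sg (x + t *. d) < sg x"
   using has_real_derivative_neg_dec_right[OF dt[THEN has_field_derivative_at_within], of UNIV] by auto
  have "sg x = 0"
  proof (rule ccontr)
   assume "sg x ~= 0"
   hence "0 < sg x" using s0 by simp
   have "(sg ---> sg x) (at x)" using has_derivative_continuous[OF dD] by (simp add: continuous_at)
   hence "eventually (%y. 0 < sg y) (at x)" using \<open>0 < sg x\<close> by (rule order_tendstoD)
   moreover have "eventually (%y. y \<in> U) (at x)" using l' by (intro eventually_at_in_open') auto
   ultimately have "eventually (%y. y \<notin> Omega) (at x)" 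
   proof eventually_elim
    case (elim y)
    hence "y \<notin> Omega \<inter> U" unfolding l'[THEN conjunct2, THEN conjunct2, THEN conjunct2, THEN conjunct2] by auto
    thus ?case using elim by auto
   qed
   then obtain eps where "0 < eps" "!!y. y ~= x ==> dist y x < eps ==> y \<notin> Omega" by (auto simp: eventually_at)
   moreover have "x \<notin> Omega" using fr op by (simp add: frontier_def interior_open)
   ultimately have "ball x eps \<inter> Omega = {}" by (auto simp: dist_commute) metis
   hence "ball x eps \<inter> closure Omega = {}" using open_Int_closure_eq_empty by blast
   thus False using fr \<open>0 < eps\<close> centre_in_ball[of x eps] by (auto simp: frontier_def disjoint_iff simp del: centre_in_ball)
  qed
  have "((%t. x + t *. d) ---> x) (at_right 0)" by (auto intro!: tendsto_eq_intros)
  hence "eventually (%t. x + t *. d \<in> U) (at_right 0)" by (rule topological_tendstoD) (use l' in auto)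
  then obtain s' where s': "0 < s'" "!!t. 0 < t ==> t < s' ==> x + t *. d \<in> U" by (auto simp: eventually_at_right_field)
  show "\<exists>s>0. \<forall>t. 0 < t & t < s --> ~ (x + t *. d \<in> ball p r & 0 < rho (x + t *. d))"
  proof (intro exI[of _ "min s s'"] conjI allI impI)
   fix t assume t: "0 < t & t < min s s'"
   hence "x + t *. d \<in> Omega" using s(2)[of t] s'(2)[of t] \<open>sg x = 0\<close> l' by auto
   thus "~ (x + t *. d \<in> ball p r & 0 < rho (x + t *. d))" using inside by force
  qed (use s s' in auto)
 qed
qed

lemma touching_ball:
 assumes x: "x \<in> ball p r" "x \<in> frontier Omega" and B: "ball c R <= Omega" and R: "0 < R" "norm (x - c) = R"
 shows "x - c = R *. sgn (N x)"
proof -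
 have "(1 / R) *. (x - c) = sgn (N x)"
 proof (rule touching_direction[OF x])
  show "norm ((1 / R) *. (x - c)) = 1" using R by simp
  fix d assume "d .* ((1 / R) *. (x - c)) < 0"
  hence d: "d .* (x - c) < 0" using R by (simp add: divide_less_0_iff)
  have dn: "0 < norm d" using d by auto
  let ?s = "- 2 * (d .* (x - c)) / (norm d)^2"
  have "x + t *. d \<in> Omega" if t: "0 < t" "t < ?s" for t
  proof -
   have "t * (norm d)^2 < - 2 * (d .* (x - c))" using t(2) dn by (subst (asm) pos_less_divide_eq) auto
   hence "t * (t * (norm d)^2) < t * (- 2 * (d .* (x - c)))" using t(1) by (rule mult_strict_left_mono)
   moreover have "(norm (x + t *. d - c))^2 = R^2 + 2 * t * (d .* (x - c)) + t * (t * (norm d)^2)"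
    unfolding R(2)[symmetric] power2_norm_eq_inner by (simp add: inner_simps inner_commute algebra_simps)
   ultimately have "(norm (x + t *. d - c))^2 < R^2" by simp
   hence "norm (x + t *. d - c) < R" by (rule power2_less_imp_less) (use R in simp)
   thus ?thesis using B by (auto simp: dist_norms)
  qed
  thus "\<exists>s>0. \<forall>t. 0 < t & t < s --> ~ (x + t *. d \<in> ball p r & 0 < rho (x + t *. d))"
   using inside d dn by (intro exI[of _ ?s]) (force simp: divide_less_0_iff)
 qed
 moreover have "x - c = R *. ((1 / R) *. (x - c))" using R(1) by simp
 ultimately show ?thesis by (simp only:)
qed

lemma mean_value:
 assumes x: "x \<in> ball p r" and y: "y \<in> ball p r"
 obtains z where "z \<in> ball p r" "norm (z - x) <= norm (y - x)" "rho y - rho x = N z .* (y - x)"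
proof -
 have "\<exists>t. 0 < t & t < 1 & rho (x + 1 *. (y - x)) - rho (x + 0 *. (y - x)) = (1 - 0) * (N (x + t *. (y - x)) .* (y - x))"
 proof (rule MVT2)
  fix t :: real assume t: "0 <= t" "t <= 1"
  have "x + t *. (y - x) = (1 - t) *. x + t *. y" by (simp add: algebra_simps)
  hence z: "x + t *. (y - x) \<in> ball p r" using convexD[OF convex_ball x y, of "1 - t" t] t by simp
  have "((%t. x + t *. (y - x)) has_derivative (%t. t *. (y - x))) (at t)" by (auto intro!: derivative_eq_intros)
  from has_derivative_compose[OF this der[OF z]]
  show "((%t. rho (x + t *. (y - x))) has_real_derivative N (x + t *. (y - x)) .* (y - x)) (at t)"
   by (simp add: has_field_derivative_def mult.commute[of _ "_ .* _"])
 qed simp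
 then obtain t where t: "0 < t" "t < 1" "rho y - rho x = N (x + t *. (y - x)) .* (y - x)" by auto
 have "x + t *. (y - x) = (1 - t) *. x + t *. y" by (simp add: algebra_simps)
 hence "x + t *. (y - x) \<in> ball p r" using convexD[OF convex_ball x y, of "1 - t" t] t by simp
 moreover have "norm (x + t *. (y - x) - x) <= norm (y - x)" using t by (simp add: mult_left_le_one_le)
 ultimately show thesis using that t(3) by blast
qed

text \<open>For a displacement w into the ball, |w|^2 is less than 2 s times the inward component of
  w. Hence the Taylor error L |w|^2 is beaten by the linear term once 2 s L lies below the least
  norm of the gradient.\<close>

lemma uniform_interior_ball:
 obtains s where "0 < s" "!!x. x \<in> cball p (r / 2) ==> x \<in> frontier Omega ==> ball (x - s *. sgn (N x)) s <= Omega"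
proof -
 have sub: "cball p (r / 2) <= ball p r" using r by (auto simp: subset_iff)
 have "\<exists>x\<in>cball p (r / 2). \<forall>y\<in>cball p (r / 2). norm (N x) <= norm (N y)"
  using r by (intro continuous_attains_inf continuous_on_norm continuous_on_subset[OF N_continuous sub]) auto
 then obtain x0 where x0: "x0 \<in> cball p (r / 2)" "!!y. y \<in> cball p (r / 2) ==> norm (N x0) <= norm (N y)" by blast
 define nu where "nu = norm (N x0)"
 have nu: "0 < nu" unfolding nu_def using nz[of x0] x0 sub by auto
 \<comment> \<open>The bound \<open>r / 8\<close> keeps the balls inside the chart, and the summand
   1 excludes division by zero when \<open>L = 0\<close>.\<close>
 define s where "s = min (r / 8) (nu / (2 * (L + 1)))"
 have s: "0 < s" "s <= r / 8" using r nu L by (simp_all only: s_def min.cobounded1) simp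
 have sL: "L * (2 * s) < nu"
 proof -
  have "s * (2 * (L + 1)) <= nu" using L by (subst pos_le_divide_eq[symmetric]) (auto simp: s_def)
  thus ?thesis using s by (simp add: algebra_simps)
 qed
 show thesis
 proof (rule that[OF s(1)], rule subsetI)
  fix x y assume x: "x \<in> cball p (r / 2)" "x \<in> frontier Omega" and y: "y \<in> ball (x - s *. sgn (N x)) s"
  have xr: "x \<in> ball p r" using x sub by auto
  let ?n = "sgn (N x)" and ?w = "y - x"
  have n: "norm ?n = 1" using nz[OF xr] by (simp add: norm_sgn)
  have "norm (?w + s *. ?n) < s" using y by (simp add: dist_norms algebra_simps)
  hence "(norm (?w + s *. ?n))^2 < s^2" by (intro power_strict_mono) auto
  moreover have "(norm (?w + s *. ?n))^2 = (norm ?w)^2 + 2 * s * (?n .* ?w) + s^2"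
   unfolding power2_norm_eq_inner using n by (simp add: inner_simps inner_commute algebra_simps norm_eq_1 power2_eq_square)
  ultimately have q: "(norm ?w)^2 < 2 * s * (- (?n .* ?w))" by simp
  have "0 < 2 * s * (- (?n .* ?w))" using q zero_le_power2[of "norm ?w"] by linarith
  hence nw: "?n .* ?w < 0" using s(1) by (simp add: mult_less_0_iff)
  have "norm ?w <= norm (?w + s *. ?n) + norm (s *. ?n)" using norm_triangle_ineq4[of "?w + s *. ?n" "s *. ?n"] by simp
  hence "norm ?w < 2 * s" using \<open>norm (?w + s *. ?n) < s\<close> n s by simp
  hence yr: "y \<in> ball p r" using x s dist_triangle[of p y x] r by (simp add: dist_norms)
  obtain z where z: "z \<in> ball p r" "norm (z - x) <= norm ?w" "rho y - rho x = N z .* ?w" using mean_value[OF xr yr] .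
  have "N z .* ?w = N x .* ?w + (N z - N x) .* ?w" by (simp add: inner_simps)
  also have "(N z - N x) .* ?w <= norm (N z - N x) * norm ?w" by (rule norm_cauchy_schwarz)
  also have "... <= (L * norm ?w) * norm ?w"
   using lip[OF z(1) xr] z(2) L by (intro mult_right_mono order_trans[OF lip[OF z(1) xr]] mult_left_mono) auto
  also have "... = L * (norm ?w)^2" by (simp add: power2_eq_square)
  also have "... <= L * (2 * s * (- (?n .* ?w)))" using q L by (intro mult_left_mono) auto
  also have "... = L * (2 * s) * (- (?n .* ?w))" by simp
  also have "... < nu * (- (?n .* ?w))" by (rule mult_strict_right_mono[OF sL]) (use nw in simp)
  also have "N x .* ?w + nu * (- (?n .* ?w)) = (norm (N x) - nu) * (?n .* ?w)"
  proof -
   have "N x = norm (N x) *. ?n" using nz[OF xr] by (simp add: sgn_div_norm)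
   hence "N x .* ?w = norm (N x) * (?n .* ?w)" by (metis inner_scaleR_left)
   thus ?thesis by (simp add: algebra_simps)
  qed
  also have "... <= 0"
  proof (rule mult_nonneg_nonpos)
   show "0 <= norm (N x) - nu" using x0(2)[OF x(1)] by (simp add: nu_def)
  qed (use nw in simp)
  finally have "rho y < 0" using z(3) frontier_iff[OF xr] x(2) by simp
  thus "y \<in> Omega" using inside[OF yr] by auto
 qed
qed

end

lemma smooth_boundary_chart:
 assumes op: "open Omega" and sm: "smooth_boundary Omega" and p: "p \<in> frontier (Omega :: (real^2) set)"
 obtains r rho N N' L where "boundary_chart Omega p r rho N N' L"
proof -
 obtain U rho where "local_defining_function Omega p U rho" using sm p unfolding smooth_boundary_def by blast
 hence U: "open U" "p \<in> U" and C: "!!k. Ck_on k U rho" and nz: "!!y. y \<in> U ==> frechet_derivative rho (at y) ~= (%v. 0)"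
  and ins: "Omega \<inter> U = {y \<in> U. rho y < 0}"
  unfolding local_defining_function_def smooth_on_def by auto
 define D where "D x v = frechet_derivative rho (at x) v" for x v
 define D2 where "D2 v x w = frechet_derivative (%x. D x v) (at x) w" for v x w
 have d1: "(rho has_derivative D x) (at x)" if "x \<in> U" for x
  using C[of "Suc 0"] that by (simp add: D_def[abs_def] frechet_derivative_works[symmetric])
 have C2: "Ck_on (Suc 0) U (%x. D x v)" for v using C[of "Suc (Suc 0)"] by (simp add: D_def)
 hence d2: "((%x. D x v) has_derivative D2 v x) (at x)" if "x \<in> U" for x v
  using that by (simp add: D2_def[abs_def] frechet_derivative_works[symmetric])
 have c2: "continuous_on U (%x. D2 v x w)" for v w using C2[of v] by (simp add: D2_def)
 let ?e1 = "axis 1 1 :: real^2" and ?e2 = "axis 2 1 :: real^2"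
 define N where "N x = vec2 (D x ?e1) (D x ?e2)" for x
 define N' where "N' x w = vec2 (D2 ?e1 x w) (D2 ?e2 x w)" for x w
 have ND: "N x .* h = D x h" if "x \<in> U" for x h
 proof -
  have lin: "linear (D x)" using d1[OF that] by (rule has_derivative_linear)
  have "D x h = D x (h $ 1 *. ?e1 + h $ 2 *. ?e2)" using vec2_eta[of h] by (simp add: vec2_def)
  also have "... = h $ 1 * D x ?e1 + h $ 2 * D x ?e2" by (simp add: linear_add[OF lin] linear_scale[OF lin])
  finally show ?thesis by (simp add: N_def inner_real2 mult.commute)
 qed
 have dN: "(N has_derivative N' x) (at x)" if "x \<in> U" for x
  unfolding N_def[abs_def] N'_def[abs_def] vec2_def by (intro has_derivative_add has_derivative_scaleR_left d2 that)
 have cN': "continuous_on U (%x. N' x w)" for w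
  unfolding N'_def vec2_def by (intro continuous_intros c2)
 obtain r where r: "0 < r" "cball p r <= U" using U open_contains_cball by blast
 have sub: "ball p r <= U" using r(2) ball_subset_cball[of p r] by (rule order_trans[rotated])
 have "\<exists>B. \<forall>x\<in>cball p r. norm (N' x w) <= B" for w
 proof -
  have "bounded ((%x. N' x w) ` cball p r)"
   by (intro compact_imp_bounded compact_continuous_image continuous_on_subset[OF cN' r(2)]) simp
  thus ?thesis by (auto simp: bounded_iff)
 qed
 then obtain B where B: "!!x w. x \<in> cball p r ==> norm (N' x w) <= B w" by metis
 define L where "L = abs (B ?e1) + abs (B ?e2)"
 have on: "onorm (N' x) <= L" if x: "x \<in> ball p r" for x
 proof (rule onorm_le)
  fix h
  have lin: "linear (N' x)" by (rule has_derivative_linear[OF dN[OF subsetD[OF sub x]]])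
  have "N' x h = N' x (h $ 1 *. ?e1 + h $ 2 *. ?e2)" using vec2_eta[of h] by (simp add: vec2_def)
  also have "... = h $ 1 *. N' x ?e1 + h $ 2 *. N' x ?e2" by (simp add: linear_add[OF lin] linear_scale[OF lin])
  also have "norm ... <= norm h * abs (B ?e1) + norm h * abs (B ?e2)"
   using B[of x ?e1] B[of x ?e2] x component_le_norm_cart[of h 1] component_le_norm_cart[of h 2]
   by (intro norm_triangle_le add_mono) (auto intro!: mult_mono)
  finally show "norm (N' x h) <= L * norm h" by (simp add: L_def algebra_simps)
 qed
 have "boundary_chart Omega p r rho N N' L"
 proof
  fix x y assume x: "x \<in> ball p r" and y: "y \<in> ball p r"
  show "norm (N x - N y) <= L * norm (x - y)"
   by (rule differentiable_bound[OF convex_ball[of p r] has_derivative_at_withinI[OF dN[OF subsetD[OF sub]]] on x y])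
 next
  fix x assume x: "x \<in> ball p r"
  hence xU: "x \<in> U" using sub by auto
  have "D x = (%h. N x .* h)" using ND[OF xU] by auto
  thus "(rho has_derivative (%h. N x .* h)) (at x)" using d1[OF xU] by simp
  show "N x ~= 0" using nz[OF xU] \<open>D x = (%h. N x .* h)\<close> by (auto simp: D_def[abs_def])
  show "(N has_derivative N' x) (at x)" by (rule dN[OF xU])
  show "x \<in> Omega \<longleftrightarrow> rho x < 0" using ins xU by blast
 qed (use op r sub cN' in "auto simp: L_def intro: continuous_on_subset")
 thus thesis by (rule that)
qed

definition perp :: "real^2 => real^2" where
 "perp e = vec2 (- e $ 2) (e $ 1)"

lemma perp_inner [simp]: "perp e .* e = 0" "e .* perp e = 0"
 by (simp_all add: perp_def inner_real2)
lemma perp_norm [simp]: "norm (perp e) = norm e"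
 using norm_vec2[of "e $ 1" "e $ 2"] by (simp add: perp_def norm_vec2 vec2_eta add.commute)
lemma perp_expansion:
 assumes "norm e = 1" shows "h = (h .* e) *. e + (h .* perp e) *. perp e"
proof -
 have 1: "(e $ 1)^2 + (e $ 2)^2 = 1" using assms norm_vec2[of "e $ 1" "e $ 2"] by (simp add: vec2_eta)
 have "h $ 1 = (h .* e) * e $ 1 - (h .* perp e) * e $ 2" "h $ 2 = (h .* e) * e $ 2 + (h .* perp e) * e $ 1"
  unfolding perp_def inner_real2 vec2_nth using 1 by algebra+
 thus ?thesis by (simp add: vec_eq_iff forall_2 perp_def)
qed

context boundary_chart
begin

text \<open>Inverse function theorem for a map that straightens the boundary while keeping the
  coordinate along \<open>e\<close>. The slope \<open>m\<close> is read off from the normal, so its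
  derivative involves the second derivatives of \<open>rho\<close> and is continuous.\<close>

lemma curve:
 assumes p: "p \<in> frontier Omega" and e: "norm e = 1" and tr: "N p .* perp e ~= 0"
 obtains a q m m' where "0 < a"
  "!!s. abs (s - p .* e) < a ==> q s \<in> ball p (r / 2) & q s \<in> frontier Omega & q s .* e = s & 0 < (N p .* perp e) * (N (q s) .* perp e)
   & N (q s) .* e = - m s * (N (q s) .* perp e) & (q has_vector_derivative (e + m s *. perp e)) (at s)
   & (m has_real_derivative m' s) (at s) & isCont m' s"
  "!!x. x \<in> ball p a ==> x \<in> frontier Omega ==> q (x .* e) = x"
proof -
 let ?f = "perp e"
 have ee: "e .* e = 1" "?f .* ?f = 1" using e perp_norm[of e] unfolding norm_eq_1[symmetric] by simp_all
 have "((%x. (N p .* ?f) * (N x .* ?f)) ---> (N p .* ?f) * (N p .* ?f)) (at p)"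
  using has_derivative_continuous[OF der2[of p]] r by (intro tendsto_intros) (simp add: continuous_at)
 moreover have pp: "0 < (N p .* ?f) * (N p .* ?f)" using tr by (auto simp: zero_less_mult_iff linorder_neq_iff)
 ultimately have "eventually (%x. 0 < (N p .* ?f) * (N x .* ?f)) (at p)" by (rule order_tendstoD)
 then obtain d where d: "0 < d" "!!x. dist x p < d ==> 0 < (N p .* ?f) * (N x .* ?f)" using pp unfolding eventually_at by (elim exE conjE) (metis UNIV_I)
 define r' where "r' = min (r / 2) d"
 have r': "0 < r'" using r d by (simp add: r'_def)
 let ?S = "ball p r'"
 have S: "x \<in> ball p r" "x \<in> ball p (r / 2)" "N x .* ?f ~= 0" "0 < (N p .* ?f) * (N x .* ?f)" if "x \<in> ?S" for x
  using that d(2)[of x] r by (auto simp: r'_def dist_commute)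
 define Phi where "Phi x = (x .* e) *. e + rho x *. ?f" for x
 define g where "g = inv_into ?S Phi"
 \<comment> \<open>The inverse of the derivative of \<open>Phi\<close>: the component along
   \<open>e\<close> is prescribed, and the one along \<open>perp e\<close> is solved from
   \<open>N x .* h\<close>.\<close>
 define G where "G x k = (k .* e) *. (e - (N x .* e / (N x .* ?f)) *. ?f) + ((k .* ?f) / (N x .* ?f)) *. ?f" for x k
 have Phie: "Phi x .* e = x .* e" "Phi x .* ?f = rho x" for x by (simp_all add: Phi_def inner_simps ee)
 have inj: "inj_on Phi ?S"
 proof (rule inj_onI)
  fix x y assume xy: "x \<in> ?S" "y \<in> ?S" "Phi x = Phi y"
  have eq: "x .* e = y .* e" "rho x = rho y" using Phie xy(3) by metis+
  interpret S: boundary_chart Omega p r' rho N N' L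
   by (unfold_locales; (rule continuous_on_subset[OF cont2])?) (use op r' L der nz der2 lip inside S(1) in auto)
  obtain z where z: "z \<in> ?S" "rho y - rho x = N z .* (y - x)" using S.mean_value[OF xy(1,2)] by blast
  have yx: "y - x = ((y - x) .* ?f) *. ?f" using perp_expansion[OF e, of "y - x"] unfolding inner_diff_left eq(1) by simp
  have "N z .* (y - x) = 0" using z(2) eq(2) by simp
  hence "((y - x) .* ?f) * (N z .* ?f) = 0" by (subst (asm) yx) simp
  hence "(y - x) .* ?f = 0" using S(3)[OF z(1)] by simp
  thus "x = y" using yx by simp
 qed
 have dPhi: "(Phi has_derivative (%h. (h .* e) *. e + (N x .* h) *. ?f)) (at x)" if "x \<in> ?S" for x
  unfolding Phi_def[abs_def] using der[OF S(1)[OF that]] by (auto intro!: derivative_eq_intros)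
 have cPhi: "continuous_on ?S Phi"
  by (intro continuous_at_imp_continuous_on ballI has_derivative_continuous[OF dPhi])
 have gF: "g (Phi x) = x" if "x \<in> ?S" for x unfolding g_def using inj that by (rule inv_into_f_f)
 have dg: "(g has_derivative G x) (at (Phi x))" if x: "x \<in> ?S" for x
 proof (rule has_derivative_inverse_strong[OF open_ball x cPhi gF dPhi[OF x]])
  show "(%h. (h .* e) *. e + (N x .* h) *. ?f) \<circ> G x = id"
  proof
   fix k
   have "N x .* G x k = k .* ?f" "G x k .* e = k .* e" unfolding G_def using S(3)[OF x] by (simp_all add: inner_simps ee)
   thus "((%h. (h .* e) *. e + (N x .* h) *. ?f) \<circ> G x) k = id k" using perp_expansion[OF e, of k] by simp
  qed
 qed
 have oV: "open (Phi ` ?S)" by (rule invariance_of_domain[OF cPhi open_ball inj])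
 have pS: "p \<in> ?S" "rho p = 0" using r' p frontier_iff[of p] r by auto
 hence "(p .* e) *. e \<in> Phi ` ?S" by (intro image_eqI[of _ _ p]) (simp_all add: Phi_def)
 then obtain a0 where a0: "0 < a0" "ball ((p .* e) *. e) a0 <= Phi ` ?S" using oV open_contains_ball by blast
 define a where "a = min a0 r'"
 define q where "q s = g (s *. e)" for s
 define m where "m s = - (N (q s) .* e) / (N (q s) .* ?f)" for s
 define w where "w s = N' (q s) (e + m s *. ?f)" for s
 define m' where "m' s = (- (w s .* e) * (N (q s) .* ?f) - - (N (q s) .* e) * (w s .* ?f)) / ((N (q s) .* ?f) * (N (q s) .* ?f))" for s
 have q: "q s \<in> ?S" "Phi (q s) = s *. e" if "abs (s - p .* e) < a" for s
 proof -
  have "dist ((p .* e) *. e) (s *. e) = abs (s - p .* e)" using e by (simp add: dist_norm scaleR_diff_left[symmetric] abs_minus_commute)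
  hence "s *. e \<in> Phi ` ?S" using that a0(2) by (auto simp: a_def)
  thus "q s \<in> ?S" "Phi (q s) = s *. e" unfolding q_def g_def by (blast intro: inv_into_into, blast intro: f_inv_into_f)
 qed
 have dq: "(q has_vector_derivative (e + m s *. ?f)) (at s)" if s: "abs (s - p .* e) < a" for s
 proof -
  have "((%s. s *. e) has_derivative (%t. t *. e)) (at s)" by (auto intro!: derivative_eq_intros)
  from has_derivative_compose[OF this, of g] dg[OF q(1)[OF s]] q(2)[OF s]
  have "(q has_derivative (%t. G (q s) (t *. e))) (at s)" unfolding q_def[abs_def] by simp
  moreover have "G (q s) (t *. e) = t *. (e + m s *. ?f)" for t
   by (simp add: G_def m_def ee algebra_simps)
  ultimately show ?thesis by (simp add: has_vector_derivative_def)
 qed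
 have dw: "((%s. N (q s)) has_vector_derivative w s) (at s)" if s: "abs (s - p .* e) < a" for s
 proof -
  have l: "linear (N' (q s))" using der2[OF S(1)[OF q(1)[OF s]]] by (rule has_derivative_linear)
  show ?thesis
   using has_derivative_compose[OF dq[OF s, unfolded has_vector_derivative_def] der2[OF S(1)[OF q(1)[OF s]]]]
   by (simp add: has_vector_derivative_def w_def linear_scale[OF l])
 qed
 have dm: "(m has_real_derivative m' s) (at s)" if s: "abs (s - p .* e) < a" for s
 proof -
  have di: "((%s. N (q s) .* y) has_real_derivative w s .* y) (at s)" for y
   using has_derivative_inner_left[OF dw[OF s, unfolded has_vector_derivative_def], of y]
   by (simp add: has_field_derivative_def mult_commute_abs)
  show ?thesis unfolding m_def[abs_def] m'_def
   by (intro DERIV_divide DERIV_minus di S(3)[OF q(1)[OF s]])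
 qed
 have cm: "isCont m' s" if s: "abs (s - p .* e) < a" for s
 proof -
  have cq: "isCont q s" using has_vector_derivative_continuous[OF dq[OF s]] .
  have cN: "isCont (%s. N (q s)) s" using has_vector_derivative_continuous[OF dw[OF s]] .
  have cv: "isCont (%s. N' (q s) y) s" for y
  proof -
   have "isCont (%x. N' x y) (q s)" using cont2[of y] S(1)[OF q(1)[OF s]] by (simp add: continuous_on_eq_continuous_at)
   thus ?thesis by (rule isCont_o2[OF cq])
  qed
  have cmm: "isCont m s" using dm[OF s] by (rule DERIV_isCont)
  have ev: "eventually (%t. t \<in> {t. abs (t - p .* e) < a}) (nhds s)"
   using s by (intro eventually_nhds_in_open open_Collect_less continuous_intros) auto
  have "eventually (%t. N' (q t) e + m t *. N' (q t) ?f = w t) (nhds s)" using ev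
  proof eventually_elim
   case (elim t)
   have l: "linear (N' (q t))" using der2[OF S(1)[OF q(1)]] elim by (auto dest: has_derivative_linear)
   show ?case by (simp add: w_def linear_add[OF l] linear_scale[OF l])
  qed
  hence "isCont w s" using isCont_cong[of "%t. N' (q t) e + m t *. N' (q t) ?f" w s] cv cmm by (simp add: continuous_intros)
  thus ?thesis unfolding m'_def[abs_def] using cN S(3)[OF q(1)[OF s]] by (intro continuous_intros) auto
 qed
 show thesis
 proof (rule that[of a q m m'])
  show "0 < a" using a0 r' by (simp add: a_def)
  fix s assume s: "abs (s - p .* e) < a"
  have "q s .* e = s" "rho (q s) = 0" using Phie[of "q s"] q(2)[OF s] ee by simp_all
  moreover have "N (q s) .* e = - m s * (N (q s) .* ?f)" using S(3)[OF q(1)[OF s]] by (simp add: m_def)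
  ultimately show "q s \<in> ball p (r / 2) & q s \<in> frontier Omega & q s .* e = s & 0 < (N p .* perp e) * (N (q s) .* perp e)
   & N (q s) .* e = - m s * (N (q s) .* perp e) & (q has_vector_derivative (e + m s *. perp e)) (at s)
   & (m has_real_derivative m' s) (at s) & isCont m' s"
   using S[OF q(1)[OF s]] frontier_iff[of "q s"] dq[OF s] dm[OF s] cm[OF s] by simp
 next
  fix x assume x: "x \<in> ball p a" "x \<in> frontier Omega"
  hence xS: "x \<in> ?S" by (simp add: a_def)
  hence "Phi x = (x .* e) *. e" using frontier_iff[OF S(1)[OF xS]] x(2) by (simp add: Phi_def)
  thus "q (x .* e) = x" using gF[OF xS] by (simp add: q_def)
 qed
qed

end

section \<open>Moving planes\<close>

context boundary_chart
begin

text \<open>Mean value theorem on a ball where \<open>N x .* d\<close> stays negative. Unlike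
  \<open>descend\<close>, the conclusion is uniform in the starting point.\<close>

lemma push:
 assumes "N p .* d < 0"
 obtains s where "0 < s" "s <= r" "!!x t. x \<in> ball p s ==> rho x <= 0 ==> 0 < t ==> x + t *. d \<in> ball p s ==> x + t *. d \<in> Omega"
proof -
 have "((%x. N x .* d) ---> N p .* d) (at p)"
  using has_derivative_continuous[OF der2[of p]] r by (intro tendsto_intros) (simp add: continuous_at)
 hence "eventually (%x. N x .* d < 0) (at p)" using assms by (rule order_tendstoD)
 then obtain s0 where s0: "0 < s0" "!!x. dist x p < s0 ==> N x .* d < 0" using assms unfolding eventually_at by (elim exE conjE) (metis UNIV_I)
 define s where "s = min s0 r"
 have s: "0 < s" "s <= r" "!!x. x \<in> ball p s ==> x \<in> ball p r & N x .* d < 0" using s0 r by (auto simp: s_def dist_commute)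
 interpret S: boundary_chart Omega p s rho N N' L
  by (unfold_locales; (rule continuous_on_subset[OF cont2])?) (use op s L der nz der2 lip inside in auto)
 show thesis
 proof (rule that[OF s(1,2)])
  fix x t assume x: "x \<in> ball p s" "rho x <= 0" and t: "(0::real) < t" "x + t *. d \<in> ball p s"
  obtain z where z: "z \<in> ball p s" "rho (x + t *. d) - rho x = N z .* (x + t *. d - x)" using S.mean_value[OF x(1) t(2)] by blast
  have "t * (N z .* d) < 0" using s(3)[OF z(1)] t(1) by (simp add: mult_less_0_iff)
  hence "rho (x + t *. d) < 0" using z(2) x(2) by simp
  thus "x + t *. d \<in> Omega" using S.inside[OF t(2)] by simp
 qed
qed

end

lemma tendsto_reflect [tendsto_intros]:
 "(f ---> e) F ==> (g ---> l) F ==> (h ---> x) F ==> ((%k. reflect (f k) (g k) (h k)) ---> reflect e l x) F"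
 unfolding reflect_def by (intro tendsto_intros)

locale smooth_domain =
 fixes Omega :: "(real^2) set"
 assumes op: "open Omega" and bd: "bounded Omega" and ne: "Omega ~= {}" and sm: "smooth_boundary Omega"
begin

lemma chart:
 assumes "p \<in> frontier Omega" obtains r rho N N' L where "boundary_chart Omega p r rho N N' L"
 using smooth_boundary_chart[OF op sm assms] by blast

text \<open>Exterior points accumulate at every boundary point, so \<open>Omega\<close> is the
  interior of its closure. This is how inclusions survive limits that only land in the
  closure.\<close>

lemma open_subset_closure:
 assumes W: "open W" "W <= closure Omega" shows "W <= Omega"
proof
 fix x assume x: "x \<in> W"
 show "x \<in> Omega"
 proof (rule ccontr)
  assume "x \<notin> Omega"
  hence fr: "x \<in> frontier Omega" using x W op by (auto simp: frontier_def interior_open)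
  then obtain r rho N N' L where "boundary_chart Omega x r rho N N' L" by (rule chart)
  then interpret boundary_chart Omega x r rho N N' L .
  obtain eps where "0 < eps" "ball x eps <= W" using W x open_contains_ball by blast
  moreover obtain y where "dist x y < eps" "y \<notin> closure Omega"
   using exterior_near[OF _ fr \<open>0 < eps\<close>] r by auto
  ultimately show False using W(2) by auto
 qed
qed

lemma frontier_eq: "frontier Omega = closure Omega - Omega" using op by (simp add: frontier_def interior_open)

lemma locally_inward: "locally_inward Omega"
 unfolding locally_inward_def
proof
 fix x assume x: "x \<in> closure Omega"
 show "\<exists>r>0. \<exists>e. \<exists>t0>0. \<forall>z\<in>cball x r \<inter> closure Omega. \<forall>t. 0 < t --> t < t0 --> z + t *. e \<in> Omega"
 proof (cases "x \<in> Omega")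
  case True
  then obtain r where "0 < r" "cball x r <= Omega" using op open_contains_cball by blast
  thus ?thesis by (intro exI[of _ r] conjI exI[of _ 0] exI[of _ 1]) auto
 next
  case False
  hence fr: "x \<in> frontier Omega" using x by (simp add: frontier_eq)
  then obtain r rho N N' L where "boundary_chart Omega x r rho N N' L" by (rule chart)
  then interpret boundary_chart Omega x r rho N N' L .
  have "N x .* (- N x) < 0" using nz[of x] r by simp
  then obtain s where s: "0 < s" "s <= r" "!!z t. z \<in> ball x s ==> rho z <= 0 ==> 0 < t ==> z + t *. (- N x) \<in> ball x s ==> z + t *. (- N x) \<in> Omega"
   by (rule push) (rule that)
  have n: "0 < norm (N x)" using nz[of x] r by simp
  have "\<forall>z\<in>cball x (s / 2) \<inter> closure Omega. \<forall>t. 0 < t --> t < s / (2 * norm (N x)) --> z + t *. (- N x) \<in> Omega"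
  proof (intro ballI allI impI)
   fix z t assume z: "z \<in> cball x (s / 2) \<inter> closure Omega" and t: "0 < t" "t < s / (2 * norm (N x))"
   have tn: "t * norm (N x) < s / 2" using t(2) n by (simp add: less_divide_eq mult_ac)
   have zb: "z \<in> ball x s" using z s(1) by auto
   moreover have "rho z <= 0" using closure_le[of z] z zb s(2) by auto
   moreover have "dist x (z + t *. (- N x)) <= dist x z + t * norm (N x)"
    using norm_triangle_ineq[of "x - z" "t *. N x"] t(1) by (simp add: dist_norm algebra_simps)
   hence "z + t *. (- N x) \<in> ball x s" using z tn by auto
   ultimately show "z + t *. (- N x) \<in> Omega" using s(3) t(1) by blast
  qed
  moreover have "0 < s / 2" "0 < s / (2 * norm (N x))" using s n by simp_all
  ultimately show ?thesis by blast
 qed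
qed

text \<open>Every position from infinity down to \<open>l\<close> is demanded, not just
  \<open>l\<close> itself. This makes the condition monotone in \<open>l\<close>, closed under
  limits, and strong enough to give star-shapedness at the end.\<close>

definition good :: "real^2 => real => bool" where
 "good e l \<longleftrightarrow> (\<forall>mu\<ge>l. \<forall>x\<in>Omega. mu < x .* e --> reflect e mu x \<in> Omega)"

lemma good_mono: "good e l ==> l <= l' ==> good e l'"
 by (auto simp: good_def)

lemma reflect_into:
 assumes e: "norm e = 1" and W: "open W" "x \<in> W" "!!y. y \<in> W ==> reflect e mu y \<in> closure Omega"
 shows "reflect e mu x \<in> Omega"
proof -
 have "open (reflect e mu -` W)" using W(1) by (rule open_vimage) (rule reflect_continuous)
 moreover have "reflect e mu -` W <= closure Omega"
 proof
  fix y assume "y \<in> reflect e mu -` W"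
  thus "y \<in> closure Omega" using W(3)[of "reflect e mu y"] e by simp
 qed
 ultimately have "reflect e mu -` W <= Omega" by (rule open_subset_closure)
 thus ?thesis using W(2) e by auto
qed

text \<open>In the limit a reflected point is only known to lie in the closure; since this holds for
  a whole open set of points, \<open>reflect_into\<close> brings it back into
  \<open>Omega\<close>.\<close>

lemma reflect_limit:
 fixes f :: "nat => real^2"
 assumes f: "f ----> e" "norm e = 1" and m: "m ----> mu" and x: "x \<in> Omega" and W: "open W" "x \<in> W"
  and ev: "!!y. y \<in> W ==> eventually (%k. y \<in> Omega --> reflect (f k) (m k) y \<in> Omega) sequentially"
 shows "reflect e mu x \<in> Omega"
proof (rule reflect_into[OF f(2), of "W \<inter> Omega"])
 fix y assume y: "y \<in> W \<inter> Omega"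
 have "(%k. reflect (f k) (m k) y) ----> reflect e mu y" by (intro tendsto_intros f m)
 moreover have "eventually (%k. reflect (f k) (m k) y \<in> closure Omega) sequentially"
  using ev[of y] y by (auto elim!: eventually_mono simp: closure_subset[THEN subsetD])
 ultimately show "reflect e mu y \<in> closure Omega" by (intro Lim_in_closed_set[OF closed_closure]) auto
qed (use W x op in auto)

lemma good_closed:
 assumes f: "f ----> e" "norm e = 1" and m: "m ----> l" and g: "!!k. good (f k) (m k)"
 shows "good e l"
 unfolding good_def
proof (intro allI impI ballI)
 fix mu x assume mu: "l <= mu" and x: "x \<in> Omega" "mu < x .* e"
 show "reflect e mu x \<in> Omega"
 proof (rule reflect_limit[OF f, of "%k. mu + (m k - l)" _ _ "{y. mu < y .* e}"])
  show "(%k. mu + (m k - l)) ----> mu" using tendsto_add[OF tendsto_const tendsto_diff[OF m tendsto_const], of mu l] by simp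
  fix y assume "y \<in> {y. mu < y .* e}"
  hence "0 < y .* e - mu - (l - l)" by simp
  moreover have "(%k. y .* f k - mu - (m k - l)) ----> y .* e - mu - (l - l)" by (intro tendsto_intros f m)
  ultimately have "eventually (%k. 0 < y .* f k - mu - (m k - l)) sequentially" by (metis order_tendstoD(1))
  thus "eventually (%k. y \<in> Omega --> reflect (f k) (mu + (m k - l)) y \<in> Omega) sequentially"
  proof eventually_elim
   case (elim k)
   thus ?case using g[of k] mu by (auto simp: good_def)
  qed
 qed (use x in "auto intro!: open_Collect_less continuous_intros")
qed

definition symmetric_about :: "real^2 => real => bool" where
 "symmetric_about e l \<longleftrightarrow> (\<forall>x\<in>Omega. reflect e l x \<in> Omega)"

lemma symmetric_closed:
 assumes f: "f ----> e" "norm e = 1" and m: "m ----> l" and g: "!!k. symmetric_about (f k) (m k)"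
 shows "symmetric_about e l"
 unfolding symmetric_about_def
 by (intro ballI reflect_limit[OF f m _ open_UNIV]) (use g in "auto simp: symmetric_about_def")

lemma good_bounds:
 obtains B where "!!x. x \<in> Omega ==> norm x <= B" "!!e. norm e = 1 ==> good e B" "!!e l. norm e = 1 ==> good e l ==> - B <= l"
proof -
 obtain B where B: "!!x. x \<in> Omega ==> norm x <= B" using bd by (auto simp: bounded_iff)
 have Be: "abs (x .* e) <= B" if "x \<in> Omega" "norm e = 1" for x e using Cauchy_Schwarz_ineq2[of x e] B[OF that(1)] that(2) by simp
 show thesis
 proof (rule that[of B])
  fix e assume e: "norm (e::real^2) = 1"
  show "good e B" unfolding good_def using Be[OF _ e] by force
  fix l assume g: "good e l"
  obtain x where x: "x \<in> Omega" using ne by auto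
  show "- B <= l"
  proof (rule ccontr)
   assume "~ - B <= l"
   hence "l < x .* e" using Be[OF x e] by linarith
   hence "reflect e l x \<in> Omega" using g x by (auto simp: good_def)
   thus False using Be[OF _ e] Be[OF x e] reflect_inner[OF e, of l x] \<open>~ - B <= l\<close> by force
  qed
 qed (rule B)
qed

lemma stop_exists:
 assumes e: "norm e = 1" obtains l where "good e l" "!!l'. l' < l ==> ~ good e l'"
proof -
 obtain B where B: "!!e. norm e = 1 ==> good e B" "!!e l. norm e = 1 ==> good e l ==> - B <= l" using good_bounds by metis
 let ?A = "{l. good e l}" and ?l = "Inf {l. good e l}"
 have A: "?A ~= {}" "bdd_below ?A" using B e by (auto intro!: bdd_belowI[of _ "- B"])
 show thesis
 proof (rule that)
  show "~ good e l'" if "l' < ?l" for l' using that cInf_lower[OF _ A(2), of l'] by auto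
  show "good e ?l"
  proof (rule good_closed[OF tendsto_const e])
   show "(%k. ?l + 1 / real (Suc k)) ----> ?l" using tendsto_add[OF tendsto_const LIMSEQ_inverse_real_of_nat, of ?l] by (simp add: inverse_eq_divide)
   fix k
   have "?l < ?l + 1 / real (Suc k)" by simp
   then obtain l' where "good e l'" "l' < ?l + 1 / real (Suc k)" using cInf_lessD[OF A(1)] by blast
   thus "good e (?l + 1 / real (Suc k))" by (auto intro: good_mono)
  qed
 qed
qed

text \<open>Failures of the inclusion for lines \<open>mu k\<close> tending to \<open>l\<close> from
  below accumulate at a point \<open>y\<close>. If \<open>y\<close> lies beyond the line, it and its
  image are boundary points; if it lies on the line, both signs of \<open>N y .* e\<close> are
  impossible.\<close>

lemma stop_dichotomy:
 assumes e: "norm e = 1" and g: "good e l" and st: "!!l'. l' < l ==> ~ good e l'"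
 shows "(\<exists>x\<in>frontier Omega. l < x .* e & reflect e l x \<in> frontier Omega)
  \<or> (\<exists>x\<in>frontier Omega. x .* e = l & (\<forall>n. outward_unit_normal Omega x n --> n .* e = 0))"
proof -
 have "\<exists>mu x. l - 1 / real (Suc k) <= mu & mu < l & x \<in> Omega & mu < x .* e & reflect e mu x \<notin> Omega" for k
 proof -
  have "~ good e (l - 1 / real (Suc k))" by (rule st) simp
  thus ?thesis using g unfolding good_def by (meson not_le)
 qed
 then obtain mu x where mx: "!!k. l - 1 / real (Suc k) <= mu k" "!!k. mu k < l" "!!k. x k \<in> Omega" "!!k. mu k < x k .* e" "!!k. reflect e (mu k) (x k) \<notin> Omega"
  by metis
 have "\<forall>k. x k \<in> closure Omega" using mx(3) closure_subset by blast
 then obtain y sg where y: "y \<in> closure Omega" and sg: "strict_mono sg" and xl: "(x \<circ> sg) ----> y"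
  using bd compact_closure unfolding compact_def by metis
 have "mu ----> l"
 proof (rule tendsto_sandwich[OF _ _ _ tendsto_const])
  show "(%k. l - 1 / real (Suc k)) ----> l" using tendsto_diff[OF tendsto_const LIMSEQ_inverse_real_of_nat, of l] by (simp add: inverse_eq_divide)
 qed (use mx(1) less_imp_le[OF mx(2)] in simp_all)
 from LIMSEQ_subseq_LIMSEQ[OF this sg] have ml: "(mu \<circ> sg) ----> l" .
 have Rl: "(%k. reflect e ((mu \<circ> sg) k) ((x \<circ> sg) k)) ----> reflect e l y" by (intro tendsto_intros ml xl)
 have Ry: "reflect e l y \<notin> Omega"
 proof -
  have "reflect e l y \<in> - Omega" by (rule Lim_in_closed_set[OF _ _ _ Rl]) (use op mx(5) in auto)
  thus ?thesis by simp
 qed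
 have ye: "l <= y .* e"
  by (rule tendsto_le[OF _ tendsto_inner[OF xl tendsto_const] ml]) (use less_imp_le[OF mx(4)] in simp_all)
 show ?thesis
 proof (cases "l < y .* e")
  case True
  have "y \<notin> Omega" using g True Ry by (auto simp: good_def)
  hence yf: "y \<in> frontier Omega" using y by (simp add: frontier_eq)
  have "(%k. reflect e l ((x \<circ> sg) k)) ----> reflect e l y" by (intro tendsto_intros xl)
  moreover have "eventually (%k. reflect e l ((x \<circ> sg) k) \<in> closure Omega) sequentially"
  proof -
   have "(%k. (x \<circ> sg) k .* e) ----> y .* e" by (intro tendsto_intros xl)
   hence "eventually (%k. l < (x \<circ> sg) k .* e) sequentially" using True by (rule order_tendstoD)
   thus ?thesis
   proof eventually_elim
    case (elim k)
    hence "reflect e l ((x \<circ> sg) k) \<in> Omega" using g mx(3) by (auto simp: good_def)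
    thus ?case using closure_subset by blast
   qed
  qed
  ultimately have "reflect e l y \<in> closure Omega" by (intro Lim_in_closed_set[OF closed_closure]) auto
  thus ?thesis using yf True Ry by (auto simp: frontier_eq)
 next
  case False
  hence yl: "y .* e = l" using ye by simp
  hence Ryy: "reflect e l y = y" by (rule reflect_fixed)
  hence yf: "y \<in> frontier Omega" using y Ry by (simp add: frontier_eq)
  then obtain r rho N N' L where "boundary_chart Omega y r rho N N' L" by (rule chart)
  then interpret boundary_chart Omega y r rho N N' L .
  have y0: "y \<in> ball y r" "rho y = 0" using r yf frontier_iff by auto
  \<comment> \<open>Otherwise moving by a multiple of \<open>- e\<close> would enter
    \<open>Omega\<close> uniformly near \<open>y\<close>; the reflections of the points
    \<open>x k\<close> are such moves and stay outside.\<close>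
  have "~ 0 < N y .* e"
  proof
   assume "0 < N y .* e"
   hence "N y .* (- e) < 0" by simp
   then obtain s where s: "0 < s" "s <= r" "!!z t. z \<in> ball y s ==> rho z <= 0 ==> 0 < t ==> z + t *. (- e) \<in> ball y s ==> z + t *. (- e) \<in> Omega"
    by (rule push) (rule that)
   have "eventually (%k. (x \<circ> sg) k \<in> ball y s) sequentially"
    by (rule topological_tendstoD[OF xl]) (use s in auto)
   moreover have "eventually (%k. reflect e ((mu \<circ> sg) k) ((x \<circ> sg) k) \<in> ball y s) sequentially"
    by (rule topological_tendstoD[OF Rl]) (use s Ryy in auto)
   ultimately have "eventually (%k. False) sequentially"
   proof eventually_elim
    case (elim k)
    let ?x = "(x \<circ> sg) k" and ?m = "(mu \<circ> sg) k"
    have eq: "reflect e ?m ?x = ?x + (2 * (?x .* e - ?m)) *. (- e)" by (simp add: reflect_def)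
    have "rho ?x <= 0" using closure_le[of ?x] elim(1) s(2) mx(3) closure_subset by fastforce
    moreover have "0 < 2 * (?x .* e - ?m)" using mx(4) by simp
    ultimately have "reflect e ?m ?x \<in> Omega" unfolding eq using s(3)[OF elim(1)] elim(2) eq by metis
    thus ?case using mx(5) by simp
   qed
   thus False by simp
  qed
  \<comment> \<open>Otherwise points of \<open>Omega\<close> just beyond the line would have mirror
    images in the exterior, against \<open>good e l\<close>.\<close>
  moreover have "~ N y .* e < 0"
  proof
   assume n: "N y .* e < 0"
   obtain s where s: "0 < s" "!!t. 0 < t ==> t < s ==> y + t *. e \<in> Omega" using descend[OF y0(1) n] y0(2) by auto
   have n': "0 < N y .* (- e)" using n by simp
   obtain s' where s': "0 < s'" "!!t. 0 < t ==> t < s' ==> y + t *. (- e) \<in> ball y r & 0 < rho (y + t *. (- e))"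
    using ascend[OF y0(1) n'] y0(2) by auto
   define t where "t = min s s' / 2"
   have t: "0 < t" "t < s" "t < s'" using s(1) s'(1) by (auto simp: t_def)
   have ee: "e .* e = 1" using e by (simp add: norm_eq_1)
   have "l < (y + t *. e) .* e" using yl t(1) ee by (simp add: inner_simps)
   hence "reflect e l (y + t *. e) \<in> Omega" using g s(2)[OF t(1,2)] by (auto simp: good_def)
   moreover have "reflect e l (y + t *. e) = y + t *. (- e)" 
   proof -
    have "(y + t *. e) .* e - l = t" using yl ee by (simp add: inner_simps)
    thus ?thesis by (simp add: reflect_def vec_eq_iff)
   qed
   ultimately show False using s'(2)[OF t(1,3)] inside by force
  qed
  ultimately have "N y .* e = 0" by simp
  hence "sgn (N y) .* e = 0" by (simp add: sgn_div_norm)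
  hence "\<forall>n. outward_unit_normal Omega y n --> n .* e = 0" using outward_unit_normal_eq[OF y0(1)] by metis
  thus ?thesis using yf yl by blast
 qed
qed

lemma reflect_reflect_perp:
 assumes "norm e = 1"
 shows "reflect e (g .* e) (reflect (perp e) (g .* perp e) x) = 2 *. g - x"
proof -
 let ?f = "perp e"
 have "x - g = ((x - g) .* e) *. e + ((x - g) .* ?f) *. ?f" by (rule perp_expansion[OF assms])
 moreover have "reflect e (g .* e) (reflect ?f (g .* ?f) x) = x - 2 *. (((x - g) .* e) *. e + ((x - g) .* ?f) *. ?f)"
  by (simp add: reflect_def inner_diff_left vec_eq_iff algebra_simps)
 ultimately have "reflect e (g .* e) (reflect ?f (g .* ?f) x) = x - 2 *. (x - g)" by metis
 thus ?thesis by (simp add: vec_eq_iff)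
qed

text \<open>Two perpendicular symmetries give a centre \<open>g\<close>. A symmetry line missing
  \<open>g\<close> would give a second centre, hence a translation preserving a bounded set. Lines
  through \<open>g\<close> in all directions yield rotational invariance, and \<open>good\<close>
  yields star-shapedness about \<open>g\<close>, which rules out annuli.\<close>

lemma all_symmetric_ball:
 assumes S: "!!e. norm e = 1 ==> \<exists>l. good e l & symmetric_about e l"
 shows "\<exists>a r. 0 < r & Omega = ball a r"
proof -
 let ?e = "axis 1 1 :: real^2"
 have e: "norm ?e = 1" by simp
 have f: "norm (perp ?e) = 1" by simp
 obtain l1 l2 where l: "symmetric_about ?e l1" "symmetric_about (perp ?e) l2" using S[OF e] S[OF f] by blast
 define g where "g = l1 *. ?e + l2 *. perp ?e"
 have gl: "g .* ?e = l1" "g .* perp ?e = l2" using e f unfolding norm_eq_1 by (simp_all add: g_def inner_simps)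
 have central: "2 *. g - x \<in> Omega" if "x \<in> Omega" for x
  using l that reflect_reflect_perp[OF e, of g x] unfolding gl symmetric_about_def by metis
 have through: "good e (g .* e) & symmetric_about e (g .* e)" if e: "norm e = 1" for e
 proof -
  obtain l where l: "good e l" "symmetric_about e l" using S[OF e] by blast
  \<comment> \<open>Conjugating the central symmetry by the reflection gives the symmetry about the
    mirror image \<open>h\<close> of \<open>g\<close>; both together translate by
    \<open>2 *. (h - g)\<close>.\<close>
  define h where "h = reflect e l g"
  have h: "2 *. h - x \<in> Omega" if "x \<in> Omega" for x
  proof -
   have "reflect e l (2 *. g - reflect e l x) \<in> Omega" using l(2) central that by (simp add: symmetric_about_def)
   moreover have "reflect e l (2 *. g - reflect e l x) = 2 *. h - x"
    using e by (simp add: h_def reflect_def inner_diff_left norm_eq_1 vec_eq_iff algebra_simps)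
   ultimately show ?thesis by simp
  qed
  have step: "x + 2 *. (h - g) \<in> Omega" if "x \<in> Omega" for x
   using h[OF central[OF that]] by (simp add: algebra_simps)
  obtain x where x: "x \<in> Omega" using ne by auto
  have iter: "x + real n *. (2 *. (h - g)) \<in> Omega" for n
  proof (induction n)
   case (Suc n)
   from step[OF Suc] show ?case by (simp add: algebra_simps)
  qed (simp add: x)
  obtain B where B: "!!y. y \<in> Omega ==> norm y <= B" using bd by (auto simp: bounded_iff)
  have "h = g"
  proof (rule ccontr)
   assume "h ~= g"
   hence n: "0 < norm (2 *. (h - g))" by simp
   obtain n where "2 * B < real n * norm (2 *. (h - g))" using reals_Archimedean3[OF n] by blast
   moreover have "norm (real n *. (2 *. (h - g))) <= norm (x + real n *. (2 *. (h - g))) + norm x"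
    using norm_triangle_ineq4[of "x + real n *. (2 *. (h - g))" x] by simp
   moreover have "... <= B + B" by (intro add_mono B iter x)
   ultimately show False by simp
  qed
  hence "(2 * (g .* e - l)) *. e = 0" by (simp add: h_def reflect_def)
  hence "g .* e = l" using e by auto
  thus ?thesis using l by simp
 qed
 have rot: "y \<in> Omega" if x: "x \<in> Omega" and n: "norm (y - g) = norm (x - g)" for x y
 proof (cases "x = y")
  case False
  define e where "e = (1 / norm (x - y)) *. (x - y)"
  have e: "norm e = 1" using False by (simp add: e_def)
  have "2 * ((x - g) .* (x - y)) = (norm (x - y))^2"
   using n unfolding norm_eq power2_norm_eq_inner by (simp add: inner_diff_left inner_diff_right inner_commute)
  moreover have "(x - g) .* e = ((x - g) .* (x - y)) / norm (x - y)" unfolding e_def inner_scaleR_right by simp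
  ultimately have "2 * ((x - g) .* e) = norm (x - y)" using False by (simp add: power2_eq_square)
  hence "reflect e (g .* e) x = y"
  proof -
   assume a: "2 * ((x - g) .* e) = norm (x - y)"
   have "reflect e (g .* e) x = x - (2 * ((x - g) .* e)) *. e" by (simp add: reflect_def inner_simps)
   thus ?thesis unfolding a using False by (simp add: e_def)
  qed
  thus ?thesis using through[OF e] x by (auto simp: symmetric_about_def)
 qed (use x in simp)
 have star: "g + t *. (x - g) \<in> Omega" if x: "x \<in> Omega" and t: "0 <= t" "t <= 1" for x t
 proof (cases "x = g \<or> t = 1")
  case False
  hence xg: "x ~= g" by simp
  define e where "e = (1 / norm (x - g)) *. (x - g)"
  have e: "norm e = 1" using xg by (simp add: e_def)
  have xe: "(x - g) .* e = norm (x - g)" using xg by (simp add: e_def power2_norm_eq_inner[symmetric] power2_eq_square)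
  \<comment> \<open>The line half-way between \<open>x\<close> and \<open>g + t *. (x - g)\<close>;
    it does not pass below \<open>g\<close>, so it is an admissible position.\<close>
  define mu where "mu = x .* e - (1 - t) / 2 * norm (x - g)"
  have "(1 - t) / 2 * norm (x - g) <= 1 * norm (x - g)" using t by (intro mult_right_mono) auto
  hence m1: "g .* e <= mu" using xe by (simp add: mu_def inner_simps)
  have m2: "mu < x .* e" using t False xg by (simp add: mu_def)
  have "reflect e mu x \<in> Omega" using through[OF e] x m1 m2 by (auto simp: good_def)
  moreover have "reflect e mu x = x - ((1 - t) * norm (x - g)) *. e" by (simp add: reflect_def mu_def)
  moreover have "norm (x - g) *. e = x - g" using xg by (simp add: e_def)
  hence "((1 - t) * norm (x - g)) *. e = (1 - t) *. (x - g)" by (metis scaleR_scaleR)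
  ultimately have "x - (1 - t) *. (x - g) \<in> Omega" by simp
  moreover have "x - (1 - t) *. (x - g) = g + t *. (x - g)" by (simp add: vec_eq_iff algebra_simps)
  ultimately show ?thesis by simp
 qed (use x in auto)
 define r where "r = Sup ((%x. norm (x - g)) ` Omega)"
 have bdd: "bdd_above ((%x. norm (x - g)) ` Omega)"
 proof -
  obtain B where B: "!!y. y \<in> Omega ==> norm y <= B" using bd by (auto simp: bounded_iff)
  show ?thesis by (rule bdd_aboveI2[where M = "B + norm g"]) (use norm_triangle_ineq4 B in "meson add_right_mono order_trans")
 qed
 have eq: "Omega = ball g r"
 proof (intro subset_antisym subsetI)
  fix y assume "y \<in> ball g r"
  hence "norm (y - g) < r" by (simp add: dist_norms)
  then obtain x where x: "x \<in> Omega" "norm (y - g) < norm (x - g)" unfolding r_def using less_cSup_iff[OF _ bdd] ne by auto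
  let ?t = "norm (y - g) / norm (x - g)"
  have xp: "0 < norm (x - g)" using x(2) norm_ge_zero[of "y - g"] by linarith
  have "g + ?t *. (x - g) \<in> Omega" using x xp by (intro star) (auto simp: divide_le_eq)
  thus "y \<in> Omega" by (rule rot) (use xp in simp)
 next
  fix x assume x: "x \<in> Omega"
  then obtain eps where eps: "0 < eps" "ball x eps <= Omega" using op open_contains_ball by blast
  define d where "d = (if x = g then ?e else (1 / norm (x - g)) *. (x - g))"
  have d: "norm d = 1" "x - g = norm (x - g) *. d" by (auto simp: d_def)
  have "x + (eps / 2) *. d \<in> Omega" using eps d(1) by (intro subsetD[OF eps(2)]) (simp add: dist_norm)
  hence "norm (x + (eps / 2) *. d - g) <= r" unfolding r_def by (intro cSup_upper bdd imageI)
  also have "x + (eps / 2) *. d - g = (norm (x - g) + eps / 2) *. d" using d(2) by (simp add: algebra_simps)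
  also have "norm ... = norm (x - g) + eps / 2" using d(1) eps(1) by simp
  finally show "x \<in> ball g r" using eps(1) by (simp add: dist_norms)
 qed
 hence "0 < r" using ne by (metis ball_eq_empty not_le)
 thus ?thesis using eq by blast
qed

end

section \<open>Boundary traces and the exclusion of tangency\<close>

lemma AE_affine:
 fixes c :: "'a::euclidean_space"
 assumes s: "s ~= 0" and P: "AEL y. P y" shows "AEL z. P (c + s *. z)"
proof -
 have "AE y in density (distr lborel borel (%z. c + s *. z)) (%_. ennreal (abs s ^ DIM('a))). P y"
  using P by (subst lborel_affine[OF s, of c, symmetric])
 hence "AE y in distr lborel borel (%z. c + s *. z). P y" using s by (subst (asm) AE_density) auto
 thus ?thesis by (rule AE_distrD[rotated]) measurable
qed

text \<open>The reflection that exchanges the two unit vectors preserves measure and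
  \<open>z .* z\<close>.\<close>

lemma radial_integral:
 fixes f :: "real => real => real" and n n' :: "real^2"
 assumes [measurable]: "borelf (%z. f (z .* z) (z .* n))" and n: "norm n = 1" "norm n' = 1"
 shows "(LBINT z. f (z .* z) (z .* n)) = (LBINT z. f (z .* z) (z .* n'))"
proof (cases "n = n'")
 case False
 define d where "d = (1 / norm (n' - n)) *. (n' - n)"
 have d: "norm d = 1" using False by (simp add: d_def)
 have "2 * (n' .* (n' - n)) = (n' - n) .* (n' - n)" using n by (simp add: inner_simps inner_commute norm_eq_1)
 moreover have "n' .* d = (n' .* (n' - n)) / norm (n' - n)" by (simp add: d_def)
 ultimately have "2 * (n' .* d) = norm (n' - n)" using False by (simp add: power2_norm_eq_inner[symmetric] power2_eq_square)
 hence r: "reflect d 0 n' = n" using False by (simp add: reflect_def) (simp add: d_def)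
 have i: "reflect d 0 z .* reflect d 0 y = z .* y" for z y
  using d by (simp add: reflect_def inner_simps norm_eq_1 inner_commute algebra_simps)
 have "reflect d 0 z .* n = z .* n'" for z using i[of z n'] r by simp
 thus ?thesis using mpm_integral[OF reflect_mpm[OF d, of 0], of "%z. f (z .* z) (z .* n)"] i by simp
qed simp

lemma disjoint_balls_dist:
 fixes a c :: "'a::real_normed_vector"
 assumes "0 < r" "0 < rho" "ball c r \<inter> ball a rho = {}" shows "r + rho <= norm (a - c)"
proof (rule ccontr)
 assume *: "~ ?thesis"
 let ?y = "c + (r / (r + rho)) *. (a - c)"
 have "norm (c - ?y) = r * (norm (a - c) / (r + rho))" using assms by simp
 also have "... < r * 1" using * assms by (intro mult_strict_left_mono) (auto simp: divide_less_eq)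
 finally have "?y \<in> ball c r" by (simp add: dist_norm)
 have "a - ?y = (rho / (r + rho)) *. (a - c)"
 proof -
  have "(1 - r / (r + rho)) = rho / (r + rho)" using assms by (simp add: field_simps)
  moreover have "a - ?y = (1 - r / (r + rho)) *. (a - c)" by (simp add: scaleR_left_diff_distrib)
  ultimately show ?thesis by simp
 qed
 hence "norm (a - ?y) = rho * (norm (a - c) / (r + rho))" using assms by simp
 also have "... < rho * 1" using * assms by (intro mult_strict_left_mono) (auto simp: divide_less_eq)
 finally have "?y \<in> ball a rho" by (simp add: dist_norm)
 with \<open>?y \<in> ball c r\<close> assms(3) show False by blast
qed

text \<open>The point is within \<open>r - t / 2\<close> of the centre, and
  \<open>r^2 - (r - t / 2)^2\<close> is at least \<open>r / 2 * t\<close> for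
  \<open>t <= r\<close>.\<close>

lemma dome_near_boundary:
 assumes t: "0 < t" "t <= r" and n: "norm n = 1" and z: "norm z <= 1 / 2"
 shows "sqrt (r / 2) * sqrt t <= dome c r (c + (r - t) *. n + t *. z)"
proof -
 let ?y = "c + (r - t) *. n + t *. z"
 have "norm (?y - c) <= norm ((r - t) *. n) + norm (t *. z)" using norm_triangle_ineq[of "(r - t) *. n" "t *. z"] by (simp add: add.assoc)
 also have "... <= (r - t) + t * (1 / 2)" using t n z by (intro add_mono) (auto intro: mult_left_mono)
 finally have le: "norm (?y - c) <= r - t / 2" by simp
 hence "(norm (?y - c))^2 <= (r - t / 2)^2" by (intro power_mono) auto
 also have "(r - t / 2)^2 <= r^2 - r / 2 * t"
 proof -
  have "t * t <= r * t" "0 <= r * t" using t by (auto intro: mult_right_mono)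
  thus ?thesis by (simp add: power2_eq_square algebra_simps)
 qed
 finally have "r / 2 * t <= (dome c r ?y)^2" using dome_square[of ?y c r] le t by simp
 thus ?thesis unfolding real_sqrt_mult[symmetric] by (rule real_le_lsqrt[rotated 1]) (use t in auto)
qed

lemma AE_cball_exists:
 assumes "AEL z. norm (z::real^2) <= 1 / 2 --> P z" obtains z where "norm z < 1 / 2" "P z"
proof (rule ccontr)
 assume "~ thesis"
 hence "~ P z" if "norm z < 1 / 2" for z using that \<open>!!z. norm z < 1 / 2 ==> P z ==> thesis\<close> by blast
 with assms have "AEL z. z \<notin> ball (0::real^2) (1 / 2)" by (auto elim!: eventually_mono)
 thus False by (rule not_AE_notin_ball) simp
qed

text \<open>Here \<open>u\<close> is the Borel representative used in the energy and
  \<open>w\<close> the given solution. The normal derivative is a pointwise condition on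
  \<open>w\<close>, which carries over to \<open>u\<close> only almost everywhere.\<close>

locale overdetermined_domain = smooth_domain Omega + torsion_solution Omega u for Omega u +
 fixes w :: "real^2 => real" and c0 :: real
 assumes uw: "AEL x. u x = w x"
  and flux: "!!x. x \<in> frontier Omega ==> has_half_normal_derivative Omega w x c0"
begin

lemma normal_exists: "p \<in> frontier Omega ==> \<exists>n. outward_unit_normal Omega p n"
 using flux unfolding has_half_normal_derivative_def by blast

lemma normal_unit: "outward_unit_normal Omega p n ==> norm n = 1"
proof -
 assume n: "outward_unit_normal Omega p n"
 hence "p \<in> frontier Omega" by (simp add: outward_unit_normal_def)
 then obtain r rho N N' L where "boundary_chart Omega p r rho N N' L" by (rule chart)
 then interpret C: boundary_chart Omega p r rho N N' L .
 have "p \<in> ball p r" using C.r by simp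
 thus ?thesis using C.outward_unit_normal_eq[OF _ n] C.nz[of p] by (simp add: norm_sgn)
qed

lemma normal_unique: "outward_unit_normal Omega p n ==> outward_unit_normal Omega p n' ==> n = n'"
proof -
 assume n: "outward_unit_normal Omega p n" "outward_unit_normal Omega p n'"
 hence "p \<in> frontier Omega" by (simp add: outward_unit_normal_def)
 then obtain r rho N N' L where "boundary_chart Omega p r rho N N' L" by (rule chart)
 then interpret C: boundary_chart Omega p r rho N N' L .
 have "p \<in> ball p r" using C.r by simp
 thus ?thesis using C.outward_unit_normal_eq[OF _ n(1)] C.outward_unit_normal_eq[OF _ n(2)] by simp
qed

text \<open>The ball of radius \<open>t / 2\<close> about \<open>p - t *. n\<close> stays in a fixed
  cone at \<open>p\<close>, so the non-tangential limit holds uniformly on it; the point with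
  parameter \<open>z\<close> has depth \<open>t * (1 - z .* n)\<close>.\<close>

lemma boundary_trace:
 assumes n: "outward_unit_normal Omega p n" and r: "0 < r" "ball (p - r *. n) r <= Omega" and eps: "0 < eps"
 obtains t0 where "0 < t0" "!!t. 0 < t ==> t < t0 ==>
  AEL z. norm z <= 1 / 2 --> abs (u (p - t *. n + t *. z) - c0 * sqrt (1 - z .* n) * sqrt t) <= eps * sqrt t"
proof -
 have n1: "norm n = 1" using n by (rule normal_unit)
 have pf: "p \<in> frontier Omega" using n by (simp add: outward_unit_normal_def)
 \<comment> \<open>The aperture 1 / 3 is the least depth \<open>t / 2\<close> on that ball divided
   by the largest distance \<open>3 * t / 2\<close> to \<open>p\<close>.\<close>
 let ?C = "{y \<in> Omega. 1 / 3 * norm (y - p) <= abs ((y - p) .* n)}"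
 obtain n' where n': "outward_unit_normal Omega p n'" and lim: "!!alpha. 0 < alpha & alpha < 1 -->
   ((%y. w y / sqrt (abs ((y - p) .* n'))) ---> c0) (at p within {y \<in> Omega. alpha * norm (y - p) <= abs ((y - p) .* n')})"
  using flux[OF pf] unfolding has_half_normal_derivative_def by blast
 have "((%y. w y / sqrt (abs ((y - p) .* n))) ---> c0) (at p within ?C)"
  using lim[of "1 / 3"] normal_unique[OF n' n] by simp
 from tendstoD[OF this, of "eps / 2"] eps
 have "eventually (%y. dist (w y / sqrt (abs ((y - p) .* n))) c0 < eps / 2) (at p within ?C)" by simp
 then obtain d where d: "0 < d" "!!y. y \<in> ?C ==> y ~= p ==> dist y p < d ==> abs (w y / sqrt (abs ((y - p) .* n)) - c0) < eps / 2"
  unfolding eventually_at dist_real_def by blast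
 show thesis
 proof (rule that[of "min r (d / 2)"])
  fix t assume t: "0 < t" "t < min r (d / 2)"
  have "AEL z. u ((p - t *. n) + t *. z) = w ((p - t *. n) + t *. z)" by (rule AE_affine[OF _ uw]) (use t in simp)
  thus "AEL z. norm z <= 1 / 2 --> abs (u (p - t *. n + t *. z) - c0 * sqrt (1 - z .* n) * sqrt t) <= eps * sqrt t"
  proof eventually_elim
   case (elim z)
   show ?case
   proof
    assume z: "norm z <= 1 / 2"
    let ?y = "p - t *. n + t *. z"
    have zn: "abs (z .* n) <= 1 / 2" using Cauchy_Schwarz_ineq2[of z n] n1 z by simp
    have yn: "(?y - p) .* n = - (t * (1 - z .* n))" using n1 by (simp add: inner_simps norm_eq_1 algebra_simps)
    hence ayn: "abs ((?y - p) .* n) = t * (1 - z .* n)" using t zn by (simp add: abs_mult)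
    have "norm (?y - p) = t * norm (z - n)" using t by (simp flip: norm_scaleR add: scaleR_diff_right) (simp flip: scaleR_diff_right)
    also have "... <= t * (3 / 2)" using t z n1 norm_triangle_ineq4[of z n] by (intro mult_left_mono) auto
    finally have yp: "norm (?y - p) <= t * (3 / 2)" .
    have "norm (?y - (p - r *. n)) < r"
    proof -
     have "?y - (p - r *. n) = (r - t) *. n + t *. z" by (simp add: algebra_simps)
     also have "norm ... <= (r - t) * 1 + t * (1 / 2)" using t z n1 by (intro norm_triangle_le add_mono) (auto intro: mult_left_mono)
     finally show ?thesis using t by simp
    qed
    hence "?y \<in> ball (p - r *. n) r" by (simp only: mem_ball dist_norms)
    hence "?y \<in> Omega" using r(2) by blast
    moreover have "t * (1 / 2) <= t * (1 - z .* n)" using t zn by (intro mult_left_mono) auto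
    ultimately have yC: "?y \<in> ?C" using yp ayn by simp
    have "?y ~= p" using yn t zn by auto
    have "dist ?y p < d" using yp t by (simp add: dist_norm)
    note b = d(2)[OF yC \<open>?y ~= p\<close> this]
    define q where "q = sqrt (t * (1 - z .* n))"
    have q: "0 < q" "q = sqrt t * sqrt (1 - z .* n)" using t zn by (auto simp: q_def real_sqrt_mult)
    have "abs (w ?y - c0 * q) = abs (w ?y / q - c0) * q" using q(1) by (simp add: abs_mult_pos field_simps flip: abs_mult)
    also have "... <= eps / 2 * q" using b q(1) unfolding ayn q_def[symmetric] by (intro mult_right_mono) auto
    also have "... <= eps / 2 * (sqrt t * 2)"
     unfolding q(2) using t eps zn by (intro mult_left_mono) (auto intro!: real_le_lsqrt)
    finally show "abs (u ?y - c0 * sqrt (1 - z .* n) * sqrt t) <= eps * sqrt t" using elim by (simp add: q(2) mult_ac)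
   qed
  qed
 qed (use r d in auto)
qed

lemma reflection_of_good: "norm e = 1 ==> good e l ==> torsion_reflection Omega u e l"
 by unfold_locales (auto simp: good_def)

text \<open>Asymmetry is witnessed by a whole ball and persists under perturbation of the line. On
  this ball the mirror value of \<open>u\<close> is 0, so the reflected difference is
  \<open>u\<close> itself, which supplies the set \<open>K\<close> of the barrier argument.\<close>

lemma asymmetric_ball:
 assumes e: "norm e = 1" and g: "good e l" and ns: "~ symmetric_about e l"
 obtains a rho d where "0 < rho" "0 < d" "ball a rho <= Omega"
  "!!e' l' y. dist e' e < d ==> dist l' l < d ==> y \<in> ball a rho ==> y .* e' < l' - rho & reflect e' l' y \<notin> Omega"
proof -
 obtain x where x: "x \<in> Omega" "reflect e l x \<notin> Omega" using ns by (auto simp: symmetric_about_def)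
 have "~ l < x .* e" using g x by (auto simp: good_def)
 moreover have "x .* e ~= l" using x reflect_fixed by metis
 ultimately have xl: "x .* e < l" by simp
 have "open (Omega \<inter> {y. y .* e < l})" using op by (intro open_Int open_Collect_less continuous_intros)
 then obtain eps where eps: "0 < eps" "ball x eps <= Omega \<inter> {y. y .* e < l}" using x xl open_contains_ball by (metis (mono_tags) IntI mem_Collect_eq)
 \<comment> \<open>The mirror image of \<open>x\<close> may be a boundary point; an exterior point
   next to it leaves room to perturb the line.\<close>
 obtain z where z: "dist (reflect e l x) z < eps" "z \<notin> closure Omega"
 proof (cases "reflect e l x \<in> closure Omega")
  case True
  hence fr: "reflect e l x \<in> frontier Omega" using x by (simp add: frontier_eq)
  then obtain r rho N N' L where "boundary_chart Omega (reflect e l x) r rho N N' L" by (rule chart)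
  then interpret C: boundary_chart Omega "reflect e l x" r rho N N' L .
  show thesis by (rule C.exterior_near[OF _ fr eps(1)]) (use C.r that in auto)
 next
  case False
  thus thesis using that[of "reflect e l x"] eps(1) by simp
 qed
 define a where "a = reflect e l z"
 have "dist x a < eps" using reflect_isometry[OF e, of l "reflect e l x" z] z(1) e by (simp add: a_def dist_norm)
 hence a: "a \<in> Omega" "a .* e < l" using eps(2) by auto
 define m where "m = (l - a .* e) / 2"
 let ?S = "{p :: (real^2) \<times> real \<times> (real^2). snd (snd p) .* fst p < fst (snd p) - m} \<inter>
  (%p. reflect (fst p) (fst (snd p)) (snd (snd p))) -` (- closure Omega)"
 have "open ?S" unfolding reflect_def
  by (intro open_Int open_Collect_less open_vimage continuous_intros) auto
 moreover have "a .* e < l - m" using a(2) by (simp add: m_def field_simps)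
 moreover have "reflect e l a \<notin> closure Omega" using z(2) e by (simp add: a_def)
 ultimately have "open ?S" "(e, l, a) \<in> ?S" by auto
 then obtain s where s: "0 < s" "ball (e, l, a) s <= ?S" by (meson open_contains_ball)
 obtain s' where s': "0 < s'" "ball a s' <= Omega" using op a open_contains_ball by blast
 define rho where "rho = min m (min s' (s / 3))"
 have rho: "0 < rho" "rho <= m" "rho <= s'" "rho <= s / 3" using a s(1) s'(1) by (simp_all add: rho_def m_def min.coboundedI1 min.coboundedI2 del: min_le_iff_disj le_divide_eq_numeral1 divide_le_eq_numeral1)
 show thesis
 proof (rule that[of rho "s / 3" a])
  show "ball a rho <= Omega" using s'(2) rho(3) by (meson order_trans subset_ball)
  fix e' l' y assume h: "dist e' e < s / 3" "dist l' l < s / 3" "y \<in> ball a rho"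
  have "dist (e, l, a) (e', l', y) <= dist e' e + (dist l' l + dist a y)"
   using norm_Pair_le[of "e - e'" "(l - l', a - y)"] norm_Pair_le[of "l - l'" "a - y"] by (simp add: dist_norms abs_minus_commute)
  also have "... < s" using h rho(4) by simp
  finally have "(e', l', y) \<in> ?S" using s(2) by (intro subsetD[OF s(2)]) simp
  thus "y .* e' < l' - rho & reflect e' l' y \<notin> Omega" using rho(2) closure_subset[of Omega] by auto
 qed (use rho s in auto)
qed

text \<open>At \<open>x\<close> and at its mirror image the normal derivatives agree, so at depth
  \<open>t\<close> the mirror values of \<open>u\<close> differ by o(sqrt t). The barrier on a ball
  touching at the mirror image makes the difference at least a multiple of sqrt t.\<close>

lemma no_tangency:
 assumes e: "norm e = 1" and g: "good e l" and ns: "~ symmetric_about e l"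
  and x: "x \<in> frontier Omega" "l < x .* e" "reflect e l x \<in> frontier Omega"
 shows False
proof -
 interpret T: torsion_reflection Omega u e l by (rule reflection_of_good[OF e g])
 let ?R = "reflect e l" and ?S = "reflect e 0"
 obtain a rho d where a: "0 < rho" "0 < d" "ball a rho <= Omega"
  and a': "!!e' l' y. dist e' e < d ==> dist l' l < d ==> y \<in> ball a rho ==> y .* e' < l' - rho & reflect e' l' y \<notin> Omega"
  by (rule asymmetric_ball[OF e g ns]) (rule that)
 have a'': "y .* e < l - rho" "?R y \<notin> Omega" if "y \<in> ball a rho" for y using a'[of e l y] that a(2) by auto
 have sub: "ball a (rho / 2) <= ball a rho" using a(1) by (intro subset_ball) simp
 obtain delta where delta: "0 < delta" "0 < measure lborel {y \<in> ball a (rho / 2). delta <= u y}"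
  by (rule u_positive_set[of "rho / 2" a]) (use a sub that in auto)
 let ?K = "{y \<in> ball a (rho / 2). delta <= u y}"
 obtain r0 sg N N' L where "boundary_chart Omega x r0 sg N N' L" using chart[OF x(1)] by blast
 then interpret C: boundary_chart Omega x r0 sg N N' L .
 define n where "n = sgn (N x)"
 have xr: "x \<in> ball x r0" "x \<in> cball x (r0 / 2)" using C.r by auto
 have n: "outward_unit_normal Omega x n" using normal_exists[OF x(1)] C.outward_unit_normal_eq[OF xr(1)] by (auto simp: n_def)
 have n1: "norm n = 1" using n by (rule normal_unit)
 obtain s where s: "0 < s" "ball (x - s *. n) s <= Omega" using C.uniform_interior_ball xr(2) x(1) unfolding n_def by metis
 \<comment> \<open>A quarter of the height of \<open>x\<close> above the line: the ball touching at
   \<open>x\<close> then keeps distance at least \<open>2 * r\<close> from the line.\<close>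
 define r where "r = min s ((x .* e - l) / 4)"
 have r: "0 < r" "r <= s" "4 * r <= x .* e - l" using s(1) x(2) min.cobounded2[of s "(x .* e - l) / 4"] by (auto simp: r_def)
 have Bx: "ball (x - r *. n) r <= Omega"
 proof -
  have "dist (x - r *. n) (x - s *. n) = norm ((s - r) *. n)" by (simp add: dist_norm algebra_simps)
  hence "ball (x - r *. n) r <= ball (x - s *. n) s" using r n1 by (simp add: ball_subset_ball_iff)
  thus ?thesis using s(2) by blast
 qed
 define c where "c = ?R (x - r *. n)"
 define p where "p = ?R x"
 define np where "np = ?S n"
 have diff: "?R y - ?R y' = ?S (y - y')" for y y' by (simp add: reflect_def inner_simps algebra_simps)
 have R0s: "?S (k *. y) = k *. ?S y" for k y by (simp add: reflect_def algebra_simps)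
 have R0i: "?S y .* ?S y' = y .* y'" for y y' using e by (simp add: reflect_def inner_simps norm_eq_1 inner_commute algebra_simps)
 have R0n: "norm (?S y) = norm y" for y by (simp add: norm_eq_sqrt_inner R0i)
 have np1: "norm np = 1" by (simp add: np_def R0n n1)
 have pc: "p - c = r *. np" by (simp add: p_def c_def diff R0s np_def)
 have xe: "l + 3 * r <= (x - r *. n) .* e" using r Cauchy_Schwarz_ineq2[of n e] n1 e by (simp add: inner_simps) (smt (verit) mult_left_le r(1))
 have Bc: "y \<in> Omega & ?R y \<in> Omega" if "y \<in> ball c r" for y
 proof -
  have "norm (?R y - (x - r *. n)) = norm (y - c)" using reflect_isometry[OF e, of l y c] e by (simp add: c_def)
  hence yr: "norm (?R y - (x - r *. n)) < r" using that by (simp add: dist_norms)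
  hence Ry: "?R y \<in> ball (x - r *. n) r" by (simp only: mem_ball dist_norms)
  have "abs ((?R y - (x - r *. n)) .* e) < r" using Cauchy_Schwarz_ineq2[of "?R y - (x - r *. n)" e] e yr by simp
  hence "l < ?R y .* e" using xe r(1) by (simp add: inner_diff_left)
  hence "?R (?R y) \<in> Omega" by (rule T.cap[rotated]) (use Ry Bx in blast)
  thus ?thesis using Ry Bx e by auto
 qed
 have disj: "r + rho <= norm (a - c)" using r(1) a(1)
 proof (rule disjoint_balls_dist)
  show "ball c r \<inter> ball a rho = {}" using Bc a''(2) by blast
 qed
 obtain gamma where gamma: "0 < gamma" "AEL y. y .* e < l --> gamma * dome c r y <= T.v y"
 proof (rule T.hopf_interior[where c = c and r = r and delta = delta and K = ?K and ?a0.0 = rho and kappa = "rho / 2" and ?d0.0 = r])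
  show "r + r <= l - c .* e" using xe r(1) by (simp add: c_def reflect_inner[OF e])
  show "ball (?R c) r <= Omega" using Bx e by (simp add: c_def)
  show "?K \<in> sets borel" by measurable
  show "bounded ?K" by (rule bounded_subset[OF bounded_ball[of a "rho / 2"]]) auto
  fix y assume y: "y \<in> ?K"
  hence ya: "norm (y - a) < rho / 2" "y \<in> ball a rho" using sub by (auto simp: dist_norms)
  have "norm (a - c) <= norm (y - a) + norm (y - c)" using norm_triangle_ineq4[of "y - c" "y - a"] by simp
  thus "rho <= l - y .* e & delta <= T.v y & r + rho / 2 <= norm (y - c)"
   using disj a''[OF ya(2)] ya(1) y off[OF a''(2)[OF ya(2)]] by (simp add: T.v_def)
 qed (use r a delta Bc in auto)
 have pf: "p \<in> frontier Omega" using x(3) by (simp add: p_def)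
 obtain r1 sg1 M M' L1 where "boundary_chart Omega p r1 sg1 M M' L1" using chart[OF pf] by blast
 then interpret P: boundary_chart Omega p r1 sg1 M M' L1 .
 have pr: "p \<in> ball p r1" using P.r by simp
 \<comment> \<open>The mirrored ball lies in \<open>Omega\<close> by the position of the line and
   touches the boundary at \<open>p\<close>, so the mirrored normal is the normal at
   \<open>p\<close>.\<close>
 have "p - c = r *. sgn (M p)" by (rule P.touching_ball[OF pr pf]) (use Bc r(1) np1 pc in auto)
 hence "np = sgn (M p)" using pc r(1) by simp
 hence npn: "outward_unit_normal Omega p np" using normal_exists[OF pf] P.outward_unit_normal_eq[OF pr] by auto
 \<comment> \<open>The barrier amounts to \<open>4 * eps * sqrt t\<close>, the errors of the two
   traces together to \<open>2 * eps * sqrt t\<close>.\<close>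
 define eps where "eps = gamma * sqrt (r / 2) / 4"
 have eps: "0 < eps" using gamma r by (simp add: eps_def)
 have Bp: "ball (p - r *. np) r <= Omega" using pc Bc by (auto simp: algebra_simps)
 obtain t1 where t1: "0 < t1" "!!t. 0 < t ==> t < t1 ==>
  AEL z. norm z <= 1 / 2 --> abs (u (p - t *. np + t *. z) - c0 * sqrt (1 - z .* np) * sqrt t) <= eps * sqrt t"
  by (rule boundary_trace[OF npn r(1) Bp eps]) (rule that)
 obtain t2 where t2: "0 < t2" "!!t. 0 < t ==> t < t2 ==>
  AEL z. norm z <= 1 / 2 --> abs (u (x - t *. n + t *. z) - c0 * sqrt (1 - z .* n) * sqrt t) <= eps * sqrt t"
  by (rule boundary_trace[OF n r(1) Bx eps]) (rule that)
 define t where "t = min (min t1 t2) r / 2"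
 have t: "0 < t" "t < t1" "t < t2" "t <= r" using t1(1) t2(1) r(1) by (auto simp: t_def)
 have "AEL z. (p - t *. np) + t *. z \<in> {y. y .* e < l} --> gamma * dome c r ((p - t *. np) + t *. z) <= T.v ((p - t *. np) + t *. z)"
  using AE_affine[OF _ gamma(2), of t "p - t *. np"] t(1) by simp
 moreover note t1(2)[OF t(1,2)] mpm_AE[OF reflect_mpm[OF e, of 0] t2(2)[OF t(1,3)]]
 ultimately have "AE z::real^2 in lborel. norm z <= 1 / 2 --> False"
 proof eventually_elim
  case (elim z)
  show ?case
  proof
   assume z: "norm z <= 1 / 2"
   let ?y = "p - t *. np + t *. z"
   have yc: "?y = c + (r - t) *. np + t *. z" using pc by (simp add: algebra_simps)
   have dm: "sqrt (r / 2) * sqrt t <= dome c r ?y" unfolding yc by (rule dome_near_boundary[OF t(1,4) np1 z])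
   hence "0 < dome c r ?y" using r(1) t(1) by (smt (verit) mult_pos_pos real_sqrt_gt_zero half_gt_zero)
   hence "?y \<in> ball c r" using r(1) by (intro dome_pos_ball) auto
   hence "norm (?y - c) < r" by (simp only: mem_ball dist_norms)
   hence "(?y - c) .* e < r" using norm_cauchy_schwarz[of "?y - c" e] e by simp
   moreover have "c .* e <= l - 3 * r" using xe by (simp add: c_def reflect_inner[OF e])
   ultimately have "?y .* e < l" using r(1) by (simp add: inner_diff_left)
   hence lower: "gamma * dome c r ?y <= u ?y - u (?R ?y)" using elim(1) by (simp add: T.v_def)
   have Ry: "?R ?y = x - t *. n + t *. ?S z"
    using diff[of ?y p] e by (simp add: p_def np_def reflect_def inner_simps norm_eq_1 algebra_simps)
   have "?S z .* n = z .* np" using R0i[of z np] e by (simp add: np_def)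
   hence "abs (u (?R ?y) - c0 * sqrt (1 - z .* np) * sqrt t) <= eps * sqrt t" using elim(3) z by (simp add: R0n Ry)
   moreover have "abs (u ?y - c0 * sqrt (1 - z .* np) * sqrt t) <= eps * sqrt t" using elim(2) z by simp
   ultimately have "gamma * dome c r ?y <= 2 * (eps * sqrt t)" using lower by linarith
   moreover have "gamma * (sqrt (r / 2) * sqrt t) <= gamma * dome c r ?y" using dm gamma(1) by (intro mult_left_mono) auto
   moreover have "gamma * (sqrt (r / 2) * sqrt t) = 4 * (eps * sqrt t)" by (simp add: eps_def)
   ultimately have "4 * (eps * sqrt t) <= 2 * (eps * sqrt t)" by linarith
   moreover have "0 < eps * sqrt t" using eps t(1) by simp
   ultimately show False by linarith
  qed
 qed
 thus False by (rule AE_cball_exists)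
qed

end

section \<open>Arcs of orthogonal contacts\<close>

text \<open>The radial factor in the gradient of \<open>bump (1 / 2)\<close>, which is -8
  \<open>bump_slope z\<close> times z: a factor 4 from the squared radius 1 / 4, a factor 2 from
  differentiating \<open>z .* z\<close>.\<close>

definition bump_slope :: "real^2 => real" where
 "bump_slope z = bump_deriv 1 (1 - 4 * (z .* z))"

lemma bump_slope_nonneg: "0 <= bump_slope z"
 by (simp add: bump_slope_def bump_deriv_def)

lemma bump_slope_support: "1 / 2 <= norm z ==> bump_slope z = 0"
 using power_mono[of "1 / 2" "norm z" 2] by (simp add: bump_slope_def bump_deriv_def power2_norm_eq_inner power_divide)

lemma bump_slope_pos: "norm z < 1 / 2 ==> 0 < bump_slope z"
 using power_strict_mono[of "norm z" "1 / 2" 2] by (simp add: bump_slope_def bump_deriv_def power2_norm_eq_inner power_divide)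

lemma bump_slope_continuous: "continuous_on UNIV bump_slope"
proof -
 have "continuous_on UNIV (bump_deriv 1)"
  by (intro continuous_at_imp_continuous_on ballI DERIV_isCont[OF bump_deriv_has_derivative])
 thus ?thesis unfolding bump_slope_def by (rule continuous_on_compose2) (auto intro!: continuous_intros)
qed

lemma bump_slope_measurable [measurable]: "borelf bump_slope"
 by (rule borel_measurable_continuous_onI[OF bump_slope_continuous])

lemma bump_frechet_derivative: "frechet_derivative (bump (1 / 2)) (at z) v = - 8 * bump_slope z * (z .* v)"
proof -
 have "((%x. 1 - x .* x / (1 / 2)^2) has_derivative (%v. - 8 * (z .* v))) (at z)"
  by (auto intro!: derivative_eq_intros simp: inner_commute power_divide)
 from has_derivative_compose[OF this bump_deriv_has_derivative[of 0, THEN has_field_derivative_imp_has_derivative]]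
 have "(bump (1 / 2) has_derivative (%v. - 8 * bump_slope z * (z .* v))) (at z)"
  unfolding bump_def[abs_def] by (simp add: bump_slope_def power_divide mult_ac)
 from frechet_derivative_at[OF this] show ?thesis by (metis (no_types))
qed

text \<open>The moments along \<open>e\<close> and \<open>perp e\<close> agree by rotation
  invariance, and their sum is positive since inside the support its integrand vanishes only at the
  origin.\<close>

lemma bump_moment:
 assumes e: "norm e = 1"
 shows "lint (%z. bump_slope z * (z .* e)^2)" "0 < (LBINT z. bump_slope z * (z .* e)^2)"
proof -
 let ?m = "LBINT z. bump_slope z * (z .* e)^2"
 have i: "lint (%z. bump_slope z * (z .* y)^2)" for y
  by (rule integrable_continuous_bounded_support[where r = "1 / 2"])
   (auto intro!: continuous_intros bump_slope_continuous simp: bump_slope_support)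
 thus "lint (%z. bump_slope z * (z .* e)^2)" .
 have "(LBINT z. bump_slope z * (z .* perp e)^2) = ?m"
  unfolding bump_slope_def
 proof (rule radial_integral[where f = "%a b. bump_deriv 1 (1 - 4 * a) * b^2"])
  show "borelf (%z. bump_deriv 1 (1 - 4 * (z .* z)) * (z .* perp e)^2)"
   unfolding bump_slope_def[symmetric] by measurable
 qed (use e in simp_all)
 moreover have "(LBINT z. bump_slope z * (z .* e)^2 + bump_slope z * (z .* perp e)^2) = ?m + (LBINT z. bump_slope z * (z .* perp e)^2)"
  by (rule LINT_add[OF i i])
 moreover have "(LBINT z. bump_slope z * (z .* e)^2 + bump_slope z * (z .* perp e)^2) ~= 0"
 proof
  assume "(LBINT z. bump_slope z * (z .* e)^2 + bump_slope z * (z .* perp e)^2) = 0"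
  hence "AEL z. bump_slope z * (z .* e)^2 + bump_slope z * (z .* perp e)^2 = 0"
   by (subst (asm) integral_nonneg_eq_0_iff_AE) (auto intro: i simp: bump_slope_nonneg)
  with AE_lborel_singleton[of "0::real^2"] have "AE z::real^2 in lborel. norm z <= 1 / 2 --> z ~= 0 & bump_slope z * (z .* e)^2 + bump_slope z * (z .* perp e)^2 = 0"
   by eventually_elim auto
  then obtain z :: "real^2" where z: "norm z < 1 / 2" "z ~= 0" "bump_slope z * ((z .* e)^2 + (z .* perp e)^2) = 0"
   by (rule AE_cball_exists) (auto simp: distrib_left)
  hence "(z .* e)^2 + (z .* perp e)^2 = 0" using bump_slope_pos[OF z(1)] by simp
  hence "z = 0" using perp_expansion[OF e, of z] by (simp add: sum_power2_eq_zero_iff)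
  thus False using z by simp
 qed
 moreover have "0 <= ?m"
  by (rule Bochner_Integration.integral_nonneg) (simp add: bump_slope_nonneg)
 ultimately show "0 < ?m" by linarith
qed

lemma integrable_affine:
 fixes u :: "real^2 => real"
 assumes "lint u" "t ~= 0" shows "lint (%z. u (c + t *. z))"
 using integrable_scale_real2[OF assms(2) integrable_translate[OF assms(1), of c]] by (simp add: add.commute)

lemma integrable_mult_bounded:
 fixes u g :: "real^2 => real"
 assumes u: "lint u" and g: "continuous_on UNIV g" "!!z. r <= norm z ==> g z = 0"
 shows "lint (%z. g z * u z)"
proof -
 obtain B where B: "!!z. abs (g z) <= B" by (rule continuous_bounded_support_bounded[OF g(1), of r]) (use g(2) that in auto)
 have [measurable]: "borelf g" by (rule borel_measurable_continuous_onI[OF g(1)])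
 show ?thesis
 proof (rule lint_bound[OF integrable_mult_right[OF integrable_norm[OF u], of B]])
  show "AEL z. norm (g z * u z) <= norm (B * norm (u z))"
   using B by (intro AE_I2) (auto simp: abs_mult intro!: mult_right_mono order_trans[OF B])
 qed (use u in measurable)
qed

context overdetermined_domain
begin

lemma ui: "lint u" using ws by (simp add: weak_solution_def)

text \<open>The trace integrated against the bump. By \<open>radial_integral\<close> the limiting
  factor is the same for every unit normal, so it can be compared between different boundary
  points.\<close>

lemma mollified_trace:
 assumes n: "outward_unit_normal Omega p n" and r: "0 < r" "ball (p - r *. n) r <= Omega" and eps: "0 < eps"
 obtains t0 where "0 < t0" "!!t. 0 < t ==> t < t0 ==>
  abs ((LBINT z. bump (1 / 2) z * u (p - t *. n + t *. z)) - sqrt t * (c0 * (LBINT z. bump (1 / 2) z * sqrt (1 - z .* n)))) <= eps * sqrt t"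
proof -
 let ?b = "bump (1 / 2)"
 have H: "lint ?b" "0 < (LBINT z. ?b z)" using bump_integrable[of "1 / 2"] bump_integral_pos[of "1 / 2"] by auto
 define eps' where "eps' = eps / (LBINT z. ?b z)"
 have eps': "0 < eps'" "eps' * (LBINT z. ?b z) = eps" using eps H by (auto simp: eps'_def)
 obtain t0 where t0: "0 < t0" "!!t. 0 < t ==> t < t0 ==>
  AEL z. norm z <= 1 / 2 --> abs (u (p - t *. n + t *. z) - c0 * sqrt (1 - z .* n) * sqrt t) <= eps' * sqrt t"
  by (rule boundary_trace[OF n r eps'(1)]) (rule that)
 have bs: "?b z = 0" if "1 / 2 <= norm z" for z by (rule bump_support) (use that in auto)
 show thesis
 proof (rule that[OF t0(1)])
  fix t assume t: "0 < t" "t < t0"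
  have i1: "lint (%z. ?b z * u (p - t *. n + t *. z))"
   by (rule integrable_mult_bounded[OF integrable_affine[OF ui] bump_continuous, of _ "1 / 2"]) (use t bs in auto)
  have i2: "lint (%z. ?b z * sqrt (1 - z .* n))"
   by (rule integrable_continuous_bounded_support[where r = "1 / 2"]) (auto intro!: continuous_intros bump_continuous bs)
  have i3: "lint (%z. sqrt t * (c0 * (?b z * sqrt (1 - z .* n))))" using i2 by simp
  have "abs ((LBINT z. ?b z * u (p - t *. n + t *. z)) - sqrt t * (c0 * (LBINT z. ?b z * sqrt (1 - z .* n))))
   = abs (LBINT z. ?b z * u (p - t *. n + t *. z) - sqrt t * (c0 * (?b z * sqrt (1 - z .* n))))"
   using Bochner_Integration.integral_diff[OF i1 i3] by simp
  also have "... <= (LBINT z. abs (?b z * u (p - t *. n + t *. z) - sqrt t * (c0 * (?b z * sqrt (1 - z .* n)))))"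
   by (rule integral_abs_bound)
  also have "... <= (LBINT z. (eps' * sqrt t) * ?b z)"
  proof (rule integral_mono_AE)
   show "AEL z. abs (?b z * u (p - t *. n + t *. z) - sqrt t * (c0 * (?b z * sqrt (1 - z .* n)))) <= (eps' * sqrt t) * ?b z"
    using t0(2)[OF t]
   proof eventually_elim
    case (elim z)
    show ?case
    proof (cases "norm z <= 1 / 2")
     case True
     have "?b z * u (p - t *. n + t *. z) - sqrt t * (c0 * (?b z * sqrt (1 - z .* n))) = ?b z * (u (p - t *. n + t *. z) - c0 * sqrt (1 - z .* n) * sqrt t)"
      by (simp add: algebra_simps)
     also have "abs (...) <= ?b z * (eps' * sqrt t)" using elim True by (simp add: abs_mult mult_left_mono)
     finally show ?thesis by (simp only: mult.commute)
    qed (use bs in simp)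
   qed
  qed (use i1 i3 H in auto)
  also have "... = eps * sqrt t" using eps'(2) by (simp add: algebra_simps)
  finally show "abs ((LBINT z. ?b z * u (p - t *. n + t *. z)) - sqrt t * (c0 * (LBINT z. ?b z * sqrt (1 - z .* n)))) <= eps * sqrt t" .
 qed
qed

text \<open>As \<open>n\<close> is orthogonal to \<open>e\<close>, the reflection fixes
  \<open>p - t *. n\<close> and acts on the ball around it by changing the sign of
  \<open>z .* e\<close>. Averaging over both halves turns the integrand into the reflected
  difference of \<open>u\<close>, where the barrier, with distance \<open>t * abs (z .* e)\<close>
  to the line, produces the second moment.\<close>

lemma tangential_decay:
 assumes e: "norm e = 1" and n: "norm n = 1" "n .* e = 0" and g: "good e (p .* e)" and t: "0 < t" "t <= r"
  and hopf: "AEL x. x .* e < p .* e --> gamma * (p .* e - x .* e) * dome (p - r *. n) r x <= u x - u (reflect e (p .* e) x)"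
  and gamma: "0 < gamma"
 shows "(LBINT z. bump_slope z * (z .* e) * u (p - t *. n + t *. z))
  <= - (gamma * t * (sqrt (r / 2) * sqrt t) / 2) * (LBINT z. bump_slope z * (z .* e)^2)"
proof -
 let ?l = "p .* e" and ?Y = "p - t *. n" and ?S = "reflect e 0" and ?c = "p - r *. n"
 let ?D = "gamma * t * (sqrt (r / 2) * sqrt t)"
 let ?h = "%z. bump_slope z * (z .* e) * u (?Y + t *. z)"
 have Si: "?S y .* ?S y' = y .* y'" for y y' using e by (simp add: reflect_def inner_simps norm_eq_1 inner_commute algebra_simps)
 have Se: "?S z .* e = - (z .* e)" for z using reflect_inner[OF e, of 0 z] by simp
 have Sn: "norm (?S z) = norm z" for z by (simp add: norm_eq_sqrt_inner Si)
 have Sb: "bump_slope (?S z) = bump_slope z" for z by (simp add: bump_slope_def Si)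
 have Ye: "?Y .* e = ?l" using n by (simp add: inner_simps)
 have RY: "reflect e ?l (?Y + t *. z) = ?Y + t *. ?S z" for z
  using n by (simp add: reflect_def inner_simps vec_eq_iff algebra_simps)
 have ih: "lint ?h"
  by (rule integrable_mult_bounded[OF integrable_affine[OF ui], where r = "1 / 2"])
   (use t in "auto intro!: continuous_intros bump_slope_continuous simp: bump_slope_support")
 note ihS = mpm_integrable[OF reflect_mpm[OF e, of 0] ih]
 have half: "bump_slope z * (z .* e) * (u (?Y + t *. z) - u (?Y + t *. ?S z)) <= - ?D * (bump_slope z * (z .* e)^2)"
  if h: "?Y + t *. z \<in> {x. x .* e < ?l} --> gamma * (?l - (?Y + t *. z) .* e) * dome ?c r (?Y + t *. z) <= u (?Y + t *. z) - u (reflect e ?l (?Y + t *. z))"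
   and z: "z .* e < 0" for z
 proof (cases "norm z <= 1 / 2")
  case True
  have ye: "(?Y + t *. z) .* e = ?l + t * (z .* e)" using Ye by (simp add: inner_add_left)
  have tz: "t * (z .* e) < 0" using t z by (simp add: mult_less_0_iff)
  have eqY: "?c + (r - t) *. n + t *. z = ?Y + t *. z" by (simp add: vec_eq_iff algebra_simps)
  from dome_near_boundary[OF t n(1) True, of ?c, unfolded eqY] have "gamma * (- (t * (z .* e))) * (sqrt (r / 2) * sqrt t) <= gamma * (- (t * (z .* e))) * dome ?c r (?Y + t *. z)"
   using gamma tz by (intro mult_left_mono mult_nonneg_nonneg) auto
  also have "... <= u (?Y + t *. z) - u (?Y + t *. ?S z)" using h tz unfolding RY mem_Collect_eq ye by simp
  finally have "bump_slope z * (- (z .* e)) * (gamma * (- (t * (z .* e))) * (sqrt (r / 2) * sqrt t)) <= bump_slope z * (- (z .* e)) * (u (?Y + t *. z) - u (?Y + t *. ?S z))"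
   using z bump_slope_nonneg[of z] by (intro mult_left_mono mult_nonneg_nonneg) auto
  thus ?thesis by (simp add: algebra_simps power2_eq_square)
 qed (simp add: bump_slope_support)
 have AEh: "AEL z. ?Y + t *. z \<in> {x. x .* e < ?l} --> gamma * (?l - (?Y + t *. z) .* e) * dome ?c r (?Y + t *. z) <= u (?Y + t *. z) - u (reflect e ?l (?Y + t *. z))"
  using AE_affine[OF _ hopf, of t ?Y] t by simp
 have "2 * (LBINT z. ?h z) = (LBINT z. ?h z) + (LBINT z. ?h (?S z))"
  using mpm_integral[OF reflect_mpm[OF e, of 0], of ?h] ih by simp
 also have "... = (LBINT z. ?h z + ?h (?S z))" by (rule LINT_add[OF ih ihS, symmetric])
 also have "... <= (LBINT z. - ?D * (bump_slope z * (z .* e)^2))"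
 proof (rule integral_mono_AE)
  show "AEL z. ?h z + ?h (?S z) <= - ?D * (bump_slope z * (z .* e)^2)"
   using AEh mpm_AE[OF reflect_mpm[OF e, of 0] AEh]
  proof eventually_elim
   case (elim z)
   have hh: "?h z + ?h (?S z) = bump_slope z * (z .* e) * (u (?Y + t *. z) - u (?Y + t *. ?S z))"
    by (simp add: Sb Se algebra_simps)
   consider "z .* e < 0" | "z .* e = 0" | "0 < z .* e" by linarith
   thus ?case
   proof cases
    case 1
    thus ?thesis unfolding hh by (rule half[OF elim(1)])
   next
    case 2
    thus ?thesis unfolding hh by simp
   next
    case 3
    hence "?S z .* e < 0" by (simp add: Se)
    from half[OF elim(2) this] have "bump_slope z * (- (z .* e)) * (u (?Y + t *. ?S z) - u (?Y + t *. z)) <= - ?D * (bump_slope z * (z .* e)^2)"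
     using e by (simp add: Sb Se)
    thus ?thesis unfolding hh by (simp add: algebra_simps)
   qed
  qed
 qed (use ih ihS bump_moment(1)[OF e] in auto)
 also have "... = - ?D * (LBINT z. bump_slope z * (z .* e)^2)" by simp
 finally show ?thesis by simp
qed

end

section \<open>Contradiction along an arc\<close>

context overdetermined_domain
begin

text \<open>The constant depends on the domain only through its bound \<open>B\<close>, so one
  \<open>gamma\<close> serves all lines that share the same witness set \<open>K\<close> and
  margins. Along an arc the direction varies, and this uniformity is essential.\<close>

lemma uniform_hopf:
 assumes K: "K \<in> sets borel" "bounded K" "0 < rho" "0 < delta" "0 < measure lborel K" and r: "0 < r"
 obtains gamma where "0 < gamma" "!!e l c. norm e = 1 ==> good e l ==> c .* e = l ==> ball c r <= Omega ==>
  (!!y. y \<in> K ==> y \<in> Omega & rho <= l - y .* e & delta <= u y - u (reflect e l y) & r + rho <= norm (y - c)) ==>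
  AEL x. x .* e < l --> gamma * (l - x .* e) * dome c r x <= u x - u (reflect e l x)"
proof -
 obtain B where B: "!!x. x \<in> Omega ==> norm x <= B" using bd by (auto simp: bounded_iff)
 define D where "D = r + 2 * abs B"
 have D: "0 < D" using r by (simp add: D_def add_pos_nonneg)
 define gamma where "gamma = 8 * delta * rho * measure lborel K / D ^ 5 / (3 * pi^2)"
 have gamma: "0 < gamma" using K D by (simp add: gamma_def)
 show thesis
 proof (rule that[OF gamma])
  fix e l c
  assume e: "norm (e::real^2) = 1" and g: "good e l" and c: "c .* e = l" "ball c r <= Omega"
   and y: "!!y. y \<in> K ==> y \<in> Omega & rho <= l - y .* e & delta <= u y - u (reflect e l y) & r + rho <= norm (y - c)"
  interpret T: torsion_reflection Omega u e l by (rule reflection_of_good[OF e g])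
  have "norm c <= B" using c(2) r by (intro B) auto
  have "AEL x. x .* e < l --> gamma * (l - x .* e) * dome c r x <= T.v x"
  proof (rule T.hopf_centred[OF c(1) r c(2) gamma K(1,2,3) less_imp_le[OF K(4)] K(3)])
   fix x assume x: "x \<in> K"
   have "norm (x - c) <= 2 * abs B" using norm_triangle_ineq4[of x c] B[of x] y[OF x] \<open>norm c <= B\<close> by linarith
   thus "rho <= l - x .* e & delta <= T.v x & r + rho <= norm (x - c) & r + norm (x - c) <= D"
    using y[OF x] by (simp add: T.v_def D_def)
  next
   show "3 * pi^2 * gamma <= 8 * delta * rho * measure lborel K / D ^ 5" by (simp add: gamma_def)
  qed
  thus "AEL x. x .* e < l --> gamma * (l - x .* e) * dome c r x <= u x - u (reflect e l x)"
   by (simp add: T.v_def)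
 qed
qed

text \<open>After rescaling by \<open>t\<close> the mollification is a convolution evaluated at
  \<open>Y s\<close> divided by \<open>t\<close>; the derivative falls on the bump, and here the
  factor \<open>1 / t\<close> arises.\<close>

lemma mollified_derivative:
 assumes Y: "(Y has_vector_derivative k *. e) (at s)" and t: "t ~= 0"
 shows "((%s. LBINT z. bump (1 / 2) z * u (Y s + t *. z)) has_real_derivative
  8 * k / t * (LBINT z. bump_slope z * (z .* e) * u (Y s + t *. z))) (at s)"
proof -
 let ?b = "bump (1 / 2)"
 define g where "g y = u (t *. y)" for y
 have gi: "lint g" unfolding g_def using integrable_scale_real2[OF t ui] .
 have [measurable]: "borelf g" using gi by simp
 have sw: "(LBINT y. f (x - y) * g y) = (LBINT z. f (- z) * u (t *. x + t *. z))"
  if [measurable]: "borelf f" for f :: "real^2 => real" and x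
  using integral_translate[of "%y. f (x - y) * g y" x] by (simp add: g_def scaleR_add_right add.commute)
 have bs: "1 / 2 <= norm z ==> ?b z = 0" for z by (rule bump_support) auto
 have conv: "(LBINT z. ?b z * u (Y s + t *. z)) = convolution ?b g ((1 / t) *. Y s)" for s
  using sw[of ?b "(1 / t) *. Y s"] t by (simp add: bump_def)
 have "((%s. (1 / t) *. Y s) has_derivative (%d. (1 / t) *. d *. k *. e)) (at s)"
  using Y unfolding has_vector_derivative_def by (rule has_derivative_scaleR_right)
 from has_derivative_compose[OF this convolution_has_derivative[OF bump_smooth bs gi]]
 have "((%s. convolution ?b g ((1 / t) *. Y s)) has_derivative
  (%d. convolution (%z. frechet_derivative ?b (at z) ((1 / t) *. d *. k *. e)) g ((1 / t) *. Y s))) (at s)" .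
 moreover have "convolution (%z. frechet_derivative ?b (at z) ((1 / t) *. d *. k *. e)) g ((1 / t) *. Y s)
  = 8 * k / t * (LBINT z. bump_slope z * (z .* e) * u (Y s + t *. z)) * d" for d
 proof -
  have "convolution (%z. - 8 * bump_slope z * (z .* ((1 / t) *. d *. k *. e))) g ((1 / t) *. Y s)
   = (LBINT z. - 8 * bump_slope (- z) * ((- z) .* ((1 / t) *. d *. k *. e)) * u (Y s + t *. z))"
   using t by (subst sw) simp_all
  also have "... = (LBINT z. (8 * k / t * d) * (bump_slope z * (z .* e) * u (Y s + t *. z)))"
   by (rule LINT_cong) (simp_all add: bump_slope_def)
  finally show ?thesis unfolding bump_frechet_derivative by simp
 qed
 ultimately show ?thesis unfolding conv has_field_derivative_def by (simp only:)
qed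

text \<open>The vectors \<open>E\<close> and \<open>n\<close> are the unit tangent and the outward
  normal of the curve \<open>q\<close>, the sign \<open>sg\<close> choosing the side. The bound
  \<open>M\<close> controls the curvature, hence the parallel curves at small depth.\<close>

lemma no_arc:
 fixes q :: "real => real^2" and m m' :: "real => real"
 assumes e0: "norm e0 = 1" and ab: "alpha < beta" and r: "0 < r" and sg: "abs sg = 1"
 defines "E \<equiv> %s. (1 / sqrt (1 + (m s)^2)) *. (e0 + m s *. perp e0)"
  and "n \<equiv> %s. (sg / sqrt (1 + (m s)^2)) *. (perp e0 - m s *. e0)"
 assumes C: "!!s. s \<in> {alpha..beta} ==> outward_unit_normal Omega (q s) (n s) & ball (q s - r *. n s) r <= Omega &
   (q has_vector_derivative (e0 + m s *. perp e0)) (at s) & (m has_real_derivative m' s) (at s) & abs (m' s) <= M & good (E s) (q s .* E s)"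
  and ns: "~ symmetric_about (E alpha) (q alpha .* E alpha)"
 shows False
proof -
 let ?f = "perp e0" and ?k = "%s. sqrt (1 + (m s)^2)"
 have ee: "e0 .* e0 = 1" "?f .* ?f = 1" using e0 perp_norm[of e0] unfolding norm_eq_1[symmetric] by simp_all
 have k: "1 <= ?k s" "0 < ?k s" "(?k s)^2 = 1 + (m s)^2" for s by (auto intro: add_pos_nonneg)
 have nE: "norm (E s) = 1" "norm (n s) = 1" "n s .* E s = 0" for s
 proof -
  have "(norm (e0 + m s *. ?f))^2 = 1 + (m s)^2" "(norm (?f - m s *. e0))^2 = 1 + (m s)^2"
   unfolding power2_norm_eq_inner by (simp_all add: inner_simps ee power2_eq_square)
  hence "norm (e0 + m s *. ?f) = ?k s" "norm (?f - m s *. e0) = ?k s"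
   by (metis norm_ge_zero real_sqrt_unique)+
  thus "norm (E s) = 1" "norm (n s) = 1" using k(2)[of s] sg by (simp_all add: E_def n_def)
  show "n s .* E s = 0" by (simp add: E_def n_def inner_simps ee)
 qed
 have cont: "isCont q s" "isCont E s" if "s \<in> {alpha..beta}" for s
 proof -
  show "isCont q s" using C[OF that] by (auto dest: has_vector_derivative_continuous)
  have "isCont m s" using C[OF that] by (auto dest: DERIV_isCont)
  thus "isCont E s" unfolding E_def using k(2)[of s] by (intro continuous_intros) auto
 qed
 obtain a rho d where a: "0 < rho" "0 < d" "ball a rho <= Omega"
  and a': "!!e' l' y. dist e' (E alpha) < d ==> dist l' (q alpha .* E alpha) < d ==> y \<in> ball a rho ==> y .* e' < l' - rho & reflect e' l' y \<notin> Omega"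
  by (rule asymmetric_ball[OF nE(1) _ ns]) (use C[of alpha] ab in auto)
 \<comment> \<open>The arc is shortened so that the asymmetry found at \<open>alpha\<close> is
   witnessed by the same ball all along it.\<close>
 obtain beta' where b': "alpha < beta'" "beta' <= beta"
  and near: "!!s. s \<in> {alpha..beta'} ==> dist (E s) (E alpha) < d & dist (q s .* E s) (q alpha .* E alpha) < d"
 proof -
  have "alpha \<in> {alpha..beta}" using ab by simp
  note c = cont[OF this]
  have "((%s. E s) ---> E alpha) (at alpha)" "((%s. q s .* E s) ---> q alpha .* E alpha) (at alpha)"
   using c by (auto simp: isCont_def intro!: tendsto_intros)
  from this[THEN tendstoD[OF _ a(2)]] have "eventually (%s. dist (E s) (E alpha) < d & dist (q s .* E s) (q alpha .* E alpha) < d) (at alpha)"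
   by (rule eventually_conj)
  then obtain d' where d': "0 < d'" "!!s. s ~= alpha ==> dist s alpha < d' ==> dist (E s) (E alpha) < d & dist (q s .* E s) (q alpha .* E alpha) < d"
   unfolding eventually_at by blast
  show thesis
  proof (rule that[of "min beta (alpha + d' / 2)"])
   fix s assume s: "s \<in> {alpha..min beta (alpha + d' / 2)}"
   show "dist (E s) (E alpha) < d & dist (q s .* E s) (q alpha .* E alpha) < d"
    using d'(2)[of s] s d'(1) a(2) by (cases "s = alpha") (auto simp: dist_real_def)
  qed (use ab d' in auto)
 qed
 have C': "outward_unit_normal Omega (q s) (n s)" "ball (q s - r *. n s) r <= Omega"
   "(q has_vector_derivative (e0 + m s *. ?f)) (at s)" "(m has_real_derivative m' s) (at s)" "abs (m' s) <= M" "good (E s) (q s .* E s)"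
   if "s \<in> {alpha..beta'}" for s using C[of s] that b' by auto
 have sub: "ball a (rho / 2) <= ball a rho" using a(1) by (intro subset_ball) simp
 obtain delta where delta: "0 < delta" "0 < measure lborel {y \<in> ball a (rho / 2). delta <= u y}"
  by (rule u_positive_set[of "rho / 2" a]) (use a sub that in auto)
 let ?K = "{y \<in> ball a (rho / 2). delta <= u y}"
 have K: "?K \<in> sets borel" "bounded ?K" by (measurable, rule bounded_subset[OF bounded_ball[of a "rho / 2"]]) auto
 obtain gamma where gamma: "0 < gamma" and hopf: "!!e l c. norm e = 1 ==> good e l ==> c .* e = l ==> ball c r <= Omega ==>
  (!!y. y \<in> ?K ==> y \<in> Omega & rho / 2 <= l - y .* e & delta <= u y - u (reflect e l y) & r + rho / 2 <= norm (y - c)) ==>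
  AEL x. x .* e < l --> gamma * (l - x .* e) * dome c r x <= u x - u (reflect e l x)"
  by (rule uniform_hopf[OF K _ delta r, of "rho / 2"]) (use a(1) that in auto)
 have hopf': "AEL x. x .* E s < q s .* E s --> gamma * (q s .* E s - x .* E s) * dome (q s - r *. n s) r x <= u x - u (reflect (E s) (q s .* E s) x)"
  if s: "s \<in> {alpha..beta'}" for s
 proof (rule hopf[OF nE(1) C'(6)[OF s] _ C'(2)[OF s]])
  let ?c = "q s - r *. n s"
  show ce: "?c .* E s = q s .* E s" using nE(3)[of s] by (simp add: inner_diff_left)
  fix y assume y: "y \<in> ?K"
  hence ya: "norm (y - a) < rho / 2" "y \<in> ball a rho" using sub by (auto simp: dist_norms)
  have aa: "y' .* E s < q s .* E s - rho" "reflect (E s) (q s .* E s) y' \<notin> Omega" if "y' \<in> ball a rho" for y'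
   using a'[of "E s" "q s .* E s" y'] near[OF s] that by auto
  have "ball ?c r \<inter> ball a rho = {}"
  proof (rule ccontr)
   assume "ball ?c r \<inter> ball a rho ~= {}"
   then obtain y' where y': "y' \<in> ball ?c r" "y' \<in> ball a rho" by blast
   have "norm (reflect (E s) (q s .* E s) y' - ?c) = norm (y' - ?c)"
    using reflect_isometry[OF nE(1), of s "q s .* E s" y' ?c] reflect_fixed[OF ce] by simp
   hence "reflect (E s) (q s .* E s) y' \<in> ball ?c r" using y'(1) by (simp add: dist_norms)
   thus False using aa(2)[OF y'(2)] C'(2)[OF s] by blast
  qed
  from disjoint_balls_dist[OF r a(1) this] have "r + rho <= norm (a - ?c)" .
  moreover have "norm (a - c) <= norm (y - a) + norm (y - c)" for c using norm_triangle_ineq4[of "y - c" "y - a"] by simp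
  from this[of ?c] have "norm (a - ?c) <= norm (y - a) + norm (y - ?c)" .
  ultimately show "y \<in> Omega & rho / 2 <= q s .* E s - y .* E s & delta <= u y - u (reflect (E s) (q s .* E s) y) & r + rho / 2 <= norm (y - ?c)"
   using aa[OF ya(2)] ya y a off[OF aa(2)[OF ya(2)]] by auto
 qed
 define J where "J = (LBINT z. bump_slope z * (z .* e0)^2)"
 have J: "0 < J" "(LBINT z. bump_slope z * (z .* E s)^2) = J" for s
 proof -
  show "0 < J" unfolding J_def by (rule bump_moment(2)[OF e0])
  show "(LBINT z. bump_slope z * (z .* E s)^2) = J"
   unfolding J_def bump_slope_def
  proof (rule radial_integral[where f = "%a b. bump_deriv 1 (1 - 4 * a) * b^2"])
   show "borelf (%z. bump_deriv 1 (1 - 4 * (z .* z)) * (z .* E s)^2)"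
    unfolding bump_slope_def[symmetric] by measurable
  qed (use e0 nE in simp_all)
 qed
 define Y where "Y t s = q s - t *. n s" for t s
 define F where "F t s = (LBINT z. bump (1 / 2) z * u (Y t s + t *. z))" for t s
 \<comment> \<open>The derivative contributes \<open>8 * (1 / 2) / t\<close>, with 1 / 2 the lower
   bound on the speed \<open>lam\<close>, and \<open>tangential_decay\<close> contributes
   \<open>gamma * t * (sqrt (r / 2) * sqrt t) / 2 * J\<close>.\<close>
 define kappa where "kappa = 2 * gamma * sqrt (r / 2) * J"
 have kappa: "0 < kappa" using gamma r J by (simp add: kappa_def)
 have decay: "F t beta' - F t alpha <= - kappa * sqrt t * (beta' - alpha)" if t: "0 < t" "t <= r" "t * M <= 1 / 2" for t
 proof -
  \<comment> \<open>The derivative of the unit normal is tangential, so the parallel curve at depth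
    \<open>t\<close> moves along \<open>E\<close> with speed \<open>lam\<close>; the condition
    \<open>t * M <= 1 / 2\<close> keeps the speed above 1 / 2.\<close>
  define lam where "lam s = ?k s * (1 + t * sg * m' s / ?k s ^ 3)" for s
  have l: "1 / 2 <= lam s" if s: "s \<in> {alpha..beta'}" for s
  proof -
   have "abs (t * sg * m' s / ?k s ^ 3) <= t * abs (m' s) / 1"
    unfolding abs_divide abs_mult using t sg k[of s] by (intro frac_le) (auto intro: one_le_power)
   also have "... <= 1 / 2" using order_trans[OF mult_left_mono[OF C'(5)[OF s], of t] t(3)] t(1) by simp
   finally have "1 / 2 <= 1 + t * sg * m' s / ?k s ^ 3" by linarith
   hence "1 * (1 / 2) <= ?k s * (1 + t * sg * m' s / ?k s ^ 3)" using k[of s] by (intro mult_mono) auto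
   thus ?thesis by (simp add: lam_def)
  qed
  have dY: "(Y t has_vector_derivative lam s *. E s) (at s)" if s: "s \<in> {alpha..beta'}" for s
  proof -
   note dm = C'(4)[OF s]
   have dk: "(?k has_real_derivative (m s * m' s) / ?k s) (at s)"
   proof -
    have "((%s. 1 + (m s)^2) has_real_derivative 2 * m s * m' s) (at s)" by (auto intro!: derivative_eq_intros dm)
    moreover have "0 < 1 + (m s)^2" by (simp add: add_pos_nonneg)
    ultimately show ?thesis using DERIV_chain2[OF DERIV_real_sqrt] by (fastforce simp: field_simps)
   qed
   have ds: "((%s. sg / ?k s) has_real_derivative - sg * (m s * m' s) / ?k s ^ 3) (at s)"
   proof -
    have "((%s. sg / ?k s) has_real_derivative (0 * ?k s - sg * ((m s * m' s) / ?k s)) / (?k s * ?k s)) (at s)"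
     using k(2)[of s] by (intro DERIV_divide DERIV_const dk) simp
    thus ?thesis using k(2)[of s] by (simp add: power3_eq_cube mult.commute)
   qed
   have dv: "((%s. ?f - m s *. e0) has_vector_derivative - m' s *. e0) (at s)"
    using has_vector_derivative_diff[OF has_vector_derivative_const[of ?f] has_vector_derivative_scaleR[OF dm has_vector_derivative_const[of e0]]] by simp
   have "(n has_vector_derivative ((sg / ?k s) *. (- m' s *. e0) + (- sg * (m s * m' s) / ?k s ^ 3) *. (?f - m s *. e0))) (at s)"
    unfolding n_def by (rule has_vector_derivative_scaleR[OF ds dv])
   moreover have "(sg / ?k s) *. (- m' s *. e0) + (- sg * (m s * m' s) / ?k s ^ 3) *. (?f - m s *. e0) = (- sg * m' s / ?k s ^ 3) *. (e0 + m s *. ?f)"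
   proof -
    have "sg / ?k s = sg * (?k s)^2 / ?k s ^ 3" using k(2)[of s] by (simp add: power2_eq_square power3_eq_cube del: real_sqrt_mult_self)
    hence "sg / ?k s = sg * (1 + (m s)^2) / ?k s ^ 3" by (simp only: k(3))
    thus ?thesis by (simp add: vec_eq_iff add_divide_distrib algebra_simps power2_eq_square)
   qed
   ultimately have dn: "(n has_vector_derivative (- sg * m' s / ?k s ^ 3) *. (e0 + m s *. ?f)) (at s)" by (simp only:)
   have "(Y t has_vector_derivative (e0 + m s *. ?f) - (t *. ((- sg * m' s / ?k s ^ 3) *. (e0 + m s *. ?f)))) (at s)"
    unfolding Y_def[abs_def] using has_vector_derivative_diff[OF C'(3)[OF s] has_vector_derivative_scaleR[OF DERIV_const[of t] dn]] by simp
   moreover have "(e0 + m s *. ?f) - (t *. ((- sg * m' s / ?k s ^ 3) *. (e0 + m s *. ?f))) = lam s *. E s"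
    using k(2)[of s] by (simp add: lam_def E_def scaleR_left_distrib)
   ultimately show ?thesis by simp
  qed
  let ?I = "%s. LBINT z. bump_slope z * (z .* E s) * u (Y t s + t *. z)"
  have dF: "(F t has_real_derivative 8 * lam s / t * ?I s) (at s)" if s: "s \<in> {alpha..beta'}" for s
   unfolding F_def[abs_def] by (rule mollified_derivative[OF dY[OF s]]) (use t in simp)
  obtain s where s: "alpha < s" "s < beta'" "F t beta' - F t alpha = (beta' - alpha) * (8 * lam s / t * ?I s)"
   using MVT2[OF b'(1), of "F t" "%s. 8 * lam s / t * ?I s"] dF by auto
  have s': "s \<in> {alpha..beta'}" using s by simp
  let ?X = "gamma * t * (sqrt (r / 2) * sqrt t) / 2 * J"
  have X: "0 <= ?X" using gamma t r J by simp
  have "?I s <= - ?X"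
   using tangential_decay[OF nE(1,2,3) C'(6)[OF s'] t(1,2) hopf'[OF s'] gamma] unfolding J(2) Y_def by simp
  hence "8 * lam s / t * ?I s <= 8 * lam s / t * (- ?X)" using l[OF s'] t by (intro mult_left_mono) auto
  also have "... <= 4 / t * (- ?X)" using l[OF s'] t X by (intro mult_right_mono_neg divide_right_mono) auto
  also have "... = - kappa * sqrt t" using t by (simp add: kappa_def)
  finally have "8 * lam s / t * ?I s <= - kappa * sqrt t" .
  from mult_left_mono[OF this, of "beta' - alpha"] show ?thesis unfolding s(3) using b'(1) by (simp add: mult.commute)
 qed
 define I where "I = (LBINT z. bump (1 / 2) z * sqrt (1 - z .* n alpha))"
 have I: "(LBINT z. bump (1 / 2) z * sqrt (1 - z .* n s)) = I" for s
  unfolding I_def bump_def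
 proof (rule radial_integral[where f = "%a b. bump_deriv 0 (1 - a / (1 / 2)^2) * sqrt (1 - b)"])
  show "borelf (%z. bump_deriv 0 (1 - z .* z / (1 / 2)^2) * sqrt (1 - z .* n s))"
   unfolding bump_def[symmetric] by measurable
 qed (use nE in simp_all)
 \<comment> \<open>The decay between the ends is then \<open>4 * eps * sqrt t\<close>, while the
   traces allow a difference of only \<open>2 * eps * sqrt t\<close>.\<close>
 define eps where "eps = kappa * (beta' - alpha) / 4"
 have eps: "0 < eps" using kappa b' by (simp add: eps_def)
 have tr: "\<exists>t0>0. \<forall>t. 0 < t & t < t0 --> abs (F t s - sqrt t * (c0 * I)) <= eps * sqrt t" if s: "s \<in> {alpha..beta'}" for s
 proof -
  obtain t0 where "0 < t0" "!!t. 0 < t ==> t < t0 ==>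
   abs ((LBINT z. bump (1 / 2) z * u (q s - t *. n s + t *. z)) - sqrt t * (c0 * (LBINT z. bump (1 / 2) z * sqrt (1 - z .* n s)))) <= eps * sqrt t"
   by (rule mollified_trace[OF C'(1)[OF s] r C'(2)[OF s] eps]) (rule that)
  thus ?thesis unfolding I F_def Y_def by blast
 qed
 obtain t1 t2 where t12: "0 < t1" "0 < t2" "!!t. 0 < t ==> t < t1 ==> abs (F t alpha - sqrt t * (c0 * I)) <= eps * sqrt t"
  "!!t. 0 < t ==> t < t2 ==> abs (F t beta' - sqrt t * (c0 * I)) <= eps * sqrt t"
  using tr[of alpha] tr[of beta'] b' by auto
 define W where "W = abs M + 1"
 define t where "t = min (min t1 t2) (min r (1 / W)) / 2"
 have W: "0 < W" "M <= W" by (simp_all add: W_def)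
 hence "0 < 1 / W" by simp
 hence t: "0 < t" "t < t1" "t < t2" "t <= r" "2 * t <= 1 / W" using t12 r by (auto simp: t_def)
 have "t * M <= t * W" using t(1) W by (intro mult_left_mono) auto
 moreover have "2 * t * W <= 1" using t(5) W by (simp add: le_divide_eq)
 ultimately have "t * M <= 1 / 2" by simp
 have "4 * (eps * sqrt t) = kappa * sqrt t * (beta' - alpha)" by (simp add: eps_def)
 hence "F t beta' - F t alpha <= - 4 * (eps * sqrt t)" using decay[OF t(1,4) \<open>t * M <= 1 / 2\<close>] by linarith
 moreover have "- 2 * (eps * sqrt t) <= F t beta' - F t alpha" using t12(3)[OF t(1,2)] t12(4)[OF t(1,3)] by linarith
 ultimately have "eps * sqrt t <= 0" by linarith
 moreover have "0 < eps * sqrt t" using eps t(1) by simp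
 ultimately show False by linarith
qed

end

text \<open>Sard's lemma in dimension one, read on \<open>real^1\<close>: the set of critical values
  is negligible, hence without interior.\<close>

lemma critical_values_interior:
 fixes m :: "real => real"
 assumes "!!s. s \<in> C ==> (m has_real_derivative 0) (at s)"
 shows "interior (m ` C) = {}"
proof (rule ccontr)
 assume ne: "interior (m ` C) ~= {}"
 define f :: "real^1 => real^1" where "f x = vec (m (x $ 1))" for x
 let ?C = "{x :: real^1. x $ 1 \<in> C}"
 have "negligible (f ` ?C)"
 proof (rule baby_Sard)
  fix x :: "real^1" assume "x \<in> ?C"
  hence "(m has_derivative (%h. 0)) (at (x $ 1))" using assms[of "x $ 1"] by (simp add: has_field_derivative_def lambda_zero)
  from has_derivative_compose[OF bounded_linear_imp_has_derivative[OF bounded_linear_vec_nth] this]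
  have "((%x. m (x $ 1)) has_derivative (%h. 0)) (at x)" .
  hence "((%x. m (x $ 1) *. vec 1) has_derivative (%h. 0 *. (vec 1 :: real^1))) (at x)" by (rule has_derivative_scaleR_left)
  hence "(f has_derivative (%h. 0)) (at x)" by (simp add: f_def[abs_def] scaleR_vec_def vec_def zero_vec_def)
  thus "(f has_derivative (%h. 0)) (at x within ?C)" by (rule has_derivative_at_withinI)
  have "matrix (%h::real^1. 0 :: real^1) = 0" by (simp add: matrix_def vec_eq_iff)
  thus "rank (matrix (%h::real^1. 0 :: real^1)) < CARD(1)" by simp
 qed simp
 moreover have "{x :: real^1. x $ 1 \<in> interior (m ` C)} <= f ` ?C"
 proof
  fix x :: "real^1" assume "x \<in> {x. x $ 1 \<in> interior (m ` C)}"
  then obtain s where s: "s \<in> C" "x $ 1 = m s" using interior_subset by blast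
  have "x = f (vec s)" using s(2) by (simp add: f_def vec_eq_iff)
  thus "x \<in> f ` ?C" using s(1) by auto
 qed
 ultimately have "negligible {x :: real^1. x $ 1 \<in> interior (m ` C)}" by (rule negligible_subset)
 moreover have "open {x :: real^1. x $ 1 \<in> interior (m ` C)}"
  using open_vimage[of "interior (m ` C)" "%x::real^1. x $ 1"] by (simp add: vimage_def continuous_on_component)
 moreover obtain y where "y \<in> interior (m ` C)" using ne by auto
 hence "(vec y :: real^1) \<in> {x. x $ 1 \<in> interior (m ` C)}" by simp
 ultimately show False using open_not_negligible by blast
qed

text \<open>Around a parameter with interior value, nearby parameters have values in the image of
  \<open>W\<close>; by injectivity they belong to \<open>W\<close>, which would then contain an
  interval.\<close>

lemma injective_image_interior:
 fixes m :: "real => real"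
 assumes c: "continuous_on {u..v} m" and inj: "inj_on m {u..v}" and W: "!!alpha beta. alpha < beta ==> ~ {alpha..beta} <= W" and uv: "u < v"
 shows "interior (m ` (W \<inter> {u..v})) = {}"
proof (rule ccontr)
 let ?U = "interior (m ` (W \<inter> {u..v}))"
 assume "?U ~= {}"
 then obtain s where s: "s \<in> {u..v}" "m s \<in> ?U" using interior_subset by blast
 obtain T where T: "open T" "m -` ?U \<inter> {u..v} = T \<inter> {u..v}"
  using c[unfolded continuous_on_open_invariant, rule_format, OF open_interior] by metis
 have "s \<in> T" using s T(2) by blast
 then obtain d where d: "0 < d" "ball s d <= T" using T(1) open_contains_ball by blast
 have "{max u (s - d / 2)..min v (s + d / 2)} <= W"
 proof
  fix x assume x: "x \<in> {max u (s - d / 2)..min v (s + d / 2)}"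
  hence xJ: "x \<in> {u..v}" by auto
  have "x \<in> ball s d" using x d(1) by (auto simp: dist_real_def)
  hence "m x \<in> ?U" using d(2) T(2) xJ by blast
  then obtain w where "w \<in> W" "w \<in> {u..v}" "m x = m w" using interior_subset by blast
  thus "x \<in> W" using inj xJ by (auto dest: inj_onD)
 qed
 moreover have "max u (s - d / 2) < min v (s + d / 2)" using s(1) d(1) uv by auto
 ultimately show False using W by blast
qed

text \<open>Otherwise the values are covered by countably many closed sets without interior: the
  critical values taken on each \<open>W i\<close>, and the images of \<open>W i\<close> cut to
  rational intervals where the derivative does not vanish. Baire's theorem forbids this.\<close>

lemma cover_contains_interval:
 fixes m m' :: "'i => real => real"
 assumes I: "finite I" and a: "!!i. i \<in> I ==> 0 < a i" and eta: "0 < eta"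
  and d: "!!i s. i \<in> I ==> abs (s - c i) < a i ==> (m i has_real_derivative m' i s) (at s) & isCont (m' i) s"
  and W: "!!i. i \<in> I ==> closed (W i)" "!!i s. i \<in> I ==> s \<in> W i ==> abs (s - c i) <= a i / 2"
  and cov: "{-eta..eta} <= (\<Union>i\<in>I. m i ` W i)"
 shows "\<exists>i\<in>I. \<exists>alpha beta. alpha < beta & {alpha..beta} <= W i"
proof (rule ccontr)
 assume *: "~ ?thesis"
 define Z where "Z i = {s \<in> W i. m' i s = 0}" for i
 \<comment> \<open>Rational end points make the family countable, and a derivative without zeros
   makes \<open>m i\<close> injective on each interval.\<close>
 define J where "J = {(i, u, v). i \<in> I & u \<in> \<rat> & v \<in> \<rat> & u < v & (\<forall>s\<in>{u..v}. abs (s - c i) < a i & m' i s ~= 0)}"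
 define \<F> where "\<F> = (%i. m i ` Z i) ` I \<union> (%(i, u, v). m i ` (W i \<inter> {u..v})) ` J"
 have inside: "abs (s - c i) < a i" if "i \<in> I" "s \<in> W i" for i s using W(2)[OF that] a[OF that(1)] by simp
 have mc: "continuous_on S (m i)" "continuous_on S (m' i)" if "i \<in> I" "!!s. s \<in> S ==> abs (s - c i) < a i" for i S
  using d[OF that(1)] that(2) by (auto intro!: continuous_at_imp_continuous_on dest: DERIV_isCont)
 have compW: "compact (W i)" if "i \<in> I" for i
 proof -
  have "W i <= cball (c i) (a i / 2)" using W(2)[OF that] by (auto simp: dist_real_def abs_minus_commute)
  thus ?thesis using W(1)[OF that] by (meson bounded_cball bounded_subset compact_eq_bounded_closed)
 qed
 have "countable J"
 proof (rule countable_subset)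
  show "J <= I \<times> (\<rat> \<times> \<rat>)" by (auto simp: J_def)
  show "countable (I \<times> (\<rat> \<times> \<rat> :: (real \<times> real) set))" using I by (intro countable_SIGMA countable_finite countable_rat)
 qed
 hence cF: "countable \<F>" using I by (simp add: \<F>_def countable_finite)
 have F: "closed X & interior X = {}" if XF: "X \<in> \<F>" for X
 proof -
  consider i where "i \<in> I" "X = m i ` Z i" | i u v where "(i, u, v) \<in> J" "X = m i ` (W i \<inter> {u..v})"
  proof -
   from XF consider "X \<in> (%i. m i ` Z i) ` I" | j where "j \<in> J" "X = (%(i, u, v). m i ` (W i \<inter> {u..v})) j"
    unfolding \<F>_def by blast
   thus thesis
   proof cases
    case (2 j)
    thus thesis using that(2)[of "fst j" "fst (snd j)" "snd (snd j)"] by (simp add: case_prod_beta)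
   qed (use that(1) in blast)
  qed
  thus ?thesis
  proof cases
   case 1
   have "Z i = W i \<inter> m' i -` {0}" by (auto simp: Z_def)
   hence "compact (Z i)"
    using continuous_closed_preimage[OF mc(2)[OF 1(1) inside[OF 1(1)]] W(1)[OF 1(1)], of "{0}"] compW[OF 1(1)]
    by (metis closed_singleton compact_Int_closed inf.left_idem)
   hence "closed X" unfolding 1(2) using mc(1)[OF 1(1), of "Z i"] inside[OF 1(1)]
    by (intro compact_imp_closed compact_continuous_image) (auto simp: Z_def)
   moreover have "interior X = {}" unfolding 1(2)
   proof (rule critical_values_interior)
    fix s assume "s \<in> Z i"
    hence "s \<in> W i" "m' i s = 0" by (auto simp: Z_def)
    thus "(m i has_real_derivative 0) (at s)" using d[OF 1(1) inside[OF 1(1)], of s] by simp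
   qed
   ultimately show ?thesis ..
  next
   case 2
   hence i: "i \<in> I" "u < v" "!!s. s \<in> {u..v} ==> abs (s - c i) < a i & m' i s ~= 0" by (auto simp: J_def)
   have cm: "continuous_on {u..v} (m i)" using mc(1)[OF i(1)] i(3) by blast
   have "closed X" unfolding 2(2)
    by (intro compact_imp_closed compact_continuous_image compact_Int_closed compW[OF i(1)] continuous_on_subset[OF cm]) auto
   moreover have "interior X = {}" unfolding 2(2)
   proof (rule injective_image_interior[OF cm _ _ i(2)])
    have neq: "m i x ~= m i y" if xy: "x \<in> {u..v}" "y \<in> {u..v}" "x < y" for x y
    proof
     assume eq: "m i x = m i y"
     obtain z where z: "x < z" "z < y" "m i y - m i x = (y - x) * m' i z"
      using MVT2[OF xy(3), of "m i" "m' i"] d[OF i(1)] i(3) xy by (metis atLeastAtMost_iff order_trans)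
     thus False using eq i(3)[of z] xy by simp
    qed
    show "inj_on (m i) {u..v}"
    proof (rule inj_onI, rule ccontr)
     fix x y assume "x \<in> {u..v}" "y \<in> {u..v}" "m i x = m i y" "x ~= y"
     thus False using neq[of x y] neq[of y x] by (cases "x < y") auto
    qed
   qed (use * i(1) in blast)
   ultimately show ?thesis ..
  qed
 qed
 have "UNIV <= closure (\<Inter> (uminus ` \<F>))"
 proof (rule Baire)
  fix T assume "T \<in> uminus ` \<F>"
  then obtain X where "X \<in> \<F>" "T = - X" by blast
  thus "openin (top_of_set UNIV) T & UNIV <= closure T" using F[of X] by (simp add: closure_complement open_closed)
 qed (use cF in auto)
 hence "0 \<in> closure (\<Inter> (uminus ` \<F>))" by blast
 moreover have "open {-eta<..<eta}" "0 \<in> {-eta<..<eta}" using eta by auto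
 ultimately obtain x where x: "x \<in> {-eta<..<eta}" "x \<in> \<Inter> (uminus ` \<F>)"
  unfolding closure_iff_nhds_not_empty by (metis Int_iff all_not_in_conv order_refl)
 have "x \<in> {-eta..eta}" using x(1) by auto
 then obtain i s where i: "i \<in> I" and s: "s \<in> W i" "x = m i s" using cov by blast
 have "\<exists>X\<in>\<F>. x \<in> X"
 proof (cases "m' i s = 0")
  case True
  hence "x \<in> m i ` Z i" using s by (auto simp: Z_def)
  thus ?thesis using i by (auto simp: \<F>_def)
 next
  case False
  have "(m' i ---> m' i s) (at s)" using d[OF i inside[OF i s(1)]] by (simp add: isCont_def)
  hence "eventually (%t. m' i t ~= 0) (at s)" using False by (rule tendsto_imp_eventually_ne)
  then obtain eps where e: "0 < eps" "!!t. dist t s < eps ==> m' i t ~= 0" using False unfolding eventually_at by (elim exE conjE) (metis UNIV_I)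
  define eps' where "eps' = min eps (a i / 2)"
  have e': "0 < eps'" using e a[OF i] by (simp add: eps'_def)
  obtain u where u: "u \<in> \<rat>" "s - eps' < u" "u < s" using Rats_dense_in_real[of "s - eps'" s] e' by auto
  obtain v where v: "v \<in> \<rat>" "s < v" "v < s + eps'" using Rats_dense_in_real[of s "s + eps'"] e' by auto
  have "abs (t - c i) < a i & m' i t ~= 0" if "t \<in> {u..v}" for t
  proof -
   have "abs (t - s) < eps'" using that u v by auto
   thus ?thesis using e(2)[of t] W(2)[OF i s(1)] unfolding eps'_def dist_real_def by linarith
  qed
  moreover have "u < v" using u v by simp
  ultimately have "(i, u, v) \<in> J" using i u(1) v(1) by (simp add: J_def)
  hence "m i ` (W i \<inter> {u..v}) \<in> \<F>" unfolding \<F>_def by (intro UnI2 image_eqI[where x = "(i, u, v)"]) simp_all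
  moreover have "x \<in> m i ` (W i \<inter> {u..v})" using s u v by auto
  ultimately show ?thesis by (rule bexI[rotated])
 qed
 thus False using x(2) by auto
qed

section \<open>Contacts parametrised by slope\<close>

definition slope_direction :: "real^2 => real => real^2" where
 "slope_direction e m = (1 / sqrt (1 + m^2)) *. (e + m *. perp e)"

lemma slope_direction_norm:
 assumes "norm e = 1" shows "norm (slope_direction e m) = 1"
proof -
 have "e .* e = 1" "perp e .* perp e = 1" using assms perp_norm[of e] unfolding norm_eq_1[symmetric] by simp_all
 hence "(norm (e + m *. perp e))^2 = 1 + m^2"
  unfolding power2_norm_eq_inner by (simp add: inner_simps power2_eq_square)
 hence "norm (e + m *. perp e) = sqrt (1 + m^2)" by (metis norm_ge_zero real_sqrt_unique)
 moreover have "0 < sqrt (1 + m^2)" by (simp add: add_pos_nonneg)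
 ultimately show ?thesis by (simp add: slope_direction_def)
qed

lemma tendsto_slope_direction [tendsto_intros]:
 "(f ---> m) F ==> ((%x. slope_direction e (f x)) ---> slope_direction e m) F"
proof -
 assume f: "(f ---> m) F"
 have "sqrt (1 + m^2) ~= 0" using add_pos_nonneg[of 1 "m^2"] by simp
 thus ?thesis unfolding slope_direction_def by (intro tendsto_intros f)
qed

context overdetermined_domain
begin

text \<open>Positions of symmetry lines are bounded because \<open>Omega\<close> is, and both
  \<open>good\<close> and symmetry pass to limits; symmetric directions therefore form a closed
  set.\<close>

lemma asymmetric_open:
 assumes e: "norm e = 1" and ns: "!!l. ~ (good e l & symmetric_about e l)"
 obtains eta where "0 < eta" "eta <= 1" "!!m l. abs m <= eta ==> ~ (good (slope_direction e m) l & symmetric_about (slope_direction e m) l)"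
proof (rule ccontr)
 assume *: "~ thesis"
 let ?e = "slope_direction e"
 have "\<exists>m l. abs m <= 1 / real (Suc k) & good (?e m) l & symmetric_about (?e m) l" for k
  using * that[of "1 / real (Suc k)"] by (force simp: divide_le_eq)
 then obtain m l where m: "!!k. abs (m k) <= 1 / real (Suc k)" and g: "!!k. good (?e (m k)) (l k)" "!!k. symmetric_about (?e (m k)) (l k)" by metis
 have m0: "m ----> 0"
  by (rule tendsto_rabs_zero_cancel, rule tendsto_sandwich[OF _ _ tendsto_const LIMSEQ_inverse_real_of_nat]) (use m in "auto simp: inverse_eq_divide")
 obtain B where B: "!!x. x \<in> Omega ==> norm x <= B" using bd by (auto simp: bounded_iff)
 obtain x where x: "x \<in> Omega" using ne by auto
 have "l k \<in> cball 0 B" for k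
 proof -
  let ?d = "?e (m k)"
  have d: "norm ?d = 1" by (rule slope_direction_norm[OF e])
  have "reflect ?d (l k) x \<in> Omega" using g(2)[of k] x by (simp add: symmetric_about_def)
  hence "abs (reflect ?d (l k) x .* ?d) <= B" using Cauchy_Schwarz_ineq2[of "reflect ?d (l k) x" ?d] B d by force
  moreover have "abs (x .* ?d) <= B" using Cauchy_Schwarz_ineq2[of x ?d] B[OF x] d by simp
  ultimately show ?thesis unfolding reflect_inner[OF d] by (simp add: dist_real_def)
 qed
 then obtain l' sg where sg: "strict_mono sg" "(l \<circ> sg) ----> l'" using compact_cball[of 0 B] unfolding compact_def by metis
 have "?e 0 = e" by (simp add: slope_direction_def)
 hence em: "(%k. ?e ((m \<circ> sg) k)) ----> e"
  using tendsto_slope_direction[OF LIMSEQ_subseq_LIMSEQ[OF m0 sg(1)], of e] by simp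
 have "good e l'" by (rule good_closed[OF em e sg(2)]) (simp add: g)
 moreover have "symmetric_about e l'" by (rule symmetric_closed[OF em e sg(2)]) (simp add: g)
 ultimately show False using ns by blast
qed

definition orthogonal_contact :: "real^2 => real^2 => bool" where
 "orthogonal_contact e x \<longleftrightarrow> x \<in> frontier Omega & (\<forall>n. outward_unit_normal Omega x n --> n .* e = 0) & good e (x .* e)"

text \<open>Of the two alternatives at the stopping position, tangency away from the line is
  excluded by \<open>no_tangency\<close>.\<close>

lemma orthogonal_contact_exists:
 assumes e: "norm e = 1" and ns: "!!l. ~ (good e l & symmetric_about e l)"
 obtains x where "orthogonal_contact e x"
proof -
 obtain l where l: "good e l" "!!l'. l' < l ==> ~ good e l'" using stop_exists[OF e] by blast
 hence "~ symmetric_about e l" using ns by blast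
 hence "~ (\<exists>x\<in>frontier Omega. l < x .* e & reflect e l x \<in> frontier Omega)"
  using no_tangency[OF e l(1)] by blast
 thus thesis using stop_dichotomy[OF e l] l(1) that unfolding orthogonal_contact_def by metis
qed

text \<open>A piece of boundary written over the coordinate along \<open>e\<close>, with slope
  \<open>m\<close> and a uniform interior ball. By the last clause a contact in the direction of
  slope \<open>mu\<close> sits at a parameter where \<open>m\<close> takes the value
  \<open>mu\<close>, so that covering slopes becomes a question about the range of
  \<open>m\<close>.\<close>

definition contact_patch where
 "contact_patch e p a q m m' sg r \<longleftrightarrow> 0 < a & abs sg = 1 & 0 < r &
  (\<forall>s. abs (s - p .* e) < a --> outward_unit_normal Omega (q s) ((sg / sqrt (1 + (m s)^2)) *. (perp e - m s *. e))
   & ball (q s - r *. ((sg / sqrt (1 + (m s)^2)) *. (perp e - m s *. e))) r <= Omega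
   & (q has_vector_derivative (e + m s *. perp e)) (at s) & (m has_real_derivative m' s) (at s) & isCont m' s) &
  (\<forall>x\<in>ball p a. \<forall>mu. orthogonal_contact (slope_direction e mu) x --> q (x .* e) = x & m (x .* e) = mu)"

text \<open>If the normal at \<open>p\<close> is parallel to \<open>e\<close>, nearby normals have a
  larger component along \<open>e\<close> than along \<open>perp e\<close>, while a contact of slope
  at most 1 in modulus has the opposite inequality. Otherwise the boundary is a curve over
  \<open>e\<close>, and orthogonality identifies its slope.\<close>

lemma contact_cover:
 assumes e: "norm e = 1" and eta: "eta <= 1" and p: "p \<in> frontier Omega"
 shows "(\<exists>a>0. \<forall>x\<in>ball p a. \<forall>mu. abs mu <= eta --> ~ orthogonal_contact (slope_direction e mu) x)
  \<or> (\<exists>a q m m' sg r. contact_patch e p a q m m' sg r)"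
proof -
 let ?f = "perp e"
 have ee: "e .* e = 1" "?f .* ?f = 1" using e perp_norm[of e] unfolding norm_eq_1[symmetric] by simp_all
 obtain r0 rho N N' L where "boundary_chart Omega p r0 rho N N' L" using chart[OF p] by blast
 then interpret C: boundary_chart Omega p r0 rho N N' L .
 have nrm: "outward_unit_normal Omega x (sgn (N x))" if "x \<in> ball p r0" "x \<in> frontier Omega" for x
  using normal_exists[OF that(2)] C.outward_unit_normal_eq[OF that(1)] by metis
 have orth: "N x .* e = - mu * (N x .* ?f)" if "x \<in> ball p r0" "orthogonal_contact (slope_direction e mu) x" for x mu
 proof -
  have "sgn (N x) .* slope_direction e mu = 0" using that nrm by (auto simp: orthogonal_contact_def)
  moreover have "sqrt (1 + mu^2) ~= 0" using add_pos_nonneg[of 1 "mu^2"] by simp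
  ultimately have "N x .* (e + mu *. ?f) = 0" using C.nz[OF that(1)] by (simp add: slope_direction_def sgn_div_norm)
  thus ?thesis by (simp add: inner_simps)
 qed
 show ?thesis
 proof (cases "N p .* ?f = 0")
  case True
  have T: "((%x. abs (N x .* e) - abs (N x .* ?f)) ---> abs (N p .* e) - abs (N p .* ?f)) (at p)"
   using has_derivative_continuous[OF C.der2[of p]] C.r by (intro tendsto_intros) (simp_all add: continuous_at)
  have "N p .* e ~= 0" using perp_expansion[OF e, of "N p"] C.nz[of p] C.r True by auto
  hence pp: "0 < abs (N p .* e) - abs (N p .* ?f)" using True by simp
  from order_tendstoD(1)[OF T this] obtain d where d: "0 < d" "!!x. dist x p < d ==> 0 < abs (N x .* e) - abs (N x .* ?f)" using pp unfolding eventually_at by (elim exE conjE) (metis UNIV_I)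
  have none: False if "x \<in> ball p (min d r0)" "abs mu <= eta" "orthogonal_contact (slope_direction e mu) x" for x mu
  proof -
   have "abs (N x .* e) <= 1 * abs (N x .* ?f)"
    using orth[of x mu] that eta by (simp add: abs_mult mult_left_le_one_le)
   thus False using d(2)[of x] that(1) by (simp add: dist_commute)
  qed
  have "0 < min d r0" using d(1) C.r by simp
  thus ?thesis using none by blast
 next
  case False
  obtain a q m m' where a: "0 < a" and q: "!!s. abs (s - p .* e) < a ==> q s \<in> ball p (r0 / 2) & q s \<in> frontier Omega & q s .* e = s & 0 < (N p .* ?f) * (N (q s) .* ?f)
   & N (q s) .* e = - m s * (N (q s) .* ?f) & (q has_vector_derivative (e + m s *. ?f)) (at s)
   & (m has_real_derivative m' s) (at s) & isCont m' s"
   and cov: "!!x. x \<in> ball p a ==> x \<in> frontier Omega ==> q (x .* e) = x"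
   by (rule C.curve[OF p e False]) (rule that)
  obtain s0 where s0: "0 < s0" "!!x. x \<in> cball p (r0 / 2) ==> x \<in> frontier Omega ==> ball (x - s0 *. sgn (N x)) s0 <= Omega"
   by (rule C.uniform_interior_ball) (rule that)
  define sg where "sg = sgn (N p .* ?f)"
  have sgnN: "sgn (N (q s)) = (sg / sqrt (1 + (m s)^2)) *. (?f - m s *. e)" if s: "abs (s - p .* e) < a" for s
  proof -
   let ?b = "N (q s) .* ?f"
   have N: "N (q s) = ?b *. (?f - m s *. e)" using perp_expansion[OF e, of "N (q s)"] q[OF s] by (simp add: vec_eq_iff algebra_simps)
   have "(norm (?f - m s *. e))^2 = 1 + (m s)^2"
    unfolding power2_norm_eq_inner by (simp add: inner_simps ee power2_eq_square)
   hence "norm (?f - m s *. e) = sqrt (1 + (m s)^2)" by (metis norm_ge_zero real_sqrt_unique)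
   moreover have "sgn ?b = sg" using q[OF s] by (auto simp: sg_def zero_less_mult_iff)
   moreover have "sgn (N (q s)) = sgn ?b *. sgn (?f - m s *. e)" by (subst N) (rule sgn_scaleR)
   ultimately show ?thesis by (simp add: sgn_div_norm[of "?f - m s *. e"] divide_inverse)
  qed
  have "contact_patch e p (min a r0) q m m' sg s0"
   unfolding contact_patch_def
  proof (intro conjI allI impI ballI)
   show "abs sg = 1" using False by (simp add: sg_def abs_sgn_eq)
   fix s assume "abs (s - p .* e) < min a r0"
   hence s: "abs (s - p .* e) < a" by simp
   have qb: "q s \<in> ball p r0" "q s \<in> cball p (r0 / 2)" "q s \<in> frontier Omega" using q[OF s] C.r by auto
   note nrm[OF qb(1,3), unfolded sgnN[OF s]] s0(2)[OF qb(2,3), unfolded sgnN[OF s]]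
   thus "outward_unit_normal Omega (q s) ((sg / sqrt (1 + (m s)^2)) *. (perp e - m s *. e))"
    and "ball (q s - s0 *. ((sg / sqrt (1 + (m s)^2)) *. (perp e - m s *. e))) s0 <= Omega" .
   show "(q has_vector_derivative (e + m s *. perp e)) (at s)" "(m has_real_derivative m' s) (at s)" "isCont m' s"
    using q[OF s] by simp_all
  next
   fix x mu assume x: "x \<in> ball p (min a r0)" and oc: "orthogonal_contact (slope_direction e mu) x"
   show qx: "q (x .* e) = x" using cov[of x] x oc by (simp add: orthogonal_contact_def)
   have "abs ((x - p) .* e) <= norm (x - p)" using Cauchy_Schwarz_ineq2[of "x - p" e] e by simp
   hence s: "abs (x .* e - p .* e) < a" using x by (simp add: inner_diff_left dist_norms)
   have "N x .* e = - mu * (N x .* ?f)" using orth[OF _ oc] x by simp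
   moreover have "N x .* e = - m (x .* e) * (N x .* ?f)" "N x .* ?f ~= 0" using q[OF s] unfolding qx by auto
   ultimately show "m (x .* e) = mu" by auto
  qed (use a C.r s0 in auto)
  thus ?thesis by blast
 qed
qed

lemma all_symmetric:
 assumes e: "norm e = 1" shows "\<exists>l. good e l & symmetric_about e l"
proof (rule ccontr)
 assume "~ ?thesis"
 then obtain eta where eta: "0 < eta" "eta <= 1" and ns: "!!m l. abs m <= eta ==> ~ (good (slope_direction e m) l & symmetric_about (slope_direction e m) l)"
  using asymmetric_open[OF e] by metis
 let ?e = "slope_direction e"
 have "\<exists>a q m m' sg r. 0 < a & ((\<forall>x\<in>ball p a. \<forall>mu. abs mu <= eta --> ~ orthogonal_contact (?e mu) x) \<or> contact_patch e p a q m m' sg r)"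
  if "p \<in> frontier Omega" for p
  using contact_cover[OF e eta(2) that] by (metis contact_patch_def)
 then obtain a q m m' sg r where a: "!!p. p \<in> frontier Omega ==> 0 < a p"
  and P: "!!p. p \<in> frontier Omega ==> (\<forall>x\<in>ball p (a p). \<forall>mu. abs mu <= eta --> ~ orthogonal_contact (?e mu) x) \<or> contact_patch e p (a p) (q p) (m p) (m' p) (sg p) (r p)"
  by metis
 have cf: "compact (frontier Omega)" using bd by (rule compact_frontier_bounded)
 have "frontier Omega <= (\<Union>p\<in>frontier Omega. ball p (a p / 2))" using a by (force intro!: centre_in_ball[THEN iffD2])
 then obtain I0 where I0: "I0 <= frontier Omega" "finite I0" "frontier Omega <= (\<Union>p\<in>I0. ball p (a p / 2))"
  by (rule compactE_image[OF cf, rotated]) auto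
 define I where "I = {p \<in> I0. contact_patch e p (a p) (q p) (m p) (m' p) (sg p) (r p)}"
 \<comment> \<open>The parameters whose tangent direction is an admissible contact. The set is
   closed since \<open>good\<close> passes to limits, and the slopes over all \<open>W p\<close>
   fill the interval from \<open>- eta\<close> to \<open>eta\<close>, because every direction there
   is asymmetric and has a contact.\<close>
 define W where "W p = {s. abs (s - p .* e) <= a p / 2 & abs (m p s) <= eta & good (?e (m p s)) (q p s .* ?e (m p s))}" for p
 have I: "finite I" "!!p. p \<in> I ==> p \<in> frontier Omega" using I0 by (auto simp: I_def)
 have patch: "contact_patch e p (a p) (q p) (m p) (m' p) (sg p) (r p)" if "p \<in> I" for p using that by (simp add: I_def)
 have ap: "0 < a p" "abs (sg p) = 1" "0 < r p" if "p \<in> I" for p using patch[OF that] by (auto simp: contact_patch_def)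
 note pd = patch[unfolded contact_patch_def, THEN conjunct2, THEN conjunct2, THEN conjunct2, THEN conjunct1, rule_format]
 have half: "abs (s - p .* e) < a p" if "p \<in> I" "abs (s - p .* e) <= a p / 2" for s p using ap(1)[OF that(1)] that(2) by linarith
 have "\<exists>p\<in>I. \<exists>alpha beta. alpha < beta & {alpha..beta} <= W p"
 proof (rule cover_contains_interval[where m = m and m' = m' and c = "%p. p .* e" and a = a, OF I(1) _ eta(1)])
  fix p assume p: "p \<in> I"
  show "closed (W p)" unfolding closed_sequential_limits
  proof (intro allI impI, elim conjE)
   fix x s assume x: "\<forall>k. x k \<in> W p" and xs: "x ----> s"
   have sl: "abs (s - p .* e) <= a p / 2"
    by (rule tendsto_upperbound[of "%k. abs (x k - p .* e)" _ sequentially]) (use x in "auto intro!: tendsto_intros xs simp: W_def")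
   note d = pd[OF p half[OF p sl]]
   have ms: "(%k. m p (x k)) ----> m p s" and qs: "(%k. q p (x k)) ----> q p s"
    using d xs by (auto intro: isCont_tendsto_compose dest: DERIV_isCont has_vector_derivative_continuous)
   have ml: "abs (m p s) <= eta"
    by (rule tendsto_upperbound[of "%k. abs (m p (x k))" _ sequentially]) (use x in "auto intro!: tendsto_intros ms simp: W_def")
   have "good (?e (m p s)) (q p s .* ?e (m p s))"
   proof (rule good_closed)
    show "(%k. ?e (m p (x k))) ----> ?e (m p s)" by (intro tendsto_intros ms)
    show "(%k. q p (x k) .* ?e (m p (x k))) ----> q p s .* ?e (m p s)" by (intro tendsto_intros ms qs)
   qed (use x slope_direction_norm[OF e] in "auto simp: W_def")
   thus "s \<in> W p" using sl ml by (simp add: W_def)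
  qed
 next
  show "{-eta..eta} <= (\<Union>p\<in>I. m p ` W p)"
  proof
   fix mu assume "mu \<in> {-eta..eta}"
   hence mu: "abs mu <= eta" by auto
   obtain x where x: "orthogonal_contact (?e mu) x"
    using orthogonal_contact_exists[OF slope_direction_norm[OF e] ns[OF mu]] by blast
   then obtain p where p: "p \<in> I0" "x \<in> ball p (a p / 2)" using I0(3) by (auto simp: orthogonal_contact_def)
   hence xb: "x \<in> ball p (a p)" using a[of p] I0(1) by auto
   have pI: "p \<in> I" using P[of p] p(1) I0(1) xb mu x unfolding I_def by blast
   have qm: "q p (x .* e) = x" "m p (x .* e) = mu" using patch[OF pI] xb x unfolding contact_patch_def by blast+
   have "abs ((x - p) .* e) <= norm (x - p)" using Cauchy_Schwarz_ineq2[of "x - p" e] e by simp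
   hence "abs (x .* e - p .* e) <= a p / 2" using p(2) by (simp add: inner_diff_left dist_norms)
   hence "x .* e \<in> W p" using qm mu x by (simp add: W_def orthogonal_contact_def)
   thus "mu \<in> (\<Union>p\<in>I. m p ` W p)" using pI qm(2) by blast
  qed
 qed (use ap pd in "auto simp: W_def")
 then obtain p alpha beta where p: "p \<in> I" and ab: "alpha < beta" "{alpha..beta} <= W p" by blast
 have inW: "abs (s - p .* e) < a p" "good (?e (m p s)) (q p s .* ?e (m p s))" "abs (m p s) <= eta" if "s \<in> {alpha..beta}" for s
  using ab(2) that half[OF p] by (auto simp: W_def)
 have "continuous_on {alpha..beta} (m' p)" using pd[OF p] inW(1) by (intro continuous_at_imp_continuous_on) blast
 hence "bounded (m' p ` {alpha..beta})" by (intro compact_imp_bounded compact_continuous_image) auto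
 then obtain M where M: "!!s. s \<in> {alpha..beta} ==> abs (m' p s) <= M" unfolding bounded_iff by (metis imageI real_norm_def)
 show False
 proof (rule no_arc[where q = "q p" and m = "m p" and m' = "m' p" and M = M, OF e ab(1) ap(3)[OF p] ap(2)[OF p]])
  fix s assume s: "s \<in> {alpha..beta}"
  show "outward_unit_normal Omega (q p s) ((sg p / sqrt (1 + (m p s)^2)) *. (perp e - m p s *. e)) &
   ball (q p s - r p *. ((sg p / sqrt (1 + (m p s)^2)) *. (perp e - m p s *. e))) (r p) <= Omega &
   (q p has_vector_derivative (e + m p s *. perp e)) (at s) & (m p has_real_derivative m' p s) (at s) & abs (m' p s) <= M &
   good ((1 / sqrt (1 + (m p s)^2)) *. (e + m p s *. perp e)) (q p s .* ((1 / sqrt (1 + (m p s)^2)) *. (e + m p s *. perp e)))"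
   using pd[OF p inW(1)[OF s]] M[OF s] inW(2)[OF s] unfolding slope_direction_def by blast
 next
  have "alpha \<in> {alpha..beta}" using ab(1) by simp
  from ns[OF inW(3)[OF this]] inW(2)[OF this]
  show "~ symmetric_about ((1 / sqrt (1 + (m p alpha)^2)) *. (e + m p alpha *. perp e)) (q p alpha .* ((1 / sqrt (1 + (m p alpha)^2)) *. (e + m p alpha *. perp e)))"
   unfolding slope_direction_def by blast
 qed
qed

end

theorem overdetermined_ball:
 fixes Omega :: "(real^2) set"
 assumes "open Omega" "bounded Omega" "Omega ~= {}" "smooth_boundary Omega" and u: "overdetermined_solution Omega c u"
 shows "\<exists>a r. 0 < r & Omega = ball a r"
proof -
 interpret D: smooth_domain Omega by unfold_locales (use assms in auto)
 obtain u0 where u0: "borelf u0" "lint u0" "AEL x. u0 x = u x"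
  "!!x. x \<notin> Omega ==> u0 x = 0" "finite_energy u0"
  "!!phi. (%x. complex_of_real (phi x)) \<in> test_functions Omega ==> lint phi ==> finite_energy phi ==>
   energy u0 phi = symbol_const * (LBINT x. phi x)"
  by (rule overdetermined_weak_solution[OF assms(1,2) u]) (rule that)
 interpret overdetermined_domain Omega u0 u c
 proof unfold_locales
  show "weak_solution Omega u0" unfolding weak_solution_def using u0(2,5,6) by blast
  show "has_half_normal_derivative Omega u x c" if "x \<in> frontier Omega" for x
   using u that by (simp add: overdetermined_solution_def)
 qed (use assms u0 D.locally_inward in auto)
 show ?thesis using all_symmetric by (rule D.all_symmetric_ball)
qed

theorem theorem3:
  fixes \<Omega> :: "(real ^ 2) set" and c\<^sub>0 :: real
  assumes "open \<Omega>" and "bounded \<Omega>" and "\<Omega> \<noteq> {}" and "smooth_boundary \<Omega>"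
    and "\<exists>u :: real ^ 2 \<Rightarrow> real. overdetermined_solution \<Omega> c\<^sub>0 u"
    and "connected \<Omega>"
  shows "\<exists>a r. 0 < r \<and> \<Omega> = ball a r"
  using overdetermined_ball[OF assms(1-4)] assms(5) by blast

end
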